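(* Let $\alpha\in(0,1/2)$ be a prescribed constant. Consider testing $H_0:\mu=0$ against $H_1:\mu\in K,\ \|\mu\|_2\ge\rho$, where $K\subset\mathbb{R}^d$ is a QCO set, from $N$ samples of $\mathcal N(\mu,\sigma^2\mathbf I_d)$ under the strong $\epsilon$-contamination model. Let $k_1^\star,k_2^\star$ be the first and second optimal dimensions, $m:=\min\{k_1^\star,k_2^\star\}$, and $$E^2(\epsilon,K,N,\sigma^2):=\sigma^2\max\left\{\frac{\sqrt m}{N},\ \epsilon^2\ln\Big(\frac1\epsilon\Big),\ \sqrt{\frac{\epsilon^2\ln(1/\epsilon)\,m}{N}}\right\},$$ $$P^2(\epsilon,K,N,\sigma^2):=\sigma^2\max\left\{\frac{\epsilon\ln(N/\alpha)}{\sqrt N},\ \epsilon^2\ln\Big(\frac N\alpha\Big),\ \sqrt{\frac{\epsilon^2m\ln(N/\alpha)}{N}},\ \frac{\sqrt m\,\ln(1/\alpha)}{N}\right\}.$$ There is a constant $C>0$ depending only on $\alpha$ such that: 1. If $\rho\ge C\,E(\epsilon,K,N,\sigma^2)$, there exists a test $\phi_e$ achieving type-I and type-II errors uniformly less than $\alpha$. 2. If $\rho\ge C\,P(\epsilon,K,N,\sigma^2)$ and the determination of $k_1^\star$ and $k_2^\star$ can be completed in time polynomial in $(N,d,\frac1\epsilon)$, there exists a test $\phi_p$ whose testing process runs in time polynomial in $(N,k_1^\star,k_2^\star,\frac1\epsilon,\frac1\alpha)$ and which achieves type-I and type-II errors uniformly less than $\alpha$.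
   Context: QCO set: $K\subset\mathbb{R}^d$ is quadratically convex orthosymmetric if (1) $K$ is convex; (2) $K^2:=\{(\theta_1^2,\dots,\theta_d^2)^\top:\theta\in K\}$ is convex; (3) $\theta\in K$ implies $(\eta_1\theta_1,\dots,\eta_d\theta_d)^\top\in K$ for all $\eta_i\in\{-1,1\}$. Model: $\tilde{\mathbf X}=\{\tilde X_1,\dots,\tilde X_N\}$ are i.i.d. $\mathcal N(\mu,\sigma^2\mathbf I_d)$ with unknown $\mu\in K$ and known $\sigma>0$; $\mathbb{P}_\mu$ is the probability law when the mean is $\mu$. Strong $\epsilon$-contamination: $\epsilon\in[0,c_0)$ is known, with $c_0<1/2$ a fixed small absolute constant. An adversary $\mathcal C$ with full knowledge of the true distribution (and of $K$) inspects $\tilde{\mathbf X}$ and replaces up to $\epsilon N$ of the samples by arbitrary values; only $\mathbf X=\mathcal C(\tilde{\mathbf X})$ is observed, and the set of corrupted indices is unknown. A test is a $\{0,1\}$-valued measurable function $\phi$ of the observed data. Type-I error: $\sup_{\mathcal C}\mathbb{P}_0(\phi(\mathcal C(\tilde{\mathbf X}))=1)$. Type-II error: $\sup_{\mu\in K,\|\mu\|_2\ge\rho}\sup_{\mathcal C}\mathbb{P}_\mu(\phi(\mathcal C(\tilde{\mathbf X}))=0)$. Kolmogorov $k$-width: $D_k(K)=\inf_{P\in\mathcal P_k}\sup_{\theta\in K}\|\theta-P\theta\|_2$, $\mathcal P_k$ being the set of orthogonal projections of rank $k$ in $\mathbb{R}^d$; $D_k(K)=\infty$ for $k<0$, $D_k(K)=0$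 for $k>d$. Optimal dimensions: $k_1^\star=\max\{j:0\le j\le d,\ D_{j-1}(K)>\frac{j^{1/4}}{\sqrt N}\sigma\}$ and $k_2^\star=\max\{j:0\le j\le d,\ D_{j-1}(K)>\frac{j^{1/4}\sqrt\epsilon}{N^{1/4}}\sigma\}$. Expressions $\epsilon^2\ln(1/\epsilon)$ are read as $0$ at $\epsilon=0$. Standing assumption of the paper: $D_0(K)=\sup_{\theta\in K}\|\theta\|_2>\sigma/\sqrt N$, i.e. $k_1^\star\ge1$. *)

theory Defs
  imports "HOL-Probability.Probability" "Jordan_Normal_Form.DL_Rank"
begin

text \<open>
  The constant of the theorem may not depend on the dimension, so the dimension has to be
  quantified inside the statement. A vector of dimension \<open>d\<close> is therefore an element of
  \<open>{..<d} \<rightarrow>\<^sub>E UNIV\<close>, the space of a finite product measure, and a data set of \<open>N\<close> samples is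
  an element of \<open>{..<N} \<rightarrow>\<^sub>E ({..<d} \<rightarrow>\<^sub>E UNIV)\<close>. The Euclidean norm is \<open>L2_set \<theta> {..<d}\<close>.
\<close>

section \<open>Quadratically convex orthosymmetric sets\<close>

definition convex_dim :: "nat \<Rightarrow> (nat \<Rightarrow> real) set \<Rightarrow> bool" where
  "convex_dim d S \<longleftrightarrow>
     (\<forall>x\<in>S. \<forall>y\<in>S. \<forall>t\<in>{0..1}. (\<lambda>i\<in>{..<d}. (1 - t) * x i + t * y i) \<in> S)"

definition QCO :: "nat \<Rightarrow> (nat \<Rightarrow> real) set \<Rightarrow> bool" where
  "QCO d K \<longleftrightarrow>
     K \<subseteq> {..<d} \<rightarrow>\<^sub>E UNIV \<and>
     convex_dim d K \<and>
     convex_dim d ((\<lambda>\<theta>. \<lambda>i\<in>{..<d}. (\<theta> i)\<^sup>2) ` K) \<and>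
     (\<forall>\<theta>\<in>K. \<forall>\<eta>. (\<forall>i<d. \<eta> i \<in> {-1, 1}) \<longrightarrow> (\<lambda>i\<in>{..<d}. \<eta> i * \<theta> i) \<in> K)"

section \<open>Kolmogorov widths and optimal dimensions\<close>

definition orth_projections :: "nat \<Rightarrow> nat \<Rightarrow> real mat set" where
  "orth_projections d k =
     {P \<in> carrier_mat d d. P * P = P \<and> transpose_mat P = P \<and> vec_space.rank d P = k}"

text \<open>The widths are extended reals because \<open>K\<close> may be unbounded.\<close>

definition kolmogorov_width :: "nat \<Rightarrow> (nat \<Rightarrow> real) set \<Rightarrow> int \<Rightarrow> ennreal" where
  "kolmogorov_width d K k =
     (if k < 0 then \<infinity> else if k > int d then 0 else
       (INF P\<in>orth_projections d (nat k). SUP \<theta>\<in>K.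
          ennreal (L2_set (\<lambda>i. \<theta> i - vec_index (P *\<^sub>v vec d \<theta>) i) {..<d})))"

text \<open>Both maxima are over finite sets that contain 0, since \<open>D\<^bsub>-1\<^esub> = \<infinity>\<close>.\<close>

definition opt_dim1 :: "nat \<Rightarrow> (nat \<Rightarrow> real) set \<Rightarrow> nat \<Rightarrow> real \<Rightarrow> nat" where
  "opt_dim1 d K N \<sigma> =
     Max {j. j \<le> d \<and> kolmogorov_width d K (int j - 1) >
                ennreal (real j powr (1/4) / sqrt (real N) * \<sigma>)}"

definition opt_dim2 :: "nat \<Rightarrow> (nat \<Rightarrow> real) set \<Rightarrow> nat \<Rightarrow> real \<Rightarrow> real \<Rightarrow> nat" where
  "opt_dim2 d K N \<sigma> \<epsilon> =
     Max {j. j \<le> d \<and> kolmogorov_width d K (int j - 1) >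
                ennreal (real j powr (1/4) * sqrt \<epsilon> / real N powr (1/4) * \<sigma>)}"

definition opt_dim_min :: "nat \<Rightarrow> (nat \<Rightarrow> real) set \<Rightarrow> nat \<Rightarrow> real \<Rightarrow> real \<Rightarrow> nat" where
  "opt_dim_min d K N \<sigma> \<epsilon> = min (opt_dim1 d K N \<sigma>) (opt_dim2 d K N \<sigma> \<epsilon>)"

section \<open>Rates\<close>

text \<open>At \<open>\<epsilon> = 0\<close> the terms containing \<open>\<epsilon>\<^sup>2 * ln (1 / \<epsilon>)\<close> are 0.\<close>

definition rate_E_sq :: "nat \<Rightarrow> (nat \<Rightarrow> real) set \<Rightarrow> nat \<Rightarrow> real \<Rightarrow> real \<Rightarrow> real" where
  "rate_E_sq d K N \<sigma> \<epsilon> = (let m = real (opt_dim_min d K N \<sigma> \<epsilon>) in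
     \<sigma>\<^sup>2 * Max {sqrt m / real N,
               \<epsilon>\<^sup>2 * ln (1 / \<epsilon>),
               sqrt (\<epsilon>\<^sup>2 * ln (1 / \<epsilon>) * m / real N)})"

definition rate_P_sq ::
  "real \<Rightarrow> nat \<Rightarrow> (nat \<Rightarrow> real) set \<Rightarrow> nat \<Rightarrow> real \<Rightarrow> real \<Rightarrow> real" where
  "rate_P_sq \<alpha> d K N \<sigma> \<epsilon> = (let m = real (opt_dim_min d K N \<sigma> \<epsilon>) in
     \<sigma>\<^sup>2 * Max {\<epsilon> * ln (real N / \<alpha>) / sqrt (real N),
               \<epsilon>\<^sup>2 * ln (real N / \<alpha>),
               sqrt (\<epsilon>\<^sup>2 * m * ln (real N / \<alpha>) / real N),
               sqrt m * ln (1 / \<alpha>) / real N})"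

section \<open>Testing under strong contamination\<close>

definition data_space :: "nat \<Rightarrow> nat \<Rightarrow> (nat \<Rightarrow> nat \<Rightarrow> real) measure" where
  "data_space N d = (\<Pi>\<^sub>M i\<in>{..<N}. \<Pi>\<^sub>M j\<in>{..<d}. borel)"

definition gauss :: "nat \<Rightarrow> (nat \<Rightarrow> real) \<Rightarrow> real \<Rightarrow> (nat \<Rightarrow> real) measure" where
  "gauss d \<mu> \<sigma> = (\<Pi>\<^sub>M j\<in>{..<d}. density lborel (\<lambda>x. ennreal (normal_density (\<mu> j) \<sigma> x)))"

definition data_law ::
  "nat \<Rightarrow> nat \<Rightarrow> (nat \<Rightarrow> real) \<Rightarrow> real \<Rightarrow> (nat \<Rightarrow> nat \<Rightarrow> real) measure" where
  "data_law N d \<mu> \<sigma> = (\<Pi>\<^sub>M i\<in>{..<N}. gauss d \<mu> \<sigma>)"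

text \<open>Adversaries are measurable, so that the error probabilities below are defined.\<close>

definition adversaries ::
  "nat \<Rightarrow> nat \<Rightarrow> real \<Rightarrow> ((nat \<Rightarrow> nat \<Rightarrow> real) \<Rightarrow> (nat \<Rightarrow> nat \<Rightarrow> real)) set" where
  "adversaries N d \<epsilon> =
     {A \<in> measurable (data_space N d) (data_space N d).
        \<forall>x\<in>space (data_space N d). real (card {i\<in>{..<N}. A x i \<noteq> x i}) \<le> \<epsilon> * real N}"

definition tests :: "nat \<Rightarrow> nat \<Rightarrow> ((nat \<Rightarrow> nat \<Rightarrow> real) \<Rightarrow> nat) set" where
  "tests N d = measurable (data_space N d) (count_space {0, 1})"

definition type1_error ::
  "nat \<Rightarrow> nat \<Rightarrow> real \<Rightarrow> real \<Rightarrow> ((nat \<Rightarrow> nat \<Rightarrow> real) \<Rightarrow> nat) \<Rightarrow> ennreal" where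
  "type1_error N d \<sigma> \<epsilon> \<phi> =
     (SUP A\<in>adversaries N d \<epsilon>.
        emeasure (data_law N d (\<lambda>i\<in>{..<d}. 0) \<sigma>) {x \<in> space (data_space N d). \<phi> (A x) = 1})"

definition type2_error ::
  "nat \<Rightarrow> nat \<Rightarrow> (nat \<Rightarrow> real) set \<Rightarrow> real \<Rightarrow> real \<Rightarrow> real \<Rightarrow>
     ((nat \<Rightarrow> nat \<Rightarrow> real) \<Rightarrow> nat) \<Rightarrow> ennreal" where
  "type2_error N d K \<sigma> \<epsilon> \<rho> \<phi> =
     (SUP \<mu>\<in>{\<mu>\<in>K. L2_set \<mu> {..<d} \<ge> \<rho>}. SUP A\<in>adversaries N d \<epsilon>.
        emeasure (data_law N d \<mu> \<sigma>) {x \<in> space (data_space N d). \<phi> (A x) = 0})"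

text \<open>The last conjunct is \<open>D\<^sub>0(K) > \<sigma> / sqrt N\<close>; it forces \<open>K\<close> to be nonempty and \<open>d \<ge> 1\<close>.\<close>

definition model :: "real \<Rightarrow> nat \<Rightarrow> (nat \<Rightarrow> real) set \<Rightarrow> nat \<Rightarrow> real \<Rightarrow> real \<Rightarrow> bool" where
  "model c0 d K N \<sigma> \<epsilon> \<longleftrightarrow>
     QCO d K \<and> N \<ge> 1 \<and> \<sigma> > 0 \<and> 0 \<le> \<epsilon> \<and> \<epsilon> < c0 \<and>
     kolmogorov_width d K 0 > ennreal (\<sigma> / sqrt (real N))"

section \<open>Running time\<close>

text \<open>
  Since the data are real numbers, running time is counted on a real RAM. Its memory cells hold
  reals; field operations, comparisons and indirect memory accesses cost one step each. There is
  no rounding operation, no transcendental function, and programs contain only integer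
  constants. An indirect access through a cell that does not hold a natural number blocks the
  machine: the configuration is left unchanged and the program never halts. Division by 0
  yields 0.
\<close>

datatype instr =
    SetConst nat int
  | AddR nat nat nat
  | SubR nat nat nat
  | MulR nat nat nat
  | DivR nat nat nat
  | LoadR nat nat
  | StoreR nat nat
  | JumpLe nat nat nat

text \<open>A program \<open>(r, code)\<close> reserves \<open>r\<close> working cells in front of its input.\<close>

type_synonym program = "nat \<times> instr list"
type_synonym config = "nat \<times> (nat \<Rightarrow> real)"

fun exec :: "instr \<Rightarrow> config \<Rightarrow> config" where
  "exec (SetConst a c) (pc, s) = (Suc pc, s(a := real_of_int c))"
| "exec (AddR a b c) (pc, s) = (Suc pc, s(a := s b + s c))"
| "exec (SubR a b c) (pc, s) = (Suc pc, s(a := s b - s c))"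
| "exec (MulR a b c) (pc, s) = (Suc pc, s(a := s b * s c))"
| "exec (DivR a b c) (pc, s) = (Suc pc, s(a := s b / s c))"
| "exec (LoadR a b) (pc, s) =
     (if s b \<in> \<nat> then (Suc pc, s(a := s (nat \<lfloor>s b\<rfloor>))) else (pc, s))"
| "exec (StoreR a b) (pc, s) =
     (if s a \<in> \<nat> then (Suc pc, s(nat \<lfloor>s a\<rfloor> := s b)) else (pc, s))"
| "exec (JumpLe a b l) (pc, s) = ((if s a \<le> s b then l else Suc pc), s)"

fun step :: "instr list \<Rightarrow> config \<Rightarrow> config" where
  "step code (pc, s) = (if pc < length code then exec (code ! pc) (pc, s) else (pc, s))"

definition input_config :: "nat \<Rightarrow> real list \<Rightarrow> config" where
  "input_config r xs = (0, \<lambda>i. if r \<le> i \<and> i < r + length xs then xs ! (i - r) else 0)"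

text \<open>
  Started on \<open>xs\<close>, the program halts after at most \<open>T\<close> steps with \<open>ys\<close> in its first cells.
  The machine halts when the program counter leaves the program. The input is in memory at the
  start, so cells that are never accessed cost nothing.
\<close>

definition computes_within :: "program \<Rightarrow> real list \<Rightarrow> real \<Rightarrow> real list \<Rightarrow> bool" where
  "computes_within prog xs T ys \<longleftrightarrow>
     (\<exists>t pc s. real t \<le> T \<and> (step (snd prog) ^^ t) (input_config (fst prog) xs) = (pc, s) \<and>
        length (snd prog) \<le> pc \<and> (\<forall>i<length ys. s i = ys ! i))"

text \<open>
  A function of nonnegative variables is polynomially bounded in them iff it has a bound of the
  following form. When \<open>1 / \<epsilon>\<close> is one of the variables and \<open>\<epsilon> = 0\<close>, that variable
  is 0, that is, the bound is a polynomial in the remaining variables.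
\<close>

definition poly_bound :: "nat \<Rightarrow> nat \<Rightarrow> real list \<Rightarrow> real" where
  "poly_bound c e vs = real c * (1 + sum_list vs) ^ e"

text \<open>
  Polynomial time makes sense only for a class of sets. An element \<open>(w, d, K)\<close> of the class is
  a set \<open>K\<close> of dimension \<open>d\<close> that is presented to algorithms by the description \<open>w\<close>.
\<close>

definition opt_dims_poly_time ::
  "real \<Rightarrow> (real list \<times> nat \<times> (nat \<Rightarrow> real) set) set \<Rightarrow> bool" where
  "opt_dims_poly_time c0 \<K> \<longleftrightarrow>
     (\<exists>prog c e. \<forall>(w, d, K)\<in>\<K>. \<forall>N \<sigma> \<epsilon>. model c0 d K N \<sigma> \<epsilon> \<and> \<epsilon> > 0 \<longrightarrow>
        computes_within prog ([real N, real d, \<sigma>, \<epsilon>, real (length w)] @ w)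
          (poly_bound c e [real N, real d, 1 / \<epsilon>])
          [real (opt_dim1 d K N \<sigma>), real (opt_dim2 d K N \<sigma> \<epsilon>)])"

text \<open>
  The input of a testing program: the parameters of the problem, the two optimal dimensions,
  the constants \<open>h\<close> that the test has hard-wired, and the raw data in row-major order.
\<close>

definition test_input ::
  "nat \<Rightarrow> nat \<Rightarrow> real \<Rightarrow> real \<Rightarrow> real \<Rightarrow> real \<Rightarrow> nat \<Rightarrow> nat \<Rightarrow> real list \<Rightarrow>
     (nat \<Rightarrow> nat \<Rightarrow> real) \<Rightarrow> real list" where
  "test_input N d \<sigma> \<epsilon> \<alpha> \<rho> k1 k2 h X =
     [real N, real d, \<sigma>, \<epsilon>, \<alpha>, \<rho>, real k1, real k2, real (length h)] @ h @
     concat (map (\<lambda>i. map (X i) [0..<d]) [0..<N])"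

text \<open>
  The program and the polynomial of a testing procedure serve all problems with \<open>K\<close> in the
  class. As \<open>K\<close> is known to the statistician, a test may contain constants describing \<open>K\<close>
  (such as a projection). They are \<open>h d K k1 k2\<close>: polynomially many in the optimal dimensions,
  and depending on nothing but \<open>K\<close> and these dimensions. Everything computed from the data is
  counted.
\<close>

definition test_poly_time ::
  "program \<Rightarrow> nat \<Rightarrow> nat \<Rightarrow> (nat \<Rightarrow> (nat \<Rightarrow> real) set \<Rightarrow> nat \<Rightarrow> nat \<Rightarrow> real list) \<Rightarrow>
     nat \<Rightarrow> (nat \<Rightarrow> real) set \<Rightarrow> nat \<Rightarrow> real \<Rightarrow> real \<Rightarrow> real \<Rightarrow> real \<Rightarrow>
     ((nat \<Rightarrow> nat \<Rightarrow> real) \<Rightarrow> nat) \<Rightarrow> bool" where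
  "test_poly_time prog c e h d K N \<sigma> \<epsilon> \<alpha> \<rho> \<phi> \<longleftrightarrow>
     (let k1 = opt_dim1 d K N \<sigma>; k2 = opt_dim2 d K N \<sigma> \<epsilon> in
        real (length (h d K k1 k2)) \<le> poly_bound c e [real k1, real k2] \<and>
        (\<forall>X\<in>space (data_space N d).
           computes_within prog (test_input N d \<sigma> \<epsilon> \<alpha> \<rho> k1 k2 (h d K k1 k2) X)
             (poly_bound c e [real N, real k1, real k2, 1 / \<epsilon>, 1 / \<alpha>])
             [real (\<phi> X)]))"

end

theory Submission
 imports Defs
begin

text \<open>
 By random signs, a projection of rank \<open>m\<close> that approximates a sign-invariant set can be
 replaced by at most \<open>2 * m + 1\<close> coordinates, since the trace of a projection is its rank.
 On these coordinates a test that is allowed exponential time looks for a large subsample all of whose large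
 subsamples have a total of moderate length. The efficient test downweights
 samples until a high power of the weighted Gram matrix certifies a spectral bound, discards samples whose
 correlation with the weighted sum is large, and compares the length of the remaining weighted
 sum with its mean. It is a program for the RAM, obtained from a verified
 compiler, so that its measurability is inherited from that of single steps.
\<close>

section \<open>A structured language for the real RAM\<close>

text \<open>The real RAM has only field operations, so eigenvectors and square roots are out of
  reach. The squared Frobenius norms of consecutive powers of a symmetric matrix are sums of even
  powers of its eigenvalues; the ratio of two neighbours is rational in the data, grows with the
  power, and after \<open>N\<close> powers bounds the largest squared eigenvalue up to a factor 1 +
  O(1 / sqrt N), since the N-th root of N is that close to 1. Which bound to demand depends on the
  number s of coordinates: for s <= N the noise Gram matrix acts like N times a projection of rank
  s, for s > N like s times the identity, which is then subtracted. A spectral bound controls pairs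
  of weight vectors of small mass, but not the cross term between the few corrupted samples and the
  many clean ones; this is why row sums are clipped as well. That the filter stops is shown only
  under the null hypothesis: the test may reject whenever a check fails, so under the alternative
  only data that pass all checks have to be examined.\<close>

datatype nexp = NC nat | NV nat | NAdd nexp nexp | NMul nexp nexp

datatype rexp = RC int | RV nat | RN nexp | Arr nat nexp | Inp nexp
 | RAdd rexp rexp | RSub rexp rexp | RMul rexp rexp | RDiv rexp rexp

datatype com = Skip | Seq com com | RSet nat rexp | ASet nat nexp rexp | LdN nat nexp
 | For nat nat com | IfLe rexp rexp com com

record st =
 nv :: "nat \<Rightarrow> nat"
 rv :: "nat \<Rightarrow> real"
 ar :: "nat \<Rightarrow> nat \<Rightarrow> real"

primrec nval :: "nexp \<Rightarrow> (nat \<Rightarrow> nat) \<Rightarrow> nat" where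
 "nval (NC c) v = c"
| "nval (NV i) v = v i"
| "nval (NAdd a b) v = nval a v + nval b v"
| "nval (NMul a b) v = nval a v * nval b v"

primrec rval :: "(nat \<Rightarrow> real) \<Rightarrow> rexp \<Rightarrow> st \<Rightarrow> real" where
 "rval I (RC c) s = real_of_int c"
| "rval I (RV i) s = rv s i"
| "rval I (RN e) s = real (nval e (nv s))"
| "rval I (Arr q e) s = ar s q (nval e (nv s))"
| "rval I (Inp e) s = I (nval e (nv s))"
| "rval I (RAdd a b) s = rval I a s + rval I b s"
| "rval I (RSub a b) s = rval I a s - rval I b s"
| "rval I (RMul a b) s = rval I a s * rval I b s"
| "rval I (RDiv a b) s = rval I a s / rval I b s"

text \<open>The loop bound is read once, before the first round. The compiled loop reads its cell
  again in every round; the two agree when \<open>written c\<close> and \<open>bounds c\<close> are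
  disjoint.\<close>

primrec ev :: "(nat \<Rightarrow> real) \<Rightarrow> com \<Rightarrow> st \<Rightarrow> st" where
 "ev I Skip s = s"
| "ev I (Seq a b) s = ev I b (ev I a s)"
| "ev I (RSet i e) s = s\<lparr>rv := (rv s)(i := rval I e s)\<rparr>"
| "ev I (ASet q x e) s =
   s\<lparr>ar := (ar s)(q := (ar s q)(nval x (nv s) := rval I e s))\<rparr>"
| "ev I (LdN v e) s = s\<lparr>nv := (nv s)(v := nat \<lfloor>I (nval e (nv s))\<rfloor>)\<rparr>"
| "ev I (For v n c) s =
   fold (\<lambda>k s. (ev I c s)\<lparr>nv := (nv (ev I c s))(v := Suc k)\<rparr>) [0..<nv s n]
    (s\<lparr>nv := (nv s)(v := 0)\<rparr>)"
| "ev I (IfLe a b c1 c2) s = (if rval I a s <= rval I b s then ev I c1 s else ev I c2 s)"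

text \<open>Arrays are unbounded, so only input reads can go wrong: behind the input begin the cells
  of the arrays.\<close>

primrec rsafe :: "nat \<Rightarrow> rexp \<Rightarrow> st \<Rightarrow> bool" where
 "rsafe L (RC c) s = True"
| "rsafe L (RV i) s = True"
| "rsafe L (RN e) s = True"
| "rsafe L (Arr q e) s = True"
| "rsafe L (Inp e) s = (nval e (nv s) < L)"
| "rsafe L (RAdd a b) s = (rsafe L a s \<and> rsafe L b s)"
| "rsafe L (RSub a b) s = (rsafe L a s \<and> rsafe L b s)"
| "rsafe L (RMul a b) s = (rsafe L a s \<and> rsafe L b s)"
| "rsafe L (RDiv a b) s = (rsafe L a s \<and> rsafe L b s)"

primrec safe :: "(nat \<Rightarrow> real) \<Rightarrow> nat \<Rightarrow> com \<Rightarrow> st \<Rightarrow> bool" where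
 "safe I L Skip s = True"
| "safe I L (Seq a b) s = (safe I L a s \<and> safe I L b (ev I a s))"
| "safe I L (RSet i e) s = rsafe L e s"
| "safe I L (ASet q x e) s = rsafe L e s"
| "safe I L (LdN v e) s = (nval e (nv s) < L \<and> I (nval e (nv s)) \<in> \<nat>)"
| "safe I L (For v n c) s = (\<forall>m<nv s n. safe I L c
   (fold (\<lambda>k s. (ev I c s)\<lparr>nv := (nv (ev I c s))(v := Suc k)\<rparr>) [0..<m]
    (s\<lparr>nv := (nv s)(v := 0)\<rparr>)))"
| "safe I L (IfLe a b c1 c2) s = (rsafe L a s \<and> rsafe L b s \<and>
   (if rval I a s <= rval I b s then safe I L c1 s else safe I L c2 s))"

primrec ndep :: "nexp \<Rightarrow> nat" where
 "ndep (NC c) = 1" | "ndep (NV c) = 1"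
| "ndep (NAdd a b) = ndep a + Suc (ndep b)"
| "ndep (NMul a b) = ndep a + Suc (ndep b)"

primrec rdep :: "rexp \<Rightarrow> nat" where
 "rdep (RC c) = 1" | "rdep (RV c) = 1" | "rdep (RN e) = ndep e"
| "rdep (Arr q e) = 2 + ndep e" | "rdep (Inp e) = 2 + ndep e"
| "rdep (RAdd a b) = rdep a + Suc (rdep b)"
| "rdep (RSub a b) = rdep a + Suc (rdep b)"
| "rdep (RMul a b) = rdep a + Suc (rdep b)"
| "rdep (RDiv a b) = rdep a + Suc (rdep b)"

primrec wfn :: "nexp \<Rightarrow> bool" where
 "wfn (NC c) = True" | "wfn (NV v) = (v < 30)"
| "wfn (NAdd a b) = (wfn a \<and> wfn b)" | "wfn (NMul a b) = (wfn a \<and> wfn b)"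

primrec wfr :: "rexp \<Rightarrow> bool" where
 "wfr (RC c) = True" | "wfr (RV v) = (v < 30)" | "wfr (RN e) = wfn e"
| "wfr (Arr q e) = (q < 8 \<and> wfn e)" | "wfr (Inp e) = wfn e"
| "wfr (RAdd a b) = (wfr a \<and> wfr b)" | "wfr (RSub a b) = (wfr a \<and> wfr b)"
| "wfr (RMul a b) = (wfr a \<and> wfr b)" | "wfr (RDiv a b) = (wfr a \<and> wfr b)"

primrec written :: "com \<Rightarrow> nat set" where
 "written Skip = {}" | "written (Seq a b) = written a \<union> written b"
| "written (RSet i e) = {}" | "written (ASet q x e) = {}" | "written (LdN v e) = {v}"
| "written (For v n c) = insert v (written c)"
| "written (IfLe a b c1 c2) = written c1 \<union> written c2"

primrec bounds :: "com \<Rightarrow> nat set" where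
 "bounds Skip = {}" | "bounds (Seq a b) = bounds a \<union> bounds b"
| "bounds (RSet i e) = {}" | "bounds (ASet q x e) = {}" | "bounds (LdN v e) = {}"
| "bounds (For v n c) = insert n (bounds c)"
| "bounds (IfLe a b c1 c2) = bounds c1 \<union> bounds c2"

primrec wfc :: "com \<Rightarrow> bool" where
 "wfc Skip = True" | "wfc (Seq a b) = (wfc a \<and> wfc b)"
| "wfc (RSet i e) = (i < 30 \<and> wfr e \<and> rdep e <= 30)"
| "wfc (ASet q x e) = (q < 8 \<and> wfn x \<and> ndep x <= 30 \<and> wfr e \<and> rdep e <= 30)"
| "wfc (LdN v e) = (v < 30 \<and> wfn e \<and> ndep e <= 30)"
| "wfc (For v n c) = (v < 30 \<and> n < 30 \<and> v \<notin> written c \<and> wfc c)"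
| "wfc (IfLe a b c1 c2) = (wfr a \<and> wfr b \<and> rdep a <= 30 \<and> rdep b <= 30 \<and> wfc c1 \<and> wfc c2)"

text \<open>
 Real variables live in the cells 0 to 29, natural ones in 30 to 59, cell 60 holds the address
 behind the input, the expression stack is in 61 to 99, and entry \<open>i\<close> of array \<open>q < 8\<close> is stored
 \<open>8 * i + q\<close> cells behind the input, so that no array needs a size.
\<close>

primrec cn :: "nexp \<Rightarrow> nat \<Rightarrow> instr list" where
 "cn (NC c) k = [SetConst (61 + k) (int c)]"
| "cn (NV v) k = [SetConst (61 + k) 0, AddR (61 + k) (61 + k) (30 + v)]"
| "cn (NAdd a b) k = cn a k @ cn b (Suc k) @ [AddR (61 + k) (61 + k) (62 + k)]"
| "cn (NMul a b) k = cn a k @ cn b (Suc k) @ [MulR (61 + k) (61 + k) (62 + k)]"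

definition adr :: "nat \<Rightarrow> nat \<Rightarrow> instr list" where
 "adr q k = [SetConst (62 + k) 8, MulR (61 + k) (61 + k) (62 + k), SetConst (62 + k) (int q),
   AddR (61 + k) (61 + k) (62 + k), AddR (61 + k) (61 + k) 60]"

primrec cr :: "rexp \<Rightarrow> nat \<Rightarrow> instr list" where
 "cr (RC c) k = [SetConst (61 + k) c]"
| "cr (RV v) k = [SetConst (61 + k) 0, AddR (61 + k) (61 + k) v]"
| "cr (RN e) k = cn e k"
| "cr (Arr q e) k = cn e k @ adr q k @ [LoadR (61 + k) (61 + k)]"
| "cr (Inp e) k = cn e k @ [SetConst (62 + k) 100, AddR (61 + k) (61 + k) (62 + k),
   LoadR (61 + k) (61 + k)]"
| "cr (RAdd a b) k = cr a k @ cr b (Suc k) @ [AddR (61 + k) (61 + k) (62 + k)]"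
| "cr (RSub a b) k = cr a k @ cr b (Suc k) @ [SubR (61 + k) (61 + k) (62 + k)]"
| "cr (RMul a b) k = cr a k @ cr b (Suc k) @ [MulR (61 + k) (61 + k) (62 + k)]"
| "cr (RDiv a b) k = cr a k @ cr b (Suc k) @ [DivR (61 + k) (61 + k) (62 + k)]"

primrec cc :: "com \<Rightarrow> nat \<Rightarrow> instr list" where
 "cc Skip p = []"
| "cc (Seq a b) p = cc a p @ cc b (p + length (cc a p))"
| "cc (RSet i e) p = cr e 0 @ [SetConst i 0, AddR i i 61]"
| "cc (ASet q x e) p = cr e 0 @ cn x 1 @ adr q 1 @ [StoreR 62 61]"
| "cc (LdN v e) p = cr (Inp e) 0 @ [SetConst (30 + v) 0, AddR (30 + v) (30 + v) 61]"
| "cc (For v n c) p = (let C = cc c (p + 2) in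
   [SetConst (30 + v) 0, JumpLe (30 + n) (30 + v) (p + length C + 5)] @ C @
   [SetConst 61 1, AddR (30 + v) (30 + v) 61, JumpLe 0 0 (p + 1)])"
| "cc (IfLe a b c1 c2) p = (let E = cr a 0 @ cr b 1; C2 = cc c2 (p + length E + 1);
   q = p + length E + length C2 + 2; C1 = cc c1 q in
   E @ [JumpLe 61 62 q] @ C2 @ [JumpLe 0 0 (q + length C1)] @ C1)"

primrec time_bound :: "com \<Rightarrow> (nat \<Rightarrow> nat) \<Rightarrow> nat" where
 "time_bound Skip v = 0"
| "time_bound (Seq a b) v = time_bound a v + time_bound b v"
| "time_bound (RSet i e) v = length (cr e 0) + 2"
| "time_bound (ASet q x e) v = length (cr e 0) + length (cn x 1) + 6"
| "time_bound (LdN i e) v = length (cn e 0) + 5"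
| "time_bound (For i n c) v = v n * (time_bound c v + 4) + 2"
| "time_bound (IfLe a b c1 c2) v =
   length (cr a 0) + length (cr b 1) + 2 + time_bound c1 v + time_bound c2 v"

section \<open>Correctness of the compiled code\<close>

definition seg :: "instr list \<Rightarrow> nat \<Rightarrow> instr list \<Rightarrow> bool" where
 "seg code p xs \<longleftrightarrow> (\<exists>us vs. code = us @ xs @ vs \<and> length us = p)"

definition reach :: "instr list \<Rightarrow> config \<Rightarrow> nat \<Rightarrow> config \<Rightarrow> bool" where
 "reach code a t b \<longleftrightarrow> (step code ^^ t) a = b"

lemma seg_append: "seg code p (xs @ ys) \<longleftrightarrow> seg code p xs \<and> seg code (p + length xs) ys"
proof
 assume "seg code p (xs @ ys)"
 then obtain us vs where 1: "code = us @ xs @ ys @ vs" "length us = p" by (auto simp: seg_def)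
 have "code = us @ xs @ (ys @ vs)" "code = (us @ xs) @ ys @ vs" "length (us @ xs) = p + length xs"
  using 1 by auto
 then show "seg code p xs \<and> seg code (p + length xs) ys" using 1(2) unfolding seg_def by blast
next
 assume "seg code p xs \<and> seg code (p + length xs) ys"
 then obtain us vs us' vs' where 1: "code = us @ xs @ vs" "length us = p"
  "code = us' @ ys @ vs'" "length us' = p + length xs" unfolding seg_def by blast
 then have "(us @ xs) @ vs = us' @ (ys @ vs')" "length (us @ xs) = length us'" by simp_all
 then have "vs = ys @ vs'" using append_eq_append_conv[of "us @ xs" us' vs "ys @ vs'"] by simp
 then show "seg code p (xs @ ys)" unfolding seg_def using 1 by (intro exI[of _ us] exI[of _ vs']) simp
qed

lemma seg_Cons: "seg code p (x # ys) \<longleftrightarrow> p < length code \<and> code ! p = x \<and> seg code (Suc p) ys"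
proof -
 have "seg code p [x] \<longleftrightarrow> p < length code \<and> code ! p = x"
 proof
  assume "p < length code \<and> code ! p = x"
  then show "seg code p [x]" unfolding seg_def
   by (intro exI[of _ "take p code"] exI[of _ "drop (Suc p) code"]) (auto simp: id_take_nth_drop[symmetric])
 qed (auto simp: seg_def)
 then show ?thesis using seg_append[of code p "[x]" ys] by simp
qed

lemma reach_refl: "reach code a 0 a" by (simp add: reach_def)

lemma reach_trans: "reach code a t b ==> reach code b u c ==> reach code a (t + u) c"
 by (auto simp: reach_def funpow_add add.commute[of t u])

lemma reach_step:
 "p < length code ==> exec (code ! p) (p, m) = b ==> reach code (p, m) (Suc 0) b"
 by (simp add: reach_def)

lemma reach_Suc:
 "p < length code ==> reach code (exec (code ! p) (p, m)) t b ==> reach code (p, m) (Suc t) b"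
 by (simp add: reach_def funpow_swap1 del: funpow.simps(2) add: funpow_Suc_right)

text \<open>Cells 61 to 99 are left unconstrained, so the evaluation of an expression on the stack
  does not disturb the representation.\<close>

definition rep :: "(nat \<Rightarrow> real) \<Rightarrow> nat \<Rightarrow> (nat \<Rightarrow> real) \<Rightarrow> st \<Rightarrow> bool" where
 "rep I L m s \<longleftrightarrow> (\<forall>i<30. m i = rv s i) \<and> (\<forall>i<30. m (30 + i) = real (nv s i)) \<and>
   m 60 = real (100 + L) \<and> (\<forall>i<L. m (100 + i) = I i) \<and>
   (\<forall>q<8. \<forall>i. m (100 + L + 8 * i + q) = ar s q i)"

lemma rep_temp: "rep I L m s ==> (\<And>x. x < 61 \<or> 100 <= x ==> m' x = m x) ==> rep I L m' s"
 by (auto simp: rep_def)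

lemma cn_correct:
 assumes "seg code p (cn e k)" "rep I L m s" "wfn e" "k + ndep e <= 38"
 shows "\<exists>m'. reach code (p, m) (length (cn e k)) (p + length (cn e k), m') \<and>
  m' (61 + k) = real (nval e (nv s)) \<and> (\<forall>x. x < 61 + k \<or> 100 <= x --> m' x = m x)"
 using assms
proof (induction e arbitrary: p k m)
 case (NC c)
 then show ?case
  using reach_step[of p code m "(Suc p, m(61 + k := real c))"]
  by (intro exI[of _ "m(61 + k := real c)"]) (simp add: seg_Cons fun_upd_def)
next
 case (NV v)
 then show ?case
  by (intro exI[of _ "m(61 + k := real (nv s v))"])
    (auto simp: seg_Cons rep_def numeral_2_eq_2 fun_eq_iff intro!: reach_Suc reach_refl[THEN back_subst[where P="\<lambda>x. reach _ x _ _"]])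
next
 case (NAdd a b)
 from NAdd.IH(1)[of p k m] NAdd.prems obtain m1 where m1:
  "reach code (p, m) (length (cn a k)) (p + length (cn a k), m1)"
  "m1 (61 + k) = real (nval a (nv s))" "\<forall>x. x < 61 + k \<or> 100 <= x --> m1 x = m x"
  by (auto simp: seg_append)
 have r1: "rep I L m1 s" using NAdd.prems(2) m1(3) by (auto intro: rep_temp)
 from NAdd.IH(2)[of "p + length (cn a k)" "Suc k" m1] NAdd.prems r1 obtain m2 where m2:
  "reach code (p + length (cn a k), m1) (length (cn b (Suc k)))
    (p + length (cn a k) + length (cn b (Suc k)), m2)"
  "m2 (62 + k) = real (nval b (nv s))" "\<forall>x. x < 62 + k \<or> 100 <= x --> m2 x = m1 x"
  by (auto simp: seg_append)
 show ?case using reach_trans[OF reach_trans[OF m1(1) m2(1)] reach_step] NAdd.prems(1,4) m1 m2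
  by (intro exI[of _ "m2(61 + k := real (nval a (nv s)) + real (nval b (nv s)))"])
    (auto simp: seg_append seg_Cons add.assoc fun_upd_def)
next
 case (NMul a b)
 from NMul.IH(1)[of p k m] NMul.prems obtain m1 where m1:
  "reach code (p, m) (length (cn a k)) (p + length (cn a k), m1)"
  "m1 (61 + k) = real (nval a (nv s))" "\<forall>x. x < 61 + k \<or> 100 <= x --> m1 x = m x"
  by (auto simp: seg_append)
 have r1: "rep I L m1 s" using NMul.prems(2) m1(3) by (auto intro: rep_temp)
 from NMul.IH(2)[of "p + length (cn a k)" "Suc k" m1] NMul.prems r1 obtain m2 where m2:
  "reach code (p + length (cn a k), m1) (length (cn b (Suc k)))
    (p + length (cn a k) + length (cn b (Suc k)), m2)"
  "m2 (62 + k) = real (nval b (nv s))" "\<forall>x. x < 62 + k \<or> 100 <= x --> m2 x = m1 x"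
  by (auto simp: seg_append)
 show ?case using reach_trans[OF reach_trans[OF m1(1) m2(1)] reach_step] NMul.prems(1,4) m1 m2
  by (intro exI[of _ "m2(61 + k := real (nval a (nv s)) * real (nval b (nv s)))"])
    (auto simp: seg_append seg_Cons add.assoc fun_upd_def)
qed

lemma reach_0_iff: "reach code a 0 b \<longleftrightarrow> a = b"
 by (simp add: reach_def)

lemma reach_Suc_iff:
 "p < length code ==> reach code (p, m) (Suc t) b \<longleftrightarrow> reach code (exec (code ! p) (p, m)) t b"
 by (simp add: reach_def funpow_swap1 del: funpow.simps(2) add: funpow_Suc_right)

lemma adr_correct:
 assumes "seg code p (adr q k)" "m (61 + k) = real i" "m 60 = real (100 + L)"
 shows "\<exists>m'. reach code (p, m) (length (adr q k)) (p + length (adr q k), m') \<and>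
  m' (61 + k) = real (100 + L + 8 * i + q) \<and>
  (\<forall>x. x \<noteq> 61 + k \<and> x \<noteq> 62 + k --> m' x = m x)"
 using assms
 by (intro exI[of _ "m(61 + k := real (100 + L + 8 * i + q), 62 + k := real q)"])
   (auto simp: adr_def seg_Cons reach_Suc_iff reach_0_iff fun_eq_iff)

lemma cr_correct:
 assumes "seg code p (cr e k)" "rep I L m s" "wfr e" "k + rdep e <= 38" "rsafe L e s"
 shows "\<exists>m'. reach code (p, m) (length (cr e k)) (p + length (cr e k), m') \<and>
  m' (61 + k) = rval I e s \<and> (\<forall>x. x < 61 + k \<or> 100 <= x --> m' x = m x)"
 using assms
proof (induction e arbitrary: p k m)
 case (RC c)
 then show ?case
  using reach_step[of p code m "(Suc p, m(61 + k := real_of_int c))"]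
  by (intro exI[of _ "m(61 + k := real_of_int c)"]) (simp add: seg_Cons fun_upd_def)
next
 case (RV v)
 then show ?case
  by (intro exI[of _ "m(61 + k := rv s v)"])
    (auto simp: seg_Cons rep_def reach_Suc_iff reach_0_iff numeral_2_eq_2 fun_eq_iff)
next
 case (RN e)
 then show ?case using cn_correct[of code p e k I L m s] by auto
next
 case (Arr q e)
 from cn_correct[of code p e k I L m s] Arr.prems obtain m1 where m1:
  "reach code (p, m) (length (cn e k)) (p + length (cn e k), m1)"
  "m1 (61 + k) = real (nval e (nv s))" "\<forall>x. x < 61 + k \<or> 100 <= x --> m1 x = m x"
  by (auto simp: seg_append)
 have m160: "m1 60 = real (100 + L)" using m1(3) Arr.prems(2) by (auto simp: rep_def)
 from adr_correct[of code "p + length (cn e k)" q k m1 "nval e (nv s)" L] m160 m1(2) Arr.prems(1)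
 obtain m2 where m2:
  "reach code (p + length (cn e k), m1) (length (adr q k))
    (p + length (cn e k) + length (adr q k), m2)"
  "m2 (61 + k) = real (100 + L + 8 * nval e (nv s) + q)"
  "\<forall>x. x \<noteq> 61 + k \<and> x \<noteq> 62 + k --> m2 x = m1 x"
  by (auto simp: seg_append)
 let ?a = "100 + L + 8 * nval e (nv s) + q"
 have nat: "real ?a \<in> \<nat>" by (rule of_nat_in_Nats)
 have fl: "nat \<lfloor>real ?a\<rfloor> = ?a" by (simp only: floor_of_nat nat_int)
 have v: "m2 ?a = ar s q (nval e (nv s))"
  using m2(3) m1(3) Arr.prems(2-4) by (auto simp: rep_def)
 have st: "reach code (p + length (cn e k) + length (adr q k), m2) (Suc 0)
   (Suc (p + length (cn e k) + length (adr q k)), m2(61 + k := m2 ?a))"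
  using Arr.prems(1) nat fl m2(2) by (intro reach_step) (auto simp: seg_append seg_Cons add.assoc simp del: of_nat_add of_nat_mult)
 show ?case using reach_trans[OF reach_trans[OF m1(1) m2(1)] st[unfolded v]] m1(3) m2(3) Arr.prems(4)
  by (intro exI[of _ "m2(61 + k := ar s q (nval e (nv s)))"]) (auto simp: add.assoc fun_upd_def)
next
 case (Inp e)
 from cn_correct[of code p e k I L m s] Inp.prems obtain m1 where m1:
  "reach code (p, m) (length (cn e k)) (p + length (cn e k), m1)"
  "m1 (61 + k) = real (nval e (nv s))" "\<forall>x. x < 61 + k \<or> 100 <= x --> m1 x = m x"
  by (auto simp: seg_append)
 let ?a = "nval e (nv s) + 100" and ?p = "p + length (cn e k)"
 define m2 where "m2 = m1(62 + k := 100, 61 + k := real ?a)"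
 have nat: "real ?a \<in> \<nat>" by (rule of_nat_in_Nats)
 have fl: "nat \<lfloor>real ?a\<rfloor> = ?a" by (simp only: floor_of_nat nat_int)
 have v: "m2 ?a = I (nval e (nv s))"
  using m1(3) Inp.prems(2,4,5) by (auto simp: rep_def m2_def add.commute)
 have st1: "reach code (?p, m1) (Suc (Suc 0)) (Suc (Suc ?p), m2)"
  using Inp.prems(1) m1(2)
  by (auto simp: seg_append seg_Cons reach_Suc_iff reach_0_iff m2_def fun_eq_iff)
 have st2: "reach code (Suc (Suc ?p), m2) (Suc 0) (Suc (Suc (Suc ?p)), m2(61 + k := m2 ?a))"
  using Inp.prems(1) nat fl
  by (intro reach_step) (auto simp: seg_append seg_Cons m2_def simp del: of_nat_add)
 show ?case using reach_trans[OF m1(1) reach_trans[OF st1 st2[unfolded v]]] m1(3) Inp.prems(4)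
  by (intro exI[of _ "m2(61 + k := I (nval e (nv s)))"])
    (auto simp: add.assoc m2_def numeral_3_eq_3 fun_upd_def)
next
 case (RAdd a b)
 from RAdd.IH(1)[of p k m] RAdd.prems obtain m1 where m1:
  "reach code (p, m) (length (cr a k)) (p + length (cr a k), m1)"
  "m1 (61 + k) = rval I a s" "\<forall>x. x < 61 + k \<or> 100 <= x --> m1 x = m x"
  by (auto simp: seg_append)
 have r1: "rep I L m1 s" using RAdd.prems(2) m1(3) by (auto intro: rep_temp)
 from RAdd.IH(2)[of "p + length (cr a k)" "Suc k" m1] RAdd.prems r1 obtain m2 where m2:
  "reach code (p + length (cr a k), m1) (length (cr b (Suc k)))
    (p + length (cr a k) + length (cr b (Suc k)), m2)"
  "m2 (62 + k) = rval I b s" "\<forall>x. x < 62 + k \<or> 100 <= x --> m2 x = m1 x"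
  by (auto simp: seg_append)
 show ?case using reach_trans[OF reach_trans[OF m1(1) m2(1)] reach_step] RAdd.prems(1,4) m1 m2
  by (intro exI[of _ "m2(61 + k := rval I a s + rval I b s)"])
    (auto simp: seg_append seg_Cons add.assoc fun_upd_def)
next
 case (RSub a b)
 from RSub.IH(1)[of p k m] RSub.prems obtain m1 where m1:
  "reach code (p, m) (length (cr a k)) (p + length (cr a k), m1)"
  "m1 (61 + k) = rval I a s" "\<forall>x. x < 61 + k \<or> 100 <= x --> m1 x = m x"
  by (auto simp: seg_append)
 have r1: "rep I L m1 s" using RSub.prems(2) m1(3) by (auto intro: rep_temp)
 from RSub.IH(2)[of "p + length (cr a k)" "Suc k" m1] RSub.prems r1 obtain m2 where m2:
  "reach code (p + length (cr a k), m1) (length (cr b (Suc k)))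
    (p + length (cr a k) + length (cr b (Suc k)), m2)"
  "m2 (62 + k) = rval I b s" "\<forall>x. x < 62 + k \<or> 100 <= x --> m2 x = m1 x"
  by (auto simp: seg_append)
 show ?case using reach_trans[OF reach_trans[OF m1(1) m2(1)] reach_step] RSub.prems(1,4) m1 m2
  by (intro exI[of _ "m2(61 + k := rval I a s - rval I b s)"])
    (auto simp: seg_append seg_Cons add.assoc fun_upd_def)
next
 case (RMul a b)
 from RMul.IH(1)[of p k m] RMul.prems obtain m1 where m1:
  "reach code (p, m) (length (cr a k)) (p + length (cr a k), m1)"
  "m1 (61 + k) = rval I a s" "\<forall>x. x < 61 + k \<or> 100 <= x --> m1 x = m x"
  by (auto simp: seg_append)
 have r1: "rep I L m1 s" using RMul.prems(2) m1(3) by (auto intro: rep_temp)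
 from RMul.IH(2)[of "p + length (cr a k)" "Suc k" m1] RMul.prems r1 obtain m2 where m2:
  "reach code (p + length (cr a k), m1) (length (cr b (Suc k)))
    (p + length (cr a k) + length (cr b (Suc k)), m2)"
  "m2 (62 + k) = rval I b s" "\<forall>x. x < 62 + k \<or> 100 <= x --> m2 x = m1 x"
  by (auto simp: seg_append)
 show ?case using reach_trans[OF reach_trans[OF m1(1) m2(1)] reach_step] RMul.prems(1,4) m1 m2
  by (intro exI[of _ "m2(61 + k := rval I a s * rval I b s)"])
    (auto simp: seg_append seg_Cons add.assoc fun_upd_def)
next
 case (RDiv a b)
 from RDiv.IH(1)[of p k m] RDiv.prems obtain m1 where m1:
  "reach code (p, m) (length (cr a k)) (p + length (cr a k), m1)"
  "m1 (61 + k) = rval I a s" "\<forall>x. x < 61 + k \<or> 100 <= x --> m1 x = m x"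
  by (auto simp: seg_append)
 have r1: "rep I L m1 s" using RDiv.prems(2) m1(3) by (auto intro: rep_temp)
 from RDiv.IH(2)[of "p + length (cr a k)" "Suc k" m1] RDiv.prems r1 obtain m2 where m2:
  "reach code (p + length (cr a k), m1) (length (cr b (Suc k)))
    (p + length (cr a k) + length (cr b (Suc k)), m2)"
  "m2 (62 + k) = rval I b s" "\<forall>x. x < 62 + k \<or> 100 <= x --> m2 x = m1 x"
  by (auto simp: seg_append)
 show ?case using reach_trans[OF reach_trans[OF m1(1) m2(1)] reach_step] RDiv.prems(1,4) m1 m2
  by (intro exI[of _ "m2(61 + k := rval I a s / rval I b s)"])
    (auto simp: seg_append seg_Cons add.assoc fun_upd_def)
qed

lemma nv_ev: "x \<notin> written c ==> nv (ev I c s) x = nv s x"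
proof (induction c arbitrary: s)
 case (For v n c)
 define F where "F m = fold (\<lambda>k s. (ev I c s)\<lparr>nv := (nv (ev I c s))(v := Suc k)\<rparr>) [0..<m]
    (s\<lparr>nv := (nv s)(v := 0)\<rparr>)" for m
 have "nv (F m) x = nv s x" for m
  by (induction m) (use For in \<open>auto simp: F_def\<close>)
 then show ?case by (simp add: F_def)
qed auto

lemma time_bound_cong:
 "(\<And>x. x \<in> bounds c ==> v x = v' x) ==> time_bound c v = time_bound c v'"
 by (induction c) auto

text \<open>Commands run in later states, yet all times are measured in the initial one. This is
  sound because \<open>time_bound\<close> looks only at variables in \<open>bounds c\<close>, and
  none of these is written.\<close>

lemma cc_correct:
 assumes "seg code p (cc c p)" "rep I L m s" "wfc c" "safe I L c s" "written c \<inter> bounds c = {}"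
 shows "\<exists>t m'. t <= time_bound c (nv s) \<and> reach code (p, m) t (p + length (cc c p), m') \<and>
  rep I L m' (ev I c s)"
 using assms
proof (induction c arbitrary: p m s)
 case Skip
 then show ?case by (auto intro!: exI[of _ m] reach_refl)
next
 case (Seq a b)
 from Seq.IH(1)[of p m s] Seq.prems obtain t1 m1 where 1: "t1 <= time_bound a (nv s)"
  "reach code (p, m) t1 (p + length (cc a p), m1)" "rep I L m1 (ev I a s)"
  by (auto simp: seg_append)
 have tb: "time_bound b (nv (ev I a s)) = time_bound b (nv s)"
  by (rule time_bound_cong, rule nv_ev) (use Seq.prems(5) in auto)
 from Seq.IH(2)[of "p + length (cc a p)" m1 "ev I a s"] Seq.prems 1(3) tb obtain t2 m2 where 2:
  "t2 <= time_bound b (nv s)"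
  "reach code (p + length (cc a p), m1) t2 (p + length (cc a p) + length (cc b (p + length (cc a p))), m2)"
  "rep I L m2 (ev I b (ev I a s))"
  by (auto simp: seg_append)
 show ?case using 1 2 reach_trans[OF 1(2) 2(2)]
  by (intro exI[of _ "t1 + t2"] exI[of _ m2]) (auto simp: add.assoc)
next
 case (RSet i e)
 from cr_correct[of code p e 0 I L m s] RSet.prems obtain m1 where m1:
  "reach code (p, m) (length (cr e 0)) (p + length (cr e 0), m1)"
  "m1 61 = rval I e s" "\<forall>x. x < 61 \<or> 100 <= x --> m1 x = m x"
  by (auto simp: seg_append)
 define m2 where "m2 = m1(i := rval I e s)"
 have st: "reach code (p + length (cr e 0), m1) (Suc (Suc 0)) (p + length (cr e 0) + 2, m2)"
  using RSet.prems(1,3) m1(2)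
  by (auto simp: seg_append seg_Cons reach_Suc_iff reach_0_iff m2_def fun_eq_iff)
 have "rep I L m2 (ev I (RSet i e) s)"
  using RSet.prems(2,3) m1(3) by (auto simp: rep_def m2_def)
 then show ?case using reach_trans[OF m1(1) st]
  by (intro exI[of _ "length (cr e 0) + 2"] exI[of _ m2]) auto
next
 case (ASet q x e)
 from cr_correct[of code p e 0 I L m s] ASet.prems obtain m1 where m1:
  "reach code (p, m) (length (cr e 0)) (p + length (cr e 0), m1)"
  "m1 61 = rval I e s" "\<forall>x. x < 61 \<or> 100 <= x --> m1 x = m x"
  by (auto simp: seg_append)
 have r1: "rep I L m1 s" using ASet.prems(2) m1(3) by (auto intro: rep_temp)
 let ?p1 = "p + length (cr e 0)"
 from cn_correct[of code ?p1 x 1 I L m1 s] r1 ASet.prems obtain m2 where m2: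
  "reach code (?p1, m1) (length (cn x 1)) (?p1 + length (cn x 1), m2)"
  "m2 62 = real (nval x (nv s))" "\<forall>z. z < 62 \<or> 100 <= z --> m2 z = m1 z"
  by (auto simp: seg_append)
 let ?p2 = "?p1 + length (cn x 1)"
 have "m2 60 = real (100 + L)" using r1 m2(3) by (auto simp: rep_def)
 with adr_correct[of code ?p2 q 1 m2 "nval x (nv s)" L] m2(2) ASet.prems(1) obtain m3 where m3:
  "reach code (?p2, m2) (length (adr q 1)) (?p2 + length (adr q 1), m3)"
  "m3 62 = real (100 + L + 8 * nval x (nv s) + q)"
  "\<forall>z. z \<noteq> 62 \<and> z \<noteq> 63 --> m3 z = m2 z"
  by (auto simp: seg_append add.assoc)
 let ?p3 = "?p2 + length (adr q 1)" and ?a = "100 + L + 8 * nval x (nv s) + q"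
 have nat: "real ?a \<in> \<nat>" by (rule of_nat_in_Nats)
 have fl: "nat \<lfloor>real ?a\<rfloor> = ?a" by (simp only: floor_of_nat nat_int)
 define m4 where "m4 = m3(?a := rval I e s)"
 have st: "reach code (?p3, m3) (Suc 0) (Suc ?p3, m4)"
  using ASet.prems(1) nat fl m3(2,3) m2(3) m1(2)
  by (intro reach_step)
    (auto simp: seg_append seg_Cons add.assoc m4_def simp del: of_nat_add of_nat_mult)
 have "rep I L m3 s" using r1 m2(3) m3(3) by (intro rep_temp[OF r1]) auto
 \<comment> \<open>The interleaved addresses \<open>8 * i + q\<close> with \<open>q < 8\<close>
   determine \<open>i\<close> and \<open>q\<close>, so one store changes one entry of one
   array.\<close>
 then have "rep I L m4 (ev I (ASet q x e) s)"
  using ASet.prems(3) unfolding rep_def m4_def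
  by (auto simp: nat_eq_iff) (presburger | (metis add_diff_cancel_left' mod_mult_self2 mod_less))+
 then show ?case
  using reach_trans[OF reach_trans[OF reach_trans[OF m1(1) m2(1)] m3(1)] st]
  by (intro exI[of _ "length (cr e 0) + length (cn x 1) + length (adr q 1) + Suc 0"] exI[of _ m4])
    (auto simp: add.assoc adr_def)
next
 case (LdN v e)
 have "seg code p (cr (Inp e) 0)" using LdN.prems(1) unfolding cc.simps seg_append by blast
 from cr_correct[OF this LdN.prems(2)] LdN.prems obtain m1 where m1:
  "reach code (p, m) (length (cr (Inp e) 0)) (p + length (cr (Inp e) 0), m1)"
  "m1 61 = rval I (Inp e) s" "\<forall>x. x < 61 \<or> 100 <= x --> m1 x = m x"
  by (auto simp del: cr.simps)
 define m2 where "m2 = m1(30 + v := I (nval e (nv s)))"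
 have st: "reach code (p + length (cr (Inp e) 0), m1) (Suc (Suc 0)) (p + length (cr (Inp e) 0) + 2, m2)"
  using LdN.prems(1,3) m1(2)
  by (auto simp: seg_append seg_Cons reach_Suc_iff reach_0_iff m2_def fun_eq_iff)
 have "I (nval e (nv s)) = real (nat \<lfloor>I (nval e (nv s))\<rfloor>)"
  using LdN.prems(4) by (auto elim!: Nats_cases)
 then have "rep I L m2 (ev I (LdN v e) s)"
  using LdN.prems(2,3) m1(3) by (auto simp: rep_def m2_def)
 then show ?case using reach_trans[OF m1(1) st]
  by (intro exI[of _ "length (cr (Inp e) 0) + 2"] exI[of _ m2]) auto
next
 case (IfLe a b c1 c2)
 define E q where "E = cr a 0 @ cr b 1" and
  "q = p + length E + length (cc c2 (p + length E + 1)) + 2"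
 have code: "seg code p (E @ [JumpLe 61 62 q] @ cc c2 (p + length E + 1) @
   [JumpLe 0 0 (q + length (cc c1 q))] @ cc c1 q)"
  using IfLe.prems(1) by (simp add: Let_def E_def q_def)
 have fin: "p + length (cc (IfLe a b c1 c2) p) = q + length (cc c1 q)"
  by (simp add: Let_def E_def q_def)
 from cr_correct[of code p a 0 I L m s] IfLe.prems code obtain m1 where m1:
  "reach code (p, m) (length (cr a 0)) (p + length (cr a 0), m1)"
  "m1 61 = rval I a s" "\<forall>x. x < 61 \<or> 100 <= x --> m1 x = m x"
  by (auto simp: seg_append E_def)
 have r1: "rep I L m1 s" using IfLe.prems(2) m1(3) by (auto intro: rep_temp)
 from cr_correct[of code "p + length (cr a 0)" b 1 I L m1 s] r1 IfLe.prems code obtain m2 where m2: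
  "reach code (p + length (cr a 0), m1) (length (cr b 1)) (p + length (cr a 0) + length (cr b 1), m2)"
  "m2 62 = rval I b s" "\<forall>x. x < 62 \<or> 100 <= x --> m2 x = m1 x"
  by (auto simp: seg_append E_def)
 have r2: "rep I L m2 s" using r1 m2(3) by (auto intro: rep_temp)
 have E: "reach code (p, m) (length E) (p + length E, m2)"
  using reach_trans[OF m1(1) m2(1)] by (simp add: E_def add.assoc)
 show ?case
 proof (cases "rval I a s <= rval I b s")
  case True
  have j: "reach code (p + length E, m2) (Suc 0) (q, m2)"
   using code m1(2) m2(2,3) True by (intro reach_step) (auto simp: seg_append seg_Cons)
  have "seg code q (cc c1 q)" using code by (simp add: seg_append seg_Cons q_def add.assoc)
  from IfLe.IH(1)[OF this r2] IfLe.prems True obtain t m' where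
   "t <= time_bound c1 (nv s)" "reach code (q, m2) t (q + length (cc c1 q), m')"
   "rep I L m' (ev I c1 s)"
   by auto
  then show ?thesis using reach_trans[OF reach_trans[OF E j]] True unfolding fin
   by (intro exI[of _ "length E + Suc 0 + t"] exI[of _ m']) (auto simp: E_def)
 next
  case False
  have j: "reach code (p + length E, m2) (Suc 0) (p + length E + 1, m2)"
   using code m1(2) m2(2,3) False by (intro reach_step) (auto simp: seg_append seg_Cons)
  have "seg code (p + length E + 1) (cc c2 (p + length E + 1))"
   using code by (simp add: seg_append seg_Cons add.assoc)
  from IfLe.IH(2)[OF this r2] IfLe.prems False obtain t m' where t:
   "t <= time_bound c2 (nv s)"
   "reach code (p + length E + 1, m2) t (p + length E + 1 + length (cc c2 (p + length E + 1)), m')"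
   "rep I L m' (ev I c2 s)"
   by auto
  have j2: "reach code (p + length E + 1 + length (cc c2 (p + length E + 1)), m') (Suc 0)
    (q + length (cc c1 q), m')"
   using code by (intro reach_step) (auto simp: seg_append seg_Cons add.assoc)
  show ?thesis using reach_trans[OF reach_trans[OF reach_trans[OF E j] t(2)] j2] False t unfolding fin
   by (intro exI[of _ "length E + Suc 0 + t + Suc 0"] exI[of _ m']) (auto simp: E_def)
 qed
next
 case (For v n c)
 define F where "F m = fold (\<lambda>k s. (ev I c s)\<lparr>nv := (nv (ev I c s))(v := Suc k)\<rparr>) [0..<m]
    (s\<lparr>nv := (nv s)(v := 0)\<rparr>)" for m
 let ?C = "cc c (p + 2)" and ?T = "time_bound c (nv s)"
 have code: "seg code p ([SetConst (30 + v) 0, JumpLe (30 + n) (30 + v) (p + length ?C + 5)] @ ?C @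
   [SetConst 61 1, AddR (30 + v) (30 + v) 61, JumpLe 0 0 (p + 1)])"
  using For.prems(1) by (simp add: Let_def)
 have nvF: "nv (F k) v = k" "x \<noteq> v ==> x \<notin> written c ==> nv (F k) x = nv s x" for k x
  by (induction k) (auto simp: F_def nv_ev)
 have vn: "v \<noteq> n" "n \<notin> written c" "v < 30" "n < 30" using For.prems(3,5) by auto
 have it: "\<exists>t m'. t <= k * (?T + 4) + 1 \<and> reach code (p, m) t (p + 1, m') \<and> rep I L m' (F k)"
  if "k <= nv s n" for k
  using that
 proof (induction k)
  case 0
  have "reach code (p, m) (Suc 0) (p + 1, m(30 + v := 0))"
   using code by (intro reach_step) (auto simp: seg_Cons)
  moreover have "rep I L (m(30 + v := 0)) (F 0)"
   using For.prems(2) vn by (auto simp: rep_def F_def)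
  ultimately show ?case by (intro exI[of _ "Suc 0"]) auto
 next
  case (Suc k)
  then obtain t m1 where 1: "t <= k * (?T + 4) + 1" "reach code (p, m) t (p + 1, m1)" "rep I L m1 (F k)"
   by auto
  have m1: "m1 (30 + n) = real (nv s n)" "m1 (30 + v) = real k"
   using 1(3) nvF vn by (auto simp: rep_def)
  have j: "reach code (p + 1, m1) (Suc 0) (p + 2, m1)"
   using code m1 Suc.prems by (intro reach_step) (auto simp: seg_Cons)
  have sg: "seg code (p + 2) ?C" using code by (auto simp: seg_append seg_Cons)
  have sf: "safe I L c (F k)" using For.prems(4) Suc.prems by (auto simp: F_def)
  have tb: "time_bound c (nv (F k)) = ?T"
   by (rule time_bound_cong, rule nvF) (use For.prems(5) in auto)
  from For.IH[OF sg 1(3) _ sf] For.prems(3,5) tb obtain t2 m2 where 2: "t2 <= ?T"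
   "reach code (p + 2, m1) t2 (p + 2 + length ?C, m2)" "rep I L m2 (ev I c (F k))"
   by auto
  define m3 where "m3 = m2(61 := 1, 30 + v := real (Suc k))"
  have m2: "m2 (30 + v) = real k"
   using 2(3) vn nvF(1)[of k] For.prems(3) by (auto simp: rep_def nv_ev)
  have j3: "reach code (p + 2 + length ?C, m2) (Suc (Suc (Suc 0))) (p + 1, m3)"
   using code m2 vn
   by (auto simp: seg_append seg_Cons reach_Suc_iff reach_0_iff m3_def fun_eq_iff add.assoc)
  have "rep I L m3 (F (Suc k))"
   using 2(3) vn by (auto simp: rep_def m3_def F_def)
  then show ?case
   using 1(1) 2(1) reach_trans[OF 1(2) reach_trans[OF j reach_trans[OF 2(2) j3]]]
   by (intro exI[of _ "t + (Suc 0 + (t2 + Suc (Suc (Suc 0))))"] exI[of _ m3]) auto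
 qed
 from it[of "nv s n"] obtain t m1 where 1: "t <= nv s n * (?T + 4) + 1"
  "reach code (p, m) t (p + 1, m1)" "rep I L m1 (F (nv s n))" by auto
 have m1: "m1 (30 + n) = real (nv s n)" "m1 (30 + v) = real (nv s n)"
  using 1(3) nvF vn by (auto simp: rep_def)
 have j: "reach code (p + 1, m1) (Suc 0) (p + length ?C + 5, m1)"
  using code m1 by (intro reach_step) (auto simp: seg_Cons)
 have fin: "p + length (cc (For v n c) p) = p + length ?C + 5" by (simp add: Let_def)
 show ?case using reach_trans[OF 1(2) j] 1 unfolding fin
  by (intro exI[of _ "t + Suc 0"] exI[of _ m1]) (auto simp: F_def)
qed

text \<open>The input starts at cell 100 with nine header numbers, followed by as many constants as
  cell 108 says and by N * d data entries, N and d being in cells 100 and 101. The four instructions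
  put the first address behind all this into cell 60.\<close>

definition assemble :: "com \<Rightarrow> program" where
 "assemble c = (100, [SetConst 60 109, AddR 60 60 108, MulR 61 100 101, AddR 60 60 61] @ cc c 4)"

definition init_st :: st where "init_st = \<lparr>nv = \<lambda>_. 0, rv = \<lambda>_. 0, ar = \<lambda>_ _. 0\<rparr>"

section \<open>Measurability of machine runs\<close>

lemma step_halted: "length code <= pc ==> (step code ^^ t) (pc, s) = (pc, s)"
 by (induction t) auto

lemma measurable_if_count:
 assumes "\<And>n::nat. f n \<in> measurable M borel" "g \<in> measurable M (count_space UNIV)"
 shows "(\<lambda>x. f (g x) x :: real) \<in> measurable M borel"
 using measurable_compose_countable'[of UNIV f M borel g] assms by auto

lemma upd_measurable:
 assumes "\<And>i. (\<lambda>x. s x i) \<in> borel_measurable M" "v \<in> borel_measurable M"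
 shows "(\<lambda>x. ((s x)(a := v x)) i :: real) \<in> borel_measurable M"
 using assms by (cases "i = a") simp_all

text \<open>An indirect access goes through the floor of a cell, a measurable index with countably
  many values, so a read is a countable case distinction between measurable cells. Blocking is
  measurable because \<open>\<nat>\<close> is countable and hence Borel.\<close>

lemma exec_measurable:
 assumes s: "\<And>i. (\<lambda>x. s x i) \<in> borel_measurable M"
 shows "(\<lambda>x. fst (exec ins (pc, s x))) \<in> measurable M (count_space UNIV) \<and>
  (\<forall>i. (\<lambda>x. snd (exec ins (pc, s x)) i) \<in> borel_measurable M)"
proof -
 have "countable (\<nat>::real set)" unfolding Nats_def by simp
 then have "(\<nat>::real set) \<in> sets borel" by (rule sets.countable[rotated]) simp
 then have nat: "Measurable.pred M (\<lambda>x. s x b \<in> \<nat>)" for b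
  using measurable_sets[OF s[of b], of \<nat>] by (simp add: pred_def vimage_def Int_def conj_commute)
 have fl: "(\<lambda>x. nat \<lfloor>s x b\<rfloor>) \<in> measurable M (count_space UNIV)" for b
  using s[of b] by measurable
 have ld: "(\<lambda>x. s x (nat \<lfloor>s x b\<rfloor>)) \<in> borel_measurable M" for b
  by (rule measurable_if_count[OF s fl])
 show ?thesis
 proof (cases ins)
  case (LoadR a b)
  have "(\<lambda>x. snd (exec ins (pc, s x)) i) =
   (\<lambda>x. if s x b \<in> \<nat> then ((s x)(a := s x (nat \<lfloor>s x b\<rfloor>))) i else s x i)" for i
   by (auto simp: LoadR)
  moreover have "(\<lambda>x. fst (exec ins (pc, s x))) = (\<lambda>x. if s x b \<in> \<nat> then Suc pc else pc)"
   by (auto simp: LoadR)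
  moreover have "(\<lambda>x. if s x b \<in> \<nat> then ((s x)(a := s x (nat \<lfloor>s x b\<rfloor>))) i else s x i) \<in> borel_measurable M" for i
   by (intro measurable_If upd_measurable s ld) (use nat[of b] in \<open>simp add: pred_def\<close>)
  moreover have "(\<lambda>x. if s x b \<in> \<nat> then Suc pc else pc) \<in> measurable M (count_space UNIV)"
   by (intro measurable_If) (use nat[of b] in \<open>auto simp: pred_def\<close>)
  ultimately show ?thesis by simp
 next
  case (StoreR a b)
  have "(\<lambda>x. snd (exec ins (pc, s x)) i) =
   (\<lambda>x. if s x a \<in> \<nat> \<and> nat \<lfloor>s x a\<rfloor> = i then s x b else s x i)" for i
   by (auto simp: StoreR)
  moreover have "(\<lambda>x. fst (exec ins (pc, s x))) = (\<lambda>x. if s x a \<in> \<nat> then Suc pc else pc)"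
   by (auto simp: StoreR)
  moreover have "Measurable.pred M (\<lambda>x. s x a \<in> \<nat> \<and> nat \<lfloor>s x a\<rfloor> = i)" for i
   using nat[of a] fl[of a] by measurable
  then have "(\<lambda>x. if s x a \<in> \<nat> \<and> nat \<lfloor>s x a\<rfloor> = i then s x b else s x i) \<in> borel_measurable M" for i
   by (intro measurable_If s) (simp add: pred_def)
  moreover have "(\<lambda>x. if s x a \<in> \<nat> then Suc pc else pc) \<in> measurable M (count_space UNIV)"
   by (intro measurable_If) (use nat[of a] in \<open>auto simp: pred_def\<close>)
  ultimately show ?thesis by simp
 next
  case (JumpLe a b l)
  have "(\<lambda>x. if s x a <= s x b then l else Suc pc) \<in> measurable M (count_space UNIV)"
   using s by measurable
  then show ?thesis using s by (simp add: JumpLe)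
 qed (simp_all only: exec.simps fst_conv snd_conv, (intro conjI allI upd_measurable s borel_measurable_add
    borel_measurable_diff borel_measurable_times borel_measurable_divide borel_measurable_const
    measurable_const; simp)+)
qed

lemma steps_measurable:
 assumes "\<And>i. (\<lambda>x. s x i) \<in> borel_measurable M"
 shows "(\<lambda>x. fst ((step code ^^ t) (pc, s x))) \<in> measurable M (count_space UNIV) \<and>
  (\<forall>i. (\<lambda>x. snd ((step code ^^ t) (pc, s x)) i) \<in> borel_measurable M)"
proof (induction t)
 case 0
 then show ?case using assms by simp
next
 case (Suc t)
 let ?p = "\<lambda>x. fst ((step code ^^ t) (pc, s x))" and ?s = "\<lambda>x. snd ((step code ^^ t) (pc, s x))"
 have e: "(step code ^^ Suc t) (pc, s x) = step code (?p x, ?s x)" for x by simp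
 have st: "(\<lambda>x. fst (step code (q, ?s x))) \<in> measurable M (count_space UNIV) \<and>
   (\<forall>i. (\<lambda>x. snd (step code (q, ?s x)) i) \<in> borel_measurable M)" for q
  using exec_measurable[of ?s M "code ! q" q] Suc by (cases "q < length code") auto
 have "(\<lambda>x. fst (step code (?p x, ?s x))) \<in> measurable M (count_space UNIV)"
  using measurable_compose_countable'[of UNIV "\<lambda>q x. fst (step code (q, ?s x))" M "count_space UNIV" ?p]
   st Suc by auto
 moreover have "(\<lambda>x. snd (step code (?p x, ?s x)) i) \<in> borel_measurable M" for i
  using measurable_compose_countable'[of UNIV "\<lambda>q x. snd (step code (q, ?s x)) i" M borel ?p]
   st Suc by auto
 ultimately show ?case unfolding e by blast
qed

section \<open>A program logic with frames\<close>

primrec rmod :: "com \<Rightarrow> nat set" where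
 "rmod Skip = {}" | "rmod (Seq a b) = rmod a \<union> rmod b"
| "rmod (RSet i e) = {i}" | "rmod (ASet q x e) = {}" | "rmod (LdN v e) = {}"
| "rmod (For v n c) = rmod c"
| "rmod (IfLe a b c1 c2) = rmod c1 \<union> rmod c2"

primrec amod :: "com \<Rightarrow> nat set" where
 "amod Skip = {}" | "amod (Seq a b) = amod a \<union> amod b"
| "amod (RSet i e) = {}" | "amod (ASet q x e) = {q}" | "amod (LdN v e) = {}"
| "amod (For v n c) = amod c"
| "amod (IfLe a b c1 c2) = amod c1 \<union> amod c2"

definition frame :: "com \<Rightarrow> st \<Rightarrow> st \<Rightarrow> bool" where
 "frame c s t \<longleftrightarrow> (\<forall>x. x \<notin> written c --> nv t x = nv s x) \<and>
   (\<forall>x. x \<notin> rmod c --> rv t x = rv s x) \<and> (\<forall>q. q \<notin> amod c --> ar t q = ar s q)"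

lemma rv_ev: "x \<notin> rmod c ==> rv (ev I c s) x = rv s x"
proof (induction c arbitrary: s)
 case (For v n c)
 define F where "F m = fold (\<lambda>k s. (ev I c s)\<lparr>nv := (nv (ev I c s))(v := Suc k)\<rparr>) [0..<m]
    (s\<lparr>nv := (nv s)(v := 0)\<rparr>)" for m
 have "rv (F m) x = rv s x" for m
  by (induction m) (use For in \<open>auto simp: F_def\<close>)
 then show ?case by (simp add: F_def)
qed auto

lemma ar_ev: "q \<notin> amod c ==> ar (ev I c s) q = ar s q"
proof (induction c arbitrary: s)
 case (For v n c)
 define F where "F m = fold (\<lambda>k s. (ev I c s)\<lparr>nv := (nv (ev I c s))(v := Suc k)\<rparr>) [0..<m]
    (s\<lparr>nv := (nv s)(v := 0)\<rparr>)" for m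
 have "ar (F m) q = ar s q" for m
  by (induction m) (use For in \<open>auto simp: F_def\<close>)
 then show ?case by (simp add: F_def)
qed auto

lemma frame_ev: "frame c s (ev I c s)"
 by (simp add: frame_def nv_ev rv_ev ar_ev)

text \<open>All loops are bounded, so termination is built into \<open>ev\<close>; total correctness
  only has to add that no access is unsafe.\<close>

definition tc :: "(nat \<Rightarrow> real) \<Rightarrow> nat \<Rightarrow> com \<Rightarrow> st \<Rightarrow> (st \<Rightarrow> bool) \<Rightarrow> bool" where
 "tc I L c s Q \<longleftrightarrow> safe I L c s \<and> Q (ev I c s)"

lemma tc_simps:
 "tc I L Skip s Q = Q s"
 "tc I L (RSet i e) s Q = (rsafe L e s \<and> Q (s\<lparr>rv := (rv s)(i := rval I e s)\<rparr>))"
 "tc I L (ASet q x e) s Q = (rsafe L e s \<and> Q (s\<lparr>ar := (ar s)(q := (ar s q)(nval x (nv s) := rval I e s))\<rparr>))"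
 "tc I L (LdN v x) s Q = (nval x (nv s) < L \<and> I (nval x (nv s)) \<in> \<nat> \<and>
   Q (s\<lparr>nv := (nv s)(v := nat \<lfloor>I (nval x (nv s))\<rfloor>)\<rparr>))"
 "tc I L (IfLe a b c1 c2) s Q = (rsafe L a s \<and> rsafe L b s \<and>
   (if rval I a s <= rval I b s then tc I L c1 s Q else tc I L c2 s Q))"
 by (auto simp: tc_def)

lemma tc_Seq: "tc I L (Seq a b) s Q = tc I L a s (\<lambda>t. tc I L b t Q)"
 by (auto simp: tc_def)

text \<open>What a command leaves unchanged is read off its syntax. Handing this to every
  continuation lets postconditions mention only what has changed.\<close>

lemma tc_mono: "tc I L c s Q ==> (\<And>t. frame c s t ==> Q t ==> R t) ==> tc I L c s R"
 by (simp add: tc_def frame_ev)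

lemma tc_SeqI:
 "tc I L a s P ==> (\<And>t. frame a s t ==> P t ==> tc I L b t Q) ==> tc I L (Seq a b) s Q"
 unfolding tc_Seq by (rule tc_mono)

lemma tc_For:
 assumes 0: "P 0 (s\<lparr>nv := (nv s)(v := 0)\<rparr>)"
  and step: "\<And>k t. k < nv s n ==> nv t v = k ==> frame (For v n c) s t ==> P k t ==>
   tc I L c t (\<lambda>t. P (Suc k) (t\<lparr>nv := (nv t)(v := Suc k)\<rparr>))"
 shows "tc I L (For v n c) s (P (nv s n))"
proof -
 define F where "F m = fold (\<lambda>k s. (ev I c s)\<lparr>nv := (nv (ev I c s))(v := Suc k)\<rparr>) [0..<m]
    (s\<lparr>nv := (nv s)(v := 0)\<rparr>)" for m
 have F: "F 0 = s\<lparr>nv := (nv s)(v := 0)\<rparr>"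
  "F (Suc m) = (ev I c (F m))\<lparr>nv := (nv (ev I c (F m)))(v := Suc m)\<rparr>" for m
  by (simp_all add: F_def)
 have inv: "frame (For v n c) s (F m) \<and> nv (F m) v = m" for m
 proof (induction m)
  case (Suc m)
  have "frame c (F m) (ev I c (F m))" by (rule frame_ev)
  with Suc show ?case unfolding F(2) by (simp add: frame_def)
 qed (simp add: F frame_def)
 have run: "P m (F m) \<and> (\<forall>k<m. safe I L c (F k))" if "m <= nv s n" for m
  using that
 proof (induction m)
  case (Suc m)
  then have "tc I L c (F m) (\<lambda>t. P (Suc m) (t\<lparr>nv := (nv t)(v := Suc m)\<rparr>))"
   using inv[of m] by (intro step) auto
  with Suc show ?case unfolding F(2) tc_def by (auto simp: less_Suc_eq)
 qed (simp add: F 0)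
 from run[of "nv s n"] show ?thesis by (simp add: tc_def F_def)
qed

lemma tc_vfill:
 assumes body: "\<And>a t. a < nv s n ==> nv t v = a ==> frame (For v n c) s t ==>
   tc I L c t (\<lambda>u. ar u q = (ar t q)(a := V a))"
 shows "tc I L (For v n c) s (\<lambda>t. \<forall>a<nv s n. ar t q a = V a)"
 by (rule tc_For[where P = "\<lambda>k t. \<forall>a<k. ar t q a = V a"])
   (auto intro!: tc_mono[OF body] simp: less_Suc_eq)

text \<open>In row-major order \<open>a * n + b\<close> with \<open>b < n\<close> determines the
  pair, so later writes leave earlier entries intact.\<close>

lemma tc_mfill:
 assumes ij: "i \<noteq> j" "i \<notin> written c" "j \<notin> written c" "n \<noteq> i" "n \<noteq> j" "n \<notin> written c"
  and body: "\<And>a b t. a < nv s n ==> b < nv s n ==> nv t i = a ==> nv t j = b ==>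
   frame (For i n (For j n c)) s t ==> tc I L c t (\<lambda>u. ar u q = (ar t q)(a * nv s n + b := M a b))"
 shows "tc I L (For i n (For j n c)) s (\<lambda>t. \<forall>a<nv s n. \<forall>b<nv s n. ar t q (a * nv s n + b) = M a b)"
proof -
 define N where "N = nv s n"
 have inj: "a * N + b = a' * N + b' \<longleftrightarrow> a = a' \<and> b = b'" if "b < N" "b' < N" for a b a' b'
 proof
  assume e: "a * N + b = a' * N + b'"
  have "(a * N + b) div N = a" "(a' * N + b') div N = a'" using that by simp_all
  then show "a = a' \<and> b = b'" using e by simp
 qed simp
 have "tc I L (For i n (For j n c)) s (\<lambda>t. \<forall>a<nv s n. \<forall>b<N. ar t q (a * N + b) = M a b)"
 proof (rule tc_For[where P = "\<lambda>k t. \<forall>a<k. \<forall>b<N. ar t q (a * N + b) = M a b"])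
  fix a t
  assume a: "a < nv s n" and ti: "nv t i = a" and fr: "frame (For i n (For j n c)) s t"
   and P: "\<forall>a'<a. \<forall>b<N. ar t q (a' * N + b) = M a' b"
  have tn: "nv t n = N" using fr ij by (simp add: frame_def N_def)
  let ?P = "\<lambda>k (u :: st). (\<forall>a'<a. \<forall>b<N. ar u q (a' * N + b) = M a' b) \<and> (\<forall>b<k. ar u q (a * N + b) = M a b)"
  have step: "tc I L c u (\<lambda>x. ?P (Suc b) (x\<lparr>nv := (nv x)(j := Suc b)\<rparr>))"
   if b: "b < nv t n" and uj: "nv u j = b" and fu: "frame (For j n c) t u" and Pu: "?P b u" for b u
  proof -
   have bN: "b < N" using b tn by simp
   have "frame (For i n (For j n c)) s u" using fr fu by (simp add: frame_def)
   moreover have "nv u i = a" using fu ti ij by (simp add: frame_def)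
   ultimately have "tc I L c u (\<lambda>x. ar x q = (ar u q)(a * N + b := M a b))"
    using body[of a b u] a bN uj unfolding N_def by simp
   then show ?thesis
   proof (rule tc_mono)
    fix x :: st assume x: "ar x q = (ar u q)(a * N + b := M a b)"
    show "?P (Suc b) (x\<lparr>nv := (nv x)(j := Suc b)\<rparr>)"
     using Pu bN inj by (auto simp: x less_Suc_eq)
   qed
  qed
  have "tc I L (For j n c) t (?P (nv t n))"
  proof (rule tc_For)
   show "?P 0 (t\<lparr>nv := (nv t)(j := 0)\<rparr>)" using P by simp
  qed (rule step)
  then show "tc I L (For j n c) t (\<lambda>u. \<forall>a'<Suc a. \<forall>b<N. ar (u\<lparr>nv := (nv u)(i := Suc a)\<rparr>) q (a' * N + b) = M a' b)"
   by (rule tc_mono) (auto simp: less_Suc_eq tn)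
 qed simp
 then show ?thesis by (simp only: N_def)
qed

lemma tc_sum:
 assumes body: "\<And>k t. k < nv s n ==> nv t v = k ==> frame (Seq (RSet r (RC 0)) (For v n c)) s t ==>
   tc I L c t (\<lambda>u. rv u r = rv t r + F k)"
 shows "tc I L (Seq (RSet r (RC 0)) (For v n c)) s (\<lambda>t. rv t r = (\<Sum>k<nv s n. F k))"
proof -
 define s0 where "s0 = s\<lparr>rv := (rv s)(r := 0)\<rparr>"
 have "tc I L (For v n c) s0 (\<lambda>t. rv t r = (\<Sum>k<nv s0 n. F k))"
 proof (rule tc_For[where P = "\<lambda>m t. rv t r = (\<Sum>k<m. F k)"])
  fix k t assume a: "k < nv s0 n" "nv t v = k" "frame (For v n c) s0 t" "rv t r = (\<Sum>k<k. F k)"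
  have "frame (Seq (RSet r (RC 0)) (For v n c)) s t" using a(3) by (simp add: frame_def s0_def)
  then have "tc I L c t (\<lambda>u. rv u r = rv t r + F k)" using a by (intro body) (simp_all add: s0_def)
  then show "tc I L c t (\<lambda>t. rv (t\<lparr>nv := (nv t)(v := Suc k)\<rparr>) r = (\<Sum>k<Suc k. F k))"
   by (rule tc_mono) (simp add: a)
 qed (simp add: s0_def)
 then show ?thesis by (simp add: tc_Seq tc_simps s0_def)
qed

text \<open>Straight-line code has constant length and every enclosing loop contributes one factor
  \<open>w\<close>. Adding the exponents in a sequence merely provides a common one.\<close>

lemma time_bound_poly:
 "\<exists>C e. \<forall>v w. 1 <= w --> (\<forall>x\<in>bounds c. real (v x) <= w) --> real (time_bound c v) <= real C * w ^ e"
proof (induction c)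
 case (Seq a b)
 then obtain C1 e1 C2 e2 where
  1: "\<And>v w. 1 <= w ==> \<forall>x\<in>bounds a. real (v x) <= w ==> real (time_bound a v) <= real C1 * w ^ e1"
  and 2: "\<And>v w. 1 <= w ==> \<forall>x\<in>bounds b. real (v x) <= w ==> real (time_bound b v) <= real C2 * w ^ e2" by metis
 show ?case
 proof (rule exI[of _ "C1 + C2"], rule exI[of _ "e1 + e2"], intro allI impI)
  fix v :: "nat \<Rightarrow> nat" and w :: real
  assume w: "1 <= w" and b: "\<forall>x\<in>bounds (Seq a b). real (v x) <= w"
  have "real C1 * w ^ e1 <= real C1 * w ^ (e1 + e2)" "real C2 * w ^ e2 <= real C2 * w ^ (e1 + e2)"
   using w by (auto intro!: mult_left_mono power_increasing)
  then show "real (time_bound (Seq a b) v) <= real (C1 + C2) * w ^ (e1 + e2)"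
   using 1[OF w, of v] 2[OF w, of v] b by (simp add: distrib_right)
 qed
next
 case (For i n c)
 then obtain C e where
  1: "\<And>v w. 1 <= w ==> \<forall>x\<in>bounds c. real (v x) <= w ==> real (time_bound c v) <= real C * w ^ e" by metis
 show ?case
 proof (rule exI[of _ "C + 6"], rule exI[of _ "Suc e"], intro allI impI)
  fix v :: "nat \<Rightarrow> nat" and w :: real
  assume w: "1 <= w" and b: "\<forall>x\<in>bounds (For i n c). real (v x) <= w"
  have we: "1 <= w ^ e" "1 <= w ^ Suc e" using w by (rule one_le_power)+
  have "real (v n) * (real (time_bound c v) + 4) <= w * (real C * w ^ e + 4 * w ^ e)"
   using 1[OF w, of v] b we w by (intro mult_mono add_mono) auto
  also have "\<dots> = (real C + 4) * w ^ Suc e" by (simp add: algebra_simps)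
  finally show "real (time_bound (For i n c) v) <= real (C + 6) * w ^ Suc e"
   using we(2) by (simp add: distrib_right del: power_Suc)
 qed
next
 case (IfLe x y a b)
 then obtain C1 e1 C2 e2 where
  1: "\<And>v w. 1 <= w ==> \<forall>x\<in>bounds a. real (v x) <= w ==> real (time_bound a v) <= real C1 * w ^ e1"
  and 2: "\<And>v w. 1 <= w ==> \<forall>x\<in>bounds b. real (v x) <= w ==> real (time_bound b v) <= real C2 * w ^ e2" by metis
 define l where "l = length (cr x 0) + length (cr y 1) + 2"
 show ?case
 proof (rule exI[of _ "l + C1 + C2"], rule exI[of _ "e1 + e2"], intro allI impI)
  fix v :: "nat \<Rightarrow> nat" and w :: real
  assume w: "1 <= w" and b: "\<forall>z\<in>bounds (IfLe x y a b). real (v z) <= w"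
  have "real C1 * w ^ e1 <= real C1 * w ^ (e1 + e2)" "real C2 * w ^ e2 <= real C2 * w ^ (e1 + e2)"
   using w by (intro mult_left_mono power_increasing; simp)+
  moreover have "real l * 1 <= real l * w ^ (e1 + e2)"
   using one_le_power[OF w] by (intro mult_left_mono) auto
  moreover have "real (time_bound a v) <= real C1 * w ^ e1" "real (time_bound b v) <= real C2 * w ^ e2"
   using 1[OF w, of v] 2[OF w, of v] b by simp_all
  moreover have "time_bound (IfLe x y a b) v = l + time_bound a v + time_bound b v" by (simp add: l_def)
  ultimately show "real (time_bound (IfLe x y a b) v) <= real (l + C1 + C2) * w ^ (e1 + e2)"
   unfolding of_nat_add distrib_right by linarith
 qed
next
 case Skip
 show ?case by (rule exI[of _ 0], rule exI[of _ 0]) simp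
next
 case (RSet i e)
 show ?case by (rule exI[of _ "length (cr e 0) + 2"], rule exI[of _ 0]) simp
next
 case (ASet q x e)
 show ?case by (rule exI[of _ "length (cr e 0) + length (cn x 1) + 6"], rule exI[of _ 0]) simp
next
 case (LdN i e)
 show ?case by (rule exI[of _ "length (cn e 0) + 5"], rule exI[of _ 0]) simp
qed

text \<open>The prelude loads the loop bounds, which must not change during the main part.\<close>

lemma assemble_Seq_correct:
 assumes len: "length xs = 9 + k + n * d" "xs ! 0 = real n" "xs ! 1 = real d" "xs ! 8 = real k"
  and c: "wfc p" "wfc c" "safe (\<lambda>i. xs ! i) (length xs) (Seq p c) init_st"
   "written p \<inter> bounds p = {}" "written c \<inter> bounds c = {}"
 shows "\<exists>t m. t <= time_bound p (\<lambda>_. 0) + time_bound c (nv (ev (\<lambda>i. xs ! i) p init_st)) + 4 \<and>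
  (step (snd (assemble (Seq p c))) ^^ t) (input_config (fst (assemble (Seq p c))) xs) =
   (length (snd (assemble (Seq p c))), m) \<and>
  (\<forall>i<30. m i = rv (ev (\<lambda>i. xs ! i) (Seq p c) init_st) i)"
proof -
 define code where "code = snd (assemble (Seq p c))"
 define L where "L = length xs"
 define I where "I i = xs ! i" for i
 have I: "(\<lambda>i. xs ! i) = I" by (simp add: I_def fun_eq_iff)
 define m0 where "m0 = snd (input_config 100 xs)"
 define m1 where "m1 = m0(60 := real (100 + L), 61 := real (n * d))"
 have sg: "seg code 0 ([SetConst 60 109, AddR 60 60 108, MulR 61 100 101, AddR 60 60 61] @ cc (Seq p c) 4)"
  unfolding seg_def code_def assemble_def by (rule exI[of _ "[]"], rule exI[of _ "[]"]) simp
 have m0: "m0 100 = real n" "m0 101 = real d" "m0 108 = real k"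
  using len by (auto simp: m0_def input_config_def)
 have "reach code (0, m0) (Suc (Suc (Suc (Suc 0)))) (Suc (Suc (Suc (Suc 0))), m1)"
  using sg m0 len(1)
  by (auto simp: seg_Cons reach_Suc_iff reach_0_iff m1_def L_def fun_eq_iff simp del: cc.simps)
 moreover have "Suc (Suc (Suc (Suc 0))) = 4" by simp
 ultimately have 1: "reach code (0, m0) 4 (4, m1)" by metis
 have "seg code (0 + length [SetConst 60 109, AddR 60 60 108, MulR 61 100 101, AddR 60 60 61]) (cc (Seq p c) 4)"
  using sg seg_append by blast
 moreover have "0 + length [SetConst 60 109, AddR 60 60 108, MulR 61 100 101, AddR 60 60 61] = 4" by simp
 ultimately have "seg code 4 (cc (Seq p c) 4)" by metis
 then have sgp: "seg code 4 (cc p 4)" and sgc: "seg code (4 + length (cc p 4)) (cc c (4 + length (cc p 4)))"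
  by (simp_all add: seg_append)
 have sf: "safe I L p init_st" "safe I L c (ev I p init_st)"
  using c(3) unfolding I L_def[symmetric] by simp_all
 have "rep I L m1 init_st"
  by (auto simp: rep_def m1_def m0_def init_st_def input_config_def L_def I_def)
 from cc_correct[OF sgp this c(1) sf(1) c(4)] obtain t m where 2:
  "t <= time_bound p (nv init_st)" "reach code (4, m1) t (4 + length (cc p 4), m)" "rep I L m (ev I p init_st)"
  by blast
 from cc_correct[OF sgc 2(3) c(2) sf(2) c(5)] obtain t' m' where 3:
  "t' <= time_bound c (nv (ev I p init_st))"
  "reach code (4 + length (cc p 4), m) t' (4 + length (cc p 4) + length (cc c (4 + length (cc p 4))), m')"
  "rep I L m' (ev I c (ev I p init_st))"
  by blast
 have r: "reach code (0, m0) (4 + (t + t')) (4 + length (cc p 4) + length (cc c (4 + length (cc p 4))), m')"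
  by (rule reach_trans[OF 1 reach_trans[OF 2(2) 3(2)]])
 show ?thesis
 proof (intro exI conjI)
  show "4 + (t + t') <= time_bound p (\<lambda>_. 0) + time_bound c (nv (ev (\<lambda>i. xs ! i) p init_st)) + 4"
   using 2(1) 3(1) by (simp add: I init_st_def)
  show "(step (snd (assemble (Seq p c))) ^^ (4 + (t + t'))) (input_config (fst (assemble (Seq p c))) xs) =
   (length (snd (assemble (Seq p c))), m')"
   using r by (simp add: reach_def code_def assemble_def m0_def input_config_def)
  show "\<forall>i<30. m' i = rv (ev (\<lambda>i. xs ! i) (Seq p c) init_st) i"
   using 3(3) by (simp add: I rep_def)
 qed
qed

section \<open>Power iteration with weights\<close>

definition mstep :: "nat \<Rightarrow> (nat \<Rightarrow> nat \<Rightarrow> real) \<Rightarrow> (nat \<Rightarrow> real) \<Rightarrow> (nat \<Rightarrow> nat \<Rightarrow> real) \<Rightarrow> nat \<Rightarrow> nat \<Rightarrow> real" where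
 "mstep N A w R = (\<lambda>i j. \<Sum>l<N. A i l * w l * R l j)"

text \<open>With W the diagonal matrix of \<open>w\<close> this is (A W)^k A. Multiplied by W^(1/2)
  from both sides it becomes the (k+1)-st power of the symmetric matrix W^(1/2) A W^(1/2).\<close>

definition mpow :: "nat \<Rightarrow> (nat \<Rightarrow> nat \<Rightarrow> real) \<Rightarrow> (nat \<Rightarrow> real) \<Rightarrow> nat \<Rightarrow> nat \<Rightarrow> nat \<Rightarrow> real" where
 "mpow N A w k = (mstep N A w ^^ k) A"

definition winner :: "nat \<Rightarrow> (nat \<Rightarrow> real) \<Rightarrow> (nat \<Rightarrow> real) \<Rightarrow> (nat \<Rightarrow> real) \<Rightarrow> real" where
 "winner N w x y = (\<Sum>i<N. w i * x i * y i)"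

text \<open>The Frobenius inner product of W^(1/2) R W^(1/2) and W^(1/2) R' W^(1/2), written without
  square roots.\<close>

definition minner :: "nat \<Rightarrow> (nat \<Rightarrow> real) \<Rightarrow> (nat \<Rightarrow> nat \<Rightarrow> real) \<Rightarrow> (nat \<Rightarrow> nat \<Rightarrow> real) \<Rightarrow> real" where
 "minner N w R R' = (\<Sum>j<N. w j * winner N w (\<lambda>i. R i j) (\<lambda>i. R' i j))"

definition vstep :: "nat \<Rightarrow> (nat \<Rightarrow> nat \<Rightarrow> real) \<Rightarrow> (nat \<Rightarrow> real) \<Rightarrow> (nat \<Rightarrow> real) \<Rightarrow> nat \<Rightarrow> real" where
 "vstep N A w x = (\<lambda>i. \<Sum>l<N. A i l * w l * x l)"

lemma weighted_CS:
 fixes c x y :: "'a \<Rightarrow> real"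
 assumes "\<And>i. i \<in> I ==> 0 <= c i"
 shows "(\<Sum>i\<in>I. c i * x i * y i)\<^sup>2 <= (\<Sum>i\<in>I. c i * (x i)\<^sup>2) * (\<Sum>i\<in>I. c i * (y i)\<^sup>2)"
proof -
 have "(\<Sum>i\<in>I. (sqrt (c i) * x i) * (sqrt (c i) * y i))\<^sup>2 <=
   (\<Sum>i\<in>I. (sqrt (c i) * x i)\<^sup>2) * (\<Sum>i\<in>I. (sqrt (c i) * y i)\<^sup>2)"
  by (rule Cauchy_Schwarz_ineq_sum)
 moreover have "(sqrt (c i) * x i) * (sqrt (c i) * y i) = c i * x i * y i" if "i \<in> I" for i
  using assms[OF that] by (simp add: algebra_simps)
 moreover have "(sqrt (c i) * z)\<^sup>2 = c i * z\<^sup>2" if "i \<in> I" for i z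
  using assms[OF that] by (simp add: power_mult_distrib)
 ultimately show ?thesis by simp
qed

locale weighted_sym =
 fixes N :: nat and A :: "nat \<Rightarrow> nat \<Rightarrow> real" and w :: "nat \<Rightarrow> real"
 assumes sym: "\<And>i j. i < N ==> j < N ==> A i j = A j i"
  and w0: "\<And>i. i < N ==> 0 <= w i" and w1: "\<And>i. i < N ==> w i <= 1"
begin

lemma winner_CS: "(winner N w x y)\<^sup>2 <= winner N w x x * winner N w y y"
 using weighted_CS[of "{..<N}" w x y] w0
 by (simp add: winner_def power2_eq_square mult.assoc)

lemma winner_nonneg: "0 <= winner N w x x"
 unfolding winner_def by (intro sum_nonneg) (simp add: w0 mult.assoc)

lemma vstep_adj: "winner N w (vstep N A w x) y = winner N w x (vstep N A w y)"
proof -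
 have "winner N w (vstep N A w x) y = (\<Sum>i<N. \<Sum>l<N. w i * A i l * w l * x l * y i)"
  by (simp add: winner_def vstep_def sum_distrib_left sum_distrib_right mult_ac)
 also have "\<dots> = (\<Sum>l<N. \<Sum>i<N. w i * A i l * w l * x l * y i)" by (rule sum.swap)
 also have "\<dots> = (\<Sum>l<N. \<Sum>i<N. w l * x l * (A l i * w i * y i))"
  by (intro sum.cong refl) (simp add: sym mult_ac)
 also have "\<dots> = winner N w x (vstep N A w y)"
  by (simp add: winner_def vstep_def sum_distrib_left)
 finally show ?thesis .
qed

lemma mstep_col: "(\<lambda>i. mstep N A w R i j) = vstep N A w (\<lambda>i. R i j)"
 by (simp add: mstep_def vstep_def)

lemma mstep_adj: "minner N w (mstep N A w R) R' = minner N w R (mstep N A w R')"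
 by (simp add: minner_def mstep_col vstep_adj)

lemma minner_nonneg: "0 <= minner N w R R"
 unfolding minner_def by (intro sum_nonneg mult_nonneg_nonneg winner_nonneg) (auto simp: w0)

lemma minner_CS: "(minner N w R R')\<^sup>2 <= minner N w R R * minner N w R' R'"
proof -
 let ?I = "{..<N} \<times> {..<N}"
 have e: "minner N w R R' = (\<Sum>p\<in>?I. (w (fst p) * w (snd p)) * R (snd p) (fst p) * R' (snd p) (fst p))" for R R'
  by (simp add: minner_def winner_def sum_distrib_left sum.cartesian_product case_prod_beta mult.assoc)
 have "\<And>p. p \<in> ?I ==> 0 <= w (fst p) * w (snd p)" using w0 by auto
 then show ?thesis
  unfolding e using weighted_CS[of ?I "\<lambda>p. w (fst p) * w (snd p)" "\<lambda>p. R (snd p) (fst p)" "\<lambda>p. R' (snd p) (fst p)"]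
  by (simp add: power2_eq_square mult.assoc case_prod_beta)
qed

text \<open>In terms of the eigenvalues \<lambda> of W^(1/2) A W^(1/2) this is the sum of
  \<lambda>^(2 (k + 1)). The proofs use only Cauchy-Schwarz and self-adjointness and never construct
  eigenvalues.\<close>

definition nrm :: "nat \<Rightarrow> real" where "nrm k = minner N w (mpow N A w k) (mpow N A w k)"

lemma mpow_Suc: "mpow N A w (Suc k) = mstep N A w (mpow N A w k)"
 by (simp add: mpow_def)

lemma nrm_nonneg: "0 <= nrm k" unfolding nrm_def by (rule minner_nonneg)

text \<open>One multiplication can be moved to the other side of the inner product, so the middle
  norm is the inner product of the two outer powers, and Cauchy-Schwarz applies.\<close>

lemma nrm_logconvex: "(nrm (Suc k))\<^sup>2 <= nrm k * nrm (Suc (Suc k))"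
proof -
 have "nrm (Suc k) = minner N w (mpow N A w k) (mpow N A w (Suc (Suc k)))"
  by (simp add: nrm_def mpow_Suc mstep_adj)
 then show ?thesis using minner_CS by (simp add: nrm_def)
qed

text \<open>The ratios \<open>nrm (Suc k) / nrm k\<close> increase, so that a bound on the last one bounds all.\<close>

lemma nrm_ratio_back:
 assumes "nrm (Suc k) <= B * nrm k" "0 <= B" "j <= k"
 shows "nrm (Suc j) <= B * nrm j"
 using assms(3,1)
proof (induction rule: inc_induct)
 case base
 then show ?case .
next
 case (step j)
 from step have IH: "nrm (Suc (Suc j)) <= B * nrm (Suc j)" by simp
 have c: "(nrm (Suc j))\<^sup>2 <= nrm j * nrm (Suc (Suc j))" by (rule nrm_logconvex)
 also have "\<dots> <= nrm j * (B * nrm (Suc j))"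
  by (intro mult_left_mono IH nrm_nonneg)
 finally have "nrm (Suc j) * nrm (Suc j) <= (B * nrm j) * nrm (Suc j)"
  by (simp add: power2_eq_square mult_ac)
 then show ?case
  using nrm_nonneg[of "Suc j"] nrm_nonneg[of j] assms(2)
  by (cases "nrm (Suc j) = 0") (auto simp: mult_le_cancel_right)
qed

lemma nrm_le_power:
 assumes "nrm (Suc k) <= B * nrm k" "0 <= B" "j <= Suc k"
 shows "nrm j <= B ^ j * nrm 0"
 using assms(3)
proof (induction j)
 case (Suc j)
 have "nrm (Suc j) <= B * nrm j" using nrm_ratio_back[OF assms(1,2)] Suc.prems by simp
 also have "\<dots> <= B * (B ^ j * nrm 0)" using Suc assms(2) by (intro mult_left_mono) auto
 finally show ?case by (simp add: mult_ac)
qed simp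

text \<open>In eigenvalues: (sum of \<lambda>^2)^2 <= N (sum of \<lambda>^4). It is Cauchy-Schwarz
  over the N diagonal entries of A W A; the other entries only enlarge \<open>nrm 1\<close>.\<close>

lemma nrm_0_sq: "(nrm 0)\<^sup>2 <= real N * nrm 1"
proof -
 let ?D = "\<lambda>i. \<Sum>l<N. A i l * w l * A l i"
 have "w j * (\<Sum>i<N. w i * A i j * A i j) = w j * ?D j" if "j < N" for j
  by (rule arg_cong[where f = "(*) (w j)"], rule sum.cong) (use that in \<open>auto simp: sym[of j]\<close>)
 then have n0: "nrm 0 = (\<Sum>j<N. w j * ?D j)"
  unfolding nrm_def mpow_def minner_def winner_def by (auto intro!: sum.cong)
 have "nrm 1 = (\<Sum>j<N. w j * (\<Sum>i<N. w i * (\<Sum>l<N. A i l * w l * A l j)\<^sup>2))"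
  by (simp add: nrm_def mpow_def minner_def winner_def mstep_def power2_eq_square mult.assoc)
 then have n1: "nrm 1 = (\<Sum>j<N. \<Sum>i<N. w j * (w i * (\<Sum>l<N. A i l * w l * A l j)\<^sup>2))"
  by (simp only: sum_distrib_left)
 have "(nrm 0)\<^sup>2 = (\<Sum>j<N. 1 * (w j * ?D j) * 1)\<^sup>2" by (simp add: n0)
 also have "\<dots> <= (\<Sum>j<N. 1 * (w j * ?D j)\<^sup>2) * (\<Sum>j<N. 1 * 1\<^sup>2)"
  by (rule weighted_CS) simp
 also have "(\<Sum>j<N. 1 * (w j * ?D j)\<^sup>2) <= nrm 1"
  unfolding n1
 proof (rule sum_mono)
  fix j assume j: "j \<in> {..<N}"
  have "1 * (w j * ?D j)\<^sup>2 = w j * (w j * (\<Sum>l<N. A j l * w l * A l j)\<^sup>2)"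
   by (simp add: power2_eq_square mult_ac)
  also have "\<dots> <= (\<Sum>i<N. w j * (w i * (\<Sum>l<N. A i l * w l * A l j)\<^sup>2))"
   using j w0 by (intro member_le_sum[of j "{..<N}" "\<lambda>i. w j * (w i * (\<Sum>l<N. A i l * w l * A l j)\<^sup>2)"]) auto
  finally show "1 * (w j * ?D j)\<^sup>2 <= (\<Sum>i<N. w j * (w i * (\<Sum>l<N. A i l * w l * A l j)\<^sup>2))" .
 qed
 finally show ?thesis by (simp add: mult.commute mult_right_mono)
qed

text \<open>The bound on the last ratio also holds for the first one, which closes the estimate of
  \<open>nrm 0\<close> against itself. In this way the data-dependent initial norm disappears from
  the final bound.\<close>

lemma nrm_0_le:
 assumes "nrm (Suc k) <= B * nrm k" "0 <= B"
 shows "nrm 0 <= real N * B"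
proof -
 have "nrm 1 <= B * nrm 0" using nrm_ratio_back[OF assms, of 0] by simp
 then have "(nrm 0)\<^sup>2 <= (real N * B) * nrm 0"
  using nrm_0_sq mult_left_mono[of "nrm 1" "B * nrm 0" "real N"] by (simp add: mult.assoc)
 then show ?thesis using nrm_nonneg[of 0] assms(2)
  by (cases "nrm 0 = 0") (auto simp: power2_eq_square mult_le_cancel_right)
qed

definition vpow :: "(nat \<Rightarrow> real) \<Rightarrow> nat \<Rightarrow> nat \<Rightarrow> real" where
 "vpow x k = (vstep N A w ^^ k) x"

lemma vpow_Suc: "vpow x (Suc k) = vstep N A w (vpow x k)" by (simp add: vpow_def)

lemma vpow_mpow: "vpow x (Suc k) i = (\<Sum>l<N. mpow N A w k i l * w l * x l)"
proof (induction k arbitrary: i)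
 case 0
 show ?case by (simp add: vpow_def mpow_def vstep_def)
next
 case (Suc k)
 have "vpow x (Suc (Suc k)) i = (\<Sum>m<N. A i m * w m * (\<Sum>l<N. mpow N A w k m l * w l * x l))"
  by (simp only: vpow_Suc[of x "Suc k"] vstep_def Suc)
 also have "\<dots> = (\<Sum>m<N. \<Sum>l<N. A i m * w m * mpow N A w k m l * w l * x l)"
  by (simp add: sum_distrib_left mult_ac)
 also have "\<dots> = (\<Sum>l<N. \<Sum>m<N. A i m * w m * mpow N A w k m l * w l * x l)" by (rule sum.swap)
 also have "\<dots> = (\<Sum>l<N. mpow N A w (Suc k) i l * w l * x l)"
  by (simp add: mpow_Suc mstep_def sum_distrib_right)
 finally show ?case .
qed

text \<open>Cauchy-Schwarz in every row: the operator norm is at most the Frobenius norm.\<close>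

lemma vpow_le: "winner N w (vpow x (Suc k)) (vpow x (Suc k)) <= winner N w x x * nrm k"
proof -
 let ?R = "mpow N A w k"
 have "winner N w (vpow x (Suc k)) (vpow x (Suc k)) = (\<Sum>i<N. w i * (\<Sum>l<N. w l * ?R i l * x l)\<^sup>2)"
  by (simp add: winner_def vpow_mpow power2_eq_square mult_ac)
 also have "\<dots> <= (\<Sum>i<N. w i * ((\<Sum>l<N. w l * (?R i l)\<^sup>2) * (\<Sum>l<N. w l * (x l)\<^sup>2)))"
  by (intro sum_mono mult_left_mono weighted_CS) (auto simp: w0)
 also have "\<dots> = (\<Sum>l<N. w l * (x l)\<^sup>2) * (\<Sum>i<N. \<Sum>l<N. w i * (w l * (?R i l)\<^sup>2))"
  by (simp add: sum_distrib_left mult_ac)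
 also have "(\<Sum>i<N. \<Sum>l<N. w i * (w l * (?R i l)\<^sup>2)) = nrm k"
  unfolding nrm_def minner_def winner_def
  by (subst sum.swap) (simp add: sum_distrib_left power2_eq_square mult_ac)
 finally show ?thesis by (simp add: winner_def power2_eq_square mult.assoc)
qed

text \<open>The step T = A W is self-adjoint, so the squared norms of x, T x, T^2 x, ... are
  log-convex and grow at least geometrically with their first ratio. The inequality is cleared of
  denominators because x may have norm 0.\<close>

lemma vpow_ge:
 "(winner N w (vstep N A w x) (vstep N A w x)) ^ k * winner N w x x
   <= (winner N w x x) ^ k * winner N w (vpow x k) (vpow x k)"
proof -
 define a where "a k = winner N w (vpow x k) (vpow x k)" for k
 have nn: "0 <= a k" for k by (simp add: a_def winner_nonneg)
 have lc: "(a (Suc k))\<^sup>2 <= a k * a (Suc (Suc k))" for k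
 proof -
  have "a (Suc k) = winner N w (vpow x k) (vpow x (Suc (Suc k)))"
   by (simp add: a_def vpow_Suc vstep_adj)
  then show ?thesis using winner_CS by (simp add: a_def)
 qed
 have r: "a 1 * a k <= a 0 * a (Suc k)" for k
 proof (induction k)
  case (Suc k)
  show ?case
  proof (cases "a k = 0")
   case True
   then show ?thesis using lc[of k] nn by simp
  next
   case False
   then have p: "a k > 0" using nn[of k] by simp
   have "a k * (a 1 * a (Suc k)) <= a 0 * (a (Suc k))\<^sup>2"
    using mult_right_mono[OF Suc nn[of "Suc k"]] by (simp add: power2_eq_square mult_ac)
   also have "\<dots> <= a 0 * (a k * a (Suc (Suc k)))" by (intro mult_left_mono lc nn)
   finally have "a k * (a 1 * a (Suc k)) <= a k * (a 0 * a (Suc (Suc k)))" by (simp add: mult_ac)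
   then show ?thesis using p by simp
  qed
 qed simp
 have "a 1 ^ k * a 0 <= a 0 ^ k * a k"
 proof (induction k)
  case (Suc k)
  have "a 1 ^ Suc k * a 0 <= a 0 ^ k * (a 1 * a k)"
   using mult_left_mono[OF Suc nn[of 1]] by (simp add: mult_ac)
  also have "\<dots> <= a 0 ^ k * (a 0 * a (Suc k))" by (intro mult_left_mono r) (simp add: nn)
  finally show ?case by (simp add: mult_ac)
 qed simp
 then show ?thesis by (simp add: a_def vpow_def)
qed

text \<open>Bernoulli's inequality gives sqrt N <= (1 + 1 / sqrt N)^(N + 1). This pays for the
  factor N by which a Frobenius norm can exceed the operator norm.\<close>

lemma pow_sqrt_ge: "real N <= (1 + 1 / sqrt (real N)) ^ (2 * Suc N)"
proof (cases "N = 0")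
 case False
 have "1 + real (Suc N) * (1 / sqrt (real N)) <= (1 + 1 / sqrt (real N)) ^ Suc N"
  by (rule Bernoulli_inequality) (simp add: order_trans[of _ 0])
 moreover have "sqrt (real N) <= real (Suc N) * (1 / sqrt (real N))"
  using False by (simp add: field_simps)
 ultimately have "sqrt (real N) <= (1 + 1 / sqrt (real N)) ^ Suc N" by simp
 then have "(sqrt (real N))\<^sup>2 <= ((1 + 1 / sqrt (real N)) ^ Suc N)\<^sup>2" by (intro power_mono) auto
 moreover have "((1 + 1 / sqrt (real N)) ^ Suc N)\<^sup>2 = (1 + 1 / sqrt (real N)) ^ (2 * Suc N)"
  by (simp only: power_mult[symmetric] mult.commute)
 ultimately show ?thesis by (simp del: power_Suc mult_Suc_right)
qed simp

text \<open>The squared norm of T^(N+1) x is at least the (N+1)-st power of the first growth factor,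
  and at most the squared Frobenius norm of that power, which is bounded by N B^(N+1). Taking
  (N+1)-st roots leaves the factor (1 + 1 / sqrt N)^2.\<close>

lemma vstep_le:
 assumes "nrm (Suc k) <= B * nrm k" "0 <= B" "Suc k = N"
 shows "winner N w (vstep N A w x) (vstep N A w x) <= B * (1 + 1 / sqrt (real N))\<^sup>2 * winner N w x x"
proof -
 define a0 a1 where "a0 = winner N w x x" and "a1 = winner N w (vstep N A w x) (vstep N A w x)"
 have nn: "0 <= a0" "0 <= a1" by (simp_all add: a0_def a1_def winner_nonneg)
 have "winner N w (vpow x (Suc N)) (vpow x (Suc N)) <= a0 * nrm N"
  using vpow_le[of x N] by (simp add: a0_def)
 also have "nrm N <= B ^ N * nrm 0" using nrm_le_power[OF assms(1,2), of N] assms(3) by simp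
 also have "\<dots> <= B ^ N * (real N * B)"
  by (intro mult_left_mono nrm_0_le[OF assms(1,2)]) (simp add: assms(2))
 also have "\<dots> <= B ^ N * ((1 + 1 / sqrt (real N)) ^ (2 * Suc N) * B)"
  by (intro mult_left_mono mult_right_mono pow_sqrt_ge) (auto simp: assms(2))
 also have "B ^ N * ((1 + 1 / sqrt (real N)) ^ (2 * Suc N) * B) = (B * (1 + 1 / sqrt (real N))\<^sup>2) ^ Suc N"
  unfolding power_mult[of _ 2] by (simp add: power_mult_distrib mult_ac)
 finally have 1: "winner N w (vpow x (Suc N)) (vpow x (Suc N)) <= a0 * (B * (1 + 1 / sqrt (real N))\<^sup>2) ^ Suc N"
  using nn by (simp add: mult_left_mono)
 have "a1 ^ Suc N * a0 <= a0 ^ Suc N * winner N w (vpow x (Suc N)) (vpow x (Suc N))"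
  using vpow_ge[of x "Suc N"] by (simp add: a0_def a1_def)
 also have "\<dots> <= a0 ^ Suc N * (a0 * (B * (1 + 1 / sqrt (real N))\<^sup>2) ^ Suc N)"
  by (intro mult_left_mono 1) (simp add: nn)
 also have "\<dots> = (B * (1 + 1 / sqrt (real N))\<^sup>2 * a0) ^ Suc N * a0"
  by (simp add: power_mult_distrib mult_ac)
 finally have 2: "a1 ^ Suc N * a0 <= (B * (1 + 1 / sqrt (real N))\<^sup>2 * a0) ^ Suc N * a0" .
 show ?thesis
 proof (cases "a0 = 0")
  case True
  \<comment> \<open>A vector of weighted norm 0 need not vanish. Self-adjointness writes the squared
    norm of T x as the inner product of x and T^2 x, which is 0 by Cauchy-Schwarz.\<close>
  have "a1\<^sup>2 <= a0 * winner N w (vpow x 2) (vpow x 2)"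
   using winner_CS[of x "vpow x 2"] unfolding a1_def a0_def vstep_adj
   by (simp add: vpow_def numeral_2_eq_2)
  then have "a1 = 0" using True by simp
  then show ?thesis using True by (simp add: a0_def a1_def)
 next
  case False
  then have "a1 ^ Suc N <= (B * (1 + 1 / sqrt (real N))\<^sup>2 * a0) ^ Suc N"
   using 2 nn by (simp add: mult_le_cancel_right del: power_Suc)
  then show ?thesis unfolding a0_def[symmetric] a1_def[symmetric]
   by (rule power_le_imp_le_base) (use nn assms(2) in auto)
 qed
qed

end

section \<open>Gaussian tail bounds\<close>

text \<open>A bound on outer probability: the failures only have to lie inside a small measurable
  set. Events quantified over all real vectors then need no measurability proof.\<close>

definition fails_le :: "'a measure \<Rightarrow> real \<Rightarrow> ('a \<Rightarrow> bool) \<Rightarrow> bool" where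
 "fails_le M p Q \<longleftrightarrow> (\<exists>E\<in>sets M. measure M E <= p \<and> (\<forall>x\<in>space M - E. Q x))"

lemma fails_le_mono:
 assumes "fails_le M p Q" "p <= q" "\<And>x. x \<in> space M ==> Q x ==> R x"
 shows "fails_le M q R"
proof -
 obtain E where "E \<in> sets M" "measure M E <= p" "\<forall>x\<in>space M - E. Q x"
  using assms(1) unfolding fails_le_def by auto
 then show ?thesis unfolding fails_le_def using assms(2,3) by (intro bexI[of _ E]) auto
qed

lemma fails_le_True: "0 <= p ==> (\<And>x. x \<in> space M ==> Q x) ==> fails_le M p Q"
 unfolding fails_le_def by (intro bexI[of _ "{}"]) auto

context prob_space begin

lemma fails_le_conj:
 assumes "fails_le M p Q" "fails_le M q R"
 shows "fails_le M (p + q) (\<lambda>x. Q x \<and> R x)"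
proof -
 obtain E F where "E \<in> sets M" "measure M E <= p" "\<forall>x\<in>space M - E. Q x"
  "F \<in> sets M" "measure M F <= q" "\<forall>x\<in>space M - F. R x"
  using assms unfolding fails_le_def by auto
 then show ?thesis unfolding fails_le_def
  using measure_Un_le[of E M F] by (intro bexI[of _ "E \<union> F"]) auto
qed

lemma fails_le_ball:
 assumes "finite I" "\<And>i. i \<in> I ==> fails_le M (p i) (Q i)"
 shows "fails_le M (\<Sum>i\<in>I. p i) (\<lambda>x. \<forall>i\<in>I. Q i x)"
 using assms
proof (induction I rule: finite_induct)
 case empty
 then show ?case by (intro fails_le_True) auto
next
 case (insert i I)
 have "fails_le M (p i + (\<Sum>i\<in>I. p i)) (\<lambda>x. Q i x \<and> (\<forall>i\<in>I. Q i x))"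
  by (rule fails_le_conj) (use insert in auto)
 then show ?case using insert by simp
qed

end

text \<open>The left-hand side is the expectation of exp (l (g^2 - 1)) for a standard normal g. The
  bound comes from ln (1 + x) >= x - 2 x^2 at x = - 2 l.\<close>

lemma mgf_const_le:
 fixes l :: real
 assumes "\<bar>l\<bar> <= 1/4"
 shows "exp (- l) / sqrt (1 - 2 * l) <= exp (4 * l\<^sup>2)"
proof -
 have p: "0 < 1 - 2 * l" using assms by auto
 have "\<bar>ln (1 + (- 2 * l)) - (- 2 * l)\<bar> <= 2 * (- 2 * l)\<^sup>2"
  by (rule abs_ln_one_plus_x_minus_x_bound) (use assms in auto)
 then have "- 2 * l - 8 * l\<^sup>2 <= ln (1 - 2 * l)" by (auto simp: abs_le_iff power2_eq_square)
 then have "- l - 4 * l\<^sup>2 <= ln (sqrt (1 - 2 * l))" using p by (simp add: ln_sqrt)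
 then have "exp (- l - 4 * l\<^sup>2) <= sqrt (1 - 2 * l)"
  using p by (metis exp_le_cancel_iff exp_ln real_sqrt_gt_zero)
 then have "exp (- l) <= exp (4 * l\<^sup>2) * sqrt (1 - 2 * l)"
  by (simp add: exp_diff field_simps)
 then show ?thesis using p by (simp add: divide_le_eq)
qed

context prob_space begin

text \<open>Tilting the standard normal density by exp (l x^2) gives a multiple of the centred
  normal density with variance 1 / (1 - 2 l), whose total mass is known.\<close>

lemma mgf_square:
 assumes g: "distributed M lborel g std_normal_density" and l: "\<bar>l\<bar> <= 1/4"
 shows "(\<integral>\<^sup>+x. ennreal (exp (l * ((g x)\<^sup>2 - 1))) \<partial>M) <= ennreal (exp (4 * l\<^sup>2))"
proof -
 have p: "0 < 1 - 2 * l" using l by auto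
 define s where "s = 1 / sqrt (1 - 2 * l)"
 have s: "0 < s" "s\<^sup>2 = 1 / (1 - 2 * l)" using p by (auto simp: s_def power_divide)
 have eq: "std_normal_density x * exp (l * (x\<^sup>2 - 1)) = exp (- l) * s * normal_density 0 s x" for x
 proof -
  have "- x\<^sup>2 / 2 + l * (x\<^sup>2 - 1) = - l + - x\<^sup>2 / (2 * s\<^sup>2)"
   unfolding s(2) using p by (simp add: field_simps)
  then have "exp (- x\<^sup>2 / 2) * exp (l * (x\<^sup>2 - 1)) = exp (- l) * exp (- x\<^sup>2 / (2 * s\<^sup>2))"
   by (simp only: exp_add[symmetric])
  then show ?thesis using s(1)
   by (simp add: normal_density_def real_sqrt_mult field_simps)
 qed
 have "(\<integral>\<^sup>+x. ennreal (exp (l * ((g x)\<^sup>2 - 1))) \<partial>M) =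
   (\<integral>\<^sup>+x. ennreal (std_normal_density x) * ennreal (exp (l * (x\<^sup>2 - 1))) \<partial>lborel)"
  by (rule distributed_nn_integral[OF g, symmetric]) simp
 also have "\<dots> = (\<integral>\<^sup>+x. ennreal (exp (- l) * s) * ennreal (normal_density 0 s x) \<partial>lborel)"
  using s(1) by (intro nn_integral_cong) (simp add: ennreal_mult''[symmetric] ennreal_mult[symmetric] eq)
 also have "\<dots> = ennreal (exp (- l) * s) * (\<integral>\<^sup>+x. ennreal (normal_density 0 s x) \<partial>lborel)"
  by (rule nn_integral_cmult) simp
 also have "(\<integral>\<^sup>+x. ennreal (normal_density 0 s x) \<partial>lborel) = 1"
 proof -
  interpret D: prob_space "density lborel (\<lambda>x. ennreal (normal_density 0 s x))"
   using s(1) by (rule prob_space_normal_density)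
  show ?thesis using D.emeasure_space_1 by (simp add: emeasure_density)
 qed
 also have "ennreal (exp (- l) * s) * 1 <= ennreal (exp (4 * l\<^sup>2))"
  using mgf_const_le[OF l] by (simp add: s_def ennreal_leI)
 finally show ?thesis .
qed

lemma chernoff_squares:
 assumes ind: "indep_vars (\<lambda>_. borel) g L" and fin: "finite L"
  and nor: "\<And>r. r \<in> L ==> distributed M lborel (g r) std_normal_density"
  and l: "\<bar>l\<bar> <= 1/4"
 defines "S \<equiv> \<lambda>x. \<Sum>r\<in>L. (g r x)\<^sup>2 - 1"
 shows "S \<in> borel_measurable M"
  "prob {x\<in>space M. y <= l * S x} <= exp (4 * l\<^sup>2 * real (card L) - y)"
proof -
 have rv: "random_variable borel (g r)" if "r \<in> L" for r
  using nor[OF that] by (simp add: distributed_def)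
 show S: "S \<in> borel_measurable M"
  unfolding S_def by (intro borel_measurable_sum borel_measurable_diff borel_measurable_power rv) auto
 have "indep_vars (\<lambda>_. borel) (\<lambda>r x. ennreal (exp (l * ((g r x)\<^sup>2 - 1)))) L"
  by (rule indep_vars_compose2[OF ind]) measurable
 then have "(\<integral>\<^sup>+x. (\<Prod>r\<in>L. ennreal (exp (l * ((g r x)\<^sup>2 - 1)))) \<partial>M) =
   (\<Prod>r\<in>L. \<integral>\<^sup>+x. ennreal (exp (l * ((g r x)\<^sup>2 - 1))) \<partial>M)"
  by (intro indep_vars_nn_integral fin) auto
 also have "\<dots> <= (\<Prod>r\<in>L. ennreal (exp (4 * l\<^sup>2)))"
  by (intro prod_mono_ennreal) (auto intro: mgf_square nor l)
 also have "\<dots> = ennreal (exp (4 * l\<^sup>2 * real (card L)))"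
  by (simp add: ennreal_power exp_of_nat_mult[symmetric] mult.commute)
 finally have *: "(\<integral>\<^sup>+x. ennreal (exp (l * S x)) \<partial>M) <= ennreal (exp (4 * l\<^sup>2 * real (card L)))"
  by (simp add: prod_ennreal exp_sum[OF fin, symmetric] sum_distrib_left S_def)
 let ?E = "{x\<in>space M. y <= l * S x}"
 have E: "?E \<in> sets M"
  using measurable_sets[OF S, of "{s. y <= l * s}"] by (simp add: vimage_def Int_def conj_commute)
 have m: "(\<lambda>x. ennreal (exp (l * S x))) \<in> borel_measurable M"
  by (rule measurable_compose[OF S]) measurable
 have "emeasure M ?E = (\<integral>\<^sup>+x. indicator ?E x \<partial>M)" using E by simp
 also have "\<dots> <= (\<integral>\<^sup>+x. ennreal (exp (- y)) * ennreal (exp (l * S x)) \<partial>M)"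
 proof (rule nn_integral_mono)
  fix x assume "x \<in> space M"
  have "1 <= exp (- y) * exp (l * S x)" if "x \<in> ?E"
   using that by (simp add: exp_add[symmetric])
  then show "indicator ?E x <= ennreal (exp (- y)) * ennreal (exp (l * S x))"
   by (auto simp: indicator_def ennreal_mult[symmetric] ennreal_1[symmetric] simp del: ennreal_1 intro: ennreal_leI)
 qed
 also have "\<dots> = ennreal (exp (- y)) * (\<integral>\<^sup>+x. ennreal (exp (l * S x)) \<partial>M)"
  by (rule nn_integral_cmult[OF m])
 also have "\<dots> <= ennreal (exp (- y)) * ennreal (exp (4 * l\<^sup>2 * real (card L)))"
  by (intro mult_left_mono *) simp
 also have "\<dots> = ennreal (exp (4 * l\<^sup>2 * real (card L) - y))"
  by (simp add: ennreal_mult[symmetric] exp_add[symmetric])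
 finally show "prob ?E <= exp (4 * l\<^sup>2 * real (card L) - y)" by (simp add: emeasure_eq_measure)
qed

lemma chi_square_tail:
 assumes ind: "indep_vars (\<lambda>_. borel) g L" and fin: "finite L"
  and nor: "\<And>r. r \<in> L ==> distributed M lborel (g r) std_normal_density"
  and t: "0 <= t"
 shows "fails_le M (2 * exp (- t))
  (\<lambda>x. \<bar>\<Sum>r\<in>L. (g r x)\<^sup>2 - 1\<bar> <= 8 * (sqrt (real (card L) * t) + t))"
proof -
 define m where "m = real (card L)"
 \<comment> \<open>The minimiser of the Chernoff exponent up to constants: sqrt (t / m) / 4 in the
   Gaussian regime t <= m, and the largest admissible value 1/4 beyond it.\<close>
 define l where "l = (if t <= m \<and> 0 < m then sqrt (t / m) / 4 else 1/4)"
 have m: "0 <= m" by (simp add: m_def)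
 have l: "0 <= l" "l <= 1/4" using t by (auto simp: l_def)
 have ex: "4 * l\<^sup>2 * m - l * (8 * (sqrt (m * t) + t)) <= - t"
 proof (cases "t <= m \<and> 0 < m")
  case True
  then have l2: "4 * l\<^sup>2 * m = t / 4" using t by (simp add: l_def power_divide)
  have "sqrt (t / m) * sqrt (m * t) = t"
   using True t by (simp add: real_sqrt_mult[symmetric])
  moreover have "l * (8 * sqrt (m * t)) = 2 * (sqrt (t / m) * sqrt (m * t))" using True by (simp add: l_def)
  ultimately have "l * (8 * sqrt (m * t)) = 2 * t" by simp
  moreover have "0 <= l * (8 * t)" using l t by simp
  ultimately show ?thesis using l2 t by (simp add: algebra_simps)
 next
  case False
  then have "m <= t" using m t by auto
  moreover have "0 <= sqrt (m * t)" using m t by simp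
  moreover have "4 * l\<^sup>2 * m - l * (8 * (sqrt (m * t) + t)) = m / 4 - 2 * sqrt (m * t) - 2 * t"
  proof -
   have "l = 1/4" using False unfolding l_def by auto
   then have l4: "4 * l = 1" by simp
   have "4 * l\<^sup>2 * m - l * (8 * (sqrt (m * t) + t)) = (4 * l) * (4 * l) * m / 4 - (4 * l) * 2 * (sqrt (m * t) + t)"
    by (simp add: power2_eq_square)
   then show ?thesis unfolding l4 by simp
  qed
  ultimately show ?thesis using t by linarith
 qed
 define S where "S x = (\<Sum>r\<in>L. (g r x)\<^sup>2 - 1)" for x
 let ?y = "l * (8 * (sqrt (m * t) + t))"
 have S [measurable]: "S \<in> borel_measurable M"
  unfolding S_def by (rule chernoff_squares(1)[of g L 0, OF ind fin nor]) auto
 have ch: "prob {x\<in>space M. y <= l' * S x} <= exp (4 * l'\<^sup>2 * real (card L) - y)"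
  if "\<bar>l'\<bar> <= 1/4" for l' y
  unfolding S_def by (rule chernoff_squares(2)[OF ind fin nor that]) auto
 let ?E = "{x\<in>space M. ?y <= l * S x}" and ?F = "{x\<in>space M. ?y <= (- l) * S x}"
 have E: "?E \<in> sets M" "?F \<in> sets M" by measurable
 have y: "exp (4 * l\<^sup>2 * real (card L) - ?y) <= exp (- t)" using ex by (simp add: m_def)
 have "prob ?E <= exp (- t)"
  by (rule order_trans[OF ch[of l ?y] y]) (use l in simp)
 moreover have "prob ?F <= exp (- t)"
  by (rule order_trans[OF ch[of "- l" ?y]]) (use l y in simp_all)
 ultimately have "prob (?E \<union> ?F) <= 2 * exp (- t)"
  using measure_Un_le[OF E] by linarith
 moreover have "\<bar>S x\<bar> <= 8 * (sqrt (m * t) + t)" if "x \<in> space M - (?E \<union> ?F)" for x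
 proof -
  let ?z = "8 * (sqrt (m * t) + t)"
  from that have 1: "l * S x < l * ?z" "l * (- S x) < l * ?z" by auto
  then have "0 < l" using l(1) by (cases "l = 0") auto
  then have "S x < ?z" "- S x < ?z" using 1 by (simp_all only: mult_less_cancel_left_pos)
  then show ?thesis by linarith
 qed
 ultimately show ?thesis
  unfolding fails_le_def m_def[symmetric] S_def[symmetric] using E by (intro bexI[of _ "?E \<union> ?F"]) auto
qed

end

locale gauss_family = prob_space +
 fixes X :: "'i \<Rightarrow> 'a \<Rightarrow> real" and I :: "'i set"
 assumes fin_I: "finite I" and ind_I: "indep_vars (\<lambda>_. borel) X I"
  and nor_I: "\<And>i. i \<in> I ==> distributed M lborel (X i) std_normal_density"
begin

lemma lin_comb_normal:
 assumes K: "K \<subseteq> I" and c: "(\<Sum>i\<in>K. (c i)\<^sup>2) = 1"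
 shows "distributed M lborel (\<lambda>x. \<Sum>i\<in>K. c i * X i x) std_normal_density"
proof -
 \<comment> \<open>Vanishing coefficients are removed because the rule for sums of independent
   normal variables asks for positive standard deviations.\<close>
 define K' where "K' = {i\<in>K. c i \<noteq> 0}"
 have fin: "finite K" "finite K'" using finite_subset[OF K fin_I] by (auto simp: K'_def)
 have c': "(\<Sum>i\<in>K'. (c i)\<^sup>2) = 1"
  using c fin by (subst sum.mono_neutral_left[of K K']) (auto simp: K'_def)
 then have ne: "K' \<noteq> {}" by auto
 have sub: "K' \<subseteq> I" using K by (auto simp: K'_def)
 have "indep_vars (\<lambda>_. borel) (\<lambda>i x. c i * X i x) K'"
  by (rule indep_vars_compose2[OF indep_vars_subset[OF ind_I sub]]) measurable
 moreover have "distributed M lborel (\<lambda>x. c i * X i x) (normal_density 0 \<bar>c i\<bar>)" if "i \<in> K'" for i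
  using normal_density_affine[OF nor_I, of i "c i" 0] that sub by (auto simp: K'_def)
 ultimately have "distributed M lborel (\<lambda>x. \<Sum>i\<in>K'. c i * X i x)
   (normal_density (\<Sum>i\<in>K'. 0) (sqrt (\<Sum>i\<in>K'. \<bar>c i\<bar>\<^sup>2)))"
  using ne fin by (intro sum_indep_normal) (auto simp: K'_def)
 moreover have "(\<Sum>i\<in>K'. c i * X i x) = (\<Sum>i\<in>K. c i * X i x)" for x
  using fin by (intro sum.mono_neutral_left) (auto simp: K'_def)
 ultimately show ?thesis using c' by simp
qed

lemma blocks_indep:
 assumes K: "\<And>r. r \<in> L ==> K r \<subseteq> I" and disj: "disjoint_family_on K L"
 shows "indep_vars (\<lambda>_. borel) (\<lambda>r x. \<Sum>i\<in>K r. c i * X i x) L"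
proof -
 have "indep_vars (\<lambda>j. PiM (K j) (\<lambda>_. borel)) (\<lambda>j \<omega>. restrict (\<lambda>i. X i \<omega>) (K j)) L"
  by (rule indep_vars_restrict[OF ind_I K disj])
 then have "indep_vars (\<lambda>_. borel) (\<lambda>j \<omega>. (\<lambda>f. \<Sum>i\<in>K j. c i * f i) (restrict (\<lambda>i. X i \<omega>) (K j))) L"
  by (rule indep_vars_compose2) measurable
 then show ?thesis by simp
qed

text \<open>Divided by the norm of \<open>u\<close>, each row sum is standard normal, and different
  rows use disjoint sets of variables. The injection \<open>e\<close> leaves open which index is
  summed inside: it is used for rows, for columns, and with one single row that contains all
  pairs.\<close>

lemma chi_square_rows:
 assumes fin: "finite L" "finite C" and inj: "inj_on (\<lambda>(r, c). e r c) (L \<times> C)"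
  and sub: "\<And>r c. r \<in> L ==> c \<in> C ==> e r c \<in> I" and t: "0 <= t"
 shows "fails_le M (2 * exp (- t))
  (\<lambda>x. \<bar>(\<Sum>r\<in>L. (\<Sum>c\<in>C. u c * X (e r c) x)\<^sup>2) - real (card L) * (\<Sum>c\<in>C. (u c)\<^sup>2)\<bar>
    <= 8 * (sqrt (real (card L) * t) + t) * (\<Sum>c\<in>C. (u c)\<^sup>2))"
proof (cases "(\<Sum>c\<in>C. (u c)\<^sup>2) = 0")
 case True
 then have "\<forall>c\<in>C. u c = 0" using fin by (simp add: sum_nonneg_eq_0_iff)
 then show ?thesis by (intro fails_le_True) (auto simp: True)
next
 case False
 define n where "n = sqrt (\<Sum>c\<in>C. (u c)\<^sup>2)"
 have n: "0 < n" "n\<^sup>2 = (\<Sum>c\<in>C. (u c)\<^sup>2)"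
  using False sum_nonneg[of C "\<lambda>c. (u c)\<^sup>2"] by (auto simp: n_def less_le)
 define a where "a i = u (snd (inv_into (L \<times> C) (\<lambda>(r, c). e r c) i)) / n" for i
 have a: "a (e r c) = u c / n" if "r \<in> L" "c \<in> C" for r c
  using inv_into_f_f[OF inj, of "(r, c)"] that by (simp add: a_def)
 define K where "K r = e r ` C" for r
 have injr: "inj_on (e r) C" if "r \<in> L" for r
 proof (rule inj_onI)
  fix c c' assume "c \<in> C" "c' \<in> C" "e r c = e r c'"
  then show "c = c'" using inj_onD[OF inj, of "(r, c)" "(r, c')"] that by simp
 qed
 have K: "K r \<subseteq> I" if "r \<in> L" for r using sub that by (auto simp: K_def)
 have disj: "disjoint_family_on K L"
  unfolding disjoint_family_on_def
 proof (intro ballI impI)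
  fix r r' assume r: "r \<in> L" "r' \<in> L" "r \<noteq> r'"
  have "e r c \<noteq> e r' c'" if "c \<in> C" "c' \<in> C" for c c'
   using inj_onD[OF inj, of "(r, c)" "(r', c')"] that r by auto
  then show "K r \<inter> K r' = {}" by (auto simp: K_def)
 qed
 have g: "(\<Sum>i\<in>K r. a i * X i x) = (\<Sum>c\<in>C. u c * X (e r c) x) / n" if "r \<in> L" for r x
  unfolding K_def by (subst sum.reindex[OF injr[OF that]]) (simp add: a that sum_divide_distrib)
 have "(\<Sum>i\<in>K r. (a i)\<^sup>2) = 1" if "r \<in> L" for r
  unfolding K_def
  by (subst sum.reindex[OF injr[OF that]])
    (use n(1) in \<open>simp add: a that power_divide sum_divide_distrib[symmetric] n(2)[symmetric]\<close>)
 from chi_square_tail[OF blocks_indep[OF K disj, of a] fin(1) lin_comb_normal[OF K this] t]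
 have "fails_le M (2 * exp (- t))
  (\<lambda>x. \<bar>\<Sum>r\<in>L. (\<Sum>i\<in>K r. a i * X i x)\<^sup>2 - 1\<bar> <= 8 * (sqrt (real (card L) * t) + t))" by simp
 then show ?thesis
 proof (rule fails_le_mono)
  fix x assume "\<bar>\<Sum>r\<in>L. (\<Sum>i\<in>K r. a i * X i x)\<^sup>2 - 1\<bar> <= 8 * (sqrt (real (card L) * t) + t)"
  then have *: "\<bar>\<Sum>r\<in>L. ((\<Sum>c\<in>C. u c * X (e r c) x) / n)\<^sup>2 - 1\<bar> * n\<^sup>2 <= 8 * (sqrt (real (card L) * t) + t) * n\<^sup>2"
   by (intro mult_right_mono) (simp_all add: g cong: sum.cong)
  have "(\<Sum>r\<in>L. ((\<Sum>c\<in>C. u c * X (e r c) x) / n)\<^sup>2 - 1) * n\<^sup>2 =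
    (\<Sum>r\<in>L. (\<Sum>c\<in>C. u c * X (e r c) x)\<^sup>2) - real (card L) * n\<^sup>2"
   using n(1) by (simp add: sum_distrib_right left_diff_distrib sum_subtractf power_divide)
  then have "\<bar>\<Sum>r\<in>L. ((\<Sum>c\<in>C. u c * X (e r c) x) / n)\<^sup>2 - 1\<bar> * n\<^sup>2 =
    \<bar>(\<Sum>r\<in>L. (\<Sum>c\<in>C. u c * X (e r c) x)\<^sup>2) - real (card L) * n\<^sup>2\<bar>"
   by (metis (no_types, lifting) abs_mult abs_power2)
  with * show "\<bar>(\<Sum>r\<in>L. (\<Sum>c\<in>C. u c * X (e r c) x)\<^sup>2) - real (card L) * (\<Sum>c\<in>C. (u c)\<^sup>2)\<bar>
    <= 8 * (sqrt (real (card L) * t) + t) * (\<Sum>c\<in>C. (u c)\<^sup>2)"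
   unfolding n(2) by simp
 qed simp
qed

end

section \<open>Quadratic forms and nets\<close>

definition quad :: "'c set \<Rightarrow> ('c \<Rightarrow> 'c \<Rightarrow> real) \<Rightarrow> ('c \<Rightarrow> real) \<Rightarrow> ('c \<Rightarrow> real) \<Rightarrow> real" where
 "quad C Q x y = (\<Sum>i\<in>C. \<Sum>j\<in>C. Q i j * x i * y j)"

lemma quad_add_left: "quad C Q (\<lambda>i. x i + y i) z = quad C Q x z + quad C Q y z"
 by (simp add: quad_def algebra_simps sum.distrib)

lemma quad_diff_left: "quad C Q (\<lambda>i. x i - y i) z = quad C Q x z - quad C Q y z"
 by (simp add: quad_def algebra_simps sum_subtractf)

lemma quad_add_right: "quad C Q z (\<lambda>i. x i + y i) = quad C Q z x + quad C Q z y"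
 by (simp add: quad_def algebra_simps sum.distrib)

lemma quad_sym:
 assumes "\<forall>i\<in>C. \<forall>j\<in>C. Q i j = Q j i"
 shows "quad C Q x y = quad C Q y x"
proof -
 have "quad C Q x y = (\<Sum>j\<in>C. \<Sum>i\<in>C. Q i j * x i * y j)" unfolding quad_def by (rule sum.swap)
 also have "\<dots> = quad C Q y x" unfolding quad_def
  by (intro sum.cong refl) (simp add: assms mult_ac)
 finally show ?thesis .
qed

lemma quad_polarize:
 assumes sym: "\<forall>i\<in>C. \<forall>j\<in>C. Q i j = Q j i"
 shows "4 * quad C Q x y = quad C Q (\<lambda>i. x i + y i) (\<lambda>i. x i + y i) - quad C Q (\<lambda>i. x i - y i) (\<lambda>i. x i - y i)"
proof -
 have r: "quad C Q z (\<lambda>i. x i + y i) = quad C Q z x + quad C Q z y"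
  "quad C Q z (\<lambda>i. x i - y i) = quad C Q z x - quad C Q z y" for z
  by (simp_all add: quad_def algebra_simps sum.distrib sum_subtractf)
 show ?thesis using quad_sym[OF sym, where x = x and y = y] by (simp add: quad_add_left quad_diff_left r)
qed

lemma quad_polar_bound:
 assumes sym: "\<forall>i\<in>C. \<forall>j\<in>C. Q i j = Q j i"
  and b: "\<And>v. \<bar>quad C Q v v\<bar> <= B * (\<Sum>i\<in>C. (v i)\<^sup>2)"
 shows "2 * \<bar>quad C Q x y\<bar> <= B * ((\<Sum>i\<in>C. (x i)\<^sup>2) + (\<Sum>i\<in>C. (y i)\<^sup>2))"
proof -
 have "4 * \<bar>quad C Q x y\<bar> <= B * (\<Sum>i\<in>C. (x i + y i)\<^sup>2) + B * (\<Sum>i\<in>C. (x i - y i)\<^sup>2)"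
  using quad_polarize[OF sym, where x = x and y = y] b[of "\<lambda>i. x i + y i"] b[of "\<lambda>i. x i - y i"]
  by linarith
 also have "\<dots> = 2 * (B * ((\<Sum>i\<in>C. (x i)\<^sup>2) + (\<Sum>i\<in>C. (y i)\<^sup>2)))"
  by (simp add: power2_eq_square algebra_simps sum.distrib sum_subtractf sum_distrib_left)
 finally show ?thesis by simp
qed

text \<open>Polarization bounds the bilinear form by the sum of the squared norms; scaling both
  vectors to length 1 turns the sum into a product.\<close>

lemma quad_op_bound:
 assumes fin: "finite C" and sym: "\<forall>i\<in>C. \<forall>j\<in>C. Q i j = Q j i"
  and b: "\<And>v. \<bar>quad C Q v v\<bar> <= B * (\<Sum>i\<in>C. (v i)\<^sup>2)"
 shows "\<bar>quad C Q x y\<bar> <= B * (sqrt (\<Sum>i\<in>C. (x i)\<^sup>2) * sqrt (\<Sum>i\<in>C. (y i)\<^sup>2))"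
proof -
 define a b where "a = sqrt (\<Sum>i\<in>C. (x i)\<^sup>2)" and "b = sqrt (\<Sum>i\<in>C. (y i)\<^sup>2)"
 have sq: "(\<Sum>i\<in>C. (x i)\<^sup>2) = a\<^sup>2" "(\<Sum>i\<in>C. (y i)\<^sup>2) = b\<^sup>2" "0 <= a" "0 <= b"
  by (auto simp: a_def b_def sum_nonneg)
 have z: "quad C Q x y = 0" if "a = 0 \<or> b = 0"
 proof -
  from that have "(\<forall>i\<in>C. x i = 0) \<or> (\<forall>i\<in>C. y i = 0)"
   using sq fin by (auto simp: sum_nonneg_eq_0_iff)
  then show ?thesis by (auto simp: quad_def)
 qed
 show ?thesis
 proof (cases "a = 0 \<or> b = 0")
  case True
  then show ?thesis using z sq by (auto simp: a_def[symmetric] b_def[symmetric])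
 next
  case False
  then have p: "0 < a" "0 < b" using sq by auto
  have 1: "(\<Sum>i\<in>C. ((1 / a) * x i)\<^sup>2) = 1" "(\<Sum>i\<in>C. ((1 / b) * y i)\<^sup>2) = 1"
   using p sq by (simp_all add: power_divide sum_divide_distrib[symmetric])
  have 2: "quad C Q (\<lambda>i. (1 / a) * x i) (\<lambda>i. (1 / b) * y i) = quad C Q x y / (a * b)"
   by (simp add: quad_def sum_divide_distrib)
  have "2 * \<bar>quad C Q (\<lambda>i. (1 / a) * x i) (\<lambda>i. (1 / b) * y i)\<bar>
   <= B * ((\<Sum>i\<in>C. ((1 / a) * x i)\<^sup>2) + (\<Sum>i\<in>C. ((1 / b) * y i)\<^sup>2))"
   by (rule quad_polar_bound[OF sym b])
  then have "\<bar>quad C Q x y\<bar> / (a * b) <= B" using p unfolding 1 2 by (simp add: abs_mult)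
  then show ?thesis using p unfolding a_def[symmetric] b_def[symmetric] by (simp add: divide_le_eq)
 qed
qed

text \<open>Lattice points of mesh 1 / (4 sqrt n). Rounding the n coordinates of a unit vector down
  costs Euclidean distance at most 1/4. The restriction on the l1 norm keeps the cardinality
  exponential in n: a unit vector has l1 norm at most sqrt n, that is 4 n meshes, and rounding adds
  at most n more.\<close>

definition net :: "'c set \<Rightarrow> ('c \<Rightarrow> real) set" where
 "net C = (\<lambda>k j. real_of_int (k j) / (4 * sqrt (real (card C)))) `
   {k \<in> PiE C (\<lambda>_. {- int (5 * card C) .. int (5 * card C)}). (\<Sum>j\<in>C. \<bar>k j\<bar>) <= int (5 * card C)}"

text \<open>The subtracted term serves the induction: exp (-1) <= 1/2, so the two new terms are at
  most what it loses.\<close>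

lemma sum_exp_abs: "(\<Sum>k\<in>{- int n..int n}. exp (- \<bar>real_of_int k\<bar>)) <= 3 - 2 * (1/2) ^ n"
proof (induction n)
 case (Suc n)
 have "{- int (Suc n)..int (Suc n)} = insert (- int (Suc n)) (insert (int (Suc n)) {- int n..int n})"
  by auto
 then have "(\<Sum>k\<in>{- int (Suc n)..int (Suc n)}. exp (- \<bar>real_of_int k\<bar>)) =
   2 * exp (- real (Suc n)) + (\<Sum>k\<in>{- int n..int n}. exp (- \<bar>real_of_int k\<bar>))"
  by (simp add: add.commute)
 moreover have "exp (- real (Suc n)) <= (1/2) ^ Suc n"
 proof -
  have "exp (- real (Suc n)) = exp (-1) ^ Suc n" by (simp only: exp_of_nat_mult[symmetric]) simp
  also have "\<dots> <= (1/2) ^ Suc n"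
   using exp_ge_add_one_self[of 1] by (intro power_mono) (auto simp: exp_minus field_simps)
  finally show ?thesis .
 qed
 ultimately show ?case using Suc by simp
qed simp

lemma finite_net: "finite C ==> finite (net C)"
 unfolding net_def by (intro finite_imageI finite_subset[OF _ finite_PiE[of C "\<lambda>_. {- int (5 * card C) .. int (5 * card C)}"]]) auto

text \<open>Counting with exponential weights: a lattice point of l1 norm at most 5 n has weight exp
  (5 n - l1 norm) >= 1. Over the whole box the sum of the weights factorizes, with factors at most 3
  <= exp 2.\<close>

lemma card_net:
 assumes fin: "finite C"
 shows "real (card (net C)) <= exp (7 * real (card C))"
proof -
 let ?n = "card C" and ?P = "PiE C (\<lambda>_. {- int (5 * card C) .. int (5 * card C)})"
 let ?K = "{k \<in> ?P. (\<Sum>j\<in>C. \<bar>k j\<bar>) <= int (5 * ?n)}"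
 have finP: "finite ?P" using fin by (intro finite_PiE) auto
 have "real (card (net C)) <= real (card ?K)"
  unfolding net_def using finP by (intro of_nat_mono card_image_le) auto
 also have "\<dots> = (\<Sum>k\<in>?K. 1)" by simp
 also have "\<dots> <= (\<Sum>k\<in>?K. exp (5 * real ?n) * (\<Prod>j\<in>C. exp (- \<bar>real_of_int (k j)\<bar>)))"
 proof (rule sum_mono)
  fix k assume k: "k \<in> ?K"
  then have "real_of_int (\<Sum>j\<in>C. \<bar>k j\<bar>) <= real_of_int (int (5 * ?n))"
   by (intro of_int_le_iff[THEN iffD2]) simp
  then have "(\<Sum>j\<in>C. \<bar>real_of_int (k j)\<bar>) <= 5 * real ?n" by simp
  then show "1 <= exp (5 * real ?n) * (\<Prod>j\<in>C. exp (- \<bar>real_of_int (k j)\<bar>))"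
   using fin by (simp add: exp_sum[symmetric] exp_add[symmetric] sum_negf)
 qed
 also have "\<dots> <= (\<Sum>k\<in>?P. exp (5 * real ?n) * (\<Prod>j\<in>C. exp (- \<bar>real_of_int (k j)\<bar>)))"
  using finP by (intro sum_mono2) (auto intro!: mult_nonneg_nonneg prod_nonneg)
 also have "\<dots> = exp (5 * real ?n) * (\<Prod>j\<in>C. \<Sum>k\<in>{- int (5 * ?n) .. int (5 * ?n)}. exp (- \<bar>real_of_int k\<bar>))"
  unfolding sum_distrib_left[symmetric]
  by (subst prod_sum_PiE) (use fin in auto)
 also have "\<dots> <= exp (5 * real ?n) * (\<Prod>j\<in>C. exp 2)"
 proof (intro mult_left_mono prod_mono conjI)
  have "(\<Sum>k\<in>{- int (5 * ?n) .. int (5 * ?n)}. exp (- \<bar>real_of_int k\<bar>)) <= 3"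
   using sum_exp_abs[of "5 * ?n"] zero_le_power[of "1/2::real" "5 * ?n"] by linarith
  also have "(3::real) <= exp 2" using exp_ge_add_one_self[of 2] by simp
  finally show "(\<Sum>k\<in>{- int (5 * ?n) .. int (5 * ?n)}. exp (- \<bar>real_of_int k\<bar>)) <= exp 2" .
 qed (auto intro!: sum_nonneg)
 also have "\<dots> = exp (7 * real ?n)"
  by (simp add: exp_of_nat_mult[symmetric] exp_add[symmetric])
 finally show ?thesis .
qed

lemma net_approx:
 assumes fin: "finite C" and v: "(\<Sum>j\<in>C. (v j)\<^sup>2) <= 1"
 shows "\<exists>x\<in>net C. (\<Sum>j\<in>C. (v j - x j)\<^sup>2) <= 1/16"
proof (cases "C = {}")
 case True
 then show ?thesis by (auto simp: net_def)
next
 case False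
 let ?n = "card C"
 have n: "0 < real ?n" using fin False by (simp add: card_gt_0_iff)
 define q where "q = 4 * sqrt (real ?n)"
 have q: "0 < q" "q\<^sup>2 = 16 * real ?n" using n by (auto simp: q_def power_mult_distrib)
 define k where "k = restrict (\<lambda>j. \<lfloor>v j * q\<rfloor>) C"
 define x where "x = (\<lambda>j. real_of_int (k j) / q)"
 have d: "(v j - x j)\<^sup>2 <= 1 / q\<^sup>2" if "j \<in> C" for j
 proof -
  have f: "real_of_int \<lfloor>v j * q\<rfloor> <= v j * q" "v j * q <= real_of_int \<lfloor>v j * q\<rfloor> + 1" by linarith+
  have "v j - x j = (v j * q - real_of_int \<lfloor>v j * q\<rfloor>) / q"
   using q that by (simp add: x_def k_def field_simps)
  moreover have "(v j * q - real_of_int \<lfloor>v j * q\<rfloor>) / q <= 1 / q"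
   using f(2) q by (intro divide_right_mono) linarith+
  moreover have "0 <= (v j * q - real_of_int \<lfloor>v j * q\<rfloor>) / q" using f q by simp
  ultimately have "0 <= v j - x j" "v j - x j <= 1 / q" by auto
  then show ?thesis by (metis power_mono power_one_over)
 qed
 have "(\<Sum>j\<in>C. (v j - x j)\<^sup>2) <= (\<Sum>j\<in>C. 1 / q\<^sup>2)" by (intro sum_mono d)
 also have "\<dots> = 1/16" using n q by simp
 finally have close: "(\<Sum>j\<in>C. (v j - x j)\<^sup>2) <= 1/16" .
 have "(\<Sum>j\<in>C. \<bar>v j\<bar> * 1) <= L2_set v C * L2_set (\<lambda>_. 1) C"
  using L2_set_mult_ineq[of v "\<lambda>_. 1" C] by simp
 also have "\<dots> <= 1 * sqrt (real ?n)"
  using v by (intro mult_mono) (auto simp: L2_set_def sum_nonneg)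
 finally have l1: "(\<Sum>j\<in>C. \<bar>v j\<bar>) <= sqrt (real ?n)" by simp
 have "real_of_int (\<Sum>j\<in>C. \<bar>k j\<bar>) <= (\<Sum>j\<in>C. \<bar>v j\<bar> * q + 1)"
  unfolding of_int_sum
 proof (rule sum_mono)
  fix j assume "j \<in> C"
  have f: "real_of_int \<lfloor>v j * q\<rfloor> <= v j * q" "v j * q <= real_of_int \<lfloor>v j * q\<rfloor> + 1" by linarith+
  have "\<bar>v j * q\<bar> = \<bar>v j\<bar> * q" using q by (simp add: abs_mult)
  moreover have "real_of_int \<bar>\<lfloor>v j * q\<rfloor>\<bar> <= \<bar>v j * q\<bar> + 1" using f by linarith
  ultimately show "real_of_int \<bar>k j\<bar> <= \<bar>v j\<bar> * q + 1" using \<open>j \<in> C\<close> by (simp add: k_def)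
 qed
 also have "\<dots> = (\<Sum>j\<in>C. \<bar>v j\<bar>) * q + real ?n" by (simp add: sum.distrib sum_distrib_right)
 also have "\<dots> <= sqrt (real ?n) * q + real ?n" using l1 q by (intro add_mono mult_right_mono) auto
 also have "\<dots> = 5 * real ?n" using n by (simp add: q_def)
 finally have s: "(\<Sum>j\<in>C. \<bar>k j\<bar>) <= int (5 * ?n)" by linarith
 have "\<bar>k j\<bar> <= int (5 * ?n)" if "j \<in> C" for j
  using member_le_sum[of j C "\<lambda>j. \<bar>k j\<bar>"] that fin s by simp
 then have "k \<in> PiE C (\<lambda>_. {- int (5 * ?n) .. int (5 * ?n)})"
  by (force simp: k_def abs_le_iff)
 then have "x \<in> net C" using s unfolding net_def x_def q_def by blast
 then show ?thesis using close by auto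
qed

text \<open>Let b be the supremum over the unit ball. A net point x at distance at most 1/4 from v
  has norm at most 5/4, so its value is at most 25/16 D, and the difference of the values at v and x
  is the form at v - x and v + x, at most 9/16 b. Hence b <= 25/7 D.\<close>

lemma quad_net_bound:
 assumes fin: "finite C" and sym: "\<forall>i\<in>C. \<forall>j\<in>C. Q i j = Q j i"
  and D: "0 <= D" "\<And>x. x \<in> net C ==> \<bar>quad C Q x x\<bar> <= D * (\<Sum>i\<in>C. (x i)\<^sup>2)"
 shows "\<bar>quad C Q v v\<bar> <= 4 * D * (\<Sum>i\<in>C. (v i)\<^sup>2)"
proof -
 let ?U = "{v :: 'a \<Rightarrow> real. (\<Sum>i\<in>C. (v i)\<^sup>2) <= 1}" and ?f = "\<lambda>v. \<bar>quad C Q v v\<bar>"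
 have comp: "\<bar>v i\<bar> <= 1" if "v \<in> ?U" "i \<in> C" for v :: "'a \<Rightarrow> real" and i
 proof -
  have "(v i)\<^sup>2 <= (\<Sum>i\<in>C. (v i)\<^sup>2)" using fin that by (intro member_le_sum[where f = "\<lambda>i. (v i :: real)\<^sup>2"]) auto
  then show ?thesis using that by (simp add: abs_square_le_1[symmetric])
 qed
 have bdd: "bdd_above (?f ` ?U)"
 proof (rule bdd_aboveI2)
  fix v assume v: "v \<in> ?U"
  have "?f v <= (\<Sum>i\<in>C. \<Sum>j\<in>C. \<bar>Q i j * v i * v j\<bar>)"
   unfolding quad_def by (rule order_trans[OF sum_abs sum_mono[OF sum_abs]])
  also have "\<dots> <= (\<Sum>i\<in>C. \<Sum>j\<in>C. \<bar>Q i j\<bar> * 1 * 1)"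
   unfolding abs_mult by (intro sum_mono mult_mono) (auto intro: comp[OF v])
  finally show "?f v <= (\<Sum>i\<in>C. \<Sum>j\<in>C. \<bar>Q i j\<bar> * 1 * 1)" .
 qed
 define b where "b = (SUP v\<in>?U. ?f v)"
 have le: "?f v <= b" if "v \<in> ?U" for v
  unfolding b_def by (rule cSUP_upper[OF that bdd])
 have b0: "0 <= b" using le[of "\<lambda>_. 0"] by (simp add: quad_def)
 have hom: "?f v <= b * (\<Sum>i\<in>C. (v i)\<^sup>2)" for v
 proof (cases "(\<Sum>i\<in>C. (v i)\<^sup>2) = 0")
  case True
  then have "\<forall>i\<in>C. v i = 0" using fin by (simp add: sum_nonneg_eq_0_iff)
  then show ?thesis using True by (simp add: quad_def)
 next
  case False
  define n where "n = sqrt (\<Sum>i\<in>C. (v i)\<^sup>2)"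
  have n: "0 < n" "n\<^sup>2 = (\<Sum>i\<in>C. (v i)\<^sup>2)"
   using False sum_nonneg[of C "\<lambda>c. (v c)\<^sup>2"] by (auto simp: n_def less_le)
  have "(\<lambda>i. v i / n) \<in> ?U" using n by (simp add: power_divide sum_divide_distrib[symmetric])
  from le[OF this] have "\<bar>quad C Q v v / n\<^sup>2\<bar> <= b"
   by (simp add: quad_def power2_eq_square sum_divide_distrib mult_ac)
  then have "\<bar>quad C Q v v\<bar> / n\<^sup>2 <= b" by simp
  then show ?thesis using n(1) unfolding n(2)[symmetric] by (simp add: pos_divide_le_eq)
 qed
 have "b <= 25/16 * D + 9/16 * b"
  unfolding b_def
 proof (rule cSUP_least)
  show "?U \<noteq> {}" by (auto intro!: exI[of _ "\<lambda>_. 0"])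
  fix v assume v: "v \<in> ?U"
  obtain x where x: "x \<in> net C" "(\<Sum>j\<in>C. (v j - x j)\<^sup>2) <= 1/16"
   using net_approx[OF fin] v by auto
  define nn where "nn = L2_set v C"
  have nv: "L2_set v C <= 1" using v by (auto simp: L2_set_def)
  have nd: "L2_set (\<lambda>j. v j - x j) C <= 1/4"
   unfolding L2_set_def using x(2) by (intro real_le_lsqrt) (auto simp: power2_eq_square)
  have "L2_set x C = L2_set (\<lambda>j. v j + (- (v j - x j))) C" by (rule arg_cong2[of _ _ _ _ L2_set]) auto
  also have "\<dots> <= L2_set v C + L2_set (\<lambda>j. - (v j - x j)) C" by (rule L2_set_triangle_ineq)
  also have "L2_set (\<lambda>j. - (v j - x j)) C = L2_set (\<lambda>j. v j - x j) C" by (simp add: L2_set_def power2_commute)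
  finally have nx: "L2_set x C <= 5/4" using nv nd by simp
  have ns: "L2_set (\<lambda>j. v j + x j) C <= 9/4"
   using L2_set_triangle_ineq[of v x C] nv nx by simp
  have sq: "(\<Sum>j\<in>C. (x j)\<^sup>2) <= 25/16" "(\<Sum>j\<in>C. (v j + x j)\<^sup>2) <= 81/16"
   using power_mono[OF nx L2_set_nonneg, of 2] power_mono[OF ns L2_set_nonneg, of 2]
   by (simp_all add: L2_set_def sum_nonneg power_divide)
  have "quad C Q v v - quad C Q x x = quad C Q (\<lambda>i. v i - x i) (\<lambda>i. v i + x i)"
   using quad_sym[OF sym, where x = v and y = x]
   by (simp add: quad_diff_left quad_add_right)
  \<comment> \<open>The factor 3 balances the norms 1/4 and 9/4 of the difference and the sum, so
    that both terms of the polarization bound become 9/16.\<close>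
  also have "\<dots> = quad C Q (\<lambda>i. 3 * (v i - x i)) (\<lambda>i. (v i + x i) / 3)"
   unfolding quad_def by (intro sum.cong refl) (simp add: field_simps)
  finally have e: "quad C Q v v - quad C Q x x = quad C Q (\<lambda>i. 3 * (v i - x i)) (\<lambda>i. (v i + x i) / 3)" .
  have "2 * \<bar>quad C Q v v - quad C Q x x\<bar> <=
    b * ((\<Sum>i\<in>C. (3 * (v i - x i))\<^sup>2) + (\<Sum>i\<in>C. ((v i + x i) / 3)\<^sup>2))"
   unfolding e by (rule quad_polar_bound[OF sym hom])
  also have "\<dots> = b * (9 * (\<Sum>i\<in>C. (v i - x i)\<^sup>2) + (\<Sum>i\<in>C. (v i + x i)\<^sup>2) / 9)"
   by (simp only: power_mult_distrib power_divide sum_distrib_left sum_divide_distrib) simp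
  also have "\<dots> <= b * (9 * (1/16) + (81/16) / 9)"
   using x(2) sq(2) b0 by (intro mult_left_mono add_mono divide_right_mono) auto
  finally have "\<bar>quad C Q v v - quad C Q x x\<bar> <= 9/16 * b" by simp
  moreover have "\<bar>quad C Q x x\<bar> <= D * (25/16)"
   using D(2)[OF x(1)] mult_left_mono[OF sq(1) D(1)] by simp
  ultimately show "?f v <= 25/16 * D + 9/16 * (SUP v\<in>?U. ?f v)"
   unfolding b_def[symmetric] by linarith
 qed
 then have "b <= 4 * D" using D(1) by simp
 then show ?thesis using hom[of v] mult_right_mono[of b "4 * D" "\<Sum>i\<in>C. (v i)\<^sup>2"]
  by (auto simp: sum_nonneg intro: order_trans)
qed

section \<open>The data as a family of independent normal variables\<close>

context
 fixes N d :: nat and \<mu> :: "nat \<Rightarrow> real" and \<sigma> :: real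
 assumes sig: "0 < \<sigma>"
begin

abbreviation "coord_law j \<equiv> density lborel (\<lambda>x. ennreal (normal_density (\<mu> j) \<sigma> x))"

lemma prob_space_coord: "prob_space (coord_law j)"
 using sig by (rule prob_space_normal_density)

lemma prob_space_gauss: "prob_space (gauss d \<mu> \<sigma>)"
 unfolding gauss_def by (rule prob_space_PiM) (rule prob_space_coord)

lemma prob_space_data: "prob_space (data_law N d \<mu> \<sigma>)"
 unfolding data_law_def by (rule prob_space_PiM) (rule prob_space_gauss)

lemma sets_data_law: "sets (data_law N d \<mu> \<sigma>) = sets (data_space N d)"
 unfolding data_law_def data_space_def gauss_def by (intro sets_PiM_cong refl) simp

lemma space_data_law: "space (data_law N d \<mu> \<sigma>) = space (data_space N d)"
 by (rule sets_eq_imp_space_eq) (rule sets_data_law)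

lemma measurable_coord:
 assumes "i < N" "j < d"
 shows "(\<lambda>x. x i j) \<in> borel_measurable (data_law N d \<mu> \<sigma>)"
proof -
 have 1: "(\<lambda>x. x i) \<in> measurable (data_law N d \<mu> \<sigma>) (gauss d \<mu> \<sigma>)"
  unfolding data_law_def by (rule measurable_component_singleton) (use assms in simp)
 have "(\<lambda>y. y j) \<in> measurable (gauss d \<mu> \<sigma>) (coord_law j)"
  unfolding gauss_def by (rule measurable_component_singleton) (use assms in simp)
 then have "(\<lambda>y. y j) \<in> borel_measurable (gauss d \<mu> \<sigma>)" by simp
 from measurable_compose[OF 1 this] show ?thesis .
qed

lemma distr_coord:
 assumes "i < N" "j < d"
 shows "distr (data_law N d \<mu> \<sigma>) (coord_law j) (\<lambda>x. x i j) = coord_law j"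
proof -
 have 1: "(\<lambda>x. x i) \<in> measurable (data_law N d \<mu> \<sigma>) (gauss d \<mu> \<sigma>)"
  unfolding data_law_def by (rule measurable_component_singleton) (use assms in simp)
 have 2: "(\<lambda>y. y j) \<in> measurable (gauss d \<mu> \<sigma>) (coord_law j)"
  unfolding gauss_def by (rule measurable_component_singleton) (use assms in simp)
 have "distr (data_law N d \<mu> \<sigma>) (coord_law j) (\<lambda>x. x i j) =
   distr (distr (data_law N d \<mu> \<sigma>) (gauss d \<mu> \<sigma>) (\<lambda>x. x i)) (coord_law j) (\<lambda>y. y j)"
  by (subst distr_distr[OF 2 1]) (simp add: comp_def)
 also have "distr (data_law N d \<mu> \<sigma>) (gauss d \<mu> \<sigma>) (\<lambda>x. x i) = gauss d \<mu> \<sigma>"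
  unfolding data_law_def by (rule distr_PiM_component) (use assms prob_space_gauss in auto)
 also have "distr (gauss d \<mu> \<sigma>) (coord_law j) (\<lambda>y. y j) = coord_law j"
  unfolding gauss_def by (rule distr_PiM_component) (use assms prob_space_coord in auto)
 finally show ?thesis .
qed

lemma distributed_coord:
 assumes "i < N" "j < d"
 shows "distributed (data_law N d \<mu> \<sigma>) lborel (\<lambda>x. x i j) (normal_density (\<mu> j) \<sigma>)"
proof -
 have "distr (data_law N d \<mu> \<sigma>) lborel (\<lambda>x. x i j) = distr (data_law N d \<mu> \<sigma>) (coord_law j) (\<lambda>x. x i j)"
  by (rule distr_cong) auto
 then show ?thesis unfolding distributed_def using distr_coord[OF assms] measurable_coord[OF assms] by simp
qed

lemma indep_coords:
 assumes pos: "0 < N" "0 < d"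
 shows "prob_space.indep_vars (data_law N d \<mu> \<sigma>) (\<lambda>_. borel) (\<lambda>p x. x (fst p) (snd p)) ({..<N} \<times> {..<d})"
proof -
 let ?M = "data_law N d \<mu> \<sigma>" and ?I = "{..<N} \<times> {..<d}"
 interpret M: prob_space ?M by (rule prob_space_data)
 interpret G: product_prob_space coord_law by (simp add: product_prob_space_def product_prob_space_axioms_def product_sigma_finite_def prob_space_coord prob_space_imp_sigma_finite)
 interpret D: product_prob_space "\<lambda>_::nat. gauss d \<mu> \<sigma>" by (simp add: product_prob_space_def product_prob_space_axioms_def product_sigma_finite_def prob_space_gauss prob_space_imp_sigma_finite)
 show ?thesis
 proof (subst M.indep_vars_finite[where E = "\<lambda>_. sets borel"])
  show "\<forall>A\<in>?I \<rightarrow> sets borel. M.prob (\<Inter>p\<in>?I. (\<lambda>x. x (fst p) (snd p)) -` A p \<inter> space ?M) =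
    (\<Prod>p\<in>?I. M.prob ((\<lambda>x. x (fst p) (snd p)) -` A p \<inter> space ?M))"
  proof
   fix A :: "nat \<times> nat \<Rightarrow> real set" assume A: "A \<in> ?I \<rightarrow> sets borel"
   let ?P = "\<lambda>i. PiE {..<d} (\<lambda>j. A (i, j))"
   have sp: "space ?M = PiE {..<N} (\<lambda>_. PiE {..<d} (\<lambda>_. UNIV))"
    by (simp add: space_data_law data_space_def space_PiM)
   have int: "(\<Inter>p\<in>?I. (\<lambda>x. x (fst p) (snd p)) -` A p \<inter> space ?M) = PiE {..<N} ?P"
    using pos unfolding sp by (auto simp: PiE_iff extensional_def)
   have P: "?P i \<in> sets (gauss d \<mu> \<sigma>)" if "i < N" for i
    unfolding gauss_def using A that by (intro sets_PiM_I_finite) auto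
   have "emeasure ?M (PiE {..<N} ?P) = (\<Prod>i<N. emeasure (gauss d \<mu> \<sigma>) (?P i))"
    unfolding data_law_def by (rule D.emeasure_PiM) (use P in auto)
   also have "\<dots> = (\<Prod>i<N. \<Prod>j<d. emeasure (coord_law j) (A (i, j)))"
    unfolding gauss_def by (intro prod.cong refl G.emeasure_PiM) (use A in auto)
   also have "\<dots> = (\<Prod>p\<in>?I. emeasure (coord_law (snd p)) (A p))"
    by (simp add: prod.cartesian_product case_prod_beta)
   also have "\<dots> = (\<Prod>p\<in>?I. emeasure ?M ((\<lambda>x. x (fst p) (snd p)) -` A p \<inter> space ?M))"
   proof (intro prod.cong refl)
    fix p assume p: "p \<in> ?I"
    have "emeasure (coord_law (snd p)) (A p) =
      emeasure (distr ?M (coord_law (snd p)) (\<lambda>x. x (fst p) (snd p))) (A p)"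
     using p distr_coord[of "fst p" "snd p"] by auto
    also have "\<dots> = emeasure ?M ((\<lambda>x. x (fst p) (snd p)) -` A p \<inter> space ?M)"
     using p A measurable_coord[of "fst p" "snd p"] by (intro emeasure_distr) auto
    finally show "emeasure (coord_law (snd p)) (A p) = emeasure ?M ((\<lambda>x. x (fst p) (snd p)) -` A p \<inter> space ?M)" .
   qed
   finally have "emeasure ?M (PiE {..<N} ?P) = (\<Prod>p\<in>?I. emeasure ?M ((\<lambda>x. x (fst p) (snd p)) -` A p \<inter> space ?M))" .
   then have "M.prob (PiE {..<N} ?P) = (\<Prod>p\<in>?I. M.prob ((\<lambda>x. x (fst p) (snd p)) -` A p \<inter> space ?M))"
    by (simp add: M.emeasure_eq_measure prod_ennreal prod_nonneg)
   then show "M.prob (\<Inter>p\<in>?I. (\<lambda>x. x (fst p) (snd p)) -` A p \<inter> space ?M) =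
    (\<Prod>p\<in>?I. M.prob ((\<lambda>x. x (fst p) (snd p)) -` A p \<inter> space ?M))" unfolding int .
  qed
  show "Int_stable (sets borel :: real set set)" by (auto simp: Int_stable_def)
 qed (use pos measurable_coord in \<open>auto simp: sets.sigma_sets_eq[where M = borel, simplified]\<close>)
qed

lemma data_gauss_family:
 assumes pos: "0 < N" "0 < d"
 shows "gauss_family (data_law N d \<mu> \<sigma>) (\<lambda>p x. (x (fst p) (snd p) - \<mu> (snd p)) / \<sigma>) ({..<N} \<times> {..<d})"
proof -
 let ?M = "data_law N d \<mu> \<sigma>" and ?I = "{..<N} \<times> {..<d}"
 interpret M: prob_space ?M by (rule prob_space_data)
 show ?thesis
 proof
  show "M.indep_vars (\<lambda>_. borel) (\<lambda>p x. (x (fst p) (snd p) - \<mu> (snd p)) / \<sigma>) ?I"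
   by (rule M.indep_vars_compose2[OF indep_coords[OF pos], of "\<lambda>p y. (y - \<mu> (snd p)) / \<sigma>"]) measurable
  fix p assume "p \<in> ?I"
  then have "distributed ?M lborel (\<lambda>x. x (fst p) (snd p)) (normal_density (\<mu> (snd p)) \<sigma>)"
   using distributed_coord[of "fst p" "snd p"] by auto
  from M.normal_density_affine[OF this sig, of "1 / \<sigma>" "- \<mu> (snd p) / \<sigma>"]
  show "distributed ?M lborel (\<lambda>x. (x (fst p) (snd p) - \<mu> (snd p)) / \<sigma>) std_normal_density"
   using sig by (simp add: diff_divide_distrib)
 qed simp
qed

end

text \<open>Union bound over the net: its at most exp (7 |C|) points are paid for by the 7 |C| in
  \<open>t\<close>, and the passage from the net to all vectors multiplies the constant 8 by
  4.\<close>

lemma (in gauss_family) uniform_tail: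
 assumes fin: "finite L" "finite C" and inj: "inj_on (\<lambda>(r, c). e r c) (L \<times> C)"
  and sub: "\<And>r c. r \<in> L ==> c \<in> C ==> e r c \<in> I" and t: "7 * real (card C) + t0 <= t" "0 <= t0"
 shows "fails_le M (2 * exp (- t0))
  (\<lambda>x. \<forall>v. \<bar>(\<Sum>r\<in>L. (\<Sum>c\<in>C. v c * X (e r c) x)\<^sup>2) - real (card L) * (\<Sum>c\<in>C. (v c)\<^sup>2)\<bar>
    <= 32 * (sqrt (real (card L) * t) + t) * (\<Sum>c\<in>C. (v c)\<^sup>2))"
proof -
 have t': "0 <= t" using t by (auto intro: order_trans[OF _ t(1)])
 define D where "D = 8 * (sqrt (real (card L) * t) + t)"
 have D: "0 <= D" using t' by (simp add: D_def)
 have "fails_le M (\<Sum>u\<in>net C. 2 * exp (- t)) (\<lambda>x. \<forall>u\<in>net C.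
   \<bar>(\<Sum>r\<in>L. (\<Sum>c\<in>C. u c * X (e r c) x)\<^sup>2) - real (card L) * (\<Sum>c\<in>C. (u c)\<^sup>2)\<bar>
    <= D * (\<Sum>c\<in>C. (u c)\<^sup>2))"
  unfolding D_def by (intro fails_le_ball finite_net fin chi_square_rows inj sub t') auto
 then show ?thesis
 proof (rule fails_le_mono)
  have "(\<Sum>u\<in>net C. 2 * exp (- t)) = real (card (net C)) * (2 * exp (- t))" by simp
  also have "\<dots> <= exp (7 * real (card C)) * (2 * exp (- t))"
   by (intro mult_right_mono card_net fin) simp
  also have "\<dots> <= 2 * exp (- t0)"
   using t(1) by (simp add: exp_add[symmetric])
  finally show "(\<Sum>u\<in>net C. 2 * exp (- t)) <= 2 * exp (- t0)" .
 next
  fix x assume net: "\<forall>u\<in>net C.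
   \<bar>(\<Sum>r\<in>L. (\<Sum>c\<in>C. u c * X (e r c) x)\<^sup>2) - real (card L) * (\<Sum>c\<in>C. (u c)\<^sup>2)\<bar>
    <= D * (\<Sum>c\<in>C. (u c)\<^sup>2)"
  define Q where "Q c c' = (\<Sum>r\<in>L. X (e r c) x * X (e r c') x) - real (card L) * (if c = c' then 1 else 0)" for c c'
  have q: "quad C Q u u = (\<Sum>r\<in>L. (\<Sum>c\<in>C. u c * X (e r c) x)\<^sup>2) - real (card L) * (\<Sum>c\<in>C. (u c)\<^sup>2)" for u
  proof -
   have "(\<Sum>r\<in>L. (\<Sum>c\<in>C. u c * X (e r c) x)\<^sup>2) =
     (\<Sum>r\<in>L. \<Sum>c\<in>C. \<Sum>c'\<in>C. X (e r c) x * X (e r c') x * u c * u c')"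
    by (simp add: power2_eq_square sum_product mult_ac)
   also have "\<dots> = (\<Sum>c\<in>C. \<Sum>c'\<in>C. (\<Sum>r\<in>L. X (e r c) x * X (e r c') x) * u c * u c')"
    unfolding sum_distrib_right
    by (subst sum.swap, intro sum.cong refl, subst sum.swap) simp
   finally have 1: "(\<Sum>r\<in>L. (\<Sum>c\<in>C. u c * X (e r c) x)\<^sup>2) =
     (\<Sum>c\<in>C. \<Sum>c'\<in>C. (\<Sum>r\<in>L. X (e r c) x * X (e r c') x) * u c * u c')" .
   have 2: "(\<Sum>c\<in>C. \<Sum>c'\<in>C. real (card L) * (if c = c' then 1 else 0) * u c * u c') =
     real (card L) * (\<Sum>c\<in>C. (u c)\<^sup>2)"
    unfolding sum_distrib_left
    by (intro sum.cong refl) (simp add: power2_eq_square if_distrib if_distribR fin mult_ac cong: if_cong)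
   show ?thesis unfolding 1 2[symmetric] quad_def Q_def
    by (simp add: left_diff_distrib sum_subtractf)
  qed
  have "\<bar>quad C Q v v\<bar> <= 4 * D * (\<Sum>c\<in>C. (v c)\<^sup>2)" for v
   by (rule quad_net_bound[OF fin(2) _ D]) (use net in \<open>auto simp: q[symmetric] Q_def mult.commute\<close>)
  then show "\<forall>v. \<bar>(\<Sum>r\<in>L. (\<Sum>c\<in>C. v c * X (e r c) x)\<^sup>2) - real (card L) * (\<Sum>c\<in>C. (v c)\<^sup>2)\<bar>
    <= 32 * (sqrt (real (card L) * t) + t) * (\<Sum>c\<in>C. (v c)\<^sup>2)"
   unfolding q D_def by simp
 qed
qed

section \<open>Counting small subsets\<close>

lemma sum_Pow_power:
 fixes x :: real
 shows "finite A ==> (\<Sum>B\<in>Pow A. x ^ card B) = (1 + x) ^ card A"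
proof (induction A rule: finite_induct)
 case (insert a A)
 have inj: "inj_on (insert a) (Pow A)" using insert(2) by (auto simp: inj_on_def)
 have fB: "finite B" "a \<notin> B" if "B \<in> Pow A" for B using that insert by (auto intro: finite_subset)
 have "(\<Sum>B\<in>Pow (insert a A). x ^ card B) = (\<Sum>B\<in>Pow A. x ^ card B) + (\<Sum>B\<in>insert a ` Pow A. x ^ card B)"
  unfolding Pow_insert using insert by (intro sum.union_disjoint) auto
 also have "(\<Sum>B\<in>insert a ` Pow A. x ^ card B) = (\<Sum>B\<in>Pow A. x * x ^ card B)"
  by (subst sum.reindex[OF inj]) (auto intro!: sum.cong simp: fB)
 finally show ?case using insert by (simp add: sum_distrib_left[symmetric] algebra_simps)
qed simp

text \<open>The usual bound (e n / b)^b. With x = b / n <= 1 every small subset B satisfies x^|B| >=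
  x^b, while the sum of x^|B| over all subsets is (1 + x)^n <= exp b.\<close>

lemma card_small_subsets:
 assumes "0 < b" "b <= n"
 shows "real (card {B. B \<subseteq> {..<n} \<and> card B <= b}) <= exp (real b * (1 + ln (real n / real b)))"
proof -
 define x where "x = real b / real n"
 have x: "0 < x" "x <= 1" using assms by (auto simp: x_def)
 let ?S = "{B. B \<subseteq> {..<n} \<and> card B <= b}"
 have "real (card ?S) * x ^ b = (\<Sum>B\<in>?S. x ^ b)" by simp
 also have "\<dots> <= (\<Sum>B\<in>?S. x ^ card B)"
  using x by (intro sum_mono power_decreasing) auto
 also have "\<dots> <= (\<Sum>B\<in>Pow {..<n}. x ^ card B)"
  using x by (intro sum_mono2) auto
 also have "\<dots> = (1 + x) ^ n" by (simp add: sum_Pow_power)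
 also have "\<dots> <= exp x ^ n" using x by (intro power_mono exp_ge_add_one_self) auto
 also have "\<dots> = exp (real b)" using assms by (simp add: exp_of_nat_mult[symmetric] x_def)
 finally have "real (card ?S) <= exp (real b) / x ^ b" using x by (simp add: pos_le_divide_eq)
 also have "x ^ b = exp (- (real b * ln (real n / real b)))"
 proof -
  have "ln x = - ln (real n / real b)" using assms by (simp add: x_def ln_div)
  then have "exp (- (real b * ln (real n / real b))) = exp (real b * ln x)" by simp
  also have "\<dots> = x ^ b" using x by (simp add: exp_of_nat_mult)
  finally show ?thesis ..
 qed
 finally show ?thesis by (simp add: exp_minus exp_add distrib_left field_simps)
qed

section \<open>The filter\<close>

definition gram :: "nat set \<Rightarrow> (nat \<Rightarrow> nat \<Rightarrow> real) \<Rightarrow> nat \<Rightarrow> nat \<Rightarrow> real" where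
 "gram S X i j = (\<Sum>c\<in>S. X i c * X j c)"

text \<open>With s <= N coordinates the noise Gram matrix has rank at most s and nonzero eigenvalues
  near N. With s > N it is close to s times the identity, and only the deviation from that is
  informative.\<close>

definition shift_of :: "nat \<Rightarrow> nat \<Rightarrow> real" where
 "shift_of N s = (if s <= N then 0 else real s)"

definition shifted :: "nat \<Rightarrow> nat \<Rightarrow> (nat \<Rightarrow> nat \<Rightarrow> real) \<Rightarrow> nat \<Rightarrow> nat \<Rightarrow> real" where
 "shifted N s G i j = G i j - (if i = j then shift_of N s else 0)"

definition new_score :: "nat \<Rightarrow> (nat \<Rightarrow> nat \<Rightarrow> real) \<Rightarrow> (nat \<Rightarrow> real) \<Rightarrow> nat \<Rightarrow> real" where
 "new_score N A w i = (\<Sum>j<N. w j * (mpow N A w N i j)\<^sup>2)"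

definition old_score :: "nat \<Rightarrow> (nat \<Rightarrow> nat \<Rightarrow> real) \<Rightarrow> (nat \<Rightarrow> real) \<Rightarrow> nat \<Rightarrow> real" where
 "old_score N A w i = (\<Sum>j<N. w j * (mpow N A w (N - 1) i j)\<^sup>2)"

definition new_total :: "nat \<Rightarrow> (nat \<Rightarrow> nat \<Rightarrow> real) \<Rightarrow> (nat \<Rightarrow> real) \<Rightarrow> real" where
 "new_total N A w = (\<Sum>i<N. w i * new_score N A w i)"

definition old_total :: "nat \<Rightarrow> (nat \<Rightarrow> nat \<Rightarrow> real) \<Rightarrow> (nat \<Rightarrow> real) \<Rightarrow> real" where
 "old_total N A w = (\<Sum>i<N. w i * old_score N A w i)"

text \<open>The squared spectral norm that clean noise would respect: N + \<Delta> for the Gram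
  matrix itself, \<Delta> after the shift.\<close>

definition ratio_bound :: "nat \<Rightarrow> nat \<Rightarrow> real \<Rightarrow> real" where
 "ratio_bound N s \<Delta> = (if s <= N then (real N + \<Delta>)\<^sup>2 else \<Delta>\<^sup>2)"

definition violated :: "nat \<Rightarrow> nat \<Rightarrow> (nat \<Rightarrow> nat \<Rightarrow> real) \<Rightarrow> real \<Rightarrow> (nat \<Rightarrow> real) \<Rightarrow> bool" where
 "violated N s A \<Delta> w \<longleftrightarrow> new_total N A w > ratio_bound N s \<Delta> * old_total N A w"

text \<open>For s <= N a clean sample, too, carries about its N-th share of the total, and many such
  shares could outweigh the corrupted samples; the threshold discards all but a few of them. For s >
  N the mass of at least one of the two powers is noticeable on the corrupted rows, but it is
  unknown which; the symmetric combination serves both cases.\<close>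

definition score ::
 "nat \<Rightarrow> nat \<Rightarrow> (nat \<Rightarrow> nat \<Rightarrow> real) \<Rightarrow> real \<Rightarrow> real \<Rightarrow> (nat \<Rightarrow> real) \<Rightarrow> nat \<Rightarrow> real" where
 "score N s A e \<Delta> w i =
   (if s <= N then
    (if new_score N A w i <= \<Delta> * new_total N A w / (4 * e * (real N + \<Delta>)) then 0 else new_score N A w i)
   else new_score N A w i * old_total N A w + old_score N A w i * new_total N A w)"

text \<open>Only indices of positive weight compete, so that a maximizer still has weight to
  lose.\<close>

definition max_score :: "nat \<Rightarrow> (nat \<Rightarrow> real) \<Rightarrow> (nat \<Rightarrow> real) \<Rightarrow> real" where
 "max_score N w g = fold (\<lambda>i m. if w i <= 0 then m else if g i <= m then m else g i) [0..<N] 0"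

definition downweight ::
 "nat \<Rightarrow> nat \<Rightarrow> (nat \<Rightarrow> nat \<Rightarrow> real) \<Rightarrow> real \<Rightarrow> real \<Rightarrow> (nat \<Rightarrow> real) \<Rightarrow> nat \<Rightarrow> real" where
 "downweight N s A e \<Delta> w = (if violated N s A \<Delta> w then
   (\<lambda>i. w i * (1 - score N s A e \<Delta> w i / max_score N w (score N s A e \<Delta> w))) else w)"

lemma max_score_props:
 shows "0 <= max_score N w g" "\<And>i. i < N ==> 0 < w i ==> g i <= max_score N w g"
  "max_score N w g = 0 \<or> (\<exists>i<N. 0 < w i \<and> g i = max_score N w g)"
proof -
 have "0 <= max_score N w g \<and> (\<forall>i<N. 0 < w i --> g i <= max_score N w g) \<and>
  (max_score N w g = 0 \<or> (\<exists>i<N. 0 < w i \<and> g i = max_score N w g))"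
 proof (induction N)
  case (Suc N)
  have "max_score (Suc N) w g = (if w N <= 0 then max_score N w g else if g N <= max_score N w g
    then max_score N w g else g N)" by (simp add: max_score_def)
  then show ?case using Suc by (auto simp: less_Suc_eq not_le)
 qed (simp add: max_score_def)
 then show "0 <= max_score N w g" "\<And>i. i < N ==> 0 < w i ==> g i <= max_score N w g"
  "max_score N w g = 0 \<or> (\<exists>i<N. 0 < w i \<and> g i = max_score N w g)" by auto
qed

context weighted_sym begin

lemma new_total_nrm: "new_total N A w = nrm N"
 unfolding new_total_def new_score_def nrm_def minner_def winner_def sum_distrib_left
 by (subst sum.swap) (simp add: power2_eq_square mult_ac)

lemma old_total_nrm: "old_total N A w = nrm (N - 1)"
 unfolding old_total_def old_score_def nrm_def minner_def winner_def sum_distrib_left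
 by (subst sum.swap) (simp add: power2_eq_square mult_ac)

lemma scores_nonneg: "0 <= new_score N A w i" "0 <= old_score N A w i"
 unfolding new_score_def old_score_def by (auto intro!: sum_nonneg simp: w0)

lemma totals_nonneg: "0 <= new_total N A w" "0 <= old_total N A w"
 unfolding new_total_nrm old_total_nrm by (rule nrm_nonneg)+

lemma score_nonneg: "0 <= score N s A e \<Delta> w i"
 unfolding score_def using scores_nonneg totals_nonneg by auto

lemma old_total_pos:
 assumes "0 < N" "0 < new_total N A w"
 shows "0 < old_total N A w"
proof -
 obtain k where k: "N = Suc k" using assms(1) by (cases N) auto
 have nt: "new_total N A w = nrm (Suc k)" "old_total N A w = nrm k"
  using new_total_nrm old_total_nrm unfolding k by simp_all
 have "nrm k \<noteq> 0" using nrm_logconvex[of k] assms(2) unfolding nt by auto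
 then show ?thesis using nrm_nonneg[of k] unfolding nt by simp
qed

lemma not_violated_vstep:
 assumes N: "0 < N" and v: "\<not> violated N s A \<Delta> w"
 shows "winner N w (vstep N A w x) (vstep N A w x)
  <= ratio_bound N s \<Delta> * (1 + 1 / sqrt (real N))\<^sup>2 * winner N w x x"
proof -
 obtain k where k: "N = Suc k" using N by (cases N) auto
 have nt: "new_total N A w = nrm (Suc k)" "old_total N A w = nrm k"
  using new_total_nrm old_total_nrm unfolding k by simp_all
 have "nrm (Suc k) <= ratio_bound N s \<Delta> * nrm k" using v by (simp add: violated_def nt)
 then show ?thesis by (rule vstep_le) (simp_all add: ratio_bound_def k)
qed

lemma vstep_le_ratio:
 assumes N: "0 < N" and n: "0 < old_total N A w"
 shows "winner N w (vstep N A w x) (vstep N A w x)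
  <= 4 * (new_total N A w / old_total N A w) * winner N w x x"
proof -
 obtain k where k: "N = Suc k" using N by (cases N) auto
 have nt: "new_total N A w = nrm (Suc k)" "old_total N A w = nrm k"
  using new_total_nrm old_total_nrm unfolding k by simp_all
 let ?r = "new_total N A w / old_total N A w"
 have r0: "0 <= ?r" using totals_nonneg by simp
 have "1 / sqrt (real N) <= 1" using N by simp
 then have "(1 + 1 / sqrt (real N))\<^sup>2 <= 2\<^sup>2" by (intro power_mono) auto
 then have "?r * (1 + 1 / sqrt (real N))\<^sup>2 * winner N w x x <= ?r * 4 * winner N w x x"
  using r0 by (intro mult_right_mono mult_left_mono winner_nonneg) auto
 moreover have "winner N w (vstep N A w x) (vstep N A w x) <= ?r * (1 + 1 / sqrt (real N))\<^sup>2 * winner N w x x"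
 proof (rule vstep_le[of k])
  show "nrm (Suc k) <= ?r * nrm k" using n by (simp add: nt)
 qed (simp_all add: r0 k[symmetric])
 ultimately show ?thesis by (simp add: mult_ac)
qed

lemma downweight_range:
 assumes "i < N"
 shows "0 <= downweight N s A e \<Delta> w i" "downweight N s A e \<Delta> w i <= w i"
proof -
 let ?g = "score N s A e \<Delta> w" and ?m = "max_score N w (score N s A e \<Delta> w)"
 have "0 <= 1 - ?g i / ?m \<or> w i = 0"
  using max_score_props(2)[OF assms, of w ?g] max_score_props(1)[of N w ?g] w0[OF assms]
  by (cases "?m = 0") (auto simp: less_le divide_le_eq_1)
 moreover have "0 <= ?g i / ?m" using score_nonneg max_score_props(1)[of N w ?g] by (simp add: divide_nonneg_nonneg)
 moreover have "w i * (1 - ?g i / ?m) <= w i * 1" if "0 <= ?g i / ?m"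
  using that w0[OF assms] by (intro mult_left_mono) auto
 ultimately show "0 <= downweight N s A e \<Delta> w i" "downweight N s A e \<Delta> w i <= w i"
  using w0[OF assms] by (auto simp: downweight_def)
qed

text \<open>The weight lost at an index is its weighted score over a common maximum, so a comparison
  of scores is a comparison of losses. A positive score on \<open>B\<close> makes the maximum
  positive, and the index attaining it is emptied.\<close>

lemma downweight_loss:
 assumes B: "B \<subseteq> {..<N}" and v: "violated N s A \<Delta> w"
  and pos: "0 < (\<Sum>i\<in>B. w i * score N s A e \<Delta> w i)"
  and le: "(\<Sum>i\<in>{..<N} - B. w i * score N s A e \<Delta> w i) <= M * (\<Sum>i\<in>B. w i * score N s A e \<Delta> w i)"
  and inv: "(\<Sum>i\<in>{..<N} - B. 1 - w i) <= M * (\<Sum>i\<in>B. 1 - w i)"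
 defines "w' \<equiv> downweight N s A e \<Delta> w"
 shows "(\<Sum>i\<in>{..<N} - B. 1 - w' i) <= M * (\<Sum>i\<in>B. 1 - w' i)" "\<exists>i<N. 0 < w i \<and> w' i = 0"
proof -
 let ?g = "score N s A e \<Delta> w" and ?m = "max_score N w (score N s A e \<Delta> w)"
 have w': "w' i = w i - w i * ?g i / ?m" for i using v by (simp add: w'_def downweight_def algebra_simps)
 have m0: "?m \<noteq> 0"
 proof
  assume m: "?m = 0"
  have "w i * ?g i <= 0" if "i \<in> B" for i
  proof (cases "0 < w i")
   case True
   then show ?thesis using max_score_props(2)[of i N w ?g] that B m by (auto simp: mult_le_0_iff)
  next
   case False
   then show ?thesis using w0[of i] that B by (auto simp: not_less)
  qed
  then have "(\<Sum>i\<in>B. w i * ?g i) <= 0" by (rule sum_nonpos)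
  then show False using pos by simp
 qed
 then have m: "0 < ?m" using max_score_props(1)[of N w ?g] by simp
 have s: "(\<Sum>i\<in>C. 1 - w' i) = (\<Sum>i\<in>C. 1 - w i) + (\<Sum>i\<in>C. w i * ?g i) / ?m" for C
  by (simp add: w' sum_subtractf sum_divide_distrib sum.distrib algebra_simps)
 have "(\<Sum>i\<in>{..<N} - B. w i * ?g i) / ?m <= M * (\<Sum>i\<in>B. w i * ?g i) / ?m"
  using le m by (intro divide_right_mono) auto
 then show "(\<Sum>i\<in>{..<N} - B. 1 - w' i) <= M * (\<Sum>i\<in>B. 1 - w' i)"
  unfolding s using inv by (simp add: distrib_left)
 show "\<exists>i<N. 0 < w i \<and> w' i = 0" using max_score_props(3)[of N w ?g] m0 by (auto simp: w')
qed

end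

definition weights ::
 "nat \<Rightarrow> nat \<Rightarrow> (nat \<Rightarrow> nat \<Rightarrow> real) \<Rightarrow> real \<Rightarrow> real \<Rightarrow> nat \<Rightarrow> nat \<Rightarrow> real" where
 "weights N s A e \<Delta> k = (downweight N s A e \<Delta> ^^ k) (\<lambda>_. 1)"

lemma weights_sym:
 assumes sym: "\<And>i j. i < N ==> j < N ==> A i j = A j i"
 shows "weighted_sym N A (weights N s A e \<Delta> k)"
proof (induction k)
 case 0
 show ?case by unfold_locales (auto simp: weights_def sym)
next
 case (Suc k)
 interpret weighted_sym N A "weights N s A e \<Delta> k" by (rule Suc)
 have e: "weights N s A e \<Delta> (Suc k) = downweight N s A e \<Delta> (weights N s A e \<Delta> k)" by (simp add: weights_def)
 show ?case unfolding e
  by unfold_locales (auto simp: sym downweight_range intro: order_trans[OF downweight_range(2) w1])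
qed

lemma weights_stable:
 assumes "\<not> violated N s A \<Delta> (weights N s A e \<Delta> k)" "k <= m"
 shows "weights N s A e \<Delta> m = weights N s A e \<Delta> k"
 using assms(2)
proof (induction rule: dec_induct)
 case (step m)
 then show ?case using assms(1) by (simp add: weights_def downweight_def)
qed simp

text \<open>Every violation empties a further index, so that fewer than \<open>N\<close> of them can occur.\<close>

lemma weights_null:
 assumes sym: "\<And>i j. i < N ==> j < N ==> A i j = A j i" and B: "B \<subseteq> {..<N}" and M: "0 <= M"
  and small: "(M + 1) * real (card B) < real N"
  and step: "\<And>w. weighted_sym N A w ==> violated N s A \<Delta> w ==>
   0 < (\<Sum>i\<in>B. w i * score N s A e \<Delta> w i) \<and>
   (\<Sum>i\<in>{..<N} - B. w i * score N s A e \<Delta> w i) <= M * (\<Sum>i\<in>B. w i * score N s A e \<Delta> w i)"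
 shows "\<not> violated N s A \<Delta> (weights N s A e \<Delta> (N - 1))"
  "(\<Sum>i<N. 1 - weights N s A e \<Delta> k i) <= (M + 1) * real (card B)"
proof -
 let ?W = "weights N s A e \<Delta>"
 have WS: "?W (Suc k) = downweight N s A e \<Delta> (?W k)" for k by (simp add: weights_def)
 have finB: "finite B" using B finite_subset by auto
 have inv: "(\<Sum>i\<in>{..<N} - B. 1 - ?W k i) <= M * (\<Sum>i\<in>B. 1 - ?W k i)" for k
 proof (induction k)
  case (Suc k)
  interpret weighted_sym N A "?W k" by (rule weights_sym) (rule sym)
  show ?case
  proof (cases "violated N s A \<Delta> (?W k)")
   case True
   show ?thesis unfolding WS
    by (rule downweight_loss(1)[OF B True conjunct1[OF step[OF weighted_sym_axioms True]]
      conjunct2[OF step[OF weighted_sym_axioms True]] Suc])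
  next
   case False
   then show ?thesis using Suc weights_stable[OF False, of "Suc k"] by simp
  qed
 qed (simp add: weights_def)
 have loss: "(\<Sum>i<N. 1 - ?W k i) <= (M + 1) * real (card B)" for k
 proof -
  interpret weighted_sym N A "?W k" by (rule weights_sym) (rule sym)
  have "(\<Sum>i<N. 1 - ?W k i) = (\<Sum>i\<in>{..<N} - B. 1 - ?W k i) + (\<Sum>i\<in>B. 1 - ?W k i)"
   by (rule sum.subset_diff) (use B in auto)
  also have "\<dots> <= (M + 1) * (\<Sum>i\<in>B. 1 - ?W k i)" using inv[of k] by (simp add: algebra_simps)
  also have "(\<Sum>i\<in>B. 1 - ?W k i) <= (\<Sum>i\<in>B. 1)" using w0 B by (intro sum_mono) force
  finally show ?thesis using M by (simp add: mult_left_mono)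
 qed
 show "(\<Sum>i<N. 1 - ?W k i) <= (M + 1) * real (card B)" by (rule loss)
 show "\<not> violated N s A \<Delta> (?W (N - 1))"
 proof
  assume v: "violated N s A \<Delta> (?W (N - 1))"
  have vk: "violated N s A \<Delta> (?W k)" if "k <= N - 1" for k
  proof (rule ccontr)
   assume n: "\<not> violated N s A \<Delta> (?W k)"
   have "?W (N - 1) = ?W k" by (rule weights_stable[OF n that])
   then show False using n v by simp
  qed
  have "card {i\<in>{..<N}. 0 < ?W k i} + k <= N" if "k <= N" for k
   using that
  proof (induction k)
   case 0
   then show ?case using card_mono[of "{..<N}" "{i\<in>{..<N}. 0 < ?W 0 i}"] by auto
  next
   case (Suc k)
   interpret weighted_sym N A "?W k" by (rule weights_sym) (rule sym)
   have v: "violated N s A \<Delta> (?W k)" using vk Suc.prems by simp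
   obtain i where i: "i < N" "0 < ?W k i" "?W (Suc k) i = 0"
    using downweight_loss(2)[OF B v conjunct1[OF step[OF weighted_sym_axioms v]]
      conjunct2[OF step[OF weighted_sym_axioms v]] inv]
    unfolding WS[symmetric] by blast
   have le: "?W (Suc k) i' <= ?W k i'" if "i' < N" for i'
    unfolding WS by (rule downweight_range(2)[OF that])
   have "{i\<in>{..<N}. 0 < ?W (Suc k) i} \<subseteq> {i\<in>{..<N}. 0 < ?W k i}"
    using le by (force dest: less_le_trans)
   moreover have "i \<in> {i\<in>{..<N}. 0 < ?W k i}" "i \<notin> {i\<in>{..<N}. 0 < ?W (Suc k) i}"
    using i by auto
   ultimately have "{i\<in>{..<N}. 0 < ?W (Suc k) i} \<subset> {i\<in>{..<N}. 0 < ?W k i}" by blast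
   then have "card {i\<in>{..<N}. 0 < ?W (Suc k) i} < card {i\<in>{..<N}. 0 < ?W k i}"
    by (intro psubset_card_mono) auto
   then show ?case using Suc.IH Suc.prems by linarith
  qed
  \<comment> \<open>After N violations all weights would be 0 and the loss would be N, more than
    \<open>(M + 1) * card B\<close>.\<close>
  from this[of N] have "{i\<in>{..<N}. 0 < ?W N i} = {}" by simp
  then have "?W N i <= 0" if "i < N" for i using that by force
  then have "(\<Sum>i<N. 1) <= (\<Sum>i<N. 1 - ?W N i)" by (intro sum_mono) simp
  then show False using loss[of N] small by simp
 qed
qed

section \<open>Gram forms and spectral certificates\<close>

lemma quad_cong:
 "(\<And>i. i \<in> C ==> x i = x' i) ==> (\<And>i. i \<in> C ==> y i = y' i) ==> quad C Q x y = quad C Q x' y'"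
 unfolding quad_def by (intro sum.cong refl) simp

lemma quad_diff_right: "quad C Q z (\<lambda>i. x i - y i) = quad C Q z x - quad C Q z y"
 by (simp add: quad_def algebra_simps sum_subtractf)

text \<open>As matrices, \<open>comb N X a\<close> is X^T a, and \<open>prj\<close> below is X v on
  the coordinates in \<open>S\<close>.\<close>

definition comb :: "nat \<Rightarrow> (nat \<Rightarrow> nat \<Rightarrow> real) \<Rightarrow> (nat \<Rightarrow> real) \<Rightarrow> nat \<Rightarrow> real" where
 "comb N X a c = (\<Sum>i<N. a i * X i c)"

definition prj :: "nat set \<Rightarrow> (nat \<Rightarrow> nat \<Rightarrow> real) \<Rightarrow> (nat \<Rightarrow> real) \<Rightarrow> nat \<Rightarrow> real" where
 "prj S X v i = (\<Sum>c\<in>S. v c * X i c)"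

lemma sum_comb_prj: "(\<Sum>c\<in>S. v c * comb N X a c) = (\<Sum>i<N. a i * prj S X v i)"
proof -
 have "(\<Sum>c\<in>S. v c * comb N X a c) = (\<Sum>c\<in>S. \<Sum>i<N. a i * (v c * X i c))"
  by (simp add: comb_def sum_distrib_left mult_ac)
 also have "\<dots> = (\<Sum>i<N. \<Sum>c\<in>S. a i * (v c * X i c))" by (rule sum.swap)
 finally show ?thesis by (simp add: prj_def sum_distrib_left)
qed

lemma quad_gram: "quad {..<N} (gram S X) a b = (\<Sum>c\<in>S. comb N X a c * comb N X b c)"
proof -
 have "(\<Sum>c\<in>S. comb N X a c * comb N X b c) = (\<Sum>c\<in>S. \<Sum>i<N. \<Sum>j<N. X i c * X j c * a i * b j)"
  by (simp add: comb_def sum_product mult_ac)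
 also have "\<dots> = (\<Sum>i<N. \<Sum>c\<in>S. \<Sum>j<N. X i c * X j c * a i * b j)" by (rule sum.swap)
 also have "\<dots> = (\<Sum>i<N. \<Sum>j<N. \<Sum>c\<in>S. X i c * X j c * a i * b j)"
  by (rule sum.cong[OF refl], rule sum.swap)
 finally show ?thesis by (simp add: quad_def gram_def sum_distrib_right)
qed

lemma quad_shifted:
 "quad {..<N} (shifted N s G) a b = quad {..<N} G a b - shift_of N s * (\<Sum>i<N. a i * b i)"
proof -
 have "(\<Sum>i<N. \<Sum>j<N. (if i = j then shift_of N s else 0) * a i * b j) = shift_of N s * (\<Sum>i<N. a i * b i)"
  unfolding sum_distrib_left
  by (intro sum.cong refl) (simp add: if_distrib if_distribR mult_ac cong: if_cong)
 then show ?thesis by (simp add: quad_def shifted_def left_diff_distrib sum_subtractf)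
qed

lemma gram_sym: "gram S X i j = gram S X j i" by (simp add: gram_def mult.commute)

lemma shifted_sym: "shifted N s (gram S X) i j = shifted N s (gram S X) j i"
 by (simp add: shifted_def gram_sym)

lemma vstep_quad: "(\<Sum>i<N. w i * y i * vstep N A w x i) = quad {..<N} A (\<lambda>i. w i * y i) (\<lambda>i. w i * x i)"
 by (simp add: quad_def vstep_def sum_distrib_left mult_ac)

context weighted_sym begin

text \<open>This passes from the N x N Gram matrix to the covariance on \<open>S\<close>. For y = X
  u of squared weighted norm Y, the weighted inner product of y and A W y is |X^T W y|^2, so it is
  at most b Y. On the other hand Y is the inner product of u and X^T W y, and Cauchy-Schwarz gives
  Y^2 <= |u|^2 b Y.\<close>

lemma low_cert:
 assumes A: "A = gram S X" and N: "0 < N" and s: "s <= N" and v: "\<not> violated N s A \<Delta> w"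
  and D: "sqrt (real N) <= \<Delta>"
 shows "(\<Sum>i<N. w i * (prj S X u i)\<^sup>2) <= (real N + 3 * \<Delta>) * (\<Sum>c\<in>S. (u c)\<^sup>2)"
proof -
 let ?y = "prj S X u" and ?b = "(real N + \<Delta>) * (1 + 1 / sqrt (real N))"
 define Y where "Y = winner N w ?y ?y"
 have D0: "0 <= \<Delta>" using D order_trans[OF real_sqrt_ge_zero[of "real N"]] by auto
 have b0: "0 <= ?b" using D0 by simp
 have Y0: "0 <= Y" by (simp add: Y_def winner_nonneg)
 let ?T = "vstep N A w ?y"
 have "winner N w ?T ?T <= ?b\<^sup>2 * Y"
  using not_violated_vstep[OF N v, of ?y] s by (simp add: ratio_bound_def Y_def power_mult_distrib)
 then have "(winner N w ?y ?T)\<^sup>2 <= Y * (?b\<^sup>2 * Y)"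
  using winner_CS[of ?y ?T] mult_left_mono[of "winner N w ?T ?T" "?b\<^sup>2 * Y" Y] Y0 unfolding Y_def by linarith
 also have "\<dots> = (?b * Y)\<^sup>2" by (simp add: power2_eq_square)
 finally have yT: "winner N w ?y ?T <= ?b * Y"
  by (rule power2_le_imp_le) (use b0 Y0 in simp)
 let ?u = "comb N X (\<lambda>i. w i * ?y i)"
 have "Y = (\<Sum>i<N. (w i * ?y i) * ?y i)" by (simp add: Y_def winner_def)
 also have "\<dots> = (\<Sum>c\<in>S. u c * ?u c)" by (rule sum_comb_prj[symmetric])
 finally have Y: "Y = (\<Sum>c\<in>S. u c * ?u c)" .
 have "(\<Sum>c\<in>S. (?u c)\<^sup>2) = winner N w ?y ?T"
  using vstep_quad[where y = ?y and x = ?y] by (simp add: A quad_gram winner_def power2_eq_square)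
 then have "Y\<^sup>2 <= (\<Sum>c\<in>S. (u c)\<^sup>2) * (?b * Y)"
  using Cauchy_Schwarz_ineq_sum[of u ?u S] yT
   mult_left_mono[OF yT, of "\<Sum>c\<in>S. (u c)\<^sup>2"] unfolding Y by (simp add: sum_nonneg)
 then have "Y * Y <= (?b * (\<Sum>c\<in>S. (u c)\<^sup>2)) * Y" by (simp add: power2_eq_square mult_ac)
 then have "Y <= ?b * (\<Sum>c\<in>S. (u c)\<^sup>2)"
  using Y0 b0 by (cases "Y = 0") (auto simp: sum_nonneg mult_le_cancel_right)
 also have "\<dots> <= (real N + 3 * \<Delta>) * (\<Sum>c\<in>S. (u c)\<^sup>2)"
 proof (rule mult_right_mono)
  have "?b = real N + \<Delta> + sqrt (real N) + \<Delta> / sqrt (real N)"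
   using N by (simp add: field_simps)
  moreover have "\<Delta> / sqrt (real N) <= \<Delta>" using N D0 by (simp add: divide_le_eq mult_le_cancel_left1)
  ultimately show "?b <= real N + 3 * \<Delta>" using D by linarith
 qed (simp add: sum_nonneg)
 finally show ?thesis by (simp add: Y_def winner_def power2_eq_square mult.assoc)
qed

text \<open>Writing a = w x and b = w y with entries of x and y at most 1 turns mass into squared
  weighted norm, and the spectral bound applies to the pair x, y.\<close>

lemma high_cert:
 assumes N: "0 < N" and s: "N < s" and v: "\<not> violated N s A \<Delta> w" and D0: "0 <= \<Delta>"
  and a: "\<And>i. i < N ==> 0 <= a i \<and> a i <= w i" and b: "\<And>i. i < N ==> 0 <= b i \<and> b i <= w i"
  and k: "(\<Sum>i<N. a i) <= \<kappa>" "(\<Sum>i<N. b i) <= \<kappa>"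
 shows "\<bar>quad {..<N} A a b\<bar> <= 2 * \<Delta> * \<kappa>"
proof -
 \<comment> \<open>Where \<open>w i = 0\<close>, both \<open>a i\<close> and \<open>b i\<close>
   vanish by domination, which agrees with the value 0 of the quotient.\<close>
 define x y where "x i = a i / w i" and "y i = b i / w i" for i
 have k0: "0 <= \<kappa>" using k(1) a by (meson order_trans sum_nonneg lessThan_iff)
 have xa: "w i * x i = a i" "w i * y i = b i" "x i <= 1" "y i <= 1" if "i < N" for i
  using a[OF that] b[OF that] by (auto simp: x_def y_def divide_le_eq_1)
 have W: "winner N w z z <= \<kappa>" if "\<And>i. i < N ==> w i * z i = c i" "\<And>i. i < N ==> z i <= 1"
  "\<And>i. i < N ==> 0 <= c i" "(\<Sum>i<N. c i) <= \<kappa>" for z c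
 proof -
  have "winner N w z z = (\<Sum>i<N. c i * z i)" by (simp add: winner_def that(1))
  also have "\<dots> <= (\<Sum>i<N. c i * 1)" using that by (intro sum_mono mult_left_mono) auto
  finally show ?thesis using that(4) by simp
 qed
 have Wx: "winner N w x x <= \<kappa>" and Wy: "winner N w y y <= \<kappa>"
  using W[of x a] W[of y b] xa a b k by auto
 let ?T = "vstep N A w y"
 have "1 / sqrt (real N) <= 1" using N by simp
 then have "(1 + 1 / sqrt (real N))\<^sup>2 <= 2\<^sup>2" by (intro power_mono) auto
 then have "\<Delta>\<^sup>2 * (1 + 1 / sqrt (real N))\<^sup>2 * winner N w y y <= \<Delta>\<^sup>2 * 4 * \<kappa>"
  using Wy by (intro mult_mono winner_nonneg) (auto intro: winner_nonneg)
 then have T: "winner N w ?T ?T <= \<Delta>\<^sup>2 * 4 * \<kappa>"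
  using not_violated_vstep[OF N v, of y] s by (simp add: ratio_bound_def)
 have "quad {..<N} A a b = quad {..<N} A (\<lambda>i. w i * x i) (\<lambda>i. w i * y i)"
  by (rule quad_cong) (simp_all add: xa)
 then have "quad {..<N} A a b = winner N w x ?T" by (simp add: winner_def vstep_quad)
 then have "(quad {..<N} A a b)\<^sup>2 <= winner N w x x * winner N w ?T ?T" using winner_CS by simp
 also have "\<dots> <= \<kappa> * (\<Delta>\<^sup>2 * 4 * \<kappa>)" by (intro mult_mono Wx T winner_nonneg k0)
 also have "\<dots> = (2 * \<Delta> * \<kappa>)\<^sup>2" by (simp add: power2_eq_square)
 finally show ?thesis using D0 k0 by (simp add: abs_le_square_iff[symmetric])
qed

end

text \<open>Weights below \<open>w\<close> of small mass that live entirely on the corrupted indices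
  or entirely off them: the two kinds are estimated differently, and mixed vectors are split
  beforehand.\<close>

definition adm :: "nat \<Rightarrow> (nat \<Rightarrow> real) \<Rightarrow> nat set \<Rightarrow> real \<Rightarrow> (nat \<Rightarrow> real) \<Rightarrow> bool" where
 "adm N w B \<kappa> a \<longleftrightarrow> (\<forall>i<N. 0 <= a i \<and> a i <= w i) \<and> (\<Sum>i<N. a i) <= \<kappa> \<and>
  ((\<forall>i<N. i \<notin> B --> a i = 0) \<or> (\<forall>i<N. i \<in> B --> a i = 0))"

definition row :: "nat \<Rightarrow> (nat \<Rightarrow> nat \<Rightarrow> real) \<Rightarrow> (nat \<Rightarrow> real) \<Rightarrow> nat \<Rightarrow> real" where
 "row N A w i = (\<Sum>j<N. A i j * w j)"

definition clip :: "nat \<Rightarrow> (nat \<Rightarrow> nat \<Rightarrow> real) \<Rightarrow> real \<Rightarrow> (nat \<Rightarrow> real) \<Rightarrow> nat \<Rightarrow> real" where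
 "clip N A \<tau> w i = (if \<bar>row N A w i\<bar> <= \<tau> then w i else 0)"

lemma quad_row:
 assumes "\<And>i j. A i j = A j i"
 shows "quad {..<N} A w h = (\<Sum>j<N. h j * row N A w j)"
proof -
 have "quad {..<N} A w h = (\<Sum>j<N. \<Sum>i<N. A i j * w i * h j)" unfolding quad_def by (rule sum.swap)
 then show ?thesis by (simp add: row_def sum_distrib_left assms mult_ac)
qed

text \<open>
 The clipped sum splits into clean and corrupted parts; their cross term is compared with the
 unclipped row sums, which are small on the rows that survive the clipping.
\<close>

lemma clip_stable:
 assumes sym: "\<And>i j. A i j = A j i" and w: "\<And>i. i < N ==> 0 <= w i \<and> w i <= 1"
  and B: "B \<subseteq> {..<N}" "real (card B) <= e" and e: "e <= \<kappa>" and tau: "0 <= \<tau>"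
  and Q: "\<And>a b. adm N w B \<kappa> a ==> adm N w B \<kappa> b ==> \<bar>quad {..<N} A a b\<bar> <= Q"
  and lost: "(\<Sum>i<N. 1 - clip N A \<tau> w i) <= \<kappa>"
 defines "g \<equiv> \<lambda>i. if i \<in> B then 0 else clip N A \<tau> w i"
 shows "\<bar>quad {..<N} A (clip N A \<tau> w) (clip N A \<tau> w) - quad {..<N} A g g\<bar> <= 2 * \<tau> * e + 5 * Q"
proof -
 let ?w = "clip N A \<tau> w" and ?q = "quad {..<N} A"
 define h where "h i = (if i \<in> B then ?w i else 0)" for i
 define wB where "wB i = (if i \<in> B then w i else 0)" for i
 define d where "d i = (if i \<in> B then 0 else w i - ?w i)" for i
 have w': "0 <= ?w i" "?w i <= w i" if "i < N" for i using w[OF that] by (auto simp: clip_def)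
 have sumB: "(\<Sum>i<N. if i \<in> B then f i else 0) <= e" if "\<And>i. i < N ==> f i <= 1" for f :: "nat \<Rightarrow> real"
 proof -
  have "(\<Sum>i<N. if i \<in> B then f i else 0) = (\<Sum>i\<in>B. f i)"
   using B(1) by (simp add: sum.If_cases Int_absorb1)
  also have "\<dots> <= (\<Sum>i\<in>B. 1)" using that B(1) by (intro sum_mono) auto
  finally show ?thesis using B(2) by simp
 qed
 have "(\<Sum>i<N. h i) <= e" unfolding h_def using w w' by (intro sumB) (meson order_trans)
 moreover have h0: "0 <= h i" if "i < N" for i using w'[OF that] by (simp add: h_def)
 ultimately have ah: "adm N w B \<kappa> h" "(\<Sum>i<N. h i) <= e"
  using e w' w by (auto simp: adm_def h_def)
 have "(\<Sum>i<N. wB i) <= e" unfolding wB_def using w by (intro sumB) auto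
 then have aw: "adm N w B \<kappa> wB" using e w by (auto simp: adm_def wB_def)
 have "(\<Sum>i<N. d i) <= (\<Sum>i<N. 1 - ?w i)"
  using w w' by (intro sum_mono) (fastforce simp: d_def intro: order_trans)
 then have ad: "adm N w B \<kappa> d" using lost w w' by (auto simp: adm_def d_def)
 have "?q w h = (\<Sum>i<N. h i * row N A w i)" by (rule quad_row[OF sym])
 also have "\<bar>\<dots>\<bar> <= (\<Sum>i<N. h i * \<tau>)"
 proof (rule order_trans[OF sum_abs sum_mono])
  fix i assume "i \<in> {..<N}"
  then show "\<bar>h i * row N A w i\<bar> <= h i * \<tau>"
   using h0[of i] tau by (auto simp: abs_mult h_def clip_def intro: mult_left_mono)
 qed
 also have "\<dots> = (\<Sum>i<N. h i) * \<tau>" by (simp add: sum_distrib_right)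
 also have "\<dots> <= e * \<tau>" using ah(2) tau by (intro mult_right_mono)
 finally have wh: "\<bar>?q w h\<bar> <= e * \<tau>" .
 \<comment> \<open>The clean clipped weights are the unclipped ones minus the corrupted part and
   minus the clean weight lost by clipping. The last two are admissible, and for the first the row
   sums are small on the support of \<open>h\<close>.\<close>
 have "?q g h = ?q (\<lambda>i. (w i - wB i) - d i) h"
  by (rule quad_cong) (auto simp: g_def wB_def d_def)
 then have gh: "?q g h = ?q w h - ?q wB h - ?q d h" by (simp add: quad_diff_left)
 have "?q ?w ?w = ?q (\<lambda>i. g i + h i) (\<lambda>i. g i + h i)"
  by (rule quad_cong) (auto simp: g_def h_def)
 also have "\<dots> = ?q g g + 2 * ?q g h + ?q h h"
  using quad_sym[of "{..<N}" A h g] sym by (simp add: quad_add_left quad_add_right)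
 finally have "?q ?w ?w - ?q g g = 2 * (?q w h - ?q wB h - ?q d h) + ?q h h" by (simp add: gh)
 moreover have "\<bar>?q wB h\<bar> <= Q" "\<bar>?q d h\<bar> <= Q" "\<bar>?q h h\<bar> <= Q"
  by (rule Q[OF aw ah(1)], rule Q[OF ad ah(1)], rule Q[OF ah(1) ah(1)])
 ultimately show ?thesis using wh by (simp add: abs_le_iff algebra_simps)
qed

section \<open>Deterministic analysis of contaminated data\<close>

abbreviation eta :: real where "eta \<equiv> 1 / 100000000"

text \<open>
 A data matrix \<open>X\<close> with corrupted rows \<open>B\<close>. In the statistical problem \<open>e = \<epsilon> * N\<close> and
 \<open>D = N * r\<^sup>2 / \<epsilon>\<close>, where \<open>r\<close> is the separation in units of the standard deviation. The
 assumptions on the noise \<open>Z\<close> hold with high probability.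
\<close>

locale contaminated =
 fixes N :: nat and S :: "nat set" and X Z :: "nat \<Rightarrow> nat \<Rightarrow> real" and mu :: "nat \<Rightarrow> real"
  and B :: "nat set" and e D :: real
 assumes finS: "finite S" and S0: "1 <= card S"
  and clean: "\<And>i c. i < N ==> i \<notin> B ==> c \<in> S ==> X i c = mu c + Z i c"
  and B: "B \<subseteq> {..<N}" "real (card B) <= e" and e: "1 <= e" "100000 * e <= real N" and D: "0 < D"
  and total: "\<bar>quad {..<N} (gram S Z) (\<lambda>_. 1) (\<lambda>_. 1) - real (card S) * real N\<bar> <= eta * (e * D)"
  and rows: "\<And>i. i < N ==> \<bar>row N (shifted N (card S) (gram S Z)) (\<lambda>_. 1) i\<bar> <= eta * D"
  and low_dim: "card S <= N ==> sqrt (real (card S) * real N) <= eta * D"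
  and low_all: "\<And>v. card S <= N ==>
   \<bar>(\<Sum>i<N. (prj S Z v i)\<^sup>2) - real N * (\<Sum>c\<in>S. (v c)\<^sup>2)\<bar> <= eta * D * (\<Sum>c\<in>S. (v c)\<^sup>2)"
  and low_few: "\<And>v C. card S <= N ==> C \<subseteq> {..<N} ==> real (card C) <= 150 * e ==>
   (\<Sum>i\<in>C. (prj S Z v i)\<^sup>2) <= eta * D * (\<Sum>c\<in>S. (v c)\<^sup>2)"
  and high_all: "\<And>y. N < card S ==>
   \<bar>quad {..<N} (shifted N (card S) (gram S Z)) y y\<bar> <= eta * D * (\<Sum>i<N. (y i)\<^sup>2)"
  and mean_total: "\<bar>\<Sum>i<N. \<Sum>c\<in>S. mu c * Z i c\<bar> <= eta * real N * (\<Sum>c\<in>S. (mu c)\<^sup>2)"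
  and mean_rows: "\<And>i. i < N ==> \<bar>\<Sum>c\<in>S. mu c * Z i c\<bar> * e <= eta * real N * (\<Sum>c\<in>S. (mu c)\<^sup>2)"
begin

abbreviation "s \<equiv> card S"
abbreviation "AX \<equiv> shifted N s (gram S X)"
abbreviation "AZ \<equiv> shifted N s (gram S Z)"
abbreviation "nsq v \<equiv> (\<Sum>c\<in>S. (v c)\<^sup>2)"
text \<open>The constants obey two constraints. With 1/32000, the form of two admissible vectors is
  at most 7/400 of \<open>e * D\<close> when the mean is 0. This has to be below
  \<open>\<tau> * e\<close>, which is 1/32, so that clipping loses little clean mass; and
  \<open>2 * \<tau> * e\<close> plus five such forms is 0.15, below the threshold 1/4 of the
  test.\<close>

definition \<Delta> where "\<Delta> = D / 32000"
definition \<tau> where "\<tau> = D / 32"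

lemma N0: "0 < N" using e by (cases N) auto

lemma finB: "finite B" using B finite_subset by auto

lemma low_shift: "s <= N ==> shifted N s G = G"
 by (auto simp: shifted_def shift_of_def fun_eq_iff)

lemma gram_clean: "mu = (\<lambda>_. 0) ==> i < N ==> j < N ==> i \<notin> B ==> j \<notin> B ==> AX i j = AZ i j"
 by (simp add: shifted_def gram_def clean)

lemma prj_clean: "i < N ==> i \<notin> B ==> prj S X v i = (\<Sum>c\<in>S. v c * mu c) + prj S Z v i"
 by (simp add: prj_def clean distrib_left sum.distrib)

text \<open>From small sets to fractional weights of small mass: fewer than about 150 e indices can
  carry more than a k-th part of the bound T, and together they carry at most T. The light rest
  contributes at most its mass times T / k, which is again at most T.\<close>

lemma low_few_weighted:
 assumes s: "s <= N" and q: "\<And>i. i < N ==> 0 <= q i \<and> q i <= 1" "(\<Sum>i<N. q i) <= 145 * e"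
 shows "(\<Sum>i<N. q i * (prj S Z v i)\<^sup>2) <= 2 * (eta * D) * nsq v"
proof -
 define f where "f i = (prj S Z v i)\<^sup>2" for i
 define T where "T = eta * D * nsq v"
 have T0: "0 <= T" using D by (simp add: T_def sum_nonneg)
 define k where "k = nat \<lceil>145 * e\<rceil>"
 have k: "145 * e <= real k" "real k <= 150 * e" "0 < k" using e by (auto simp: k_def) linarith+
 define H where "H = {i\<in>{..<N}. T < real k * f i}"
 have cH: "card H <= k"
 proof (rule ccontr)
  assume "\<not> card H <= k"
  then obtain C where C: "C \<subseteq> H" "card C = k" "finite C"
   by (metis nat_le_linear obtain_subset_with_card_n)
  have "real k * T = (\<Sum>i\<in>C. T)" using C by simp
  also have "\<dots> < (\<Sum>i\<in>C. real k * f i)"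
   using C k by (intro sum_strict_mono) (auto simp: H_def)
  also have "\<dots> = real k * (\<Sum>i\<in>C. f i)" by (simp add: sum_distrib_left)
  also have "\<dots> <= real k * T"
   using low_few[OF s, of C v] C k unfolding f_def T_def
   by (intro mult_left_mono) (auto simp: H_def)
  finally show False by simp
 qed
 have "(\<Sum>i<N. q i * f i) = (\<Sum>i\<in>H. q i * f i) + (\<Sum>i\<in>{..<N} - H. q i * f i)"
  by (subst sum.subset_diff[of H]) (auto simp: H_def)
 also have "(\<Sum>i\<in>H. q i * f i) <= (\<Sum>i\<in>H. 1 * f i)"
  using q by (intro sum_mono mult_right_mono) (auto simp: H_def f_def)
 also have "(\<Sum>i\<in>H. 1 * f i) <= T"
 proof -
  have "H \<subseteq> {..<N}" "real (card H) <= 150 * e" using cH k by (auto simp: H_def)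
  from low_few[OF s this] show ?thesis by (simp add: f_def T_def)
 qed
 also have "(\<Sum>i\<in>{..<N} - H. q i * f i) <= (\<Sum>i\<in>{..<N} - H. q i * (T / real k))"
  using q k by (intro sum_mono mult_left_mono) (auto simp: H_def pos_le_divide_eq mult.commute)
 also have "\<dots> = (\<Sum>i\<in>{..<N} - H. q i) * (T / real k)" by (rule sum_distrib_right[symmetric])
 also have "\<dots> <= real k * (T / real k)"
 proof (rule mult_right_mono)
  have "(\<Sum>i\<in>{..<N} - H. q i) <= (\<Sum>i<N. q i)" using q by (intro sum_mono2) auto
  then show "(\<Sum>i\<in>{..<N} - H. q i) <= real k" using q(2) k by linarith
 qed (use T0 in simp)
 also have "\<dots> = T" using k by simp
 finally show ?thesis by (simp add: f_def T_def)
qed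

text \<open>Applying the projection bound in the direction of the sum itself makes the estimate
  self-bounding: n^2 <= k T n for its squared norm n.\<close>

lemma comb_norm_le:
 assumes q: "\<And>i. i < N ==> 0 <= q i" "(\<Sum>i<N. q i) <= k"
  and f: "\<And>v. (\<Sum>i<N. q i * (prj S Y v i)\<^sup>2) <= T * nsq v" and T: "0 <= T"
 shows "nsq (comb N Y q) <= k * T"
proof -
 let ?u = "comb N Y q" let ?n = "nsq ?u"
 have "?n = (\<Sum>i<N. q i * 1 * prj S Y ?u i)"
  using sum_comb_prj[of ?u N Y q S] by (simp add: power2_eq_square)
 then have "?n\<^sup>2 <= (\<Sum>i<N. q i * 1\<^sup>2) * (\<Sum>i<N. q i * (prj S Y ?u i)\<^sup>2)"
  using weighted_CS[of "{..<N}" q "\<lambda>_. 1" "prj S Y ?u"] q by simp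
 also have "\<dots> <= k * (T * ?n)"
  using q f[of ?u] T by (intro mult_mono) (auto intro!: sum_nonneg order_trans[OF sum_nonneg q(2)])
 finally have "?n * ?n <= (k * T) * ?n" by (simp add: power2_eq_square mult_ac)
 moreover have "0 <= k" using q by (meson order_trans sum_nonneg lessThan_iff)
 ultimately show ?thesis using T
  by (cases "?n = 0") (auto simp: mult_le_cancel_right sum_nonneg less_le)
qed

lemma quad_gram_bound:
 assumes "nsq (comb N Y a) <= T" "nsq (comb N Y b) <= T"
 shows "\<bar>quad {..<N} (gram S Y) a b\<bar> <= T"
proof -
 have "0 <= nsq (comb N Y a)" by (simp add: sum_nonneg)
 then have "0 <= T" using assms(1) by linarith
 have "(quad {..<N} (gram S Y) a b)\<^sup>2 <= nsq (comb N Y a) * nsq (comb N Y b)"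
  unfolding quad_gram by (rule Cauchy_Schwarz_ineq_sum)
 also have "\<dots> <= T * T" using assms \<open>0 <= T\<close> by (intro mult_mono) (auto simp: sum_nonneg)
 finally show ?thesis using \<open>0 <= T\<close> by (simp add: power2_eq_square[symmetric] abs_le_square_iff[symmetric])
qed

lemma clean_small:
 assumes q: "\<And>i. i < N ==> 0 <= q i \<and> q i <= 1" "(\<Sum>i<N. q i) <= 145 * e"
  and q': "\<And>i. i < N ==> 0 <= q' i \<and> q' i <= 1" "(\<Sum>i<N. q' i) <= 145 * e"
 shows "\<bar>quad {..<N} AZ q q'\<bar> <= 290 * eta * (e * D)"
proof (cases "s <= N")
 case True
 have "nsq (comb N Z q) <= 145 * e * (2 * (eta * D))"
  by (rule comb_norm_le) (use q low_few_weighted[OF True q] D in auto)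
 moreover have "nsq (comb N Z q') <= 145 * e * (2 * (eta * D))"
  by (rule comb_norm_le) (use q' low_few_weighted[OF True q'] D in auto)
 ultimately have "\<bar>quad {..<N} (gram S Z) q q'\<bar> <= 145 * e * (2 * (eta * D))" by (rule quad_gram_bound)
 then show ?thesis by (simp add: low_shift[OF True] mult.commute[of D])
next
 case False
 have n: "(\<Sum>i<N. (q i)\<^sup>2) <= 145 * e" if "\<And>i. i < N ==> 0 <= q i \<and> q i <= 1" "(\<Sum>i<N. q i) <= 145 * e" for q
 proof -
  have "(\<Sum>i<N. (q i)\<^sup>2) <= (\<Sum>i<N. q i)"
   using that by (intro sum_mono) (auto simp: power2_eq_square mult_left_le)
  then show ?thesis using that by simp
 qed
 have "2 * \<bar>quad {..<N} AZ q q'\<bar> <= eta * D * ((\<Sum>i<N. (q i)\<^sup>2) + (\<Sum>i<N. (q' i)\<^sup>2))"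
  by (rule quad_polar_bound) (use high_all False shifted_sym in auto)
 also have "\<dots> <= eta * D * (145 * e + 145 * e)"
  using D by (intro mult_left_mono add_mono n q q') auto
 finally show ?thesis using e D by (simp add: field_simps)
qed

text \<open>The current power factors as X V with V = X^T W R, R being the previous power. The
  weighted squared norm p of the columns of V is the inner product of R and A W R, so p^2 is at most
  the product of the two totals, and the violation gives p <= q. Clean rows thus have total at most
  (N + eta D) q of (N + \<Delta>) q, and about \<Delta> q is left for the corrupted ones.\<close>

lemma low_null_step:
 assumes s: "s <= N" and mu: "mu = (\<lambda>_. 0)" and w: "weighted_sym N AX w" and v: "violated N s AX \<Delta> w"
 shows "0 < (\<Sum>i\<in>B. w i * score N s AX e \<Delta> w i) \<and>
  (\<Sum>i\<in>{..<N} - B. w i * score N s AX e \<Delta> w i) <= 128 * (\<Sum>i\<in>B. w i * score N s AX e \<Delta> w i)"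
proof -
 interpret weighted_sym N AX w by (rule w)
 let ?a = "new_score N AX w" and ?n = "new_total N AX w" and ?n' = "old_total N AX w"
 have Dp: "0 < \<Delta>" using D by (simp add: \<Delta>_def)
 have ND: "0 < real N + \<Delta>" using Dp by simp
 have n: "(real N + \<Delta>)\<^sup>2 * ?n' < ?n" using v s by (simp add: violated_def ratio_bound_def)
 have n0: "0 < ?n" using n totals_nonneg by (meson le_less_trans mult_nonneg_nonneg zero_le_power2)
 define R where "R = mpow N AX w (N - 1)"
 define V where "V j = comb N X (\<lambda>l. w l * R l j)" for j
 have RN: "mpow N AX w N = mstep N AX w R" using mpow_Suc[of "N - 1"] N0 by (simp add: R_def)
 have col: "mpow N AX w N i j = prj S X (V j) i" for i j
 proof -
  have "mpow N AX w N i j = (\<Sum>l<N. AX i l * w l * R l j)" by (simp only: RN mstep_def)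
  also have "\<dots> = (\<Sum>l<N. \<Sum>c\<in>S. X i c * (w l * R l j * X l c))"
   by (simp add: low_shift[OF s] gram_def sum_distrib_left sum_distrib_right mult_ac)
  also have "\<dots> = (\<Sum>c\<in>S. \<Sum>l<N. X i c * (w l * R l j * X l c))" by (rule sum.swap)
  also have "\<dots> = prj S X (V j) i" by (simp add: prj_def V_def comb_def sum_distrib_left mult_ac)
  finally show ?thesis .
 qed
 define p where "p = (\<Sum>j<N. w j * nsq (V j))"
 have lin: "(\<Sum>j<N. w j * (a * f j)) = a * (\<Sum>j<N. w j * f j)" for a :: real and f
  by (simp add: sum_distrib_left mult_ac)
 have p0: "0 <= p" unfolding p_def by (intro sum_nonneg mult_nonneg_nonneg) (auto simp: w0 sum_nonneg)
 have "p = minner N w R (mstep N AX w R)"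
 proof -
  have "nsq (V j) = winner N w (\<lambda>i. R i j) (vstep N AX w (\<lambda>i. R i j))" for j
   using vstep_quad[where N = N and w = w and y = "\<lambda>i. R i j" and A = AX and x = "\<lambda>i. R i j"] unfolding low_shift[OF s] quad_gram
   by (simp add: winner_def V_def power2_eq_square)
  then show ?thesis by (simp add: p_def minner_def mstep_col)
 qed
 then have "p\<^sup>2 <= minner N w R R * minner N w (mstep N AX w R) (mstep N AX w R)"
  using minner_CS by simp
 also have "\<dots> = ?n' * ?n" by (simp only: new_total_nrm old_total_nrm nrm_def RN R_def[symmetric])
 finally have pp: "p\<^sup>2 <= ?n' * ?n" .
 define q where "q = ?n / (real N + \<Delta>)"
 have qn: "?n = (real N + \<Delta>) * q" using ND by (simp add: q_def)
 have q0: "0 < q" using n0 ND by (simp add: q_def)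
 have "(real N + \<Delta>) * ((real N + \<Delta>) * ?n') < (real N + \<Delta>) * q"
  using n qn by (simp add: power2_eq_square mult.assoc)
 then have "(real N + \<Delta>) * ?n' < q" using ND mult_less_cancel_left_pos by blast
 then have "?n' * ?n <= q * q"
  using mult_right_mono[of "(real N + \<Delta>) * ?n'" q q] q0 unfolding qn by (simp add: mult_ac)
 then have pq: "p <= q" using pp q0 by (intro power2_le_imp_le[of p q]) (auto simp: power2_eq_square)
 have D8: "eta * D <= \<Delta> / 8" using D by (simp add: \<Delta>_def)
 have asum: "(\<Sum>i\<in>C. w i * ?a i) = (\<Sum>j<N. w j * (\<Sum>i\<in>C. w i * (prj S X (V j) i)\<^sup>2))" if "C \<subseteq> {..<N}" for C
 proof -
  have "(\<Sum>i\<in>C. w i * ?a i) = (\<Sum>i\<in>C. \<Sum>j<N. w j * (w i * (prj S X (V j) i)\<^sup>2))"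
   using that by (intro sum.cong refl) (auto simp: new_score_def col sum_distrib_left mult_ac)
  also have "\<dots> = (\<Sum>j<N. \<Sum>i\<in>C. w j * (w i * (prj S X (V j) i)\<^sup>2))" by (rule sum.swap)
  finally show ?thesis by (simp add: sum_distrib_left)
 qed
 have "(\<Sum>i\<in>{..<N} - B. w i * ?a i) <= (\<Sum>j<N. w j * ((real N + eta * D) * nsq (V j)))"
  unfolding asum[OF Diff_subset]
 proof (intro sum_mono mult_left_mono)
  fix j assume "j \<in> {..<N}"
  have "(\<Sum>i\<in>{..<N} - B. w i * (prj S X (V j) i)\<^sup>2) <= (\<Sum>i\<in>{..<N} - B. 1 * (prj S Z (V j) i)\<^sup>2)"
   using w1 by (intro sum_mono) (auto simp: prj_clean mu mult_right_mono mult_left_le_one_le w0)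
  also have "\<dots> <= (\<Sum>i<N. (prj S Z (V j) i)\<^sup>2)" by (simp add: sum_mono2)
  also have "\<dots> <= (real N + eta * D) * nsq (V j)"
   using low_all[OF s, of "V j"] unfolding distrib_right by linarith
  finally show "(\<Sum>i\<in>{..<N} - B. w i * (prj S X (V j) i)\<^sup>2) <= (real N + eta * D) * nsq (V j)" .
 qed (auto simp: w0)
 also have "\<dots> = (real N + eta * D) * p" unfolding p_def by (rule lin)
 also have "\<dots> <= (real N + eta * D) * q" using pq D by (intro mult_left_mono) auto
 finally have G: "(\<Sum>i\<in>{..<N} - B. w i * ?a i) <= (real N + eta * D) * q" .
 have "?n = (\<Sum>i\<in>{..<N} - B. w i * ?a i) + (\<Sum>i\<in>B. w i * ?a i)"
  unfolding new_total_def by (rule sum.subset_diff) (use B in auto)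
 then have Bb: "(\<Delta> - eta * D) * q <= (\<Sum>i\<in>B. w i * ?a i)" using G qn by (simp add: algebra_simps)
 \<comment> \<open>At most e corrupted rows fall below the threshold, so all of them together
   forfeit at most a quarter of \<Delta> q.\<close>
 define t where "t = \<Delta> * q / (4 * e)"
 have t0: "0 < t" using Dp q0 e by (simp add: t_def)
 have teq: "\<Delta> * ?n / (4 * e * (real N + \<Delta>)) = t" by (simp add: t_def q_def)
 have sc: "score N s AX e \<Delta> w i = (if ?a i <= t then 0 else ?a i)" for i
  using s by (simp add: score_def teq)
 have "(\<Sum>i\<in>B. w i * ?a i) <= (\<Sum>i\<in>B. w i * score N s AX e \<Delta> w i + t)"
 proof (rule sum_mono)
  fix i assume "i \<in> B"
  then have i: "i < N" using B by auto
  have "w i * ?a i <= 1 * t" if "?a i <= t"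
   using that w0[OF i] w1[OF i] scores_nonneg(1)[of i] by (intro mult_mono) auto
  then show "w i * ?a i <= w i * score N s AX e \<Delta> w i + t" using t0 by (auto simp: sc)
 qed
 also have "\<dots> = (\<Sum>i\<in>B. w i * score N s AX e \<Delta> w i) + real (card B) * t" by (simp add: sum.distrib)
 also have "real (card B) * t <= e * t" using B t0 by (intro mult_right_mono) auto
 also have "e * t = \<Delta> * q / 4" using e by (simp add: t_def)
 finally have SB: "(\<Delta> - eta * D) * q - \<Delta> * q / 4 <= (\<Sum>i\<in>B. w i * score N s AX e \<Delta> w i)" using Bb by simp
 define H where "H = {i\<in>{..<N} - B. t < ?a i}"
 have few: "(\<Sum>i\<in>C. ?a i) <= eta * D * q" if C: "C \<subseteq> {..<N} - B" "real (card C) <= 150 * e" for C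
 proof -
  have "(\<Sum>i\<in>C. ?a i) = (\<Sum>i\<in>C. \<Sum>j<N. w j * (prj S Z (V j) i)\<^sup>2)"
   using C by (intro sum.cong refl) (auto simp: new_score_def col prj_clean mu subset_eq intro!: sum.cong)
  also have "\<dots> = (\<Sum>j<N. w j * (\<Sum>i\<in>C. (prj S Z (V j) i)\<^sup>2))"
   by (subst sum.swap) (simp add: sum_distrib_left)
  also have "\<dots> <= (\<Sum>j<N. w j * (eta * D * nsq (V j)))"
   using C by (intro sum_mono mult_left_mono low_few[OF s]) (auto simp: w0)
  also have "\<dots> = eta * D * p" unfolding p_def by (rule lin)
  also have "\<dots> <= eta * D * q" using pq D by (intro mult_left_mono) auto
  finally show ?thesis .
 qed
 \<comment> \<open>Were there more, some \<lceil>e\<rceil> of them would already carry \<Delta> q /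
   4, more than so few clean rows can.\<close>
 have "real (card H) <= 150 * e"
 proof (rule ccontr)
  assume a: "\<not> real (card H) <= 150 * e"
  define k where "k = nat \<lceil>e\<rceil>"
  have k: "e <= real k" "real k <= 150 * e" using e by (auto simp: k_def) linarith
  then have "k <= card H" using a by linarith
  then obtain C where C: "C \<subseteq> H" "card C = k" by (metis obtain_subset_with_card_n)
  have "e * t <= real k * t" using k t0 by (intro mult_right_mono) auto
  also have "\<dots> = (\<Sum>i\<in>C. t)" using C by simp
  also have "\<dots> <= (\<Sum>i\<in>C. ?a i)" using C by (intro sum_mono) (auto simp: H_def less_imp_le)
  also have "\<dots> <= eta * D * q" using C k by (intro few) (auto simp: H_def)
  also have "\<dots> <= \<Delta> / 8 * q" using D8 q0 by (intro mult_right_mono) auto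
  finally have "\<Delta> * q / 4 <= \<Delta> * q / 8" using e by (simp add: t_def)
  then show False using Dp q0 by (simp add: zero_less_mult_iff)
 qed
 then have "(\<Sum>i\<in>H. ?a i) <= eta * D * q" by (intro few) (auto simp: H_def)
 moreover have "(\<Sum>i\<in>{..<N} - B. w i * score N s AX e \<Delta> w i) = (\<Sum>i\<in>H. w i * ?a i)"
  by (rule sum.mono_neutral_cong_right) (auto simp: H_def sc)
 moreover have "(\<Sum>i\<in>H. w i * ?a i) <= (\<Sum>i\<in>H. 1 * ?a i)"
  using w1 scores_nonneg by (intro sum_mono mult_right_mono) (auto simp: H_def)
 ultimately have SG: "(\<Sum>i\<in>{..<N} - B. w i * score N s AX e \<Delta> w i) <= eta * D * q" by simp
 have x: "eta * D * q <= \<Delta> * q / 8" using mult_right_mono[OF D8, of q] q0 by simp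
 have y: "0 < \<Delta> * q" using Dp q0 by simp
 have "\<Delta> * q / 2 <= (\<Sum>i\<in>B. w i * score N s AX e \<Delta> w i)"
  using SB x y unfolding left_diff_distrib by linarith
 then show ?thesis using SG x y by linarith
qed

text \<open>There is no certificate here, but the ratio of the totals itself bounds the squared
  operator norm by 4 n / n'. Mass of the new power on clean rows comes from clean rows of the old
  power, where the noise matrix shrinks it below the violated level, or from its corrupted rows. So
  the corrupted rows must carry a fixed share of the old or of the new mass.\<close>

lemma high_null_step:
 assumes s: "N < s" and mu: "mu = (\<lambda>_. 0)" and w: "weighted_sym N AX w" and v: "violated N s AX \<Delta> w"
 shows "0 < (\<Sum>i\<in>B. w i * score N s AX e \<Delta> w i) \<and>
  (\<Sum>i\<in>{..<N} - B. w i * score N s AX e \<Delta> w i) <= 128 * (\<Sum>i\<in>B. w i * score N s AX e \<Delta> w i)"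
proof -
 interpret weighted_sym N AX w by (rule w)
 let ?a = "new_score N AX w" and ?b = "old_score N AX w"
 define n n' where "n = new_total N AX w" and "n' = old_total N AX w"
 have Dp: "0 < \<Delta>" using D by (simp add: \<Delta>_def)
 have vn: "\<Delta>\<^sup>2 * n' < n" using v s by (simp add: violated_def ratio_bound_def n_def n'_def)
 have n0: "0 < n" using vn totals_nonneg unfolding n_def n'_def
  by (meson le_less_trans mult_nonneg_nonneg zero_le_power2)
 then have n'0: "0 < n'" using old_total_pos[OF N0] by (simp add: n_def n'_def)
 define R where "R = mpow N AX w (N - 1)"
 have RN: "mpow N AX w N = mstep N AX w R" using mpow_Suc[of "N - 1"] N0 by (simp add: R_def)
 define nG nB bG bB where "nG = (\<Sum>i\<in>{..<N} - B. w i * ?a i)" and "nB = (\<Sum>i\<in>B. w i * ?a i)"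
  and "bG = (\<Sum>i\<in>{..<N} - B. w i * ?b i)" and "bB = (\<Sum>i\<in>B. w i * ?b i)"
 have split: "n = nG + nB" "n' = bG + bB"
  unfolding n_def n'_def new_total_def old_total_def nG_def nB_def bG_def bB_def
  by (rule sum.subset_diff, use B in auto)+
 have nn: "0 <= nG" "0 <= nB" "0 <= bG" "0 <= bB"
  unfolding nG_def nB_def bG_def bB_def using B scores_nonneg w0
  by (auto intro!: sum_nonneg mult_nonneg_nonneg)
 \<comment> \<open>Between clean rows \<open>AX\<close> equals \<open>AZ\<close>, whose operator
   norm is at most \<open>eta * D\<close>; weights in [0, 1] do not increase it.\<close>
 have block: "(\<Sum>i\<in>{..<N} - B. w i * (vstep N AX w x i)\<^sup>2) <= (eta * D)\<^sup>2 * (\<Sum>i<N. w i * (x i)\<^sup>2)"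
  if xB: "\<And>i. i \<in> B ==> x i = 0" for x
 proof -
  define y where "y i = (if i \<in> B then 0 else vstep N AX w x i)" for i
  define Y U where "Y = (\<Sum>i<N. w i * (y i)\<^sup>2)" and "U = (\<Sum>i<N. w i * (x i)\<^sup>2)"
  have YU: "0 <= Y" "0 <= U" by (auto simp: Y_def U_def intro!: sum_nonneg mult_nonneg_nonneg w0)
  have "Y = (\<Sum>i<N. w i * y i * vstep N AX w x i)"
   unfolding Y_def by (intro sum.cong refl) (simp add: y_def power2_eq_square)
  also have "\<dots> = quad {..<N} AX (\<lambda>i. w i * y i) (\<lambda>i. w i * x i)" by (rule vstep_quad)
  also have "\<dots> = quad {..<N} AZ (\<lambda>i. w i * y i) (\<lambda>i. w i * x i)"
   unfolding quad_def
  proof (intro sum.cong refl)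
   fix i j assume "i \<in> {..<N}" "j \<in> {..<N}"
   then show "AX i j * (w i * y i) * (w j * x j) = AZ i j * (w i * y i) * (w j * x j)"
    using gram_clean[OF mu, of i j] xB[of j] by (cases "i \<in> B \<or> j \<in> B") (auto simp: y_def)
  qed
  also have "\<dots> <= eta * D * (sqrt (\<Sum>i<N. (w i * y i)\<^sup>2) * sqrt (\<Sum>i<N. (w i * x i)\<^sup>2))"
   by (rule order_trans[OF abs_ge_self quad_op_bound]) (use high_all s shifted_sym in auto)
  also have "\<dots> <= eta * D * (sqrt Y * sqrt U)"
  proof -
   have "(\<Sum>i<N. (w i * z i)\<^sup>2) <= (\<Sum>i<N. w i * (z i)\<^sup>2)" for z
   proof (rule sum_mono)
    fix i assume "i \<in> {..<N}"
    then have "w i * (w i * (z i)\<^sup>2) <= 1 * (w i * (z i)\<^sup>2)"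
     using w0[of i] w1[of i] by (intro mult_right_mono) auto
    then show "(w i * z i)\<^sup>2 <= w i * (z i)\<^sup>2" by (simp add: power2_eq_square mult_ac)
   qed
   then show ?thesis using D unfolding Y_def U_def
    by (intro mult_left_mono mult_mono real_sqrt_le_mono) (auto intro!: sum_nonneg mult_nonneg_nonneg w0)
  qed
  finally have "Y <= eta * D * (sqrt Y * sqrt U)" .
  then have "sqrt Y * sqrt Y <= (eta * D * sqrt U) * sqrt Y" using YU by (simp add: mult_ac)
  then have "sqrt Y <= eta * D * sqrt U"
   using YU D mult_right_le_imp_le[of "sqrt Y" "sqrt Y" "eta * D * sqrt U"]
   by (cases "Y = 0") simp_all
  then have "(sqrt Y)\<^sup>2 <= (eta * D * sqrt U)\<^sup>2" using YU by (intro power_mono) auto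
  moreover have "(eta * D * sqrt U)\<^sup>2 = (eta * D)\<^sup>2 * U"
   using YU by (simp only: power_mult_distrib real_sqrt_pow2)
  ultimately have "Y <= (eta * D)\<^sup>2 * U" using YU by simp
  moreover have "Y = (\<Sum>i\<in>{..<N} - B. w i * (vstep N AX w x i)\<^sup>2)"
   unfolding Y_def y_def by (rule sum.mono_neutral_cong_right) auto
  ultimately show ?thesis by (simp add: U_def)
 qed
 have colsum: "(\<Sum>i\<in>C. w i * f i) = (\<Sum>j<N. w j * (\<Sum>i\<in>C. w i * (K i j)\<^sup>2))"
  if "\<And>i. f i = (\<Sum>j<N. w j * (K i j)\<^sup>2)" for C f K
  unfolding that sum_distrib_left by (subst sum.swap) (simp add: mult_ac)
 define RB RG where "RB j i = (if i \<in> B then R i j else 0)" and "RG j i = (if i \<in> B then 0 else R i j)" for j i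
 have a: "?a i = (\<Sum>j<N. w j * (vstep N AX w (\<lambda>i. R i j) i)\<^sup>2)" for i
  by (simp add: new_score_def RN mstep_col[symmetric])
 have b: "?b i = (\<Sum>j<N. w j * (R i j)\<^sup>2)" for i by (simp add: old_score_def R_def)
 have "nG = (\<Sum>j<N. w j * (\<Sum>i\<in>{..<N} - B. w i * (vstep N AX w (\<lambda>i. R i j) i)\<^sup>2))"
  unfolding nG_def by (rule colsum[OF a])
 also have "\<dots> <= (\<Sum>j<N. w j * (2 * ((eta * D)\<^sup>2 * (\<Sum>i<N. w i * (RG j i)\<^sup>2)) + 8 * (n / n') * (\<Sum>i<N. w i * (RB j i)\<^sup>2)))"
 proof (intro sum_mono mult_left_mono)
  fix j assume "j \<in> {..<N}"
  have sp: "vstep N AX w (\<lambda>i. R i j) i = vstep N AX w (RG j) i + vstep N AX w (RB j) i" for i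
  proof -
   have "(\<lambda>i. R i j) = (\<lambda>i. RG j i + RB j i)" by (auto simp: RG_def RB_def)
   then show ?thesis by (simp add: vstep_def distrib_left sum.distrib)
  qed
  have "(\<Sum>i\<in>{..<N} - B. w i * (vstep N AX w (\<lambda>i. R i j) i)\<^sup>2) <=
    (\<Sum>i\<in>{..<N} - B. 2 * (w i * (vstep N AX w (RG j) i)\<^sup>2) + 2 * (w i * (vstep N AX w (RB j) i)\<^sup>2))"
  proof (rule sum_mono)
   fix i assume "i \<in> {..<N} - B"
   have "(vstep N AX w (\<lambda>i. R i j) i)\<^sup>2 <= 2 * (vstep N AX w (RG j) i)\<^sup>2 + 2 * (vstep N AX w (RB j) i)\<^sup>2"
    unfolding sp using sum_squares_bound[of "vstep N AX w (RG j) i" "vstep N AX w (RB j) i"]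
    by (simp add: power2_sum)
   then have "w i * (vstep N AX w (\<lambda>i. R i j) i)\<^sup>2 <= w i * (2 * (vstep N AX w (RG j) i)\<^sup>2 + 2 * (vstep N AX w (RB j) i)\<^sup>2)"
    using w0[of i] \<open>i \<in> {..<N} - B\<close> by (intro mult_left_mono) auto
   then show "w i * (vstep N AX w (\<lambda>i. R i j) i)\<^sup>2 <= 2 * (w i * (vstep N AX w (RG j) i)\<^sup>2) + 2 * (w i * (vstep N AX w (RB j) i)\<^sup>2)"
    by (simp add: distrib_left mult_ac)
  qed
  also have "\<dots> = 2 * (\<Sum>i\<in>{..<N} - B. w i * (vstep N AX w (RG j) i)\<^sup>2) + 2 * (\<Sum>i\<in>{..<N} - B. w i * (vstep N AX w (RB j) i)\<^sup>2)"
   by (simp add: sum.distrib sum_distrib_left)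
  also have "\<dots> <= 2 * ((eta * D)\<^sup>2 * (\<Sum>i<N. w i * (RG j i)\<^sup>2)) + 2 * (4 * (n / n') * (\<Sum>i<N. w i * (RB j i)\<^sup>2))"
  proof (intro add_mono mult_left_mono)
   show "(\<Sum>i\<in>{..<N} - B. w i * (vstep N AX w (RG j) i)\<^sup>2) <= (eta * D)\<^sup>2 * (\<Sum>i<N. w i * (RG j i)\<^sup>2)"
    by (rule block) (simp add: RG_def)
   have "(\<Sum>i\<in>{..<N} - B. w i * (vstep N AX w (RB j) i)\<^sup>2) <= winner N w (vstep N AX w (RB j)) (vstep N AX w (RB j))"
    unfolding winner_def power2_eq_square mult.assoc[symmetric] by (rule sum_mono2) (auto simp: w0 mult.assoc)
   also have "\<dots> <= 4 * (n / n') * winner N w (RB j) (RB j)"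
    using vstep_le_ratio[OF N0, of "RB j"] n'0 by (simp add: n_def n'_def)
   finally show "(\<Sum>i\<in>{..<N} - B. w i * (vstep N AX w (RB j) i)\<^sup>2) <= 4 * (n / n') * (\<Sum>i<N. w i * (RB j i)\<^sup>2)"
    by (simp add: winner_def power2_eq_square mult.assoc)
  qed auto
  finally show "(\<Sum>i\<in>{..<N} - B. w i * (vstep N AX w (\<lambda>i. R i j) i)\<^sup>2) <=
    2 * ((eta * D)\<^sup>2 * (\<Sum>i<N. w i * (RG j i)\<^sup>2)) + 8 * (n / n') * (\<Sum>i<N. w i * (RB j i)\<^sup>2)" by simp
 qed (auto simp: w0)
 also have "\<dots> = 2 * (eta * D)\<^sup>2 * (\<Sum>j<N. w j * (\<Sum>i<N. w i * (RG j i)\<^sup>2)) + 8 * (n / n') * (\<Sum>j<N. w j * (\<Sum>i<N. w i * (RB j i)\<^sup>2))"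
 proof -
  have "(\<Sum>j<N. w j * (2 * (a * f j) + 8 * b * g j)) = 2 * a * (\<Sum>j<N. w j * f j) + 8 * b * (\<Sum>j<N. w j * g j)"
   for a b :: real and f g
   by (simp add: distrib_left sum.distrib sum_distrib_left mult_ac)
  then show ?thesis .
 qed
 also have "(\<Sum>j<N. w j * (\<Sum>i<N. w i * (RG j i)\<^sup>2)) = bG"
 proof -
  have "(\<Sum>i<N. w i * (RG j i)\<^sup>2) = (\<Sum>i\<in>{..<N} - B. w i * (R i j)\<^sup>2)" for j
   unfolding RG_def by (rule sum.mono_neutral_cong_right) auto
  then show ?thesis unfolding bG_def colsum[OF b] by simp
 qed
 also have "(\<Sum>j<N. w j * (\<Sum>i<N. w i * (RB j i)\<^sup>2)) = bB"
 proof -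
  have "(\<Sum>i<N. w i * (RB j i)\<^sup>2) = (\<Sum>i\<in>B. w i * (R i j)\<^sup>2)" for j
   unfolding RB_def by (rule sum.mono_neutral_cong_right) (use B in auto)
  then show ?thesis unfolding bB_def colsum[OF b] by simp
 qed
 finally have nG: "nG <= 2 * (eta * D)\<^sup>2 * bG + 8 * (n / n') * bB" .
 have "2 * (eta * D)\<^sup>2 * bG <= 2 * (\<Delta> / 4)\<^sup>2 * n'"
  using D nn split(2) by (intro mult_mono power_mono) (auto simp: \<Delta>_def)
 also have "\<dots> = \<Delta>\<^sup>2 * n' / 8" by (simp add: power2_eq_square)
 also have "\<dots> <= n / 8" using vn by simp
 finally have g1: "2 * (eta * D)\<^sup>2 * bG <= n / 8" .
 \<comment> \<open>If the corrupted share of the old mass is below 1/64, both sources contribute at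
   most n / 8 each, and at least 3/4 of the new mass is corrupted. The 64 here, with 2 n n' as an
   upper bound for the clean scores, gives the factor 128.\<close>
 have key: "n * n' <= 64 * (nB * n' + bB * n)"
 proof (cases "bB <= n' / 64")
  case True
  have "8 * (n / n') * bB <= 8 * (n / n') * (n' / 64)" using True n0 n'0 by (intro mult_left_mono) auto
  also have "\<dots> = n / 8" using n'0 by simp
  finally have "nG <= n / 4" using nG g1 by simp
  then have "n / 64 <= nB" using split(1) n0 by simp
  then have "n * n' <= 64 * (nB * n')" using n'0 by simp
  then show ?thesis using nn n0 by (simp add: add_increasing2)
 next
  case False
  then have "n * n' <= 64 * (bB * n)" using n0 by simp
  then show ?thesis using nn n'0 by (simp add: add_increasing)
 qed
 have sc: "(\<Sum>i\<in>C. w i * score N s AX e \<Delta> w i) = (\<Sum>i\<in>C. w i * ?a i) * n' + (\<Sum>i\<in>C. w i * ?b i) * n" for C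
  using s by (simp add: score_def n_def n'_def sum_distrib_left sum.distrib distrib_left mult_ac)
 have "nG * n' + bG * n <= n * n' + n' * n"
  using nn split n0 n'0 by (intro add_mono mult_right_mono) auto
 then show ?thesis
  unfolding sc nG_def[symmetric] nB_def[symmetric] bG_def[symmetric] bB_def[symmetric]
  using key mult_pos_pos[OF n0 n'0] by (simp add: mult.commute)
qed

end

context contaminated begin

lemma eD: "e * D <= real N * D / 100000" "0 < e * D"
 using e D mult_right_mono[OF e(2), of D] by auto

text \<open>\<open>1 - q\<close> is the vector of the remaining clean weights. Since q has small
  mass, sums with clean weights are full noise sums minus small corrections.\<close>

lemma clean_mass:
 assumes w: "\<And>i. i < N ==> 0 <= w i \<and> w i <= 1" and lost: "(\<Sum>i<N. 1 - w i) <= 140 * e"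
  and q: "\<And>i. q i = (if i \<in> B then 1 else 1 - w i)"
 shows "\<forall>i<N. 0 <= q i \<and> q i <= 1" "(\<Sum>i<N. q i) <= 145 * e"
proof -
 show "\<forall>i<N. 0 <= q i \<and> q i <= 1" using w by (auto simp: q)
 have "(\<Sum>i<N. q i) <= (\<Sum>i<N. (1 - w i) + (if i \<in> B then 1 else 0))"
  using w by (intro sum_mono) (auto simp: q)
 also have "\<dots> = (\<Sum>i<N. 1 - w i) + real (card B)"
  using B(1) by (simp add: sum.distrib sum.If_cases Int_absorb1)
 finally show "(\<Sum>i<N. q i) <= 145 * e" using lost B(2) e(1) by linarith
qed

text \<open>The mean enters only through m, the projection of the mean onto v, and the form is m^2 W
  + 2 m L + Q2. Minimizing over m leaves Q2 - L^2 / W: an unknown common mean cannot reduce the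
  second moment below the variance.\<close>

lemma low_lower_bound:
 assumes s: "s <= N" and w: "\<And>i. i < N ==> 0 <= w i \<and> w i <= 1" and lost: "(\<Sum>i<N. 1 - w i) <= 140 * e"
 shows "(real N - 12 * (eta * D)) * nsq v <= (\<Sum>i\<in>{..<N} - B. w i * (prj S X v i)\<^sup>2)"
proof -
 define q where "q = (\<lambda>i. if i \<in> B then 1 else 1 - w i)"
 have q: "\<And>i. i < N ==> 0 <= q i \<and> q i <= 1" "(\<Sum>i<N. q i) <= 145 * e"
  using clean_mass[of w q] w lost by (auto simp: q_def)
 define m where "m = (\<Sum>c\<in>S. v c * mu c)"
 define z where "z = prj S Z v"
 define n where "n = nsq v"
 have n0: "0 <= n" by (simp add: n_def sum_nonneg)
 define W L Q2 where "W = (\<Sum>i<N. 1 - q i)" and "L = (\<Sum>i<N. (1 - q i) * z i)"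
  and "Q2 = (\<Sum>i<N. (1 - q i) * (z i)\<^sup>2)"
 have "(\<Sum>i\<in>{..<N} - B. w i * (prj S X v i)\<^sup>2) = (\<Sum>i<N. (1 - q i) * (m + z i)\<^sup>2)"
  by (rule sum.mono_neutral_cong_left) (auto simp: q_def prj_clean m_def z_def)
 also have "\<dots> = m\<^sup>2 * W + 2 * m * L + Q2"
  by (simp add: W_def L_def Q2_def power2_sum distrib_left sum.distrib sum_distrib_left mult_ac)
 finally have eq: "(\<Sum>i\<in>{..<N} - B. w i * (prj S X v i)\<^sup>2) = m\<^sup>2 * W + 2 * m * L + Q2" .
 have W: "real N / 2 <= W" using q(2) e by (simp add: W_def sum_subtractf)
 have W0: "0 < W" using W N0 by simp
 have "0 <= (m * W + L)\<^sup>2 / W" using W0 by simp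
 also have "\<dots> = m\<^sup>2 * W + 2 * m * L + L\<^sup>2 / W" using W0 by (simp add: power2_sum field_simps power2_eq_square)
 finally have lower: "Q2 - L\<^sup>2 / W <= (\<Sum>i\<in>{..<N} - B. w i * (prj S X v i)\<^sup>2)" unfolding eq by simp
 have zq: "(\<Sum>i<N. q i * (z i)\<^sup>2) <= 2 * (eta * D) * n"
  unfolding z_def n_def by (rule low_few_weighted[OF s q])
 have "Q2 = (\<Sum>i<N. (z i)\<^sup>2) - (\<Sum>i<N. q i * (z i)\<^sup>2)"
  by (simp add: Q2_def left_diff_distrib sum_subtractf)
 moreover have "real N * n - eta * D * n <= (\<Sum>i<N. (z i)\<^sup>2)"
  using low_all[OF s, of v] unfolding z_def n_def by linarith
 ultimately have Q2: "real N * n - 3 * (eta * D * n) <= Q2" using zq by simp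
 define a b where "a = (\<Sum>i<N. z i)" and "b = (\<Sum>i<N. q i * z i)"
 have "a = (\<Sum>c\<in>S. v c * comb N Z (\<lambda>_. 1) c)" by (simp add: a_def z_def sum_comb_prj)
 then have "a\<^sup>2 <= n * nsq (comb N Z (\<lambda>_. 1))" unfolding n_def by (simp add: Cauchy_Schwarz_ineq_sum)
 also have "nsq (comb N Z (\<lambda>_. 1)) = quad {..<N} (gram S Z) (\<lambda>_. 1) (\<lambda>_. 1)"
  by (simp add: quad_gram power2_eq_square)
 also have "\<dots> <= real N * (2 * (eta * D))"
 proof -
  have "real s * real s <= real s * real N" using s by (intro mult_left_mono) auto
  then have "real s <= sqrt (real s * real N)" by (intro real_le_rsqrt) (simp add: power2_eq_square)
  then have "real s <= eta * D" using low_dim[OF s] by linarith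
  then have "real s * real N <= (eta * D) * real N" by (intro mult_right_mono) auto
  moreover have "eta * (e * D) <= eta * (real N * D / 100000)" using eD(1) by (intro mult_left_mono) auto
  moreover have "0 <= real N * D" using D by simp
  moreover have "quad {..<N} (gram S Z) (\<lambda>_. 1) (\<lambda>_. 1) <= real s * real N + eta * (e * D)"
   using total by linarith
  ultimately show ?thesis by (simp add: algebra_simps)
 qed
 finally have a: "a\<^sup>2 <= n * (real N * (2 * (eta * D)))" using n0 by (simp add: mult_left_mono)
 have "b\<^sup>2 <= (\<Sum>i<N. q i * 1\<^sup>2) * (\<Sum>i<N. q i * (z i)\<^sup>2)"
  using weighted_CS[of "{..<N}" q "\<lambda>_. 1" z] q(1) by (simp add: b_def)
 also have "\<dots> <= (145 * e) * (2 * (eta * D) * n)"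
  using q zq e by (intro mult_mono) (auto intro!: sum_nonneg)
 also have "\<dots> = 290 * eta * n * (e * D)" by simp
 also have "\<dots> <= 290 * eta * n * (real N * D / 100000)" using eD(1) n0 by (intro mult_left_mono) auto
 finally have b: "b\<^sup>2 <= 290 * eta * n * (real N * D / 100000)" .
 have "L = a - b" by (simp add: L_def a_def b_def left_diff_distrib sum_subtractf)
 then have "L\<^sup>2 <= 2 * a\<^sup>2 + 2 * b\<^sup>2"
  using zero_le_power2[of "a + b"] by (simp add: power2_sum power2_diff)
 also have "\<dots> <= 9 * (eta * D * n) * (real N / 2)"
 proof -
  have "0 <= n * (real N * D)" using n0 D by simp
  then show ?thesis using a b by (simp add: algebra_simps)
 qed
 also have "\<dots> <= 9 * (eta * D * n) * W"
  using W n0 D by (intro mult_mono) auto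
 finally have "L\<^sup>2 / W <= 9 * (eta * D * n)" using W0 by (simp add: divide_le_eq)
 then have "real N * n - 12 * (eta * D * n) <= (\<Sum>i\<in>{..<N} - B. w i * (prj S X v i)\<^sup>2)"
  using lower Q2 by linarith
 then show ?thesis by (simp add: n_def left_diff_distrib)
qed

text \<open>560 is 4 * 140, from mass 140 e times the excess 4 \<Delta> on corrupted rows. The
  second term is the contribution of the mean to clean vectors, whose mass is at most N /
  700.\<close>

definition Qb :: real where "Qb = 560 / 32000 * (e * D) + (real N)\<^sup>2 * nsq mu / 100000"

text \<open>For s > N the certificate applies directly. For s <= N the two vectors are separated by
  Cauchy-Schwarz. A vector on the corrupted rows is bounded by the certificate for all rows minus
  the lower bound for the clean ones, which cancels the N; a vector on clean rows is bounded by the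
  noise events.\<close>

lemma pair_bound:
 assumes w: "weighted_sym N AX w" and v: "\<not> violated N s AX \<Delta> w" and lost: "(\<Sum>i<N. 1 - w i) <= 140 * e"
  and a: "adm N w B (140 * e) a" and b: "adm N w B (140 * e) b"
 shows "\<bar>quad {..<N} AX a b\<bar> <= Qb"
proof -
 interpret weighted_sym N AX w by (rule w)
 have mu0: "0 <= (real N)\<^sup>2 * nsq mu" by (simp add: sum_nonneg)
 have D0: "0 <= \<Delta>" "0 < \<Delta>" using D by (auto simp: \<Delta>_def)
 show ?thesis
 proof (cases "s <= N")
  case False
  have "\<bar>quad {..<N} AX a b\<bar> <= 2 * \<Delta> * (140 * e)"
   by (rule high_cert[OF N0 _ v D0(1)]) (use False a b in \<open>auto simp: adm_def\<close>)
  then show ?thesis using mu0 eD(2) by (simp add: Qb_def \<Delta>_def mult.commute[of D])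
 next
  case True
  have sqN: "sqrt (real N) <= \<Delta>"
  proof -
   have "real N <= real s * real N" using S0 by (simp add: mult_le_cancel_right1)
   then have "sqrt (real N) <= eta * D" using low_dim[OF True] real_sqrt_le_mono order_trans by blast
   then show ?thesis using D by (simp add: \<Delta>_def)
  qed
  have cert: "(\<Sum>i<N. w i * (prj S X u i)\<^sup>2) <= (real N + 3 * \<Delta>) * nsq u" for u
   by (rule low_cert[OF _ N0 True v sqN]) (simp add: low_shift[OF True])
  have main: "nsq (comb N X a) <= Qb" if a: "adm N w B (140 * e) a" for a
   using a unfolding adm_def
  proof (elim conjE disjE)
   assume a1: "\<forall>i<N. 0 <= a i \<and> a i <= w i" "(\<Sum>i<N. a i) <= 140 * e" and supp: "\<forall>i<N. i \<notin> B --> a i = 0"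
   have "(\<Sum>i<N. a i * (prj S X u i)\<^sup>2) <= 4 * \<Delta> * nsq u" for u
   proof -
    have "(\<Sum>i<N. a i * (prj S X u i)\<^sup>2) = (\<Sum>i\<in>B. a i * (prj S X u i)\<^sup>2)"
     by (rule sum.mono_neutral_right) (use B supp in auto)
    also have "\<dots> <= (\<Sum>i\<in>B. w i * (prj S X u i)\<^sup>2)"
     using a1 B by (intro sum_mono mult_right_mono) auto
    also have "\<dots> = (\<Sum>i<N. w i * (prj S X u i)\<^sup>2) - (\<Sum>i\<in>{..<N} - B. w i * (prj S X u i)\<^sup>2)"
     by (subst sum.subset_diff[OF B(1), of "\<lambda>i. w i * (prj S X u i)\<^sup>2"]) auto
    also have "\<dots> <= (real N + 3 * \<Delta>) * nsq u - (real N - 12 * (eta * D)) * nsq u"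
     by (intro diff_mono cert low_lower_bound True lost) (use w0 w1 in auto)
    also have "\<dots> = (3 * \<Delta> + 12 * (eta * D)) * nsq u" by (simp add: algebra_simps)
    also have "\<dots> <= 4 * \<Delta> * nsq u"
     using D by (intro mult_right_mono) (auto simp: \<Delta>_def sum_nonneg)
    finally show ?thesis .
   qed
   then have "nsq (comb N X a) <= 140 * e * (4 * \<Delta>)"
    using a1 D0 by (intro comb_norm_le) auto
   then show ?thesis using mu0 by (simp add: Qb_def \<Delta>_def mult.commute[of D])
  next
   assume a1: "\<forall>i<N. 0 <= a i \<and> a i <= w i" "(\<Sum>i<N. a i) <= 140 * e" and supp: "\<forall>i<N. i \<in> B --> a i = 0"
   have a01: "0 <= a i \<and> a i <= 1" if "i < N" for i using a1(1) w1[OF that] that by (meson order_trans)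
   have a145: "(\<Sum>i<N. a i) <= 145 * e" using a1(2) e by linarith
   define t where "t = (\<Sum>i<N. a i)"
   have t: "0 <= t" "t <= 140 * e" using a1 by (auto simp: t_def intro: sum_nonneg)
   have ct: "comb N X a c = t * mu c + comb N Z a c" if "c \<in> S" for c
   proof -
    have "a i * X i c = a i * mu c + a i * Z i c" if "i < N" for i
     using supp clean[OF that _ \<open>c \<in> S\<close>] that by (cases "i \<in> B") (auto simp: distrib_left)
    then show ?thesis by (simp add: comb_def t_def sum.distrib sum_distrib_right)
   qed
   have "nsq (comb N X a) <= (\<Sum>c\<in>S. 2 * (t\<^sup>2 * (mu c)\<^sup>2) + 2 * (comb N Z a c)\<^sup>2)"
   proof (rule sum_mono)
    fix c assume "c \<in> S"
    show "(comb N X a c)\<^sup>2 <= 2 * (t\<^sup>2 * (mu c)\<^sup>2) + 2 * (comb N Z a c)\<^sup>2"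
     unfolding ct[OF \<open>c \<in> S\<close>] using zero_le_power2[of "t * mu c - comb N Z a c"]
     by (simp add: power2_sum power2_diff power_mult_distrib)
   qed
   also have "\<dots> = 2 * (t\<^sup>2 * nsq mu) + 2 * nsq (comb N Z a)"
    by (simp add: sum.distrib sum_distrib_left)
   also have "\<dots> <= 2 * ((real N / 700)\<^sup>2 * nsq mu) + 2 * (145 * e * (2 * (eta * D)))"
   proof (intro add_mono mult_left_mono mult_right_mono power_mono)
    show "nsq (comb N Z a) <= 145 * e * (2 * (eta * D))"
     by (rule comb_norm_le) (use a01 a145 low_few_weighted[OF True a01 a145] D in auto)
    show "t <= real N / 700" using t e by linarith
   qed (auto simp: t sum_nonneg)
   also have "\<dots> <= Qb" using mu0 eD(2) by (simp add: Qb_def power_divide algebra_simps)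
   finally show ?thesis .
  qed
  show ?thesis using quad_gram_bound[OF main[OF a] main[OF b]] by (simp add: low_shift[OF True])
 qed
qed

text \<open>Clipping makes the statistic comparable with the same form for the clean weights alone.
  There it is the squared mean times the square of the clean mass, a cross term, and the form of the
  noise; the last differs from its expectation only by terms with the small-mass vector q.\<close>

lemma statistic_bounds:
 assumes w: "weighted_sym N AX w" and v: "\<not> violated N s AX \<Delta> w"
  and lost: "(\<Sum>i<N. 1 - clip N AX \<tau> w i) <= 140 * e"
 defines "T \<equiv> quad {..<N} AX (clip N AX \<tau> w) (clip N AX \<tau> w) - (real s - shift_of N s) * real N"
 shows "mu = (\<lambda>_. 0) ==> T <= e * D / 4"
  "e * D <= 2 * ((real N)\<^sup>2 * nsq mu) ==> e * D / 4 < T"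
proof -
 interpret weighted_sym N AX w by (rule w)
 let ?w = "clip N AX \<tau> w"
 have w': "0 <= ?w i \<and> ?w i <= 1" "?w i <= w i" if "i < N" for i
  using w0[OF that] w1[OF that] by (auto simp: clip_def)
 have "(\<Sum>i<N. 1 - w i) <= (\<Sum>i<N. 1 - ?w i)" using w' by (intro sum_mono) auto
 then have lost': "(\<Sum>i<N. 1 - w i) <= 140 * e" using lost by linarith
 define g where "g = (\<lambda>i. if i \<in> B then 0 else ?w i)"
 have st: "\<bar>quad {..<N} AX ?w ?w - quad {..<N} AX g g\<bar> <= 2 * \<tau> * e + 5 * Qb"
  unfolding g_def
 proof (rule clip_stable[where \<kappa> = "140 * e"])
  show "\<bar>quad {..<N} AX a b\<bar> <= Qb" if "adm N w B (140 * e) a" "adm N w B (140 * e) b" for a b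
   by (rule pair_bound[OF w v lost' that])
 qed (use w0 w1 B e D lost in \<open>auto simp: \<tau>_def shifted_sym\<close>)
 define q where "q = (\<lambda>i. if i \<in> B then 1 else 1 - ?w i)"
 have q: "\<And>i. i < N ==> 0 <= q i \<and> q i <= 1" "(\<Sum>i<N. q i) <= 145 * e"
  using clean_mass[of ?w q] w'(1) lost by (auto simp: q_def)
 have gq: "g i = 1 - q i" for i by (simp add: g_def q_def)
 define \<Gamma> where "\<Gamma> = (\<Sum>i<N. g i)"
 have \<Gamma>: "99 / 100 * real N <= \<Gamma>" "\<Gamma> <= real N"
 proof -
  have "\<Gamma> = real N - (\<Sum>i<N. q i)" by (simp add: \<Gamma>_def gq sum_subtractf)
  moreover have "0 <= (\<Sum>i<N. q i)" using q(1) by (intro sum_nonneg) auto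
  ultimately show "99 / 100 * real N <= \<Gamma>" "\<Gamma> <= real N" using q(2) e by linarith+
 qed
 define M where "M = nsq mu"
 have M0: "0 <= M" by (simp add: M_def sum_nonneg)
 define L where "L = (\<Sum>c\<in>S. mu c * comb N Z g c)"
 have ct: "comb N X g c = \<Gamma> * mu c + comb N Z g c" if "c \<in> S" for c
 proof -
  have "g i * X i c = g i * mu c + g i * Z i c" if "i < N" for i
   using clean[OF that _ \<open>c \<in> S\<close>] by (cases "i \<in> B") (auto simp: g_def distrib_left)
  then show ?thesis by (simp add: comb_def \<Gamma>_def sum.distrib sum_distrib_right)
 qed
 have "quad {..<N} (gram S X) g g = (\<Sum>c\<in>S. (\<Gamma> * mu c + comb N Z g c)\<^sup>2)"
  by (simp add: quad_gram ct power2_eq_square)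
 also have "\<dots> = \<Gamma>\<^sup>2 * M + 2 * \<Gamma> * L + quad {..<N} (gram S Z) g g"
 proof -
  have "(\<Gamma> * x + y)\<^sup>2 = \<Gamma>\<^sup>2 * x\<^sup>2 + 2 * \<Gamma> * (x * y) + y * y" for x y
   by (simp add: power2_eq_square algebra_simps)
  then show ?thesis by (simp only: quad_gram sum.distrib sum_distrib_left[symmetric] M_def L_def)
 qed
 finally have gg: "quad {..<N} AX g g = \<Gamma>\<^sup>2 * M + 2 * \<Gamma> * L + quad {..<N} AZ g g"
  by (simp add: quad_shifted)
 have "quad {..<N} AZ g g = quad {..<N} AZ (\<lambda>i. 1 - q i) (\<lambda>i. 1 - q i)"
  by (rule quad_cong) (simp_all add: gq)
 also have "\<dots> = quad {..<N} AZ (\<lambda>_. 1) (\<lambda>_. 1) - 2 * quad {..<N} AZ (\<lambda>_. 1) q + quad {..<N} AZ q q"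
  using quad_sym[of "{..<N}" AZ q "\<lambda>_. 1"] shifted_sym by (simp add: quad_diff_left quad_diff_right)
 finally have zz: "quad {..<N} AZ g g = quad {..<N} AZ (\<lambda>_. 1) (\<lambda>_. 1) - 2 * quad {..<N} AZ (\<lambda>_. 1) q + quad {..<N} AZ q q" .
 have one: "\<bar>quad {..<N} AZ (\<lambda>_. 1) (\<lambda>_. 1) - (real s - shift_of N s) * real N\<bar> <= eta * (e * D)"
  using total by (simp add: quad_shifted algebra_simps)
 have "quad {..<N} AZ (\<lambda>_. 1) q = (\<Sum>i<N. q i * row N AZ (\<lambda>_. 1) i)" by (rule quad_row[OF shifted_sym])
 also have "\<bar>\<dots>\<bar> <= (\<Sum>i<N. q i * (eta * D))"
  proof (rule order_trans[OF sum_abs sum_mono])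
  fix i assume "i \<in> {..<N}"
  then show "\<bar>q i * row N AZ (\<lambda>_. 1) i\<bar> <= q i * (eta * D)"
   unfolding abs_mult using q(1)[of i] rows[of i] by (intro mult_mono) auto
 qed
 also have "\<dots> = (\<Sum>i<N. q i) * (eta * D)" by (simp only: sum_distrib_right)
 also have "\<dots> <= 145 * e * (eta * D)" using q(2) D by (intro mult_right_mono) auto
 finally have two: "\<bar>quad {..<N} AZ (\<lambda>_. 1) q\<bar> <= 145 * eta * (e * D)" by (simp add: mult.commute[of D])
 have three: "\<bar>quad {..<N} AZ q q\<bar> <= 290 * eta * (e * D)" by (rule clean_small) (use q in auto)
 have zz': "\<bar>quad {..<N} AZ g g - (real s - shift_of N s) * real N\<bar> <= 600 * eta * (e * D)"
  unfolding zz using one two three eD(2) by linarith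
 have "L = (\<Sum>i<N. g i * prj S Z mu i)" unfolding L_def by (rule sum_comb_prj)
 also have "\<dots> = (\<Sum>i<N. prj S Z mu i) - (\<Sum>i<N. q i * prj S Z mu i)"
  by (simp add: gq left_diff_distrib sum_subtractf)
 finally have L: "\<bar>L\<bar> <= \<bar>\<Sum>i<N. prj S Z mu i\<bar> + \<bar>\<Sum>i<N. q i * prj S Z mu i\<bar>" by simp
 have L1: "\<bar>\<Sum>i<N. prj S Z mu i\<bar> <= eta * real N * M" using mean_total by (simp add: prj_def M_def)
 have "\<bar>\<Sum>i<N. q i * prj S Z mu i\<bar> <= (\<Sum>i<N. q i * (eta * real N * M / e))"
 proof (rule order_trans[OF sum_abs sum_mono])
  fix i assume i: "i \<in> {..<N}"
  have "\<bar>prj S Z mu i\<bar> <= eta * real N * M / e"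
   using mean_rows[of i] i e by (simp add: prj_def M_def pos_le_divide_eq)
  then show "\<bar>q i * prj S Z mu i\<bar> <= q i * (eta * real N * M / e)"
   unfolding abs_mult using q(1)[of i] i by (intro mult_mono) auto
 qed
 also have "\<dots> = (\<Sum>i<N. q i) * (eta * real N * M / e)" by (simp only: sum_distrib_right)
 also have "\<dots> <= 145 * e * (eta * real N * M / e)"
  using q(2) M0 e by (intro mult_right_mono) auto
 also have "\<dots> = 145 * (eta * real N * M)" using e by simp
 finally have L': "\<bar>L\<bar> <= 146 * (eta * real N * M)" using L L1 by linarith
 have tau: "2 * \<tau> * e = e * D / 16" by (simp add: \<tau>_def)
 show "T <= e * D / 4" if mu: "mu = (\<lambda>_. 0)"
 proof -
  have "M = 0" by (simp add: M_def mu)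
  moreover have "L = 0" by (simp add: L_def mu)
  ultimately have "quad {..<N} AX g g = quad {..<N} AZ g g" "5 * Qb = 2800 / 32000 * (e * D)"
   by (simp_all add: gg Qb_def M_def[symmetric])
  then show ?thesis using st zz' eD(2) tau unfolding T_def by linarith
 qed
 show "e * D / 4 < T" if P: "e * D <= 2 * ((real N)\<^sup>2 * nsq mu)"
 proof -
  define K where "K = (real N)\<^sup>2 * M"
  have K: "e * D <= 2 * K" using P by (simp add: K_def M_def)
  have "(99 / 100 * real N)\<^sup>2 * M <= \<Gamma>\<^sup>2 * M" using \<Gamma> M0 by (intro mult_right_mono power_mono) auto
  moreover have "(99 / 100 * real N)\<^sup>2 * M = 9801 / 10000 * K" by (simp add: K_def power2_eq_square)
  moreover have "0 <= K" using M0 by (simp add: K_def)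
  ultimately have G1: "98 / 100 * K <= \<Gamma>\<^sup>2 * M" by linarith
  have "\<bar>\<Gamma> * L\<bar> <= real N * (146 * (eta * real N * M))"
   unfolding abs_mult using \<Gamma> L' M0 by (intro mult_mono) auto
  also have "\<dots> = 146 * eta * K" by (simp add: K_def power2_eq_square)
  finally have G2: "\<bar>\<Gamma> * L\<bar> <= 146 * eta * K" .
  have "0 < K" using K eD(2) by linarith
  moreover have "5 * Qb = 2800 / 32000 * (e * D) + K / 20000"
   by (simp add: Qb_def M_def[symmetric] K_def[symmetric])
  moreover have "2 * \<Gamma> * L = 2 * (\<Gamma> * L)" by simp
  ultimately show ?thesis using st zz' eD(2) G1 G2 K gg tau unfolding T_def by linarith
 qed
qed

text \<open>Of the mass 140 e allowed to be lost, the filter takes at most 129 e, and clipping takes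
  at most e on the corrupted rows and e for each sign of a large clean row sum.\<close>

lemma null_accept:
 assumes mu: "mu = (\<lambda>_. 0)"
 defines "w \<equiv> weights N s AX e \<Delta> N"
 shows "\<not> violated N s AX \<Delta> (weights N s AX e \<Delta> (N - 1))"
  "(\<Sum>i<N. 1 - clip N AX \<tau> w i) <= 140 * e"
  "quad {..<N} AX (clip N AX \<tau> w) (clip N AX \<tau> w) - (real s - shift_of N s) * real N <= e * D / 4"
proof -
 have step: "0 < (\<Sum>i\<in>B. w i * score N s AX e \<Delta> w i) \<and>
   (\<Sum>i\<in>{..<N} - B. w i * score N s AX e \<Delta> w i) <= 128 * (\<Sum>i\<in>B. w i * score N s AX e \<Delta> w i)"
  if "weighted_sym N AX w" "violated N s AX \<Delta> w" for w
  using low_null_step[OF _ mu that] high_null_step[OF _ mu that] by (cases "s <= N") auto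
 have "129 * real (card B) < real N" using B(2) e by linarith
 then have small: "(128 + 1) * real (card B) < real N" by simp
 note wn = weights_null[where N = N and A = AX and B = B and M = 128 and s = s and \<Delta> = \<Delta> and e = e,
   OF shifted_sym B(1) _ small step]
 show nv: "\<not> violated N s AX \<Delta> (weights N s AX e \<Delta> (N - 1))" by (rule wn(1)) auto
 have weq: "w = weights N s AX e \<Delta> (N - 1)"
  unfolding w_def by (rule weights_stable[OF nv]) simp
 have v: "\<not> violated N s AX \<Delta> w" using nv by (simp add: weq)
 have ws: "weighted_sym N AX w" unfolding w_def by (rule weights_sym) (rule shifted_sym)
 interpret weighted_sym N AX w by (rule ws)
 have "(\<Sum>i<N. 1 - w i) <= (128 + 1) * real (card B)" unfolding w_def by (rule wn(2)) auto
 then have "(\<Sum>i<N. 1 - w i) <= 129 * real (card B)" by simp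
 then have l1: "(\<Sum>i<N. 1 - w i) <= 129 * e" using B(2) by linarith
 then have l2: "(\<Sum>i<N. 1 - w i) <= 140 * e" using e by linarith
 let ?r = "row N AX w"
 define wB where "wB i = (if i \<in> B then w i else 0)" for i
 have sB: "(\<Sum>i<N. wB i) <= e"
 proof -
  have "(\<Sum>i<N. wB i) = (\<Sum>i\<in>B. w i)" unfolding wB_def using B(1) by (simp add: sum.If_cases Int_absorb1)
  also have "\<dots> <= (\<Sum>i\<in>B. 1)" using w1 B(1) by (intro sum_mono) auto
  finally show ?thesis using B(2) by simp
 qed
 have awB: "adm N w B (140 * e) wB" using sB e w0 by (auto simp: adm_def wB_def)
 define q where "q = (\<lambda>i. if i \<in> B then 1 else 1 - w i)"
 have q: "\<And>i. i < N ==> 0 <= q i \<and> q i <= 1" "(\<Sum>i<N. q i) <= 145 * e"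
  using clean_mass[of w q] w0 w1 l2 by (auto simp: q_def)
 \<comment> \<open>For a clean vector of mass e the pairing with all weights splits into a pairing
   with clean noise and one with the corrupted weights; both are small relative to
   \<open>\<tau> * e\<close>.\<close>
 have big: "\<not> (\<tau> * e < \<bar>quad {..<N} AX a w\<bar>)"
  if a: "\<And>i. i < N ==> 0 <= a i \<and> a i <= w i" "\<And>i. i \<in> B ==> a i = 0" and sa: "(\<Sum>i<N. a i) = e" for a
 proof -
  have aa: "adm N w B (140 * e) a" using a sa e by (auto simp: adm_def)
  have "quad {..<N} AX a w = quad {..<N} AX a (\<lambda>i. (if i \<in> B then 0 else w i) + wB i)"
   by (rule quad_cong) (auto simp: wB_def)
  also have "\<dots> = quad {..<N} AX a (\<lambda>i. if i \<in> B then 0 else w i) + quad {..<N} AX a wB"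
   by (rule quad_add_right)
  also have "quad {..<N} AX a (\<lambda>i. if i \<in> B then 0 else w i) = quad {..<N} AZ a (\<lambda>i. 1 - q i)"
   unfolding quad_def
  proof (intro sum.cong refl)
   fix i j assume "i \<in> {..<N}" "j \<in> {..<N}"
   then show "AX i j * a i * (if j \<in> B then 0 else w j) = AZ i j * a i * (1 - q j)"
    using gram_clean[OF mu, of i j] a(2)[of i] by (cases "i \<in> B \<or> j \<in> B") (auto simp: q_def)
  qed
  also have "\<dots> = quad {..<N} AZ (\<lambda>_. 1) a - quad {..<N} AZ a q"
   using quad_sym[of "{..<N}" AZ a "\<lambda>_. 1"] shifted_sym by (simp add: quad_diff_right)
  finally have eq: "quad {..<N} AX a w = quad {..<N} AZ (\<lambda>_. 1) a - quad {..<N} AZ a q + quad {..<N} AX a wB" .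
  have "quad {..<N} AZ (\<lambda>_. 1) a = (\<Sum>i<N. a i * row N AZ (\<lambda>_. 1) i)" by (rule quad_row[OF shifted_sym])
  also have "\<bar>\<dots>\<bar> <= (\<Sum>i<N. a i * (eta * D))"
   proof (rule order_trans[OF sum_abs sum_mono])
  fix i assume "i \<in> {..<N}"
  then show "\<bar>a i * row N AZ (\<lambda>_. 1) i\<bar> <= a i * (eta * D)"
   unfolding abs_mult using a(1)[of i] rows[of i] by (intro mult_mono) auto
 qed
  also have "\<dots> = e * (eta * D)" unfolding sa[symmetric] by (simp only: sum_distrib_right)
  finally have 1: "\<bar>quad {..<N} AZ (\<lambda>_. 1) a\<bar> <= eta * (e * D)" by simp
  have a1: "0 <= a i \<and> a i <= 1" if "i < N" for i using a(1)[OF that] w1[OF that] by (meson order_trans)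
  have 2: "\<bar>quad {..<N} AZ a q\<bar> <= 290 * eta * (e * D)"
   by (rule clean_small) (use a1 sa q e in auto)
  have 3: "\<bar>quad {..<N} AX a wB\<bar> <= Qb" by (rule pair_bound[OF ws v l2 aa awB])
  have "Qb = 560 / 32000 * (e * D)" unfolding Qb_def by (simp add: mu)
  moreover have "\<bar>quad {..<N} AX a w\<bar> <= eta * (e * D) + 290 * eta * (e * D) + Qb"
   unfolding eq using 1 2 3 by linarith
  ultimately have "\<bar>quad {..<N} AX a w\<bar> <= 1/32 * (e * D)" using eD(2) by linarith
  then show ?thesis by (simp add: \<tau>_def mult.commute[of D])
 qed
 \<comment> \<open>If more than mass e of clean rows were clipped with one sign, scaling that part
   of the weights down to mass exactly e would contradict \<open>big\<close>.\<close>
 have side: "(\<Sum>i<N. if i \<notin> B \<and> \<tau> < sg * ?r i then w i else 0) <= e" if sg: "sg = 1 \<or> sg = -1" for sg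
 proof (rule ccontr)
  define f where "f i = (if i \<notin> B \<and> \<tau> < sg * ?r i then w i else 0)" for i
  define F where "F = (\<Sum>i<N. f i)"
  assume "\<not> ?thesis"
  then have F: "e < F" by (simp add: F_def f_def)
  define th where "th = e / F"
  have th: "0 < th" "th <= 1" "th * F = e" using F e by (auto simp: th_def)
  define a where "a i = th * f i" for i
  have f: "0 <= f i" "f i <= w i" if "i < N" for i using w0[OF that] by (auto simp: f_def)
  have a1: "0 <= a i \<and> a i <= w i" if "i < N" for i
   using f[OF that] th mult_mono[of th 1 "f i" "w i"] by (auto simp: a_def)
  have a2: "a i = 0" if "i \<in> B" for i using that by (simp add: a_def f_def)
  have sa: "(\<Sum>i<N. a i) = e" using th by (simp add: a_def F_def sum_distrib_left)
  have "\<exists>i<N. 0 < a i"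
  proof (rule ccontr)
   assume "\<not> ?thesis"
   then have "(\<Sum>i<N. a i) <= 0" by (intro sum_nonpos) force
   then show False using sa e by simp
  qed
  then obtain k where k: "k < N" "0 < a k" by auto
  have le: "a i * \<tau> <= a i * (sg * ?r i)" if "i < N" for i
   using a1[OF that] by (cases "f i = 0") (auto simp: a_def f_def split: if_splits intro!: mult_left_mono)
  have "(\<Sum>i<N. a i * \<tau>) < (\<Sum>i<N. a i * (sg * ?r i))"
  proof (rule sum_strict_mono_ex1)
   have "\<tau> < sg * ?r k" using k by (auto simp: a_def f_def split: if_splits)
   then show "\<exists>i\<in>{..<N}. a i * \<tau> < a i * (sg * ?r i)"
    using k by (intro bexI[of _ k] mult_strict_left_mono) auto
  qed (use le in auto)
  also have "\<dots> = sg * quad {..<N} AX a w"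
  proof -
   have "quad {..<N} AX a w = quad {..<N} AX w a" by (rule quad_sym) (use shifted_sym in blast)
   also have "\<dots> = (\<Sum>j<N. a j * ?r j)" by (rule quad_row[OF shifted_sym])
   finally show ?thesis by (simp add: sum_distrib_left mult_ac)
  qed
  also have "\<dots> <= \<bar>quad {..<N} AX a w\<bar>" using sg by auto
  finally have "(\<Sum>i<N. a i * \<tau>) < \<bar>quad {..<N} AX a w\<bar>" .
  moreover have "(\<Sum>i<N. a i * \<tau>) = \<tau> * e"
   unfolding sa[symmetric] mult.commute[of \<tau>] by (rule sum_distrib_right[symmetric])
  ultimately have "\<tau> * e < \<bar>quad {..<N} AX a w\<bar>" by simp
  then show False using big[OF a1 a2 sa] by simp
 qed
 have "(\<Sum>i<N. 1 - clip N AX \<tau> w i) <= (\<Sum>i<N. (1 - w i) + (wB i + (if i \<notin> B \<and> \<tau> < 1 * ?r i then w i else 0)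
   + (if i \<notin> B \<and> \<tau> < (-1) * ?r i then w i else 0)))"
  using w0 by (intro sum_mono) (auto simp: clip_def wB_def)
 also have "\<dots> <= 129 * e + (e + e + e)"
  unfolding sum.distrib using l1 sB side[of 1] side[of "-1"] by (intro add_mono) auto
 finally show l3: "(\<Sum>i<N. 1 - clip N AX \<tau> w i) <= 140 * e" using e by linarith
 show "quad {..<N} AX (clip N AX \<tau> w) (clip N AX \<tau> w) - (real s - shift_of N s) * real N <= e * D / 4"
  by (rule statistic_bounds(1)[OF ws v l3 mu])
qed

text \<open>The two checks are premises, because data that fail one of them are rejected
  anyway.\<close>

lemma alt_reject:
 assumes P: "e * D <= 2 * ((real N)\<^sup>2 * nsq mu)"
 defines "w \<equiv> weights N s AX e \<Delta> N"
 assumes nv: "\<not> violated N s AX \<Delta> (weights N s AX e \<Delta> (N - 1))"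
  and lost: "(\<Sum>i<N. 1 - clip N AX \<tau> w i) <= 140 * e"
 shows "e * D / 4 < quad {..<N} AX (clip N AX \<tau> w) (clip N AX \<tau> w) - (real s - shift_of N s) * real N"
proof -
 have weq: "w = weights N s AX e \<Delta> (N - 1)"
  unfolding w_def by (rule weights_stable[OF nv]) simp
 have v: "\<not> violated N s AX \<Delta> w" using nv by (simp add: weq)
 have ws: "weighted_sym N AX w" unfolding w_def by (rule weights_sym) (rule shifted_sym)
 show ?thesis by (rule statistic_bounds(2)[OF ws v lost P])
qed

end

lemma inj_pairs: "inj_on (\<lambda>(r, c). (r, c)) A" "inj_on (\<lambda>(r, c). (c, r)) A"
 by (auto simp: inj_on_def)

section \<open>Probability of the noise events\<close>

locale sample =
 fixes N d :: nat and \<mu> :: "nat \<Rightarrow> real" and \<sigma> :: real and S :: "nat set"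
 assumes sig: "0 < \<sigma>" and Npos: "0 < N" and S: "S \<subseteq> {..<d}" "1 <= card S"
begin

abbreviation "M \<equiv> data_law N d \<mu> \<sigma>"
abbreviation "s \<equiv> card S"
abbreviation "noise x i j \<equiv> (x i j - \<mu> j) / \<sigma>"
abbreviation "nmu \<equiv> (\<Sum>j\<in>S. (\<mu> j / \<sigma>)\<^sup>2)"

lemma finS: "finite S" using S finite_subset by auto

lemma dpos: "0 < d"
proof -
 have "S \<noteq> {}" using S(2) by auto
 then show ?thesis using S(1) by (cases d) auto
qed

sublocale gauss_family M "\<lambda>p x. noise x (fst p) (snd p)" "{..<N} \<times> {..<d}"
 by (rule data_gauss_family[OF sig Npos dpos])

lemma tail_gram:
 assumes "0 <= t"
 shows "fails_le M (2 * exp (- t)) (\<lambda>x. \<bar>quad {..<N} (gram S (noise x)) u u - real s * (\<Sum>i<N. (u i)\<^sup>2)\<bar>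
  <= 8 * (sqrt (real s * t) + t) * (\<Sum>i<N. (u i)\<^sup>2))"
proof -
 have "fails_le M (2 * exp (- t)) (\<lambda>x. \<bar>(\<Sum>r\<in>S. (\<Sum>c<N. u c * noise x c r)\<^sup>2) - real s * (\<Sum>i<N. (u i)\<^sup>2)\<bar>
  <= 8 * (sqrt (real s * t) + t) * (\<Sum>i<N. (u i)\<^sup>2))"
  using chi_square_rows[of S "{..<N}" "\<lambda>r c. (c, r)" t u] finS S(1) assms inj_pairs(2) by auto
 then show ?thesis by (simp add: quad_gram comb_def power2_eq_square)
qed

text \<open>Polarization with each vector multiplied by the norm of the other. Both then have the
  same length, and two chi-square events suffice.\<close>

lemma tail_cross:
 assumes t: "0 <= t"
 shows "fails_le M (4 * exp (- t)) (\<lambda>x. \<bar>quad {..<N} (gram S (noise x)) a b - real s * (\<Sum>i<N. a i * b i)\<bar>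
  <= 16 * (sqrt (real s * t) + t) * (sqrt (\<Sum>i<N. (a i)\<^sup>2) * sqrt (\<Sum>i<N. (b i)\<^sup>2)))"
proof -
 define p q where "p = sqrt (\<Sum>i<N. (a i)\<^sup>2)" and "q = sqrt (\<Sum>i<N. (b i)\<^sup>2)"
 have pq: "0 <= p" "0 <= q" "p\<^sup>2 = (\<Sum>i<N. (a i)\<^sup>2)" "q\<^sup>2 = (\<Sum>i<N. (b i)\<^sup>2)"
  by (auto simp: p_def q_def sum_nonneg)
 show ?thesis
 proof (cases "p = 0 \<or> q = 0")
  case True
  then have "(\<forall>i<N. a i = 0) \<or> (\<forall>i<N. b i = 0)"
   using pq by (auto simp: sum_nonneg_eq_0_iff)
  then show ?thesis
   by (intro fails_le_True) (auto simp: quad_def sum_nonneg t intro!: mult_nonneg_nonneg)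
 next
  case False
  then have pq0: "0 < p" "0 < q" using pq by auto
  define K where "K = 8 * (sqrt (real s * t) + t)"
  have K0: "0 <= K" using t by (simp add: K_def)
  let ?u = "\<lambda>i. q * a i + p * b i" and ?v = "\<lambda>i. q * a i - p * b i"
  have sq: "(\<Sum>i<N. (?u i)\<^sup>2) = 2 * (p * q)\<^sup>2 + 2 * (p * q) * (\<Sum>i<N. a i * b i)"
   "(\<Sum>i<N. (?v i)\<^sup>2) = 2 * (p * q)\<^sup>2 - 2 * (p * q) * (\<Sum>i<N. a i * b i)"
  proof -
   have "(\<Sum>i<N. (q * a i)\<^sup>2) = (p * q)\<^sup>2" "(\<Sum>i<N. (p * b i)\<^sup>2) = (p * q)\<^sup>2"
    by (simp_all add: power_mult_distrib sum_distrib_left[symmetric] pq(3,4)[symmetric] mult.commute)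
   moreover have "(\<Sum>i<N. 2 * (q * a i) * (p * b i)) = 2 * (p * q) * (\<Sum>i<N. a i * b i)"
    by (simp add: sum_distrib_left mult_ac)
   ultimately show "(\<Sum>i<N. (?u i)\<^sup>2) = 2 * (p * q)\<^sup>2 + 2 * (p * q) * (\<Sum>i<N. a i * b i)"
    "(\<Sum>i<N. (?v i)\<^sup>2) = 2 * (p * q)\<^sup>2 - 2 * (p * q) * (\<Sum>i<N. a i * b i)"
    by (simp_all only: power2_sum power2_diff sum.distrib sum_subtractf)
  qed
  have "fails_le M (2 * exp (- t) + 2 * exp (- t)) (\<lambda>x.
   \<bar>quad {..<N} (gram S (noise x)) ?u ?u - real s * (\<Sum>i<N. (?u i)\<^sup>2)\<bar> <= K * (\<Sum>i<N. (?u i)\<^sup>2) \<and>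
   \<bar>quad {..<N} (gram S (noise x)) ?v ?v - real s * (\<Sum>i<N. (?v i)\<^sup>2)\<bar> <= K * (\<Sum>i<N. (?v i)\<^sup>2))"
   unfolding K_def by (intro fails_le_conj tail_gram t)
  then show ?thesis
  proof (rule fails_le_mono)
   fix x assume *: "\<bar>quad {..<N} (gram S (noise x)) ?u ?u - real s * (\<Sum>i<N. (?u i)\<^sup>2)\<bar> <= K * (\<Sum>i<N. (?u i)\<^sup>2) \<and>
    \<bar>quad {..<N} (gram S (noise x)) ?v ?v - real s * (\<Sum>i<N. (?v i)\<^sup>2)\<bar> <= K * (\<Sum>i<N. (?v i)\<^sup>2)"
   let ?Q = "quad {..<N} (gram S (noise x))"
   have "4 * ?Q (\<lambda>i. q * a i) (\<lambda>i. p * b i) = ?Q ?u ?u - ?Q ?v ?v"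
    by (rule quad_polarize) (simp add: gram_sym)
   moreover have "?Q (\<lambda>i. q * a i) (\<lambda>i. p * b i) = (p * q) * ?Q a b"
    by (simp add: quad_def sum_distrib_left mult_ac)
   ultimately have "4 * (p * q) * ?Q a b = ?Q ?u ?u - ?Q ?v ?v" by simp
   then have "4 * (p * q) * (?Q a b - real s * (\<Sum>i<N. a i * b i)) =
     (?Q ?u ?u - real s * (\<Sum>i<N. (?u i)\<^sup>2)) - (?Q ?v ?v - real s * (\<Sum>i<N. (?v i)\<^sup>2))"
    unfolding sq by (simp add: algebra_simps)
   then have "\<bar>4 * (p * q) * (?Q a b - real s * (\<Sum>i<N. a i * b i))\<bar> <= K * (\<Sum>i<N. (?u i)\<^sup>2) + K * (\<Sum>i<N. (?v i)\<^sup>2)"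
    using * by linarith
   also have "\<dots> = 4 * (p * q) * (K * (p * q))" unfolding sq by (simp add: algebra_simps power2_eq_square)
   finally have "4 * (p * q) * \<bar>?Q a b - real s * (\<Sum>i<N. a i * b i)\<bar> <= 4 * (p * q) * (K * (p * q))"
    using pq0 by (simp add: abs_mult)
   then have "\<bar>?Q a b - real s * (\<Sum>i<N. a i * b i)\<bar> <= K * (p * q)"
    using pq0 by (simp add: mult_le_cancel_left_pos)
   also have "\<dots> <= 2 * K * (p * q)" using K0 pq0 by simp
   finally show "\<bar>?Q a b - real s * (\<Sum>i<N. a i * b i)\<bar> <= 16 * (sqrt (real s * t) + t) * (sqrt (\<Sum>i<N. (a i)\<^sup>2) * sqrt (\<Sum>i<N. (b i)\<^sup>2))"
    by (simp add: K_def p_def q_def)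
  qed simp
 qed
qed

text \<open>The double sum is one normal variable: all pairs of indices form a single row of
  \<open>chi_square_rows\<close>. For t >= 1 the constants 1 + 8 * 2 add up to 17.\<close>

lemma tail_mean:
 assumes t: "1 <= t" and B: "B \<subseteq> {..<N}"
 shows "fails_le M (2 * exp (- t)) (\<lambda>x. (\<Sum>i\<in>B. \<Sum>c\<in>S. \<mu> c / \<sigma> * noise x i c)\<^sup>2 <= 17 * t * real (card B) * nmu)"
proof -
 have finB: "finite B" using B finite_subset by auto
 have inj: "inj_on (\<lambda>(r, c). c) ({()} \<times> (B \<times> S))" by (auto simp: inj_on_def)
 have "fails_le M (2 * exp (- t))
  (\<lambda>x. \<bar>(\<Sum>r\<in>{()}. (\<Sum>p\<in>B \<times> S. \<mu> (snd p) / \<sigma> * noise x (fst p) (snd p))\<^sup>2) - real (card {()}) * (\<Sum>p\<in>B \<times> S. (\<mu> (snd p) / \<sigma>)\<^sup>2)\<bar>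
    <= 8 * (sqrt (real (card {()}) * t) + t) * (\<Sum>p\<in>B \<times> S. (\<mu> (snd p) / \<sigma>)\<^sup>2))"
  using chi_square_rows[of "{()}" "B \<times> S" "\<lambda>r c. c" t "\<lambda>p. \<mu> (snd p) / \<sigma>"] inj finB finS S(1) B t by auto
 then show ?thesis
 proof (rule fails_le_mono)
  fix x assume *: "\<bar>(\<Sum>r\<in>{()}. (\<Sum>p\<in>B \<times> S. \<mu> (snd p) / \<sigma> * noise x (fst p) (snd p))\<^sup>2) - real (card {()}) * (\<Sum>p\<in>B \<times> S. (\<mu> (snd p) / \<sigma>)\<^sup>2)\<bar>
    <= 8 * (sqrt (real (card {()}) * t) + t) * (\<Sum>p\<in>B \<times> S. (\<mu> (snd p) / \<sigma>)\<^sup>2)"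
  define n where "n = real (card B) * nmu"
  have n0: "0 <= n" by (simp add: n_def sum_nonneg)
  have n: "(\<Sum>p\<in>B \<times> S. (\<mu> (snd p) / \<sigma>)\<^sup>2) = n"
   using sum.cartesian_product[of "\<lambda>i j. (\<mu> j / \<sigma>)\<^sup>2" S B] by (simp add: n_def case_prod_beta)
  have "(\<Sum>p\<in>B \<times> S. \<mu> (snd p) / \<sigma> * noise x (fst p) (snd p)) = (\<Sum>i\<in>B. \<Sum>c\<in>S. \<mu> c / \<sigma> * noise x i c)"
   using sum.cartesian_product[of "\<lambda>i c. \<mu> c / \<sigma> * noise x i c" S B] by (simp add: case_prod_beta)
  then have "(\<Sum>i\<in>B. \<Sum>c\<in>S. \<mu> c / \<sigma> * noise x i c)\<^sup>2 <= n + 8 * (sqrt t + t) * n"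
   using * unfolding n by simp
  also have "\<dots> <= t * n + 8 * (t + t) * n"
  proof -
   have "sqrt t <= t" using t by (simp add: real_le_lsqrt power2_eq_square)
   moreover have "n <= t * n" using mult_right_mono[OF t n0] by simp
   ultimately show ?thesis using n0 by (intro add_mono mult_right_mono mult_left_mono) auto
  qed
  finally show "(\<Sum>i\<in>B. \<Sum>c\<in>S. \<mu> c / \<sigma> * noise x i c)\<^sup>2 <= 17 * t * real (card B) * nmu"
   by (simp add: n_def)
 qed simp
qed

lemma tail_rows_uniform:
 assumes t: "7 * real s + t0 <= t" "0 <= t0" and B: "B \<subseteq> {..<N}"
 shows "fails_le M (2 * exp (- t0)) (\<lambda>x. \<forall>v. \<bar>(\<Sum>i\<in>B. (prj S (noise x) v i)\<^sup>2) - real (card B) * (\<Sum>c\<in>S. (v c)\<^sup>2)\<bar>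
  <= 32 * (sqrt (real (card B) * t) + t) * (\<Sum>c\<in>S. (v c)\<^sup>2))"
 using uniform_tail[of B S "\<lambda>r c. (r, c)" t0 t] finS S(1) B t inj_pairs(1) finite_subset[OF B]
 by (auto simp: prj_def)

lemma tail_cols_uniform:
 assumes t: "7 * real N + t0 <= t" "0 <= t0"
 shows "fails_le M (2 * exp (- t0)) (\<lambda>x. \<forall>y. \<bar>quad {..<N} (gram S (noise x)) y y - real s * (\<Sum>i<N. (y i)\<^sup>2)\<bar>
  <= 32 * (sqrt (real s * t) + t) * (\<Sum>i<N. (y i)\<^sup>2))"
proof -
 have "fails_le M (2 * exp (- t0)) (\<lambda>x. \<forall>y. \<bar>(\<Sum>r\<in>S. (\<Sum>c<N. y c * noise x c r)\<^sup>2) - real s * (\<Sum>i<N. (y i)\<^sup>2)\<bar>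
  <= 32 * (sqrt (real s * t) + t) * (\<Sum>i<N. (y i)\<^sup>2))"
  using uniform_tail[of S "{..<N}" "\<lambda>r c. (c, r)" t0 t] finS S(1) t inj_pairs(2) by auto
 then show ?thesis by (simp add: quad_gram comb_def power2_eq_square)
qed

lemma fails_small_subsets:
 assumes b: "0 < b" "b <= N" and t: "t0 + real b * (1 + ln (real N / real b)) <= t" and c: "0 <= c"
  and Q: "\<And>B. B \<subseteq> {..<N} ==> card B <= b ==> fails_le M (c * exp (- t)) (Q B)"
 shows "fails_le M (c * exp (- t0)) (\<lambda>x. \<forall>B. B \<subseteq> {..<N} --> card B <= b --> Q B x)"
proof -
 let ?F = "{B. B \<subseteq> {..<N} \<and> card B <= b}"
 have "fails_le M (\<Sum>B\<in>?F. c * exp (- t)) (\<lambda>x. \<forall>B\<in>?F. Q B x)"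
  by (rule fails_le_ball) (use Q in auto)
 then show ?thesis
 proof (rule fails_le_mono)
  have "(\<Sum>B\<in>?F. c * exp (- t)) = real (card ?F) * (c * exp (- t))" by simp
  also have "\<dots> <= exp (real b * (1 + ln (real N / real b))) * (c * exp (- t))"
   using c by (intro mult_right_mono card_small_subsets b) auto
  also have "\<dots> = c * exp (real b * (1 + ln (real N / real b)) - t)" by (simp add: exp_diff exp_minus field_simps)
  also have "\<dots> <= c * exp (- t0)" using t c by (intro mult_left_mono) auto
  finally show "(\<Sum>B\<in>?F. c * exp (- t)) <= c * exp (- t0)" .
 qed auto
qed

end

section \<open>Noise events for the filter\<close>

definition good_noise ::
 "nat \<Rightarrow> nat set \<Rightarrow> (nat \<Rightarrow> nat \<Rightarrow> real) \<Rightarrow> (nat \<Rightarrow> real) \<Rightarrow> real \<Rightarrow> real \<Rightarrow> bool" where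
 "good_noise N S Z mu e D \<longleftrightarrow>
  \<bar>quad {..<N} (gram S Z) (\<lambda>_. 1) (\<lambda>_. 1) - real (card S) * real N\<bar> <= eta * (e * D) \<and>
  (\<forall>i<N. \<bar>row N (shifted N (card S) (gram S Z)) (\<lambda>_. 1) i\<bar> <= eta * D) \<and>
  (card S <= N --> (\<forall>v.
   \<bar>(\<Sum>i<N. (prj S Z v i)\<^sup>2) - real N * (\<Sum>c\<in>S. (v c)\<^sup>2)\<bar> <= eta * D * (\<Sum>c\<in>S. (v c)\<^sup>2))) \<and>
  (card S <= N --> (\<forall>C. C \<subseteq> {..<N} --> real (card C) <= 150 * e -->
   (\<forall>v. (\<Sum>i\<in>C. (prj S Z v i)\<^sup>2) <= eta * D * (\<Sum>c\<in>S. (v c)\<^sup>2)))) \<and>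
  (N < card S --> (\<forall>y.
   \<bar>quad {..<N} (shifted N (card S) (gram S Z)) y y\<bar> <= eta * D * (\<Sum>i<N. (y i)\<^sup>2))) \<and>
  \<bar>\<Sum>i<N. \<Sum>c\<in>S. mu c * Z i c\<bar> <= eta * real N * (\<Sum>c\<in>S. (mu c)\<^sup>2) \<and>
  (\<forall>i<N. \<bar>\<Sum>c\<in>S. mu c * Z i c\<bar> * e <= eta * real N * (\<Sum>c\<in>S. (mu c)\<^sup>2))"

lemma sqrt_mult_le_add: "0 <= x ==> 0 <= y ==> sqrt (x * y) <= x + (y :: real)"
 by (rule real_le_lsqrt) (auto simp: power2_eq_square algebra_simps)

lemma row_unit: "i < N ==> row N A w i = quad {..<N} A (\<lambda>j. if j = i then 1 else 0) w"
 by (simp add: row_def quad_def if_distrib if_distribR sum.delta cong: if_cong) (simp add: sum.swap[of _ "{..<N}"] sum.delta)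

lemma sqrt_bound:
 fixes a b c :: real
 assumes "0 <= a" "0 <= c" "0 <= b" "a <= c\<^sup>2 * b"
 shows "sqrt a <= c * sqrt b"
proof -
 have "sqrt a <= sqrt (c\<^sup>2 * b)" using assms by simp
 then show ?thesis using assms by (simp add: real_sqrt_mult)
qed

context sample begin

text \<open>Seven tail bounds; the coefficient 16 is 2 + 4 + 5 * 2. Statements about each of the N
  rows use the exponent t0 + ln N, those about small sets add the logarithm of the number of such
  sets, and those about all vectors use nets in the smaller of the two dimensions. The large
  constant must beat \<open>eta\<close>, and in the two bounds on the mean even its square, since
  there a variance is compared with a squared bound.\<close>

lemma noise_event:
 fixes e D t0 L :: real
 assumes t0: "1 <= t0" and L: "1/2 <= L" "ln (real N) <= L"
  and e: "1 <= e" "100000 * e <= real N" and D: "0 < D"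
  and H1: "100000000000000000000 * t0 * (sqrt (real s) * real N) <= e * D"
  and H2: "100000000000000000000 * t0 * sqrt (real s * real N * L) <= D"
  and H3: "100000000000000000000 * t0 * (sqrt (real N) * L) <= D"
  and H4: "100000000000000000000 * t0 * (e * L) <= D"
  and mu: "(\<forall>c\<in>S. \<mu> c = 0) \<or> e * D <= 2 * ((real N)\<^sup>2 * nmu)"
 shows "fails_le M (16 * exp (- t0)) (\<lambda>x. good_noise N S (noise x) (\<lambda>c. \<mu> c / \<sigma>) e D)"
  "s <= N ==> sqrt (real s * real N) <= eta * D"
proof -
 define R where "R = sqrt (real s * real N)"
 have N1: "1 <= real N" using Npos by simp
 have s1: "1 <= real s" using S(2) by simp
 have R0: "0 <= R" by (simp add: R_def)
 have L0: "0 <= L" using L by simp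
 have "R <= 2 * sqrt (real s * real N * L)"
  unfolding R_def
 proof (rule sqrt_bound)
  have "1 * (real s * real N) <= (4 * L) * (real s * real N)" using L by (intro mult_right_mono) auto
  then show "real s * real N <= 2\<^sup>2 * (real s * real N * L)" by (simp add: mult_ac)
 qed (use L0 in auto)
 then have "t0 * R <= t0 * (2 * sqrt (real s * real N * L))" using t0 by (intro mult_left_mono) auto
 then have HR: "5 * 10000000000000000000 * (t0 * R) <= D" using H2 by simp
 have R1: "R <= t0 * R" using mult_right_mono[OF t0 R0] by simp
 show low_dim: "sqrt (real s * real N) <= eta * D" if "s <= N"
  using HR R1 R0 unfolding R_def[symmetric] by simp
 have lnN: "0 <= ln (real N)" using N1 by simp
 define t where "t = t0 + ln (real N)"
 have t: "1 <= t" "t <= 3 * t0 * L"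
 proof -
  have "t0 * (1/2) <= t0 * L" "1 * L <= t0 * L" using t0 L L0 by (intro mult_left_mono mult_right_mono; simp)+
  then have "t0 + ln (real N) <= 3 * (t0 * L)" using L(2) by linarith
  then show "1 <= t" "t <= 3 * t0 * L" using t0 lnN by (simp_all add: t_def)
 qed
 have expt: "real N * exp (- t) = exp (- t0)"
  using N1 by (simp add: t_def exp_diff exp_minus exp_add)
 have sN: "real s <= R" if "s <= N"
 proof -
  have "real s * real s <= real s * real N" using that by (intro mult_left_mono) auto
  then show ?thesis unfolding R_def by (intro real_le_rsqrt) (simp add: power2_eq_square)
 qed
 have NR: "real N <= R" if "N < s"
 proof -
  have "real N * real N <= real s * real N" using that by (intro mult_right_mono) auto
  then show ?thesis unfolding R_def by (intro real_le_rsqrt) (simp add: power2_eq_square)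
 qed
 let ?Q = "\<lambda>x. quad {..<N} (gram S (noise x))"
 have total: "fails_le M (2 * exp (- t0)) (\<lambda>x. \<bar>?Q x (\<lambda>_. 1) (\<lambda>_. 1) - real s * real N\<bar> <= eta * (e * D))"
 proof (rule fails_le_mono[OF tail_gram[of t0 "\<lambda>_. 1"]])
  fix x assume "\<bar>?Q x (\<lambda>_. 1) (\<lambda>_. 1) - real s * (\<Sum>i<N. 1\<^sup>2)\<bar> <= 8 * (sqrt (real s * t0) + t0) * (\<Sum>i<N. 1\<^sup>2)"
  then have "\<bar>?Q x (\<lambda>_. 1) (\<lambda>_. 1) - real s * real N\<bar> <= 8 * (sqrt (real s * t0) + t0) * real N" by simp
  also have "\<dots> <= 8 * (t0 * sqrt (real s) + t0 * sqrt (real s)) * real N"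
  proof (intro mult_right_mono mult_left_mono add_mono)
   show "sqrt (real s * t0) <= t0 * sqrt (real s)"
    by (rule sqrt_bound) (use t0 in \<open>auto simp: power2_eq_square mult.commute mult_right_mono\<close>)
   have "1 <= sqrt (real s)" using s1 by simp
   then show "t0 <= t0 * sqrt (real s)" using t0 by simp
  qed auto
  also have "\<dots> = 16 * (t0 * (sqrt (real s) * real N))" by simp
  also have "\<dots> <= eta * (e * D)"
  proof -
   have "0 <= t0 * (sqrt (real s) * real N)" using t0 by simp
   then show ?thesis using H1 by simp
  qed
  finally show "\<bar>?Q x (\<lambda>_. 1) (\<lambda>_. 1) - real s * real N\<bar> <= eta * (e * D)" .
 qed (use t0 in auto)
 have rowb: "\<bar>row N (shifted N s (gram S (noise x))) (\<lambda>_. 1) i\<bar> <= eta * D"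
  if i: "i < N" and *: "\<bar>?Q x (\<lambda>j. if j = i then 1 else 0) (\<lambda>_. 1) - real s * (\<Sum>j<N. (if j = i then 1 else 0) * 1)\<bar>
   <= 16 * (sqrt (real s * t) + t) * (sqrt (\<Sum>j<N. (if j = i then 1 else 0)\<^sup>2) * sqrt (\<Sum>j<N. 1\<^sup>2))" for i x
 proof -
  let ?q = "?Q x (\<lambda>j. if j = i then 1 else 0) (\<lambda>_. 1)"
  have d: "(\<Sum>j<N. (if j = i then 1 else 0 :: real)) = 1" "(\<Sum>j<N. (if j = i then 1 else 0 :: real)\<^sup>2) = 1"
   using i by (simp_all add: if_distrib[of "\<lambda>x. x\<^sup>2"] cong: if_cong)
  have q: "\<bar>?q - real s\<bar> <= 16 * (sqrt (real s * t) + t) * sqrt (real N)"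
   using * by (simp add: d)
  have "sqrt (real s * t) <= 2 * t0 * sqrt (real s * L)"
  proof (rule sqrt_bound)
   have "t <= 3 * t0 * L" by (rule t)
   also have "\<dots> <= 4 * t0 * (t0 * L)" using t0 L0 mult_right_mono[of 1 t0 "t0 * L"] by simp
   finally have "real s * t <= real s * (4 * t0 * (t0 * L))" by (intro mult_left_mono) auto
   then show "real s * t <= (2 * t0)\<^sup>2 * (real s * L)" by (simp add: power2_eq_square mult_ac)
  qed (use t0 t L0 in auto)
  then have "16 * (sqrt (real s * t) + t) * sqrt (real N) <= 16 * (2 * t0 * sqrt (real s * L) + 3 * t0 * L) * sqrt (real N)"
   using t by (intro mult_right_mono mult_left_mono add_mono) auto
  also have "\<dots> = 32 * (t0 * sqrt (real s * real N * L)) + 48 * (t0 * (sqrt (real N) * L))"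
   by (simp add: real_sqrt_mult algebra_simps)
  finally have 1: "\<bar>?q - real s\<bar> <= 32 * (t0 * sqrt (real s * real N * L)) + 48 * (t0 * (sqrt (real N) * L))"
   using q by simp
  have "(\<Sum>j<N. (if j = i then 1 else 0) * 1) = (1 :: real)" using d by simp
  then have "row N (shifted N s (gram S (noise x))) (\<lambda>_. 1) i = ?q - shift_of N s"
   unfolding row_unit[OF i] quad_shifted by simp
  moreover have "\<bar>?q - shift_of N s\<bar> <= \<bar>?q - real s\<bar> + t0 * R"
   using sN R1 R0 by (cases "s <= N") (auto simp: shift_of_def)
  ultimately have "\<bar>row N (shifted N s (gram S (noise x))) (\<lambda>_. 1) i\<bar> <=
    32 * (t0 * sqrt (real s * real N * L)) + 48 * (t0 * (sqrt (real N) * L)) + t0 * R"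
   using 1 by linarith
  moreover have "0 <= t0 * sqrt (real s * real N * L)" "0 <= t0 * (sqrt (real N) * L)" using t0 L0 by auto
  ultimately show ?thesis using H2 H3 HR D by simp
 qed
 have rows: "fails_le M (4 * exp (- t0)) (\<lambda>x. \<forall>i\<in>{..<N}. \<bar>row N (shifted N s (gram S (noise x))) (\<lambda>_. 1) i\<bar> <= eta * D)"
 proof -
  have "fails_le M (\<Sum>i<N. 4 * exp (- t)) (\<lambda>x. \<forall>i\<in>{..<N}. \<bar>row N (shifted N s (gram S (noise x))) (\<lambda>_. 1) i\<bar> <= eta * D)"
  proof (rule fails_le_ball)
   fix i assume "i \<in> {..<N}"
   then have i: "i < N" by simp
   show "fails_le M (4 * exp (- t)) (\<lambda>x. \<bar>row N (shifted N s (gram S (noise x))) (\<lambda>_. 1) i\<bar> <= eta * D)"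
    by (rule fails_le_mono[OF tail_cross[of t "\<lambda>j. if j = i then 1 else 0" "\<lambda>_. 1"]]) (use t rowb[OF i] in auto)
  qed simp
  moreover have "(\<Sum>i<N. 4 * exp (- t)) = 4 * exp (- t0)" using expt by simp
  ultimately show ?thesis by (simp only:)
 qed
 have unif: "32 * (sqrt (real a * (7 * real b + t0)) + (7 * real b + t0)) <= eta * D"
  if "real b <= R" "real a * real b = real s * real N" "1 <= b" for a b :: nat
 proof -
  have b: "7 * real b + t0 <= 8 * t0 * real b"
  proof -
   have "7 * real b <= 7 * (t0 * real b)" using t0 mult_right_mono[OF t0, of "real b"] by simp
   moreover have "t0 * 1 <= t0 * real b" using t0 that(3) by (intro mult_left_mono) auto
   ultimately show ?thesis by simp
  qed
  have "sqrt (real a * (7 * real b + t0)) <= 3 * t0 * R"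
   unfolding R_def
  proof (rule sqrt_bound)
   have "real a * (7 * real b + t0) <= real a * (8 * t0 * real b)" using b by (intro mult_left_mono) auto
   also have "\<dots> = 8 * t0 * (real s * real N)" using that(2) by (simp add: mult_ac)
   also have "\<dots> <= 9 * t0 * t0 * (real s * real N)"
    using t0 mult_right_mono[OF t0, of t0] by (intro mult_right_mono) auto
   finally show "real a * (7 * real b + t0) <= (3 * t0)\<^sup>2 * (real s * real N)" by (simp add: power2_eq_square)
  qed (use t0 in auto)
  moreover have "8 * t0 * real b <= 8 * (t0 * R)" using that(1) t0 mult_left_mono[of "real b" R t0] by simp
  ultimately have "32 * (sqrt (real a * (7 * real b + t0)) + (7 * real b + t0)) <= 352 * (t0 * R)"
   using b by simp
  also have "352 * (t0 * R) <= eta * D"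
  proof -
   have "0 <= t0 * R" using t0 R0 by simp
   then show ?thesis using HR by linarith
  qed
  finally show ?thesis .
 qed
 have low_all: "fails_le M (2 * exp (- t0)) (\<lambda>x. s <= N --> (\<forall>v.
   \<bar>(\<Sum>i<N. (prj S (noise x) v i)\<^sup>2) - real N * (\<Sum>c\<in>S. (v c)\<^sup>2)\<bar> <= eta * D * (\<Sum>c\<in>S. (v c)\<^sup>2)))"
 proof (cases "s <= N")
  case True
  have "32 * (sqrt (real N * (7 * real s + t0)) + (7 * real s + t0)) <= eta * D"
   by (rule unif) (use sN[OF True] S(2) in auto)
  then show ?thesis
  proof (intro fails_le_mono[OF tail_rows_uniform[of t0 "7 * real s + t0" "{..<N}"]] impI allI)
   fix x v
   let ?n = "\<Sum>c\<in>S. (v c)\<^sup>2" and ?P = "\<Sum>i<N. (prj S (noise x) v i)\<^sup>2"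
    and ?B = "32 * (sqrt (real N * (7 * real s + t0)) + (7 * real s + t0))"
   assume B: "?B <= eta * D" and
    "\<forall>v. \<bar>(\<Sum>i<N. (prj S (noise x) v i)\<^sup>2) - real (card {..<N}) * (\<Sum>c\<in>S. (v c)\<^sup>2)\<bar>
     <= 32 * (sqrt (real (card {..<N}) * (7 * real s + t0)) + (7 * real s + t0)) * (\<Sum>c\<in>S. (v c)\<^sup>2)"
   then have "\<bar>?P - real N * ?n\<bar> <= ?B * ?n" unfolding card_lessThan by blast
   also have "\<dots> <= eta * D * ?n" using B by (intro mult_right_mono) (auto simp: sum_nonneg)
   finally show "\<bar>?P - real N * ?n\<bar> <= eta * D * ?n" .
  qed (use t0 in auto)
 qed (auto intro: fails_le_True)
 have high_all: "fails_le M (2 * exp (- t0)) (\<lambda>x. N < s --> (\<forall>y.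
   \<bar>quad {..<N} (shifted N s (gram S (noise x))) y y\<bar> <= eta * D * (\<Sum>i<N. (y i)\<^sup>2)))"
 proof (cases "N < s")
  case True
  have "32 * (sqrt (real s * (7 * real N + t0)) + (7 * real N + t0)) <= eta * D"
   by (rule unif) (use NR[OF True] Npos in auto)
  then show ?thesis
  proof (intro fails_le_mono[OF tail_cols_uniform[of t0 "7 * real N + t0"]] impI allI)
   fix x and y :: "nat \<Rightarrow> real"
   let ?n = "\<Sum>i<N. (y i)\<^sup>2"
    and ?B = "32 * (sqrt (real s * (7 * real N + t0)) + (7 * real N + t0))"
   assume B: "?B <= eta * D" and
    "\<forall>y. \<bar>?Q x y y - real s * (\<Sum>i<N. (y i)\<^sup>2)\<bar> <= ?B * (\<Sum>i<N. (y i)\<^sup>2)"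
   then have "\<bar>?Q x y y - real s * ?n\<bar> <= ?B * ?n" by blast
   also have "\<dots> <= eta * D * ?n" using B by (intro mult_right_mono) (auto simp: sum_nonneg)
   finally show "\<bar>quad {..<N} (shifted N s (gram S (noise x))) y y\<bar> <= eta * D * ?n"
    using True by (simp add: quad_shifted shift_of_def power2_eq_square)
  qed (use t0 in auto)
 qed (auto intro: fails_le_True)
 have low_few: "fails_le M (2 * exp (- t0)) (\<lambda>x. s <= N --> (\<forall>C. C \<subseteq> {..<N} --> real (card C) <= 150 * e -->
   (\<forall>v. (\<Sum>i\<in>C. (prj S (noise x) v i)\<^sup>2) <= eta * D * (\<Sum>c\<in>S. (v c)\<^sup>2))))"
 proof (cases "s <= N")
  case True
  define b where "b = nat \<lfloor>150 * e\<rfloor>"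
  have b: "real b <= 150 * e" "0 < b" "b <= N" and bmax: "\<And>c. real c <= 150 * e ==> c <= b"
   using e by (auto simp: b_def le_nat_floor) linarith+
  define tt where "tt = t0 + real b * (1 + L)"
  have lnb: "ln (real N / real b) <= L"
  proof -
   have "real N / real b <= real N" using b N1 by (simp add: divide_le_eq mult_le_cancel_left1)
   then have "ln (real N / real b) <= ln (real N)" using b N1 by (intro ln_mono) auto
   then show ?thesis using L by simp
  qed
  have "fails_le M (2 * exp (- t0)) (\<lambda>x. \<forall>C. C \<subseteq> {..<N} --> card C <= b -->
   (\<forall>v. (\<Sum>i\<in>C. (prj S (noise x) v i)\<^sup>2) <= eta * D * (\<Sum>c\<in>S. (v c)\<^sup>2)))"
  proof (rule fails_small_subsets[OF b(2,3)])
   show "t0 + real b * (1 + ln (real N / real b)) <= tt"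
    using lnb by (auto simp: tt_def intro!: mult_left_mono)
   fix C assume C: "C \<subseteq> {..<N}" "card C <= b"
   have tt0: "0 <= tt" using t0 L0 by (simp add: tt_def)
   have arith: "c + 32 * (x + (7 * y + u)) <= 40000 * p + 600 * q"
    if "x <= c + (7 * y + u)" "c <= 150 * z" "u <= a + 450 * p" "z <= 2 * p" "y <= q" "a <= q" "0 <= p" "0 <= q"
    for x c y u z a p q :: real
    using that by argo
   have "real (card C) + 32 * (sqrt (real (card C) * (7 * real s + tt)) + (7 * real s + tt)) <= eta * D"
   proof -
    have "sqrt (real (card C) * (7 * real s + tt)) <= real (card C) + (7 * real s + tt)"
     using tt0 by (intro sqrt_mult_le_add) auto
    moreover have "real (card C) <= 150 * e" using C(2) b by linarith
    moreover have "tt <= t0 + 450 * (e * L)"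
    proof -
     have "real b * (1 + L) <= (150 * e) * (3 * L)" using b L e by (intro mult_mono) auto
     then show ?thesis by (simp add: tt_def)
    qed
    moreover have "e <= 2 * (e * L)" using mult_left_mono[OF L(1), of e] e by simp
    moreover have "real s <= t0 * R" using sN[OF True] R1 by linarith
    moreover have "t0 <= t0 * R" using sN[OF True] s1 t0 by simp
    moreover have eL: "0 <= e * L" and tR: "0 <= t0 * R" using e L0 t0 R0 by simp_all
    ultimately have "real (card C) + 32 * (sqrt (real (card C) * (7 * real s + tt)) + (7 * real s + tt))
      <= 40000 * (e * L) + 600 * (t0 * R)"
     using arith[of "sqrt (real (card C) * (7 * real s + tt))" "real (card C)" "real s" tt e t0 "e * L" "t0 * R"] by blast
    moreover have "e * L <= t0 * (e * L)" using mult_right_mono[OF t0, of "e * L"] e L0 by simp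
    ultimately show ?thesis using HR H4 eL tR by linarith
   qed
   then show "fails_le M (2 * exp (- tt)) (\<lambda>x. \<forall>v. (\<Sum>i\<in>C. (prj S (noise x) v i)\<^sup>2) <= eta * D * (\<Sum>c\<in>S. (v c)\<^sup>2))"
   proof (intro fails_le_mono[OF tail_rows_uniform[of tt "7 * real s + tt" C]] allI)
    fix x v
    let ?n = "\<Sum>c\<in>S. (v c)\<^sup>2" and ?P = "\<Sum>i\<in>C. (prj S (noise x) v i)\<^sup>2" and ?k = "real (card C)"
     and ?B = "32 * (sqrt (real (card C) * (7 * real s + tt)) + (7 * real s + tt))"
    assume a: "?k + ?B <= eta * D" and "\<forall>v. \<bar>(\<Sum>i\<in>C. (prj S (noise x) v i)\<^sup>2) - ?k * (\<Sum>c\<in>S. (v c)\<^sup>2)\<bar> <= ?B * (\<Sum>c\<in>S. (v c)\<^sup>2)"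
    then have "\<bar>?P - ?k * ?n\<bar> <= ?B * ?n" by blast
    then have "?P <= (?k + ?B) * ?n" unfolding distrib_right by linarith
    also have "\<dots> <= eta * D * ?n" using a by (intro mult_right_mono) (auto simp: sum_nonneg)
    finally show "?P <= eta * D * ?n" .
   qed (use tt0 C in auto)
  qed simp
  then show ?thesis by (rule fails_le_mono) (use bmax in auto)
 qed (auto intro: fails_le_True)
 let ?m = "\<lambda>x B. \<Sum>i\<in>B. \<Sum>c\<in>S. \<mu> c / \<sigma> * noise x i c"
 have nmu: "100000000000000000000 * t0 * real N <= 2 * ((real N)\<^sup>2 * nmu)" "100000000000000000000 * t0 * (e * e * L) <= 2 * ((real N)\<^sup>2 * nmu)"
  if nz: "e * D <= 2 * ((real N)\<^sup>2 * nmu)"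
 proof -
  have "1 * real N <= sqrt (real s) * real N" using s1 by (intro mult_right_mono) auto
  then have "real N <= sqrt (real s) * real N" by simp
  then have "100000000000000000000 * t0 * real N <= 100000000000000000000 * t0 * (sqrt (real s) * real N)" using t0 by (intro mult_left_mono) auto
  then show "100000000000000000000 * t0 * real N <= 2 * ((real N)\<^sup>2 * nmu)" using H1 nz by linarith
  have "e * (100000000000000000000 * t0 * (e * L)) <= e * D" using H4 e by (intro mult_left_mono) auto
  then show "100000000000000000000 * t0 * (e * e * L) <= 2 * ((real N)\<^sup>2 * nmu)" using nz by (simp add: mult_ac)
 qed
 have eta2: "eta\<^sup>2 = 1 / 10000000000000000" by (simp add: power2_eq_square)
 have eN: "0 <= eta * real N * nmu" by (intro mult_nonneg_nonneg sum_nonneg) auto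
 have mean_total: "fails_le M (2 * exp (- t0)) (\<lambda>x. \<bar>?m x {..<N}\<bar> <= eta * real N * nmu)"
  using mu
 proof
  assume "\<forall>c\<in>S. \<mu> c = 0"
  then show ?thesis using eN by (intro fails_le_True) auto
 next
  assume nz: "e * D <= 2 * ((real N)\<^sup>2 * nmu)"
  show ?thesis
  proof (rule fails_le_mono[OF tail_mean[OF t0, of "{..<N}"]])
   fix x assume "(?m x {..<N})\<^sup>2 <= 17 * t0 * real (card {..<N}) * nmu"
   then have "(?m x {..<N})\<^sup>2 <= (17 * t0 * real N) * nmu" unfolding card_lessThan .
   also have "\<dots> <= (eta\<^sup>2 * ((real N)\<^sup>2 * nmu)) * nmu"
   proof (rule mult_right_mono)
    have "0 <= t0 * real N" using t0 by simp
    then show "17 * t0 * real N <= eta\<^sup>2 * ((real N)\<^sup>2 * nmu)"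
     unfolding eta2 using nmu(1)[OF nz] by linarith
   qed (rule sum_nonneg, simp)
   also have "\<dots> = (eta * real N * nmu)\<^sup>2" by (simp only: power2_eq_square mult_ac)
   finally have "\<bar>?m x {..<N}\<bar>\<^sup>2 <= (eta * real N * nmu)\<^sup>2" by (simp only: power2_abs)
   then show "\<bar>?m x {..<N}\<bar> <= eta * real N * nmu"
    using eN by (rule power2_le_imp_le)
  qed auto
 qed
 have mean_rows: "fails_le M (2 * exp (- t0)) (\<lambda>x. \<forall>i\<in>{..<N}. \<bar>\<Sum>c\<in>S. \<mu> c / \<sigma> * noise x i c\<bar> * e <= eta * real N * nmu)"
  using mu
 proof
  assume "\<forall>c\<in>S. \<mu> c = 0"
  then show ?thesis using eN by (intro fails_le_True) auto
 next
  assume nz: "e * D <= 2 * ((real N)\<^sup>2 * nmu)"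
  have "fails_le M (\<Sum>i<N. 2 * exp (- t)) (\<lambda>x. \<forall>i\<in>{..<N}. \<bar>\<Sum>c\<in>S. \<mu> c / \<sigma> * noise x i c\<bar> * e <= eta * real N * nmu)"
  proof (rule fails_le_ball)
   fix i assume i: "i \<in> {..<N}"
   show "fails_le M (2 * exp (- t)) (\<lambda>x. \<bar>\<Sum>c\<in>S. \<mu> c / \<sigma> * noise x i c\<bar> * e <= eta * real N * nmu)"
   proof (rule fails_le_mono[OF tail_mean[OF t(1), of "{i}"]])
    fix x assume *: "(?m x {i})\<^sup>2 <= 17 * t * real (card {i}) * nmu"
    let ?y = "\<Sum>c\<in>S. \<mu> c / \<sigma> * noise x i c"
    have eq: "?m x {i} = ?y" "real (card {i}) = 1" by simp_all
    have "?y\<^sup>2 <= 17 * t * nmu" using * unfolding eq mult_1_right .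
    then have "?y\<^sup>2 * e\<^sup>2 <= 17 * t * nmu * e\<^sup>2" by (rule mult_right_mono) simp
    then have "(\<bar>?y\<bar> * e)\<^sup>2 <= 17 * t * nmu * e\<^sup>2" by (simp only: power_mult_distrib power2_abs)
    also have "\<dots> = (17 * t * (e * e)) * nmu" by (simp only: power2_eq_square mult_ac)
    also have "\<dots> <= (51 * t0 * (e * e * L)) * nmu"
    proof (intro mult_right_mono)
     show "17 * t * (e * e) <= 51 * t0 * (e * e * L)"
      using mult_right_mono[OF t(2), of "e * e"] e by (simp add: mult_ac)
    qed (rule sum_nonneg, simp)
    also have "\<dots> <= (eta\<^sup>2 * ((real N)\<^sup>2 * nmu)) * nmu"
    proof (intro mult_right_mono)
     have "0 <= t0 * (e * e * L)" using t0 L0 by simp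
     then show "51 * t0 * (e * e * L) <= eta\<^sup>2 * ((real N)\<^sup>2 * nmu)"
      unfolding eta2 using nmu(2)[OF nz] by linarith
    qed (rule sum_nonneg, simp)
    also have "\<dots> = (eta * real N * nmu)\<^sup>2" by (simp only: power2_eq_square mult_ac)
    finally show "\<bar>?y\<bar> * e <= eta * real N * nmu"
     using eN by (rule power2_le_imp_le)
   qed (use i in auto)
  qed simp
  moreover have "(\<Sum>i<N. 2 * exp (- t)) = 2 * exp (- t0)" using expt by simp
  ultimately show ?thesis by (simp only:)
 qed
 have "fails_le M (2 * exp (- t0) + (4 * exp (- t0) + (2 * exp (- t0) + (2 * exp (- t0) + (2 * exp (- t0) + (2 * exp (- t0) + 2 * exp (- t0)))))))
   (\<lambda>x. \<bar>?Q x (\<lambda>_. 1) (\<lambda>_. 1) - real s * real N\<bar> <= eta * (e * D) \<and>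
   (\<forall>i\<in>{..<N}. \<bar>row N (shifted N s (gram S (noise x))) (\<lambda>_. 1) i\<bar> <= eta * D) \<and>
   (s <= N --> (\<forall>v. \<bar>(\<Sum>i<N. (prj S (noise x) v i)\<^sup>2) - real N * (\<Sum>c\<in>S. (v c)\<^sup>2)\<bar> <= eta * D * (\<Sum>c\<in>S. (v c)\<^sup>2))) \<and>
   (s <= N --> (\<forall>C. C \<subseteq> {..<N} --> real (card C) <= 150 * e -->
    (\<forall>v. (\<Sum>i\<in>C. (prj S (noise x) v i)\<^sup>2) <= eta * D * (\<Sum>c\<in>S. (v c)\<^sup>2)))) \<and>
   (N < s --> (\<forall>y. \<bar>quad {..<N} (shifted N s (gram S (noise x))) y y\<bar> <= eta * D * (\<Sum>i<N. (y i)\<^sup>2))) \<and>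
   \<bar>?m x {..<N}\<bar> <= eta * real N * nmu \<and>
   (\<forall>i\<in>{..<N}. \<bar>\<Sum>c\<in>S. \<mu> c / \<sigma> * noise x i c\<bar> * e <= eta * real N * nmu))"
  by (intro fails_le_conj total rows low_all low_few high_all mean_total mean_rows)
 then show "fails_le M (16 * exp (- t0)) (\<lambda>x. good_noise N S (noise x) (\<lambda>c. \<mu> c / \<sigma>) e D)"
  by (rule fails_le_mono) (simp_all add: good_noise_def)
qed

end

section \<open>The exhaustive test\<close>

definition ind :: "nat set \<Rightarrow> nat \<Rightarrow> real" where
 "ind B i = of_bool (i \<in> B)"

definition subset_noise ::
 "nat \<Rightarrow> nat set \<Rightarrow> (nat \<Rightarrow> nat \<Rightarrow> real) \<Rightarrow> (nat \<Rightarrow> real) \<Rightarrow> nat \<Rightarrow> real \<Rightarrow> bool" where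
 "subset_noise N S Z mu b P \<longleftrightarrow>
  \<bar>quad {..<N} (gram S Z) (\<lambda>_. 1) (\<lambda>_. 1) - real (card S) * real N\<bar> <= P / 100 \<and>
  \<bar>\<Sum>i<N. \<Sum>c\<in>S. mu c * Z i c\<bar> <= real N * (\<Sum>c\<in>S. (mu c)\<^sup>2) / 100 \<and>
  (\<forall>B. B \<subseteq> {..<N} --> card B <= b -->
   \<bar>quad {..<N} (gram S Z) (ind B) (ind B) - real (card S) * real (card B)\<bar> <= P / 100 \<and>
   \<bar>quad {..<N} (gram S Z) (\<lambda>_. 1) (ind B) - real (card S) * real (card B)\<bar> <= P / 100 \<and>
   \<bar>\<Sum>i\<in>B. \<Sum>c\<in>S. mu c * Z i c\<bar> <= real N * (\<Sum>c\<in>S. (mu c)\<^sup>2) / 100)"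

definition excess :: "nat \<Rightarrow> nat set \<Rightarrow> (nat \<Rightarrow> nat \<Rightarrow> real) \<Rightarrow> nat set \<Rightarrow> real" where
 "excess N S X T = quad {..<N} (gram S X) (ind T) (ind T) - real (card S) * real (card T)"

text \<open>Quantifying over the large subsets of \<open>T1\<close> gives acceptance its force under
  the alternative: removing the at most k corrupted samples from \<open>T1\<close> leaves one of
  these subsets, and it is clean. Under the null hypothesis the complement of the corrupted samples
  serves as \<open>T1\<close>.\<close>

definition core_accept :: "nat \<Rightarrow> nat set \<Rightarrow> nat \<Rightarrow> real \<Rightarrow> (nat \<Rightarrow> nat \<Rightarrow> real) \<Rightarrow> bool" where
 "core_accept N S k P X \<longleftrightarrow>
  (\<exists>T1\<in>Pow {..<N}. N <= card T1 + k \<and> (\<forall>T\<in>Pow T1. N <= card T + 2 * k --> excess N S X T <= P / 4))"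

lemma ind_sums:
 assumes "B \<subseteq> {..<N}"
 shows "(\<Sum>i<N. ind B i) = real (card B)" "(\<Sum>i<N. (ind B i)\<^sup>2) = real (card B)"
  "(\<Sum>i<N. ind B i * f i) = (\<Sum>i\<in>B. f i)"
proof -
 have B: "{..<N} \<inter> B = B" using assms by auto
 show 1: "(\<Sum>i<N. ind B i * f i) = (\<Sum>i\<in>B. f i)" for f :: "nat \<Rightarrow> real"
  using assms by (intro sum.mono_neutral_cong_right) (auto simp: ind_def)
 show "(\<Sum>i<N. ind B i) = real (card B)" using 1[of "\<lambda>_. 1"] by simp
 have "(ind B i)\<^sup>2 = ind B i * 1" for i by (simp add: ind_def)
 then show "(\<Sum>i<N. (ind B i)\<^sup>2) = real (card B)" using 1[of "\<lambda>_. 1"] by simp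
qed

text \<open>Everything is expressed through the small complement of \<open>T\<close>, over which the noise is uniform.\<close>

lemma quad_compl:
 assumes T: "T \<subseteq> {..<N}"
 defines "B \<equiv> {..<N} - T"
 shows "quad {..<N} (gram S Z) (ind T) (ind T) =
  quad {..<N} (gram S Z) (\<lambda>_. 1) (\<lambda>_. 1) - 2 * quad {..<N} (gram S Z) (\<lambda>_. 1) (ind B)
   + quad {..<N} (gram S Z) (ind B) (ind B)"
proof -
 have c: "comb N Z (ind T) c = comb N Z (\<lambda>_. 1) c - comb N Z (ind B) c" for c
 proof -
  have "ind T i = 1 - ind B i" if "i < N" for i using that by (auto simp: ind_def B_def)
  then have "comb N Z (ind T) c = (\<Sum>i<N. 1 * Z i c - ind B i * Z i c)"
   unfolding comb_def by (intro sum.cong) (auto simp: left_diff_distrib)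
  then show ?thesis by (simp add: comb_def sum_subtractf)
 qed
 show ?thesis unfolding quad_gram c sum_distrib_left sum_subtractf[symmetric] sum.distrib[symmetric]
  by (intro sum.cong) (auto simp: algebra_simps)
qed

lemma excess_noise:
 assumes g: "subset_noise N S Z mu b P" and T: "T \<subseteq> {..<N}" "N <= card T + b"
 shows "\<bar>excess N S Z T\<bar> <= 4 * P / 100"
  "\<bar>\<Sum>i\<in>T. \<Sum>c\<in>S. mu c * Z i c\<bar> <= 2 * (real N * (\<Sum>c\<in>S. (mu c)\<^sup>2) / 100)"
proof -
 define B where "B = {..<N} - T"
 have fT: "finite T" using T finite_subset by auto
 have cB: "card B = N - card T" "card T <= N" "B \<subseteq> {..<N}"
  using T fT card_mono[of "{..<N}" T] by (auto simp: B_def card_Diff_subset)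
 then have b: "card B <= b" using T by simp
 have rc: "real (card B) = real N - real (card T)" using cB by simp
 show "\<bar>excess N S Z T\<bar> <= 4 * P / 100"
 proof -
  let ?Q = "quad {..<N} (gram S Z)"
  have "excess N S Z T = (?Q (\<lambda>_. 1) (\<lambda>_. 1) - real (card S) * real N)
    - 2 * (?Q (\<lambda>_. 1) (ind B) - real (card S) * real (card B)) + (?Q (ind B) (ind B) - real (card S) * real (card B))"
   unfolding excess_def quad_compl[OF T(1)] B_def[symmetric] rc by (simp add: algebra_simps)
  moreover have "\<bar>?Q (\<lambda>_. 1) (\<lambda>_. 1) - real (card S) * real N\<bar> <= P / 100"
   "\<bar>?Q (\<lambda>_. 1) (ind B) - real (card S) * real (card B)\<bar> <= P / 100"
   "\<bar>?Q (ind B) (ind B) - real (card S) * real (card B)\<bar> <= P / 100"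
   using g cB b unfolding subset_noise_def by blast+
  moreover have "\<bar>v\<bar> <= 4 * P / 100"
   if "v = x - 2 * y + z" "\<bar>x\<bar> <= P / 100" "\<bar>y\<bar> <= P / 100" "\<bar>z\<bar> <= P / 100" for v x y z :: real
   using that by linarith
  ultimately show ?thesis by blast
 qed
 let ?m = "\<lambda>i. \<Sum>c\<in>S. mu c * Z i c"
 have "(\<Sum>i<N. ?m i) = (\<Sum>i\<in>T. ?m i) + (\<Sum>i\<in>B. ?m i)"
  using T unfolding B_def by (subst sum.subset_diff[of T]) auto
 moreover have "\<bar>\<Sum>i<N. ?m i\<bar> <= real N * (\<Sum>c\<in>S. (mu c)\<^sup>2) / 100"
  "\<bar>\<Sum>i\<in>B. ?m i\<bar> <= real N * (\<Sum>c\<in>S. (mu c)\<^sup>2) / 100"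
  using g cB b unfolding subset_noise_def by blast+
 ultimately show "\<bar>\<Sum>i\<in>T. ?m i\<bar> <= 2 * (real N * (\<Sum>c\<in>S. (mu c)\<^sup>2) / 100)" by linarith
qed

lemma excess_cong:
 assumes "T \<subseteq> {..<N}" "\<And>i c. i \<in> T ==> c \<in> S ==> X i c = Y i c"
 shows "excess N S X T = excess N S Y T"
proof -
 have "comb N X (ind T) c = comb N Y (ind T) c" if "c \<in> S" for c
  using assms that unfolding comb_def by (intro sum.cong) (auto simp: ind_def)
 then show ?thesis by (simp add: excess_def quad_gram)
qed

lemma core_null:
 assumes g: "subset_noise N S Z mu (2 * k) P" and P: "0 <= P"
  and C: "C \<subseteq> {..<N}" "card C <= k" and X: "\<And>i c. i < N ==> i \<notin> C ==> c \<in> S ==> X i c = Z i c"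
 shows "core_accept N S k P X"
 unfolding core_accept_def
proof (intro bexI[of _ "{..<N} - C"] conjI ballI impI)
 have "card ({..<N} - C) = N - card C"
  using C finite_subset[OF C(1)] by (simp add: card_Diff_subset)
 then show "N <= card ({..<N} - C) + k" using C by simp
 fix T assume T: "T \<in> Pow ({..<N} - C)" "N <= card T + 2 * k"
 then have T': "T \<subseteq> {..<N}" by auto
 have "excess N S X T = excess N S Z T" using T by (intro excess_cong[OF T'] X) auto
 then show "excess N S X T <= P / 4" using excess_noise(1)[OF g T' T(2)] P by linarith
qed auto

lemma core_alternative:
 assumes g: "subset_noise N S Z mu (2 * k) P" and P: "0 < P"
  and k: "200 * k <= N" and mu: "P <= 2 * ((real N)\<^sup>2 * (\<Sum>c\<in>S. (mu c)\<^sup>2))"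
  and C: "C \<subseteq> {..<N}" "card C <= k" and X: "\<And>i c. i < N ==> i \<notin> C ==> c \<in> S ==> X i c = mu c + Z i c"
 shows "\<not> core_accept N S k P X"
proof
 assume "core_accept N S k P X"
 then obtain T1 where T1: "T1 \<subseteq> {..<N}" "N <= card T1 + k"
  and all: "\<And>T. T \<subseteq> T1 ==> N <= card T + 2 * k ==> excess N S X T <= P / 4"
  unfolding core_accept_def by auto
 define T where "T = T1 - C"
 have T: "T \<subseteq> {..<N}" "T \<subseteq> T1" using T1 by (auto simp: T_def)
 have "card T1 - card C <= card T" unfolding T_def using finite_subset[OF C(1)] by (intro diff_card_le_card_Diff) auto
 then have cT: "N <= card T + 2 * k" using T1 C by linarith
 have cT2: "card T <= N" using card_mono[OF _ T(1)] by simp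
 define n where "n = (\<Sum>c\<in>S. (mu c)\<^sup>2)"
 have n0: "0 <= n" by (simp add: n_def sum_nonneg)
 define u where "u = real (card T)"
 define m where "m = (\<Sum>i\<in>T. \<Sum>c\<in>S. mu c * Z i c)"
 have u: "99/100 * real N <= u" "u <= real N" using cT k cT2 by (auto simp: u_def)
 have comb: "comb N X (ind T) c = u * mu c + comb N Z (ind T) c" if "c \<in> S" for c
 proof -
  have "comb N X (ind T) c = (\<Sum>i\<in>T. X i c)" "comb N Z (ind T) c = (\<Sum>i\<in>T. Z i c)"
   unfolding comb_def by (rule ind_sums(3)[OF T(1)])+
  moreover have "(\<Sum>i\<in>T. X i c) = (\<Sum>i\<in>T. mu c + Z i c)"
   using T that by (intro sum.cong refl X) (auto simp: T_def)
  ultimately show ?thesis by (simp add: sum.distrib u_def)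
 qed
 have cm: "(\<Sum>c\<in>S. mu c * comb N Z (ind T) c) = m"
  unfolding sum_comb_prj prj_def ind_sums(3)[OF T(1)] m_def ..
 have "quad {..<N} (gram S X) (ind T) (ind T) =
   (\<Sum>c\<in>S. u\<^sup>2 * (mu c)\<^sup>2 + (2 * u) * (mu c * comb N Z (ind T) c) + comb N Z (ind T) c * comb N Z (ind T) c)"
  unfolding quad_gram by (intro sum.cong) (auto simp: comb power2_eq_square algebra_simps)
 also have "\<dots> = u\<^sup>2 * n + 2 * u * m + quad {..<N} (gram S Z) (ind T) (ind T)"
  unfolding quad_gram sum.distrib sum_distrib_left[symmetric] cm n_def ..
 finally have ex: "excess N S X T = u\<^sup>2 * n + 2 * u * m + excess N S Z T" by (simp add: excess_def)
 have m: "\<bar>m\<bar> <= 2 * (real N * n / 100)" and z: "\<bar>excess N S Z T\<bar> <= 4 * P / 100"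
  using excess_noise[OF g T(1) cT] by (simp_all add: m_def n_def)
 define a where "a = (real N)\<^sup>2 * n"
 have "(99/100 * real N)\<^sup>2 * n <= u\<^sup>2 * n" using u n0 by (intro mult_right_mono power_mono) auto
 moreover have "(99/100 * real N)\<^sup>2 * n = 9801/10000 * a" "real N * (2 * (real N * n / 100)) = 2/100 * a"
  by (simp_all add: a_def power2_eq_square)
 moreover have "\<bar>u * m\<bar> <= real N * (2 * (real N * n / 100))"
  unfolding abs_mult using u m by (intro mult_mono) auto
 moreover have "2 * u * m = 2 * (u * m)" by simp
 ultimately have "9801/10000 * a - 4/100 * a - 4 * P / 100 <= excess N S X T"
  unfolding ex using z by linarith
 then have "P / 4 < excess N S X T" using mu[folded n_def a_def] P by linarith
 then show False using all[OF T(2) cT] by linarith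
qed

lemma core_accept_measurable:
 assumes "S \<subseteq> {..<d}" "0 < \<sigma>"
 shows "{x \<in> space (data_law N d \<mu> \<sigma>). core_accept N S k P (\<lambda>i c. x i c / \<tau>)} \<in> sets (data_law N d \<mu> \<sigma>)"
proof -
 have m[measurable]: "(\<lambda>x. quad {..<N} (gram S (\<lambda>i c. x i c / \<tau>)) (ind T) (ind T)) \<in> borel_measurable (data_law N d \<mu> \<sigma>)" for T
  unfolding quad_def gram_def
  by (intro borel_measurable_sum borel_measurable_times borel_measurable_const borel_measurable_divide measurable_coord)
   (use assms in auto)
 have f: "finite (Pow {..<N})" "\<And>T1. T1 \<in> Pow {..<N} ==> finite (Pow T1)"
  using finite_subset by auto
 have "{x \<in> space (data_law N d \<mu> \<sigma>). core_accept N S k P (\<lambda>i c. x i c / \<tau>)} =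
  (\<Union>T1\<in>{T1\<in>Pow {..<N}. N <= card T1 + k}. {x \<in> space (data_law N d \<mu> \<sigma>).
   \<forall>T\<in>{T\<in>Pow T1. N <= card T + 2 * k}. excess N S (\<lambda>i c. x i c / \<tau>) T <= P / 4})"
  unfolding core_accept_def by blast
 also have "\<dots> \<in> sets (data_law N d \<mu> \<sigma>)"
 proof (intro sets.finite_UN sets.sets_Collect_finite_All)
  fix T show "{x \<in> space (data_law N d \<mu> \<sigma>). excess N S (\<lambda>i c. x i c / \<tau>) T <= P / 4} \<in> sets (data_law N d \<mu> \<sigma>)"
   unfolding excess_def by measurable
 qed (use f in auto)
 finally show ?thesis .
qed

context sample begin

text \<open>The exponent t of order t0 k l pays for all subsets of size at most 2 k. The delicate
  event is the cross term between the full sum and the sum over a small subset: its direct tail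
  bound is used for t <= s and Cauchy-Schwarz for t > s. The sharper bound P / 1000 on the total is
  needed in the latter.\<close>

lemma subset_noise_event:
 fixes P l t0 :: real
 assumes t0: "1 <= t0" and P: "0 < P"
  and H1: "100000000 * t0 * (sqrt (real s) * real N) <= P"
  and H2: "0 < k ==> 100000000 * t0 * (real k * sqrt (real s * real N * l)) <= P"
  and H3: "0 < k ==> 100000000 * t0 * ((real k)\<^sup>2 * l) <= P"
  and l: "0 < k ==> 1 <= l" "0 < k ==> 2 * k <= N" "0 < k ==> ln (real N / real (2 * k)) <= l"
  and mu: "(\<forall>c\<in>S. \<mu> c = 0) \<or> P <= 2 * ((real N)\<^sup>2 * nmu)"
 shows "fails_le M (12 * exp (- t0)) (\<lambda>x. subset_noise N S (noise x) (\<lambda>c. \<mu> c / \<sigma>) (2 * k) P)"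
proof -
 let ?Q = "\<lambda>x. quad {..<N} (gram S (noise x))"
 let ?m = "\<lambda>x B. \<Sum>i\<in>B. \<Sum>c\<in>S. \<mu> c / \<sigma> * noise x i c"
 have n0: "0 <= nmu" by (simp add: sum_nonneg)
 have total: "fails_le M (2 * exp (- t0)) (\<lambda>x. \<bar>?Q x (\<lambda>_. 1) (\<lambda>_. 1) - real s * real N\<bar> <= P / 1000)"
 proof (rule fails_le_mono[OF tail_gram[of t0 "\<lambda>_. 1"]])
  fix x assume "\<bar>?Q x (\<lambda>_. 1) (\<lambda>_. 1) - real s * (\<Sum>i<N. 1\<^sup>2)\<bar> <= 8 * (sqrt (real s * t0) + t0) * (\<Sum>i<N. 1\<^sup>2)"
  then have "\<bar>?Q x (\<lambda>_. 1) (\<lambda>_. 1) - real s * real N\<bar> <= 8 * (sqrt (real s * t0) + t0) * real N" by simp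
  also have "\<dots> <= 8 * (t0 * sqrt (real s) + t0 * sqrt (real s)) * real N"
  proof (intro mult_right_mono mult_left_mono add_mono)
   have "real s * t0 <= real s * (t0 * t0)" using t0 by (intro mult_left_mono) auto
   then have "sqrt (real s * t0) <= sqrt (t0\<^sup>2 * real s)" by (simp add: power2_eq_square mult_ac)
   then show "sqrt (real s * t0) <= t0 * sqrt (real s)" using t0 by (simp add: real_sqrt_mult)
   have "1 <= sqrt (real s)" using S(2) by simp
   then show "t0 <= t0 * sqrt (real s)" using t0 by simp
  qed auto
  also have "\<dots> = 16 * (t0 * (sqrt (real s) * real N))" by simp
  also have "\<dots> <= P / 1000"
  proof -
   have "0 <= t0 * (sqrt (real s) * real N)" using t0 by simp
   then show ?thesis using H1 by simp
  qed
  finally show "\<bar>?Q x (\<lambda>_. 1) (\<lambda>_. 1) - real s * real N\<bar> <= P / 1000" .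
 qed (use t0 in auto)
 have nmuN: "100000000 * t0 * real N <= 2 * ((real N)\<^sup>2 * nmu)" if "P <= 2 * ((real N)\<^sup>2 * nmu)"
 proof -
  have "1 * real N <= sqrt (real s) * real N" using S(2) by (intro mult_right_mono) auto
  then have "real N <= sqrt (real s) * real N" by simp
  then have "100000000 * t0 * real N <= 100000000 * t0 * (sqrt (real s) * real N)" using t0 by (intro mult_left_mono) auto
  then show ?thesis using H1 that by linarith
 qed
 have mean_bound: "\<bar>y\<bar> <= real N * nmu / 100" if y: "y\<^sup>2 <= q * nmu" and q: "10000 * q <= (real N)\<^sup>2 * nmu" for y q :: real
 proof (rule power2_le_imp_le)
  have "q * nmu <= ((real N)\<^sup>2 * nmu / 10000) * nmu" using q n0 by (intro mult_right_mono) auto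
  also have "\<dots> = (real N * nmu / 100)\<^sup>2" by (simp add: power2_eq_square)
  finally show "\<bar>y\<bar>\<^sup>2 <= (real N * nmu / 100)\<^sup>2" using y by simp
 qed (use n0 in auto)
 have mean_total: "fails_le M (2 * exp (- t0)) (\<lambda>x. \<bar>?m x {..<N}\<bar> <= real N * nmu / 100)"
  using mu
 proof
  assume "\<forall>c\<in>S. \<mu> c = 0"
  then show ?thesis by (intro fails_le_True) (auto intro!: mult_nonneg_nonneg sum_nonneg)
 next
  assume nz: "P <= 2 * ((real N)\<^sup>2 * nmu)"
  have "0 <= t0 * real N" using t0 by simp
  then have q: "10000 * (17 * t0 * real N) <= (real N)\<^sup>2 * nmu" using nmuN[OF nz] by linarith
  show ?thesis
  proof (rule fails_le_mono[OF tail_mean[OF t0, of "{..<N}"]])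
   fix x assume "(?m x {..<N})\<^sup>2 <= 17 * t0 * real (card {..<N}) * nmu"
   then show "\<bar>?m x {..<N}\<bar> <= real N * nmu / 100" unfolding card_lessThan by (rule mean_bound[OF _ q])
  qed auto
 qed
 have small: "fails_le M (2 * exp (- t0) + (4 * exp (- t0) + 2 * exp (- t0))) (\<lambda>x.
  (\<forall>B. B \<subseteq> {..<N} --> card B <= 2 * k --> \<bar>?Q x (ind B) (ind B) - real s * real (card B)\<bar> <= P / 100) \<and>
  (\<forall>B. B \<subseteq> {..<N} --> card B <= 2 * k --> \<bar>?Q x (\<lambda>_. 1) (\<lambda>_. 1) - real s * real N\<bar> <= P / 1000 -->
    \<bar>?Q x (\<lambda>_. 1) (ind B) - real s * real (card B)\<bar> <= P / 100) \<and>
  (\<forall>B. B \<subseteq> {..<N} --> card B <= 2 * k --> \<bar>?m x B\<bar> <= real N * nmu / 100))"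
 proof (cases "k = 0")
  case True
  have "B = {}" if "B \<subseteq> {..<N}" "card B <= 2 * k" for B
   using that True finite_subset by fastforce
  moreover have z: "quad {..<N} A v (ind {}) = 0" for A v by (simp add: quad_def ind_def)
  moreover have "\<bar>quad {..<N} A v (ind {}) - real s * real (card {})\<bar> <= P / 100" for A v using P z by simp
  moreover have "\<bar>\<Sum>i\<in>{}. f i\<bar> <= real N * nmu / 100" for f :: "nat \<Rightarrow> real" using n0 by simp
  ultimately show ?thesis by (intro fails_le_True conjI allI impI) (simp, blast, blast, blast)
 next
  case False
  then have k: "0 < k" by simp
  note l = l[OF k] and H2 = H2[OF k] and H3 = H3[OF k]
  define t where "t = 5 * t0 * real k * l"
  define W where "W = real k * sqrt (real s * real N * l)"
  have k1: "1 <= real k" using k by simp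
  have kl: "1 <= real k * l" using k1 l mult_mono[of 1 "real k" 1 l] by simp
  have t1: "1 <= t" "0 <= t"
   using mult_mono[of 1 t0 1 "real k * l"] t0 kl by (auto simp: t_def mult.assoc)
  have tt: "t0 + real (2 * k) * (1 + ln (real N / real (2 * k))) <= t"
  proof -
   have "real (2 * k) * (1 + ln (real N / real (2 * k))) <= 2 * real k * (2 * l)"
    using l k1 by (intro mult_mono) auto
   moreover have "t0 * 1 <= t0 * (real k * l)" "1 * (real k * l) <= t0 * (real k * l)"
    using t0 kl by (intro mult_left_mono mult_right_mono; simp)+
   moreover have "5 * t0 * real k * l = 5 * (t0 * (real k * l))" "2 * real k * (2 * l) = 4 * (real k * l)" by simp_all
   ultimately show ?thesis unfolding t_def by linarith
  qed
  have W0: "0 <= W" using l by (simp add: W_def)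
  have kt: "real k * t = 5 * (t0 * ((real k)\<^sup>2 * l))" by (simp add: t_def power2_eq_square)
  have kt0: "0 <= t0 * ((real k)\<^sup>2 * l)" using t0 l by simp
  have tW: "0 <= t0 * W" using t0 W0 by simp
  have st: "real k * sqrt (real s * t) <= 3 * (t0 * W)"
  proof -
   have kN: "real k <= real N" using l(2) by simp
   have "real s * t <= (3 * t0)\<^sup>2 * (real s * real N * l)"
   proof -
    have "real s * (t0 * real k * l) * 5 <= real s * (t0 * t0 * real N * l) * 9"
     using t0 kN l by (intro mult_mono) auto
    then show ?thesis by (simp add: t_def power2_eq_square mult_ac)
   qed
   then have "sqrt (real s * t) <= sqrt ((3 * t0)\<^sup>2 * (real s * real N * l))" by simp
   also have "\<dots> = 3 * t0 * sqrt (real s * real N * l)" using t0 by (simp add: real_sqrt_mult)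
   finally have "real k * sqrt (real s * t) <= real k * (3 * t0 * sqrt (real s * real N * l))"
    by (intro mult_left_mono) auto
   then show ?thesis by (simp add: W_def mult_ac)
  qed
  have H2': "100000000 * (t0 * W) <= P" using H2 by (simp add: W_def)
  have H3': "100000000 * (t0 * ((real k)\<^sup>2 * l)) <= P" using H3 by simp
  have sqrtB: "sqrt (\<Sum>i<N. 1\<^sup>2) * sqrt (\<Sum>i<N. (ind B i)\<^sup>2) <= sqrt (real N) * sqrt (2 * real k)"
   if "B \<subseteq> {..<N}" "card B <= 2 * k" for B
   using that by (auto simp: ind_sums(2) intro!: mult_left_mono)
  have sNk: "sqrt (real s * t) * (sqrt (real N) * sqrt (2 * real k)) <= 4 * (t0 * W)"
  proof -
   have "real s * t * (real N * (2 * real k)) = 10 * t0 * ((real k)\<^sup>2 * (real s * real N * l))"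
    by (simp add: t_def power2_eq_square)
   also have "\<dots> <= (4 * t0)\<^sup>2 * ((real k)\<^sup>2 * (real s * real N * l))"
   proof (rule mult_right_mono)
    show "10 * t0 <= (4 * t0)\<^sup>2" using t0 mult_right_mono[OF t0, of t0] by (simp add: power2_eq_square)
   qed (use l in auto)
   finally have "sqrt (real s * t * (real N * (2 * real k))) <= sqrt ((4 * t0)\<^sup>2 * ((real k)\<^sup>2 * (real s * real N * l)))" by simp
   also have "\<dots> = 4 * (t0 * W)" using t0 by (simp add: real_sqrt_mult W_def)
   finally show ?thesis by (simp only: real_sqrt_mult)
  qed
  have within: "fails_le M (2 * exp (- t0)) (\<lambda>x. \<forall>B. B \<subseteq> {..<N} --> card B <= 2 * k -->
    \<bar>?Q x (ind B) (ind B) - real s * real (card B)\<bar> <= 16 * (real k * sqrt (real s * t) + real k * t))"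
  proof (rule fails_small_subsets[OF _ l(2) tt])
   fix B assume B: "B \<subseteq> {..<N}" "card B <= 2 * k"
   show "fails_le M (2 * exp (- t)) (\<lambda>x. \<bar>?Q x (ind B) (ind B) - real s * real (card B)\<bar> <= 16 * (real k * sqrt (real s * t) + real k * t))"
   proof (rule fails_le_mono[OF tail_gram[OF t1(2), of "ind B"]])
    fix x assume "\<bar>?Q x (ind B) (ind B) - real s * (\<Sum>i<N. (ind B i)\<^sup>2)\<bar> <= 8 * (sqrt (real s * t) + t) * (\<Sum>i<N. (ind B i)\<^sup>2)"
    then have "\<bar>?Q x (ind B) (ind B) - real s * real (card B)\<bar> <= 8 * (sqrt (real s * t) + t) * real (card B)"
     unfolding ind_sums(2)[OF B(1)] .
    also have "\<dots> <= 8 * (sqrt (real s * t) + t) * (2 * real k)"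
     using B t1 by (intro mult_left_mono) auto
    finally show "\<bar>?Q x (ind B) (ind B) - real s * real (card B)\<bar> <= 16 * (real k * sqrt (real s * t) + real k * t)"
     by (simp add: algebra_simps)
   qed simp
  qed (use k in auto)
  have cross1: "fails_le M (4 * exp (- t0)) (\<lambda>x. \<forall>B. B \<subseteq> {..<N} --> card B <= 2 * k -->
    t <= real s --> \<bar>?Q x (\<lambda>_. 1) (ind B) - real s * real (card B)\<bar> <= P / 100)"
  proof (rule fails_small_subsets[OF _ l(2) tt])
   fix B assume B: "B \<subseteq> {..<N}" "card B <= 2 * k"
   show "fails_le M (4 * exp (- t)) (\<lambda>x. t <= real s --> \<bar>?Q x (\<lambda>_. 1) (ind B) - real s * real (card B)\<bar> <= P / 100)"
   proof (rule fails_le_mono[OF tail_cross[OF t1(2), of "\<lambda>_. 1" "ind B"]])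
    fix x assume tc:
     "\<bar>?Q x (\<lambda>_. 1) (ind B) - real s * (\<Sum>i<N. 1 * ind B i)\<bar> <= 16 * (sqrt (real s * t) + t) * (sqrt (\<Sum>i<N. 1\<^sup>2) * sqrt (\<Sum>i<N. (ind B i)\<^sup>2))"
    show "t <= real s --> \<bar>?Q x (\<lambda>_. 1) (ind B) - real s * real (card B)\<bar> <= P / 100"
    proof
    assume ts: "t <= real s"
    have "\<bar>?Q x (\<lambda>_. 1) (ind B) - real s * real (card B)\<bar> <= 16 * (sqrt (real s * t) + t) * (sqrt (\<Sum>i<N. 1\<^sup>2) * sqrt (\<Sum>i<N. (ind B i)\<^sup>2))"
     using tc by (simp only: mult_1 ind_sums(1)[OF B(1)])
    also have "\<dots> <= 16 * (sqrt (real s * t) + sqrt (real s * t)) * (sqrt (real N) * sqrt (2 * real k))"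
    proof (intro mult_mono[OF _ sqrtB[OF B]] mult_left_mono add_mono order_refl)
     have "t * t <= real s * t" using ts t1 by (intro mult_right_mono)
     then show "t <= sqrt (real s * t)" by (intro real_le_rsqrt) (simp add: power2_eq_square)
    qed (use t1 in \<open>auto intro!: mult_nonneg_nonneg sum_nonneg\<close>)
    also have "\<dots> = 32 * (sqrt (real s * t) * (sqrt (real N) * sqrt (2 * real k)))" by simp
    also have "\<dots> <= P / 100" using sNk H2' tW by linarith
    finally show "\<bar>?Q x (\<lambda>_. 1) (ind B) - real s * real (card B)\<bar> <= P / 100" .
    qed
   qed simp
  qed (use k in auto)
  have mean: "fails_le M (2 * exp (- t0)) (\<lambda>x. \<forall>B. B \<subseteq> {..<N} --> card B <= 2 * k --> \<bar>?m x B\<bar> <= real N * nmu / 100)"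
   using mu
  proof
   assume "\<forall>c\<in>S. \<mu> c = 0"
   then show ?thesis by (intro fails_le_True) (auto intro!: mult_nonneg_nonneg sum_nonneg)
  next
   assume nz: "P <= 2 * ((real N)\<^sup>2 * nmu)"
   show ?thesis
   proof (rule fails_small_subsets[OF _ l(2) tt])
    fix B assume B: "B \<subseteq> {..<N}" "card B <= 2 * k"
    have "17 * t * real (card B) <= 17 * t * (2 * real k)" using B t1 by (intro mult_left_mono) auto
    then have q: "10000 * (17 * t * real (card B)) <= (real N)\<^sup>2 * nmu" using kt kt0 H3' nz by (simp add: mult_ac)
    show "fails_le M (2 * exp (- t)) (\<lambda>x. \<bar>?m x B\<bar> <= real N * nmu / 100)"
     using mean_bound[OF _ q] by (intro fails_le_mono[OF tail_mean[OF t1(1) B(1)]]) simp_all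
   qed (use k in auto)
  qed
  show ?thesis
  proof (rule fails_le_mono[OF fails_le_conj[OF within fails_le_conj[OF cross1 mean]]])
   fix x
   assume a: "(\<forall>B. B \<subseteq> {..<N} --> card B <= 2 * k -->
     \<bar>?Q x (ind B) (ind B) - real s * real (card B)\<bar> <= 16 * (real k * sqrt (real s * t) + real k * t)) \<and>
    (\<forall>B. B \<subseteq> {..<N} --> card B <= 2 * k --> t <= real s --> \<bar>?Q x (\<lambda>_. 1) (ind B) - real s * real (card B)\<bar> <= P / 100) \<and>
    (\<forall>B. B \<subseteq> {..<N} --> card B <= 2 * k --> \<bar>?m x B\<bar> <= real N * nmu / 100)"
   have wB: "\<bar>?Q x (ind B) (ind B) - real s * real (card B)\<bar> <= 16 * (real k * sqrt (real s * t) + real k * t)"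
    if "B \<subseteq> {..<N}" "card B <= 2 * k" for B using a that by blast
   have wthn: "\<bar>?Q x (ind B) (ind B) - real s * real (card B)\<bar> <= P / 100" if "B \<subseteq> {..<N}" "card B <= 2 * k" for B
    using wB[OF that] st kt H2' H3' tW kt0 by argo
   have crs: "\<bar>?Q x (\<lambda>_. 1) (ind B) - real s * real (card B)\<bar> <= P / 100"
    if B: "B \<subseteq> {..<N}" "card B <= 2 * k" and tot: "\<bar>?Q x (\<lambda>_. 1) (\<lambda>_. 1) - real s * real N\<bar> <= P / 1000" for B
   proof (cases "t <= real s")
    case True
    then show ?thesis using a B by blast
   next
    case False
    \<comment> \<open>In this regime the direct tail bound contains t * sqrt (k N), which in general
      is too large. The product of the two squared norms is better: the small subset contributes
      only k t, and s N k t is of the order of the square of P.\<close>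
    then have ts: "real s <= t" by simp
    define U where "U = real k * t"
    have U0: "0 <= U" using t1 by (simp add: U_def)
    have UP: "10000000 * U <= P" using kt H3' kt0 by (simp add: U_def)
    have cB: "real (card B) <= 2 * real k" using B by simp
    have sB: "real s * real (card B) <= 2 * U"
    proof -
     have "real s * real (card B) <= t * (2 * real k)" using ts cB t1 by (intro mult_mono) auto
     then show ?thesis by (simp add: U_def mult_ac)
    qed
    have "real s * t <= t\<^sup>2" using ts t1 by (simp add: power2_eq_square mult_right_mono)
    then have "sqrt (real s * t) <= t" using t1 by (intro real_le_lsqrt) auto
    then have "real k * sqrt (real s * t) <= U" unfolding U_def by (intro mult_left_mono) auto
    then have QB: "?Q x (ind B) (ind B) <= 34 * U" using wB[OF B] sB unfolding U_def by argo
    have sNU: "real s * real N * U <= 5 * (t0 * W)\<^sup>2"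
    proof -
     have "real s * real N * U = 5 * t0 * W\<^sup>2"
      using l by (simp add: U_def W_def t_def power_mult_distrib) (simp add: power2_eq_square)
     also have "\<dots> <= 5 * (t0 * t0) * W\<^sup>2" using t0 by (intro mult_right_mono) auto
     finally show ?thesis by (simp add: power2_eq_square mult_ac)
    qed
    have tW2: "10000000000000000 * (t0 * W)\<^sup>2 <= P\<^sup>2"
    proof -
     have "(100000000 * (t0 * W))\<^sup>2 <= P\<^sup>2" using H2' tW by (intro power_mono) auto
     then show ?thesis by (simp add: power_mult_distrib)
    qed
    have PU: "10000000 * (P * U) <= P\<^sup>2"
     using mult_left_mono[OF UP, of P] P by (simp add: power2_eq_square mult_ac)
    let ?c = "\<lambda>a c. comb N (noise x) a c"
    have "(?Q x (\<lambda>_. 1) (ind B))\<^sup>2 <= ?Q x (\<lambda>_. 1) (\<lambda>_. 1) * ?Q x (ind B) (ind B)"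
     unfolding quad_gram using Cauchy_Schwarz_ineq_sum[of "?c (\<lambda>_. 1)" "?c (ind B)" S]
     by (simp add: power2_eq_square)
    also have "\<dots> <= (real s * real N + P / 1000) * (34 * U)"
    proof (rule mult_mono)
     show "?Q x (\<lambda>_. 1) (\<lambda>_. 1) <= real s * real N + P / 1000" using tot by linarith
     show "0 <= ?Q x (ind B) (ind B)" unfolding quad_gram by (intro sum_nonneg) simp
    qed (use QB P in auto)
    also have "\<dots> = 34 * (real s * real N * U) + 34 / 1000 * (P * U)" by (simp add: algebra_simps)
    also have "\<dots> <= (P / 200)\<^sup>2"
    proof -
     have "(P / 200)\<^sup>2 = P\<^sup>2 / 40000" by (simp add: power_divide)
     then show ?thesis using sNU tW2 PU zero_le_power2[of P] by linarith
    qed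
    finally have "\<bar>?Q x (\<lambda>_. 1) (ind B)\<bar>\<^sup>2 <= (P / 200)\<^sup>2" by (simp only: power2_abs)
    then have "\<bar>?Q x (\<lambda>_. 1) (ind B)\<bar> <= P / 200" by (rule power2_le_imp_le) (use P in simp)
    moreover have "0 <= real s * real (card B)" by simp
    ultimately show ?thesis using sB UP U0 P by linarith
   qed
   show "(\<forall>B. B \<subseteq> {..<N} --> card B <= 2 * k --> \<bar>?Q x (ind B) (ind B) - real s * real (card B)\<bar> <= P / 100) \<and>
  (\<forall>B. B \<subseteq> {..<N} --> card B <= 2 * k --> \<bar>?Q x (\<lambda>_. 1) (\<lambda>_. 1) - real s * real N\<bar> <= P / 1000 -->
    \<bar>?Q x (\<lambda>_. 1) (ind B) - real s * real (card B)\<bar> <= P / 100) \<and>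
  (\<forall>B. B \<subseteq> {..<N} --> card B <= 2 * k --> \<bar>?m x B\<bar> <= real N * nmu / 100)"
    using wthn crs a by blast
  qed simp
 qed
 have "fails_le M (2 * exp (- t0) + (2 * exp (- t0) + (2 * exp (- t0) + (4 * exp (- t0) + 2 * exp (- t0)))))
   (\<lambda>x. \<bar>?Q x (\<lambda>_. 1) (\<lambda>_. 1) - real s * real N\<bar> <= P / 1000 \<and> \<bar>?m x {..<N}\<bar> <= real N * nmu / 100 \<and>
  (\<forall>B. B \<subseteq> {..<N} --> card B <= 2 * k --> \<bar>?Q x (ind B) (ind B) - real s * real (card B)\<bar> <= P / 100) \<and>
  (\<forall>B. B \<subseteq> {..<N} --> card B <= 2 * k --> \<bar>?Q x (\<lambda>_. 1) (\<lambda>_. 1) - real s * real N\<bar> <= P / 1000 -->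
    \<bar>?Q x (\<lambda>_. 1) (ind B) - real s * real (card B)\<bar> <= P / 100) \<and>
  (\<forall>B. B \<subseteq> {..<N} --> card B <= 2 * k --> \<bar>?m x B\<bar> <= real N * nmu / 100))"
  by (intro fails_le_conj total mean_total small)
 then show ?thesis
 proof (rule fails_le_mono)
  fix x assume a: "\<bar>?Q x (\<lambda>_. 1) (\<lambda>_. 1) - real s * real N\<bar> <= P / 1000 \<and> \<bar>?m x {..<N}\<bar> <= real N * nmu / 100 \<and>
  (\<forall>B. B \<subseteq> {..<N} --> card B <= 2 * k --> \<bar>?Q x (ind B) (ind B) - real s * real (card B)\<bar> <= P / 100) \<and>
  (\<forall>B. B \<subseteq> {..<N} --> card B <= 2 * k --> \<bar>?Q x (\<lambda>_. 1) (\<lambda>_. 1) - real s * real N\<bar> <= P / 1000 -->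
    \<bar>?Q x (\<lambda>_. 1) (ind B) - real s * real (card B)\<bar> <= P / 100) \<and>
  (\<forall>B. B \<subseteq> {..<N} --> card B <= 2 * k --> \<bar>?m x B\<bar> <= real N * nmu / 100)"
  then have "\<bar>?Q x (\<lambda>_. 1) (\<lambda>_. 1) - real s * real N\<bar> <= P / 100" using P by linarith
  then show "subset_noise N S (noise x) (\<lambda>c. \<mu> c / \<sigma>) (2 * k) P"
   unfolding subset_noise_def using a by blast
 qed simp
qed

end

section \<open>Coordinate sections of sign-invariant sets\<close>

text \<open>A maximal independent set of columns v has rank many elements, and P is the sum of v
  c_v^T with coefficient vectors c_v. As P fixes each v, independence forces c_v^T v = 1, and the
  trace adds up these numbers.\<close>

lemma trace_projection:
 assumes P: "P \<in> orth_projections d m"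
 shows "(\<Sum>i<d. P $$ (i, i)) = real m"
proof -
 interpret vec_space "TYPE(real)" d .
 have carr: "P \<in> carrier_mat d d" and idem: "P * P = P" and rk: "rank P = m"
  using P by (auto simp: orth_projections_def)
 have cols: "set (cols P) \<subseteq> carrier_vec d" using carr cols_dim by blast
 obtain S where S: "finite S" "maximal S (\<lambda>T. T \<subseteq> set (cols P) \<and> lin_indpt T)"
 proof -
  have "lin_indpt {}" unfolding lin_dep_def by auto
  then show ?thesis
   using maximal_exists_superset[of "set (cols P)" "\<lambda>T. T \<subseteq> set (cols P) \<and> lin_indpt T" "{}"] that by auto
 qed
 have cS: "m = card S" using rank_card_indpt[OF carr S(2)] rk by simp
 have SP: "S \<subseteq> set (cols P)" and ind: "lin_indpt S" using S(2) by (auto simp: maximal_def)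
 have Sc: "S \<subseteq> carrier_vec d" using SP cols by blast
 have sp: "v \<in> span S" if v: "v \<in> set (cols P)" for v
 proof (rule ccontr)
  assume nv: "v \<notin> span S"
  have "v \<notin> S" using nv Sc in_own_span by blast
  moreover have "lin_indpt (S \<union> {v})"
   using nv lin_dep_iff_in_span[OF _ ind, of v] Sc cols v \<open>v \<notin> S\<close> by auto
  ultimately show False using S(2) SP v unfolding maximal_def by blast
 qed
 have "\<exists>a. lincomb a S = col P j" if "j < d" for j
 proof -
  have "col P j \<in> set (cols P)" using that carr by (auto simp: cols_def)
  from finite_in_span[OF S(1) _ sp[OF this]] Sc show ?thesis by auto
 qed
 then obtain c where c: "\<And>j. j < d ==> lincomb (c j) S = col P j" by metis
 have Pij: "P $$ (i, j) = (\<Sum>v\<in>S. c j v * v $ i)" if "i < d" "j < d" for i j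
  using lincomb_index[OF that(1) Sc, of "c j"] c[OF that(2)] that carr by simp
 have fixed: "(\<Sum>j<d. P $$ (i, j) * v $ j) = v $ i" if v: "v \<in> S" and i: "i < d" for v i
 proof -
  obtain k where k: "k < d" "v = col P k" using v SP carr by (auto simp: cols_def)
  have "P $$ (i, k) = (P * P) $$ (i, k)" by (simp add: idem)
  also have "\<dots> = (\<Sum>j<d. P $$ (i, j) * P $$ (j, k))"
   using carr i k by (auto simp: scalar_prod_def atLeast0LessThan intro!: sum.cong)
  finally show ?thesis using k i carr by (simp add: mult.commute)
 qed
 have unit: "(\<Sum>j<d. c j v * v $ j) = 1" if v: "v \<in> S" for v
 proof -
  define f where "f u = (\<Sum>j<d. c j u * v $ j) - (if u = v then 1 else 0)" for u
  have "lincomb f S = 0\<^sub>v d"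
  proof (rule eq_vecI)
   fix i assume "i < dim_vec (0\<^sub>v d :: real vec)"
   then have i: "i < d" by simp
   have "lincomb f S $ i = (\<Sum>u\<in>S. f u * u $ i)" by (rule lincomb_index[OF i Sc])
   also have "\<dots> = (\<Sum>u\<in>S. (\<Sum>j<d. c j u * u $ i * v $ j) - (if u = v then u $ i else 0))"
   proof (rule sum.cong[OF refl])
    fix u
    show "f u * u $ i = (\<Sum>j<d. c j u * u $ i * v $ j) - (if u = v then u $ i else 0)"
     unfolding f_def left_diff_distrib sum_distrib_right by (cases "u = v") (simp_all add: mult_ac)
   qed
   also have "\<dots> = (\<Sum>u\<in>S. \<Sum>j<d. c j u * u $ i * v $ j) - (\<Sum>u\<in>S. if u = v then u $ i else 0)"
    by (rule sum_subtractf)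
   also have "(\<Sum>u\<in>S. if u = v then u $ i else 0) = v $ i" using S(1) v by simp
   also have "(\<Sum>u\<in>S. \<Sum>j<d. c j u * u $ i * v $ j) = (\<Sum>j<d. \<Sum>u\<in>S. c j u * u $ i * v $ j)" by (rule sum.swap)
   also have "\<dots> = (\<Sum>j<d. P $$ (i, j) * v $ j)"
    by (intro sum.cong) (auto simp: Pij[OF i] sum_distrib_right)
   finally show "lincomb f S $ i = 0\<^sub>v d $ i" using fixed[OF v i] i by simp
  next
   have "lincomb f S \<in> carrier_vec d" using Sc S(1) by (intro lincomb_closed) auto
   then show "dim_vec (lincomb f S) = dim_vec (0\<^sub>v d :: real vec)" by simp
  qed
  from not_lindepD[OF ind S(1) order_refl _ this] have "f v = 0" using v by auto
  then show ?thesis by (simp add: f_def)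
 qed
 have "(\<Sum>i<d. P $$ (i, i)) = (\<Sum>i<d. \<Sum>v\<in>S. c i v * v $ i)" by (intro sum.cong) (auto simp: Pij)
 also have "\<dots> = (\<Sum>v\<in>S. \<Sum>i<d. c i v * v $ i)" by (rule sum.swap)
 also have "\<dots> = real (card S)" using unit by simp
 finally show ?thesis using cS by simp
qed

text \<open>The average of the form over random signs is its diagonal part. Here the signs are
  chosen one after another, each making its cross term with the earlier coordinates
  nonnegative.\<close>

lemma signs_diagonal:
 fixes Q :: "nat \<Rightarrow> nat \<Rightarrow> real"
 assumes "finite C" "\<And>i j. Q i j = Q j i"
 shows "\<exists>\<eta>. (\<forall>i. \<eta> i \<in> {-1, 1}) \<and> (\<Sum>i\<in>C. Q i i * (\<theta> i)\<^sup>2) <= quad C Q (\<lambda>i. \<eta> i * \<theta> i) (\<lambda>i. \<eta> i * \<theta> i)"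
 using assms(1)
proof (induction C rule: finite_induct)
 case empty
 show ?case by (intro exI[of _ "\<lambda>_. 1"]) (simp add: quad_def)
next
 case (insert a C)
 then obtain \<eta> where \<eta>: "\<forall>i. \<eta> i \<in> {-1, 1}"
  and le: "(\<Sum>i\<in>C. Q i i * (\<theta> i)\<^sup>2) <= quad C Q (\<lambda>i. \<eta> i * \<theta> i) (\<lambda>i. \<eta> i * \<theta> i)" by blast
 define u where "u = (\<Sum>j\<in>C. Q a j * (\<eta> j * \<theta> j))"
 define e :: real where "e = (if 0 <= \<theta> a * u then 1 else -1)"
 define \<eta>' where "\<eta>' = \<eta>(a := e)"
 have eq: "\<eta>' i = \<eta> i" if "i \<in> C" for i using that insert by (auto simp: \<eta>'_def)
 let ?y = "\<lambda>i. \<eta>' i * \<theta> i" and ?x = "\<lambda>i. \<eta> i * \<theta> i"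
 have e2: "e * e = 1" by (simp add: e_def)
 have "quad (insert a C) Q ?y ?y = Q a a * (\<theta> a)\<^sup>2 + 2 * (e * (\<theta> a * u)) + quad C Q ?x ?x"
 proof -
  have "quad (insert a C) Q ?y ?y = Q a a * ?y a * ?y a + (\<Sum>j\<in>C. Q a j * ?y a * ?y j)
    + (\<Sum>i\<in>C. Q i a * ?y i * ?y a + (\<Sum>j\<in>C. Q i j * ?y i * ?y j))"
   unfolding quad_def using insert by simp
  also have "(\<Sum>j\<in>C. Q a j * ?y a * ?y j) = e * \<theta> a * u"
   unfolding u_def sum_distrib_left using eq by (intro sum.cong) (auto simp: \<eta>'_def)
  also have "(\<Sum>i\<in>C. Q i a * ?y i * ?y a + (\<Sum>j\<in>C. Q i j * ?y i * ?y j)) = e * \<theta> a * u + quad C Q ?x ?x"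
   unfolding sum.distrib quad_def u_def sum_distrib_left
   using eq assms(2)[of _ a] by (intro arg_cong2[of _ _ _ _ "(+)"] sum.cong) (auto simp: \<eta>'_def)
  also have "Q a a * ?y a * ?y a = Q a a * (\<theta> a)\<^sup>2" using e2 by (simp add: \<eta>'_def power2_eq_square)
  finally show ?thesis by simp
 qed
 moreover have "0 <= e * (\<theta> a * u)" by (simp add: e_def)
 moreover have "(\<Sum>i\<in>insert a C. Q i i * (\<theta> i)\<^sup>2) = Q a a * (\<theta> a)\<^sup>2 + (\<Sum>i\<in>C. Q i i * (\<theta> i)\<^sup>2)" using insert by simp
 ultimately have "(\<Sum>i\<in>insert a C. Q i i * (\<theta> i)\<^sup>2) <= quad (insert a C) Q ?y ?y" using le by linarith
 moreover have "\<forall>i. \<eta>' i \<in> {-1, 1}" using \<eta> by (auto simp: \<eta>'_def e_def)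
 ultimately show ?case by blast
qed

lemma projection_residual:
 assumes P: "P \<in> orth_projections d m"
  and Q_def: "Q = (\<lambda>i j. (if i = j then 1 else 0) - (if i < d \<and> j < d then P $$ (i, j) else 0))"
 shows "Q i j = Q j i"
  "(\<Sum>i<d. (x i - (P *\<^sub>v vec d x) $ i)\<^sup>2) = quad {..<d} Q x x"
  "i < d ==> 0 <= Q i i"
proof -
 have carr: "P \<in> carrier_mat d d" and idem: "P * P = P" and tr: "transpose_mat P = P"
  using P by (auto simp: orth_projections_def)
 have sym: "P $$ (i, j) = P $$ (j, i)" if "i < d" "j < d" for i j
  using arg_cong[OF tr, of "\<lambda>A. A $$ (i, j)"] that carr by simp
 have idem': "(\<Sum>l<d. P $$ (i, l) * P $$ (l, j)) = P $$ (i, j)" if "i < d" "j < d" for i j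
 proof -
  have "(P * P) $$ (i, j) = (\<Sum>l<d. P $$ (i, l) * P $$ (l, j))"
   using carr that by (auto simp: scalar_prod_def atLeast0LessThan intro!: sum.cong)
  then show ?thesis by (simp add: idem)
 qed
 show Qsym: "Q i j = Q j i" for i j using sym[of i j] by (simp add: Q_def)
 have Qx: "x i - (P *\<^sub>v vec d x) $ i = (\<Sum>j<d. Q i j * x j)" if "i < d" for i
 proof -
  have "(P *\<^sub>v vec d x) $ i = (\<Sum>j<d. P $$ (i, j) * x j)"
   using carr that by (auto simp: scalar_prod_def atLeast0LessThan intro!: sum.cong)
  moreover have "(\<Sum>j<d. Q i j * x j) = (\<Sum>j<d. (if j = i then x j else 0) - P $$ (i, j) * x j)"
   using that by (intro sum.cong) (auto simp: Q_def left_diff_distrib)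
  ultimately show ?thesis using that by (simp add: sum_subtractf)
 qed
 have QQ: "(\<Sum>i<d. Q i j * Q i l) = Q j l" if j: "j < d" and l: "l < d" for j l
 proof -
  have "Q i j * Q i l = (if i = j then (if i = l then 1 else 0) else 0)
    - (if i = j then P $$ (i, l) else 0) - (if i = l then P $$ (i, j) else 0) + P $$ (i, j) * P $$ (i, l)"
   if "i < d" for i
   using j l that by (cases "i = j"; cases "i = l") (simp_all add: Q_def left_diff_distrib right_diff_distrib)
  then have "(\<Sum>i<d. Q i j * Q i l) = (\<Sum>i<d. (if i = j then (if i = l then 1 else 0) else 0)
    - (if i = j then P $$ (i, l) else 0) - (if i = l then P $$ (i, j) else 0) + P $$ (i, j) * P $$ (i, l))"
   by (intro sum.cong) auto
  also have "\<dots> = (if j = l then 1 else 0) - P $$ (j, l) - P $$ (l, j) + (\<Sum>i<d. P $$ (i, j) * P $$ (i, l))"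
   using j l by (simp add: sum.distrib sum_subtractf)
  also have "(\<Sum>i<d. P $$ (i, j) * P $$ (i, l)) = (\<Sum>i<d. P $$ (j, i) * P $$ (i, l))"
   by (rule sum.cong[OF refl]) (simp only: lessThan_iff sym[OF _ j])
  also have "\<dots> = P $$ (j, l)" by (rule idem'[OF j l])
  finally show ?thesis using j l sym[OF j l] by (simp add: Q_def)
 qed
 have "(\<Sum>i<d. (x i - (P *\<^sub>v vec d x) $ i)\<^sup>2) = (\<Sum>i<d. \<Sum>j<d. \<Sum>l<d. Q i j * Q i l * x j * x l)"
 proof (rule sum.cong[OF refl])
  fix i assume "i \<in> {..<d}"
  then have "(x i - (P *\<^sub>v vec d x) $ i)\<^sup>2 = (\<Sum>j<d. Q i j * x j) * (\<Sum>l<d. Q i l * x l)"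
   using Qx[of i] by (simp only: lessThan_iff power2_eq_square)
  also have "\<dots> = (\<Sum>j<d. \<Sum>l<d. (Q i j * x j) * (Q i l * x l))" by (rule sum_product)
  finally show "(x i - (P *\<^sub>v vec d x) $ i)\<^sup>2 = (\<Sum>j<d. \<Sum>l<d. Q i j * Q i l * x j * x l)"
   by (simp only: mult_ac)
 qed
 also have "\<dots> = (\<Sum>j<d. \<Sum>i<d. \<Sum>l<d. Q i j * Q i l * x j * x l)" by (rule sum.swap)
 also have "\<dots> = (\<Sum>j<d. \<Sum>l<d. \<Sum>i<d. Q i j * Q i l * x j * x l)" by (rule sum.cong[OF refl], rule sum.swap)
 also have "\<dots> = quad {..<d} Q x x"
  unfolding quad_def by (intro sum.cong refl) (simp add: sum_distrib_right[symmetric] QQ)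
 finally show "(\<Sum>i<d. (x i - (P *\<^sub>v vec d x) $ i)\<^sup>2) = quad {..<d} Q x x" .
 assume i: "i < d"
 have "Q i i = (\<Sum>l<d. (Q l i)\<^sup>2)" using QQ[OF i i] by (simp add: power2_eq_square)
 then show "0 <= Q i i" by (simp add: sum_nonneg)
qed

text \<open>At most 2 m diagonal entries of P exceed 1/2, because they are nonnegative with sum m.
  On the other coordinates the residual form I - P has diagonal at least 1/2, and a suitable choice
  of signs, which stays in \<open>K\<close>, makes the residual dominate the diagonal part.\<close>

lemma coordinate_tail:
 assumes K: "QCO d K" and d: "1 <= d" and P: "P \<in> orth_projections d m"
  and W: "\<And>\<theta>. \<theta> \<in> K ==> L2_set (\<lambda>i. \<theta> i - (P *\<^sub>v vec d \<theta>) $ i) {..<d} <= b"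
 shows "\<exists>S. S \<subseteq> {..<d} \<and> 1 <= card S \<and> card S <= 2 * m + 1 \<and> (\<forall>\<theta>\<in>K. (\<Sum>i\<in>{..<d} - S. (\<theta> i)\<^sup>2) <= 2 * b\<^sup>2)"
proof (intro exI conjI ballI)
 define Q where "Q = (\<lambda>i j. (if i = j then 1 else 0) - (if i < d \<and> j < d then P $$ (i, j) else 0 :: real))"
 note Q = projection_residual[OF P Q_def]
 let ?H = "{i. i < d \<and> 1/2 < P $$ (i, i)}" 
 \<comment> \<open>Coordinate 0 is added only to make the set nonempty; it is the 1 in 2 m +
   1.\<close>
 let ?S = "insert 0 ?H"
 have P0: "0 <= P $$ (i, i)" if "i < d" for i
 proof -
  have carr: "P \<in> carrier_mat d d" and idem: "P * P = P" and tr: "transpose_mat P = P"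
   using P by (auto simp: orth_projections_def)
  have "P $$ (i, i) = (P * transpose_mat P) $$ (i, i)" by (simp add: idem tr)
  also have "\<dots> = (\<Sum>j<d. P $$ (i, j) * P $$ (i, j))"
   using carr that by (auto simp: scalar_prod_def atLeast0LessThan intro!: sum.cong)
  also have "0 <= \<dots>" by (intro sum_nonneg) simp
  finally show ?thesis .
 qed
 show "?S \<subseteq> {..<d}" using d by auto
 have "finite ?H" by simp
 then show "1 <= card ?S" by (simp add: Suc_le_eq card_gt_0_iff)
 have "real (card ?H) * (1/2) <= (\<Sum>i\<in>?H. P $$ (i, i))"
  by (rule sum_bounded_below) auto
 also have "\<dots> <= (\<Sum>i<d. P $$ (i, i))" using P0 by (intro sum_mono2) auto
 also have "\<dots> = real m" by (rule trace_projection[OF P])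
 finally have "card ?H <= 2 * m" by simp
 moreover have "card ?S <= Suc (card ?H)" by (rule card_insert_le_m1) simp_all
 ultimately show "card ?S <= 2 * m + 1" by simp
 fix \<theta> assume \<theta>: "\<theta> \<in> K"
 obtain \<eta> where \<eta>: "\<forall>i. \<eta> i \<in> {-1, 1}"
  and le: "(\<Sum>i<d. Q i i * (\<theta> i)\<^sup>2) <= quad {..<d} Q (\<lambda>i. \<eta> i * \<theta> i) (\<lambda>i. \<eta> i * \<theta> i)"
  using signs_diagonal[of "{..<d}" Q \<theta>, OF finite_lessThan Q(1)] by (elim exE conjE) (rule that)
 define \<theta>' where "\<theta>' = (\<lambda>i\<in>{..<d}. \<eta> i * \<theta> i)"
 have "\<forall>\<theta>\<in>K. \<forall>\<eta>. (\<forall>i<d. \<eta> i \<in> {-1, 1}) --> (\<lambda>i\<in>{..<d}. \<eta> i * \<theta> i) \<in> K"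
  using K unfolding QCO_def by (elim conjE)
 from this[rule_format, OF \<theta>, of \<eta>] have "\<theta>' \<in> K" using \<eta> unfolding \<theta>'_def by simp
 from W[OF this] have "(L2_set (\<lambda>i. \<theta>' i - (P *\<^sub>v vec d \<theta>') $ i) {..<d})\<^sup>2 <= b\<^sup>2"
  by (intro power_mono) (auto simp: L2_set_nonneg)
 then have "quad {..<d} Q \<theta>' \<theta>' <= b\<^sup>2"
  unfolding Q(2)[symmetric] L2_set_def by (simp add: sum_nonneg)
 moreover have "quad {..<d} Q \<theta>' \<theta>' = quad {..<d} Q (\<lambda>i. \<eta> i * \<theta> i) (\<lambda>i. \<eta> i * \<theta> i)"
  unfolding quad_def by (intro sum.cong) (auto simp: \<theta>'_def)
 ultimately have bd: "(\<Sum>i<d. Q i i * (\<theta> i)\<^sup>2) <= b\<^sup>2" using le by linarith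
 have "(\<Sum>i\<in>{..<d} - ?S. (\<theta> i)\<^sup>2) <= (\<Sum>i\<in>{..<d} - ?S. 2 * (Q i i * (\<theta> i)\<^sup>2))"
 proof (rule sum_mono)
  fix i assume "i \<in> {..<d} - ?S"
  then have "1 <= 2 * Q i i" by (auto simp: Q_def)
  from mult_right_mono[OF this, of "(\<theta> i)\<^sup>2"] show "(\<theta> i)\<^sup>2 <= 2 * (Q i i * (\<theta> i)\<^sup>2)" by simp
 qed
 also have "\<dots> <= (\<Sum>i<d. 2 * (Q i i * (\<theta> i)\<^sup>2))" using Q(3) by (intro sum_mono2) auto
 also have "\<dots> <= 2 * b\<^sup>2" using bd by (simp add: sum_distrib_left[symmetric])
 finally show "(\<Sum>i\<in>{..<d} - ?S. (\<theta> i)\<^sup>2) <= 2 * b\<^sup>2" .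
qed

text \<open>The infimum in the width need not be attained, so the tail is bounded through every b
  strictly above it. At m = d all coordinates can be taken; the tail is then empty and any b will
  do.\<close>

definition good_coords :: "nat \<Rightarrow> (nat \<Rightarrow> real) set \<Rightarrow> nat \<Rightarrow> nat set \<Rightarrow> bool" where
 "good_coords d K m S \<longleftrightarrow> S \<subseteq> {..<d} \<and> 1 <= card S \<and> card S <= 2 * m + 1 \<and>
  (\<forall>b>0. m = d \<or> kolmogorov_width d K (int m) < ennreal b -->
    (\<forall>\<theta>\<in>K. (\<Sum>i\<in>{..<d} - S. (\<theta> i)\<^sup>2) <= 2 * b\<^sup>2))"

text \<open>One coordinate set serves all bounds on the width, because there are only finitely many.\<close>

lemma good_coords_exist:
 assumes K: "QCO d K" and d: "1 <= d" and m: "m <= d"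
 shows "\<exists>S. good_coords d K m S"
proof (cases "m = d")
 case True
 then show ?thesis using d by (intro exI[of _ "{..<d}"]) (auto simp: good_coords_def)
next
 case False
 let ?F = "{S. S \<subseteq> {..<d} \<and> 1 <= card S \<and> card S <= 2 * m + 1}"
 let ?T = "\<lambda>b S. \<forall>\<theta>\<in>K. (\<Sum>i\<in>{..<d} - S. (\<theta> i)\<^sup>2) <= 2 * b\<^sup>2"
 have one: "\<exists>S\<in>?F. ?T b S" if b: "0 < b" "kolmogorov_width d K (int m) < ennreal b" for b :: real
 proof -
  have "(INF P\<in>orth_projections d m. SUP \<theta>\<in>K. ennreal (L2_set (\<lambda>i. \<theta> i - vec_index (P *\<^sub>v vec d \<theta>) i) {..<d})) < ennreal b"
   using b m by (simp add: kolmogorov_width_def)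
  then obtain P where P: "P \<in> orth_projections d m"
   and lt: "(SUP \<theta>\<in>K. ennreal (L2_set (\<lambda>i. \<theta> i - vec_index (P *\<^sub>v vec d \<theta>) i) {..<d})) < ennreal b"
   unfolding INF_less_iff by blast
  have "L2_set (\<lambda>i. \<theta> i - (P *\<^sub>v vec d \<theta>) $ i) {..<d} <= b" if "\<theta> \<in> K" for \<theta>
  proof -
   have "ennreal (L2_set (\<lambda>i. \<theta> i - (P *\<^sub>v vec d \<theta>) $ i) {..<d}) < ennreal b"
    by (rule le_less_trans[OF SUP_upper[OF that] lt])
   then show ?thesis using b by (simp add: L2_set_nonneg ennreal_less_iff)
  qed
  from coordinate_tail[OF K d P this] show ?thesis by blast
 qed
 show ?thesis
 proof (rule ccontr)
  assume "\<nexists>S. good_coords d K m S"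
  then have "\<forall>S\<in>?F. \<exists>b. 0 < b \<and> kolmogorov_width d K (int m) < ennreal b \<and> \<not> ?T b S"
  proof (intro ballI)
   fix S assume S: "S \<in> ?F"
   have "\<not> good_coords d K m S" using \<open>\<nexists>S. good_coords d K m S\<close> by simp
   then show "\<exists>b. 0 < b \<and> kolmogorov_width d K (int m) < ennreal b \<and> \<not> ?T b S"
    using S False unfolding good_coords_def by simp
  qed
  from bchoice[OF this] obtain b where
   "\<forall>S\<in>?F. 0 < b S \<and> kolmogorov_width d K (int m) < ennreal (b S) \<and> \<not> ?T (b S) S" by (elim exE)
  then have b: "\<And>S. S \<in> ?F ==> 0 < b S \<and> kolmogorov_width d K (int m) < ennreal (b S) \<and> \<not> ?T (b S) S" by (rule bspec)
  have fin: "finite ?F" by simp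
  have "{0} \<in> ?F" using d by simp
  then have "?F \<noteq> {}" by (rule ex_in_conv[THEN iffD1, OF exI])
  then have ne: "b ` ?F \<noteq> {}" by (simp only: image_is_empty not_False_eq_True)
  define b0 where "b0 = Min (b ` ?F)"
  have "b0 \<in> b ` ?F" unfolding b0_def using fin ne by (intro Min_in finite_imageI)
  then obtain S0 where "S0 \<in> ?F" "b0 = b S0" by (rule imageE)
  then have "0 < b0" "kolmogorov_width d K (int m) < ennreal b0" using b[of S0] by simp_all
  from one[OF this] obtain S where S: "S \<in> ?F" "?T b0 S" by blast
  have "b0 <= b S" unfolding b0_def using fin S by (intro Min_le finite_imageI imageI)
  then have "b0\<^sup>2 <= (b S)\<^sup>2" using \<open>0 < b0\<close> by (intro power_mono) auto
  then have "2 * b0\<^sup>2 <= 2 * (b S)\<^sup>2" by simp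
  then have "?T (b S) S" using S(2) by (meson order_trans)
  then show False using b[OF S(1)] by (elim conjE notE)
 qed
qed

text \<open>The choice depends on d, \<open>K\<close> and m alone, so a test may have it
  hard-wired.\<close>

definition coords :: "nat \<Rightarrow> (nat \<Rightarrow> real) set \<Rightarrow> nat \<Rightarrow> nat set" where
 "coords d K m = (SOME S. good_coords d K m S)"

lemma good_coords: "QCO d K ==> 1 <= d ==> m <= d ==> good_coords d K m (coords d K m)"
 unfolding coords_def using good_coords_exist by (rule someI_ex)

section \<open>The program of the filter\<close>

text \<open>The expectation of the total of the shifted Gram matrix of pure noise.\<close>

definition noise_free_total :: "nat \<Rightarrow> nat \<Rightarrow> real" where
 "noise_free_total N s = (real s - shift_of N s) * real N"

text \<open>If \<open>\<epsilon> * N < 1\<close>, nothing is corrupted, and the test compares the total with its mean.\<close>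

definition filter_rejects ::
 "nat \<Rightarrow> nat \<Rightarrow> (nat \<Rightarrow> nat \<Rightarrow> real) \<Rightarrow> real \<Rightarrow> real \<Rightarrow> real \<Rightarrow> bool" where
 "filter_rejects N s A e D P \<longleftrightarrow>
  (let \<Delta> = D / 32000;
     w = if 1 <= e then clip N A (D / 32) (weights N s A e \<Delta> N) else (\<lambda>_. 1) in
   (1 <= e \<and> violated N s A \<Delta> (weights N s A e \<Delta> (N - 1))) \<or>
   (\<Sum>i<N. w i) < real N - 140 * e \<or>
   P / 4 < quad {..<N} A w w - noise_free_total N s)"

abbreviation "ent i j \<equiv> NAdd (NMul (NV i) (NV 0)) (NV j)"
text \<open>The entry of sample \<open>i\<close> at the coordinate held in variable 6: behind nine
  header numbers and the hard-wired coordinates lie the data in rows of length d.\<close>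

abbreviation "dat i \<equiv> NAdd (NAdd (NC 9) (NV 2)) (NAdd (NMul (NV i) (NV 1)) (NV 6))"
abbreviation "sumR r v n c \<equiv> Seq (RSet r (RC 0)) (For v n c)"
abbreviation "accu r e \<equiv> RSet r (RAdd (RV r) e)"
abbreviation "rsN \<equiv> RN (NV 0)"
abbreviation "rss \<equiv> RN (NV 2)"

text \<open>Natural variables 0, 1, 2 hold N, d and the number of coordinates. Array 0 is the
  shifted Gram matrix, 1 and 2 the current and previous power, 3 the weights, 4 the scores, 5 and 6
  the row contributions to the two powers, and 7 the final weights.\<close>

definition "load_prog = Seq (LdN 0 (NC 0)) (Seq (LdN 1 (NC 1)) (LdN 2 (NC 8)))"

definition "gram_prog = For 3 0 (For 4 0 (Seq
  (sumR 1 5 2 (Seq (LdN 6 (NAdd (NC 9) (NV 5))) (Seq (RSet 14 (Inp (dat 3)))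
   (accu 1 (RDiv (RMul (RV 14) (Inp (dat 4))) (RMul (Inp (NC 2)) (Inp (NC 2))))))))
  (Seq (IfLe rss rsN Skip (IfLe (RN (NV 3)) (RN (NV 4)) (IfLe (RN (NV 4)) (RN (NV 3)) (RSet 1 (RSub (RV 1) rss)) Skip) Skip))
   (ASet 0 (ent 3 4) (RV 1)))))"

text \<open>Real variables 2, 3, 4, 5 hold e, D, \<Delta> and the ratio bound, 6 and 7 the two
  totals, 8 the flag of a violation, 12 the threshold P and 13 the expected noise total.\<close>

definition "param_prog = Seq (RSet 2 (RMul (Inp (NC 3)) rsN))
  (Seq (RSet 1 (RDiv (RMul (Inp (NC 5)) (Inp (NC 5))) (RMul (Inp (NC 2)) (Inp (NC 2)))))
  (Seq (RSet 3 (RDiv (RMul rsN (RV 1)) (Inp (NC 3))))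
  (Seq (RSet 4 (RDiv (RV 3) (RC 32000)))
  (Seq (IfLe rss rsN (RSet 5 (RMul (RAdd rsN (RV 4)) (RAdd rsN (RV 4)))) (RSet 5 (RMul (RV 4) (RV 4))))
  (Seq (RSet 12 (RMul (RMul rsN rsN) (RV 1)))
  (Seq (IfLe rss rsN (RSet 13 (RMul rss rsN)) (RSet 13 (RC 0)))
  (RSet 8 (RC 0))))))))"

definition "init_prog = For 3 0 (ASet 3 (NV 3) (RC 1))"

definition "copy_prog = For 3 0 (For 4 0 (ASet 1 (ent 3 4) (Arr 0 (ent 3 4))))"
definition "shift_prog = For 3 0 (For 4 0 (ASet 2 (ent 3 4) (Arr 1 (ent 3 4))))"
definition "mult_prog = For 3 0 (For 4 0 (Seq
  (sumR 1 5 0 (accu 1 (RMul (RMul (Arr 0 (ent 3 5)) (Arr 3 (NV 5))) (Arr 2 (ent 5 4)))))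
  (ASet 1 (ent 3 4) (RV 1))))"
definition "power_prog = Seq copy_prog (For 7 0 (Seq shift_prog mult_prog))"

definition "score_prog q r = For 3 0 (Seq
  (sumR 1 4 0 (accu 1 (RMul (Arr 3 (NV 4)) (RMul (Arr q (ent 3 4)) (Arr q (ent 3 4))))))
  (ASet r (NV 3) (RV 1)))"
definition "total_prog x q = sumR x 3 0 (accu x (RMul (Arr 3 (NV 3)) (Arr q (NV 3))))"

definition "combine_prog = For 3 0 (IfLe rss rsN
  (IfLe (Arr 5 (NV 3)) (RDiv (RMul (RV 4) (RV 6)) (RMul (RMul (RC 4) (RV 2)) (RAdd rsN (RV 4))))
   (ASet 4 (NV 3) (RC 0)) (ASet 4 (NV 3) (Arr 5 (NV 3))))
  (ASet 4 (NV 3) (RAdd (RMul (Arr 5 (NV 3)) (RV 7)) (RMul (Arr 6 (NV 3)) (RV 6)))))"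
definition "max_prog = Seq (RSet 9 (RC 0)) (For 3 0 (IfLe (Arr 3 (NV 3)) (RC 0) Skip
  (IfLe (Arr 4 (NV 3)) (RV 9) Skip (RSet 9 (Arr 4 (NV 3))))))"
definition "reweight_prog = For 3 0 (ASet 3 (NV 3)
  (RMul (Arr 3 (NV 3)) (RSub (RC 1) (RDiv (Arr 4 (NV 3)) (RV 9)))))"
definition "down_prog = IfLe (RV 6) (RMul (RV 5) (RV 7)) (RSet 8 (RC 0))
  (Seq (RSet 8 (RC 1)) (Seq combine_prog (Seq max_prog reweight_prog)))"

definition "round_prog = Seq power_prog (Seq (score_prog 1 5) (Seq (score_prog 2 6)
  (Seq (total_prog 6 5) (Seq (total_prog 7 6) down_prog))))"
definition "filter_prog = For 8 0 round_prog"

definition "clip_prog = For 3 0 (Seq (sumR 1 4 0 (accu 1 (RMul (Arr 0 (ent 3 4)) (Arr 3 (NV 4)))))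
  (IfLe (RV 1) (RDiv (RV 3) (RC 32)) (IfLe (RSub (RC 0) (RDiv (RV 3) (RC 32))) (RV 1)
   (ASet 7 (NV 3) (Arr 3 (NV 3))) (ASet 7 (NV 3) (RC 0))) (ASet 7 (NV 3) (RC 0))))"
definition "ones_prog = For 3 0 (ASet 7 (NV 3) (RC 1))"
definition "mass_prog = sumR 10 3 0 (accu 10 (Arr 7 (NV 3)))"
definition "stat_prog = sumR 11 3 0 (Seq
  (sumR 1 4 0 (accu 1 (RMul (RMul (Arr 0 (ent 3 4)) (Arr 7 (NV 3))) (Arr 7 (NV 4)))))
  (accu 11 (RV 1)))"
definition "decide_prog = IfLe (RV 8) (RC 0)
  (IfLe (RSub rsN (RMul (RC 140) (RV 2))) (RV 10)
   (IfLe (RSub (RV 11) (RV 13)) (RDiv (RV 12) (RC 4)) (RSet 0 (RC 0)) (RSet 0 (RC 1)))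
   (RSet 0 (RC 1)))
  (RSet 0 (RC 1))"

definition "main_prog = Seq gram_prog (Seq param_prog (Seq init_prog
  (Seq (IfLe (RC 1) (RV 2) (Seq filter_prog clip_prog) ones_prog)
  (Seq mass_prog (Seq stat_prog decide_prog)))))"

lemmas prog_defs = gram_prog_def param_prog_def init_prog_def copy_prog_def shift_prog_def mult_prog_def
 power_prog_def score_prog_def total_prog_def combine_prog_def max_prog_def reweight_prog_def down_prog_def
 round_prog_def filter_prog_def clip_prog_def ones_prog_def mass_prog_def stat_prog_def decide_prog_def
 main_prog_def

text \<open>The loops of the main part run up to N or to the number of coordinates, never up to d:
  only the selected coordinates of the data are read. This keeps the running time free of d.\<close>

lemma wf_progs: "wfc load_prog" "wfc main_prog" "written load_prog \<inter> bounds load_prog = {}"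
 "written main_prog \<inter> bounds main_prog = {}" "bounds main_prog = {0, 2}" "bounds load_prog = {}"
 by (auto simp: prog_defs load_prog_def)

section \<open>Verification of the program\<close>

context
 fixes I :: "nat \<Rightarrow> real" and L N :: nat
begin

lemma copy_run: "nv s 0 = N ==>
  tc I L copy_prog s (\<lambda>t. \<forall>a<N. \<forall>b<N. ar t 1 (a * N + b) = ar s 0 (a * N + b))"
 unfolding copy_prog_def
 using tc_mfill[of 3 4 "ASet 1 (ent 3 4) (Arr 0 (ent 3 4))" 0 s I L 1 "\<lambda>a b. ar s 0 (a * N + b)"]
 by (simp add: tc_simps frame_def)

lemma shift_run: "nv s 0 = N ==>
  tc I L shift_prog s (\<lambda>t. \<forall>a<N. \<forall>b<N. ar t 2 (a * N + b) = ar s 1 (a * N + b))"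
 unfolding shift_prog_def
 using tc_mfill[of 3 4 "ASet 2 (ent 3 4) (Arr 1 (ent 3 4))" 0 s I L 2 "\<lambda>a b. ar s 1 (a * N + b)"]
 by (simp add: tc_simps frame_def)

lemma mult_run:
 assumes N: "nv s 0 = N"
 shows "tc I L mult_prog s (\<lambda>t. \<forall>a<N. \<forall>b<N. ar t 1 (a * N + b) =
  (\<Sum>l<N. ar s 0 (a * N + l) * ar s 3 l * ar s 2 (l * N + b)))"
 unfolding mult_prog_def N[symmetric]
proof (rule tc_mfill)
 fix a b t
 assume ab: "nv t 3 = a" "nv t 4 = b" and fr: "frame (For 3 0 (For 4 0 (Seq
  (sumR 1 5 0 (accu 1 (RMul (RMul (Arr 0 (ent 3 5)) (Arr 3 (NV 5))) (Arr 2 (ent 5 4)))))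
  (ASet 1 (ent 3 4) (RV 1))))) s t"
 from fr have f: "nv t 0 = nv s 0" "ar t 0 = ar s 0" "ar t 2 = ar s 2" "ar t 3 = ar s 3" by (simp_all add: frame_def)
 show "tc I L (Seq (sumR 1 5 0 (accu 1 (RMul (RMul (Arr 0 (ent 3 5)) (Arr 3 (NV 5))) (Arr 2 (ent 5 4)))))
   (ASet 1 (ent 3 4) (RV 1))) t (\<lambda>u. ar u 1 = (ar t 1)(a * nv s 0 + b :=
    (\<Sum>l<nv s 0. ar s 0 (a * nv s 0 + l) * ar s 3 l * ar s 2 (l * nv s 0 + b))))"
 proof (rule tc_SeqI[OF tc_sum[where F = "\<lambda>l. ar s 0 (a * nv s 0 + l) * ar s 3 l * ar s 2 (l * nv s 0 + b)"]])
  fix u assume "frame (sumR 1 5 0 (accu 1 (RMul (RMul (Arr 0 (ent 3 5)) (Arr 3 (NV 5))) (Arr 2 (ent 5 4))))) t u"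
   "rv u 1 = (\<Sum>l<nv t 0. ar s 0 (a * nv s 0 + l) * ar s 3 l * ar s 2 (l * nv s 0 + b))"
  then show "tc I L (ASet 1 (ent 3 4) (RV 1)) u (\<lambda>u. ar u 1 = (ar t 1)(a * nv s 0 + b :=
    (\<Sum>l<nv s 0. ar s 0 (a * nv s 0 + l) * ar s 3 l * ar s 2 (l * nv s 0 + b))))"
   using ab f by (simp add: tc_simps frame_def)
 qed (use ab f in \<open>simp add: tc_simps frame_def\<close>)
qed simp_all

lemma score_run:
 assumes N: "nv s 0 = N" and qr: "q \<noteq> r" "r \<noteq> 3"
 shows "tc I L (score_prog q r) s (\<lambda>t. \<forall>a<N. ar t r a = (\<Sum>j<N. ar s 3 j * (ar s q (a * N + j))\<^sup>2))"
 unfolding score_prog_def N[symmetric]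
proof (rule tc_vfill)
 let ?b = "sumR 1 4 0 (accu 1 (RMul (Arr 3 (NV 4)) (RMul (Arr q (ent 3 4)) (Arr q (ent 3 4)))))"
 fix a t
 assume ab: "nv t 3 = a" and fr: "frame (For 3 0 (Seq ?b (ASet r (NV 3) (RV 1)))) s t"
 from fr qr have f: "nv t 0 = nv s 0" "ar t q = ar s q" "ar t 3 = ar s 3" by (simp_all add: frame_def)
 show "tc I L (Seq ?b (ASet r (NV 3) (RV 1))) t
   (\<lambda>u. ar u r = (ar t r)(a := (\<Sum>j<nv s 0. ar s 3 j * (ar s q (a * nv s 0 + j))\<^sup>2)))"
 proof (rule tc_SeqI[OF tc_sum[where F = "\<lambda>j. ar s 3 j * (ar s q (a * nv s 0 + j))\<^sup>2"]])
  fix u assume "frame ?b t u" "rv u 1 = (\<Sum>j<nv t 0. ar s 3 j * (ar s q (a * nv s 0 + j))\<^sup>2)"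
  then show "tc I L (ASet r (NV 3) (RV 1)) u (\<lambda>u. ar u r = (ar t r)(a := (\<Sum>j<nv s 0. ar s 3 j * (ar s q (a * nv s 0 + j))\<^sup>2)))"
   using ab f by (simp add: tc_simps frame_def)
 qed (use ab f in \<open>simp add: tc_simps frame_def power2_eq_square\<close>)
qed

lemma total_run:
 assumes N: "nv s 0 = N"
 shows "tc I L (total_prog x q) s (\<lambda>t. rv t x = (\<Sum>i<N. ar s 3 i * ar s q i))"
 unfolding total_prog_def N[symmetric] by (rule tc_sum) (simp add: tc_simps frame_def)

lemma max_run:
 assumes N: "nv s 0 = N"
 shows "tc I L max_prog s (\<lambda>t. rv t 9 = max_score N (ar s 3) (ar s 4))"
proof -
 let ?f = "\<lambda>i m. if ar s 3 i <= 0 then m else if ar s 4 i <= m then m else ar s 4 i"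
 let ?s = "s\<lparr>rv := (rv s)(9 := 0)\<rparr>"
 have "tc I L (For 3 0 (IfLe (Arr 3 (NV 3)) (RC 0) Skip
   (IfLe (Arr 4 (NV 3)) (RV 9) Skip (RSet 9 (Arr 4 (NV 3)))))) ?s (\<lambda>t. rv t 9 = fold ?f [0..<nv ?s 0] 0)"
  by (rule tc_For[where P = "\<lambda>k t. rv t 9 = fold ?f [0..<k] 0"]) (auto simp: tc_simps frame_def)
 then show ?thesis by (simp add: max_prog_def tc_Seq tc_simps max_score_def N)
qed

lemma max_score_cong:
 assumes "\<And>i. i < n ==> w i = w' i" "\<And>i. i < n ==> g i = g' i"
 shows "max_score n w g = max_score n w' g'"
 unfolding max_score_def by (rule List.fold_cong) (use assms in \<open>auto simp: fun_eq_iff\<close>)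

text \<open>The old power is copied before each multiplication, so that both of the last two powers
  are available at the end. The alternative \<open>k = 0\<close> of the invariant reflects that
  nothing has been copied before the first round.\<close>

lemma power_run:
 assumes N: "nv s 0 = N" "0 < N" and A: "\<forall>i<N. \<forall>j<N. ar s 0 (i * N + j) = A i j" and w: "\<forall>i<N. ar s 3 i = w i"
 shows "tc I L power_prog s (\<lambda>t. (\<forall>i<N. \<forall>j<N. ar t 1 (i * N + j) = mpow N A w N i j) \<and>
  (\<forall>i<N. \<forall>j<N. ar t 2 (i * N + j) = mpow N A w (N - 1) i j))"
 unfolding power_prog_def
proof (rule tc_SeqI[OF copy_run[OF N(1)]])
 fix t assume fr: "frame copy_prog s t" and c: "\<forall>a<N. \<forall>b<N. ar t 1 (a * N + b) = ar s 0 (a * N + b)"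
 let ?P = "\<lambda>k t. (\<forall>i<N. \<forall>j<N. ar t 1 (i * N + j) = mpow N A w k i j) \<and>
  (k = 0 \<or> (\<forall>i<N. \<forall>j<N. ar t 2 (i * N + j) = mpow N A w (k - 1) i j))"
 have f: "nv t 0 = N" "ar t 0 = ar s 0" "ar t 3 = ar s 3"
  using fr N(1) by (simp_all add: frame_def copy_prog_def)
 have "tc I L (For 7 0 (Seq shift_prog mult_prog)) t (?P (nv t 0))"
 proof (rule tc_For)
  show "?P 0 (t\<lparr>nv := (nv t)(7 := 0)\<rparr>)" using c A by (simp add: mpow_def)
 next
  fix k u assume k: "k < nv t 0" "nv u 7 = k" and fu: "frame (For 7 0 (Seq shift_prog mult_prog)) t u" and P: "?P k u"
  have fu': "nv u 0 = N" "ar u 0 = ar s 0" "ar u 3 = ar s 3"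
   using fu f by (simp_all add: frame_def shift_prog_def mult_prog_def)
  show "tc I L (Seq shift_prog mult_prog) u (\<lambda>x. ?P (Suc k) (x\<lparr>nv := (nv x)(7 := Suc k)\<rparr>))"
  proof (rule tc_SeqI[OF shift_run[OF fu'(1)]])
   fix x assume fx: "frame shift_prog u x" and X: "\<forall>a<N. \<forall>b<N. ar x 2 (a * N + b) = ar u 1 (a * N + b)"
   have fx': "nv x 0 = N" "ar x 0 = ar s 0" "ar x 3 = ar s 3"
    using fx fu' by (simp_all add: frame_def shift_prog_def)
   have x2: "\<forall>i<N. \<forall>j<N. ar x 2 (i * N + j) = mpow N A w k i j" using X P by simp
   show "tc I L mult_prog x (\<lambda>x. ?P (Suc k) (x\<lparr>nv := (nv x)(7 := Suc k)\<rparr>))"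
   proof (rule tc_mono[OF mult_run[OF fx'(1)]])
    fix y assume fy: "frame mult_prog x y" and Y: "\<forall>a<N. \<forall>b<N. ar y 1 (a * N + b) =
     (\<Sum>l<N. ar x 0 (a * N + l) * ar x 3 l * ar x 2 (l * N + b))"
    have "ar y 1 (a * N + b) = mpow N A w (Suc k) a b" if "a < N" "b < N" for a b
    proof -
     have "ar y 1 (a * N + b) = (\<Sum>l<N. A a l * w l * mpow N A w k l b)"
      using Y that by (simp add: fx' A w x2)
     then show ?thesis by (simp add: mpow_def mstep_def)
    qed
    moreover have "ar y 2 = ar x 2" using fy by (simp add: frame_def mult_prog_def)
    ultimately show "?P (Suc k) (y\<lparr>nv := (nv y)(7 := Suc k)\<rparr>)" using x2 by simp
   qed
  qed
 qed
 then show "tc I L (For 7 0 (Seq shift_prog mult_prog)) t (\<lambda>t. (\<forall>i<N. \<forall>j<N. ar t 1 (i * N + j) = mpow N A w N i j) \<and>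
  (\<forall>i<N. \<forall>j<N. ar t 2 (i * N + j) = mpow N A w (N - 1) i j))"
  by (rule tc_mono) (use f N in auto)
qed

lemma down_run:
 assumes N: "nv s 0 = N" and ss: "nv s 2 = ss" and w: "\<forall>i<N. ar s 3 i = w i"
  and p: "rv s 2 = e" "rv s 4 = \<Delta>" "rv s 5 = ratio_bound N ss \<Delta>"
  and a: "\<forall>i<N. ar s 5 i = new_score N A w i" and b: "\<forall>i<N. ar s 6 i = old_score N A w i"
  and n: "rv s 6 = new_total N A w" and n': "rv s 7 = old_total N A w"
 shows "tc I L down_prog s (\<lambda>t. (\<forall>i<N. ar t 3 i = downweight N ss A e \<Delta> w i) \<and>
  rv t 8 = of_bool (violated N ss A \<Delta> w))"
proof (cases "violated N ss A \<Delta> w")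
 case False
 then have "new_total N A w <= ratio_bound N ss \<Delta> * old_total N A w" by (simp add: violated_def)
 then show ?thesis using False w by (simp add: down_prog_def tc_simps n n' p downweight_def)
next
 case True
 then have le: "\<not> new_total N A w <= ratio_bound N ss \<Delta> * old_total N A w" by (simp add: violated_def)
 let ?g = "score N ss A e \<Delta> w"
 have "tc I L (Seq combine_prog (Seq max_prog reweight_prog)) (s\<lparr>rv := (rv s)(8 := 1)\<rparr>)
  (\<lambda>t. (\<forall>i<N. ar t 3 i = downweight N ss A e \<Delta> w i) \<and> rv t 8 = 1)" (is "tc I L _ ?s _")
 proof (rule tc_SeqI)
  have "tc I L combine_prog ?s (\<lambda>t. \<forall>a<nv ?s 0. ar t 4 a = ?g a)"
   unfolding combine_prog_def
   by (rule tc_vfill) (use N ss p a b n n' in \<open>simp add: tc_simps frame_def score_def\<close>)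
  then show "tc I L combine_prog ?s (\<lambda>t. \<forall>a<N. ar t 4 a = ?g a)" using N by simp
  fix t assume "frame combine_prog ?s t" and g: "\<forall>a<N. ar t 4 a = ?g a"
  then have f: "nv t 0 = N" "ar t 3 = ar s 3" "rv t 8 = 1"
   using N by (simp_all add: frame_def combine_prog_def)
  show "tc I L (Seq max_prog reweight_prog) t (\<lambda>t. (\<forall>i<N. ar t 3 i = downweight N ss A e \<Delta> w i) \<and> rv t 8 = 1)"
  proof (rule tc_SeqI[OF max_run[OF f(1)]])
   fix u assume fu: "frame max_prog t u" and m: "rv u 9 = max_score N (ar t 3) (ar t 4)"
   have fu': "nv u 0 = N" "ar u 3 = ar s 3" "ar u 4 = ar t 4" "rv u 8 = 1"
    using fu f by (simp_all add: frame_def max_prog_def)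
   have m': "rv u 9 = max_score N w ?g" unfolding m by (rule max_score_cong) (use f w g in auto)
   \<comment> \<open>Weights are overwritten in place, so the invariant also records that the
     entries not yet visited are still the old ones.\<close>
   have "tc I L reweight_prog u (\<lambda>t. \<forall>a<nv u 0. ar t 3 a = ar u 3 a * (1 - ar u 4 a / rv u 9))"
    unfolding reweight_prog_def
   proof (rule tc_For[where P = "\<lambda>k t. (\<forall>a<k. ar t 3 a = ar u 3 a * (1 - ar u 4 a / rv u 9)) \<and> (\<forall>a\<ge>k. ar t 3 a = ar u 3 a)", THEN tc_mono])
   qed (auto simp: tc_simps frame_def less_Suc_eq)
   then show "tc I L reweight_prog u (\<lambda>t. (\<forall>i<N. ar t 3 i = downweight N ss A e \<Delta> w i) \<and> rv t 8 = 1)"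
   proof (rule tc_mono)
    fix x assume fx: "frame reweight_prog u x" and X: "\<forall>a<nv u 0. ar x 3 a = ar u 3 a * (1 - ar u 4 a / rv u 9)"
    have "rv x 8 = 1" using fx fu' by (simp add: frame_def reweight_prog_def)
    moreover have "\<forall>i<N. ar x 3 i = downweight N ss A e \<Delta> w i"
     using X True by (simp add: fu' w g m' downweight_def)
    ultimately show "(\<forall>i<N. ar x 3 i = downweight N ss A e \<Delta> w i) \<and> rv x 8 = 1" by blast
   qed
  qed
 qed
 then show ?thesis using True le by (simp add: down_prog_def tc_simps tc_Seq n n' p)
qed

lemma round_run:
 assumes N: "nv s 0 = N" "0 < N" and ss: "nv s 2 = ss" and A: "\<forall>i<N. \<forall>j<N. ar s 0 (i * N + j) = A i j"
  and w: "\<forall>i<N. ar s 3 i = w i" and p: "rv s 2 = e" "rv s 4 = \<Delta>" "rv s 5 = ratio_bound N ss \<Delta>"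
 shows "tc I L round_prog s (\<lambda>t. (\<forall>i<N. ar t 3 i = downweight N ss A e \<Delta> w i) \<and>
  rv t 8 = of_bool (violated N ss A \<Delta> w))"
 unfolding round_prog_def
proof (rule tc_SeqI[OF power_run[OF N A w]])
 fix t1 assume fr1: "frame power_prog s t1" and R: "(\<forall>i<N. \<forall>j<N. ar t1 1 (i * N + j) = mpow N A w N i j) \<and>
  (\<forall>i<N. \<forall>j<N. ar t1 2 (i * N + j) = mpow N A w (N - 1) i j)"
 have f1: "nv t1 0 = N" "nv t1 2 = ss" "ar t1 3 = ar s 3" "rv t1 2 = e" "rv t1 4 = \<Delta>" "rv t1 5 = ratio_bound N ss \<Delta>"
  using fr1 N ss p by (simp_all add: frame_def power_prog_def copy_prog_def shift_prog_def mult_prog_def)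
 let ?Q = "\<lambda>t. (\<forall>i<N. ar t 3 i = downweight N ss A e \<Delta> w i) \<and> rv t 8 = of_bool (violated N ss A \<Delta> w)"
 show "tc I L (Seq (score_prog 1 5) (Seq (score_prog 2 6) (Seq (total_prog 6 5) (Seq (total_prog 7 6) down_prog)))) t1 ?Q"
 proof (rule tc_SeqI[OF score_run[OF f1(1)]])
  fix t2 assume fr2: "frame (score_prog 1 5) t1 t2"
   and a: "\<forall>a<N. ar t2 5 a = (\<Sum>j<N. ar t1 3 j * (ar t1 1 (a * N + j))\<^sup>2)"
  have f2: "nv t2 0 = N" "nv t2 2 = ss" "ar t2 3 = ar s 3" "rv t2 2 = e" "rv t2 4 = \<Delta>" "rv t2 5 = ratio_bound N ss \<Delta>"
   "ar t2 2 = ar t1 2"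
   using fr2 f1 by (simp_all add: frame_def score_prog_def)
  have a': "\<forall>i<N. ar t2 5 i = new_score N A w i" using a R by (simp add: new_score_def f1 w)
  show "tc I L (Seq (score_prog 2 6) (Seq (total_prog 6 5) (Seq (total_prog 7 6) down_prog))) t2 ?Q"
  proof (rule tc_SeqI[OF score_run[OF f2(1)]])
   fix t3 assume fr3: "frame (score_prog 2 6) t2 t3"
    and b: "\<forall>a<N. ar t3 6 a = (\<Sum>j<N. ar t2 3 j * (ar t2 2 (a * N + j))\<^sup>2)"
   have f3: "nv t3 0 = N" "nv t3 2 = ss" "ar t3 3 = ar s 3" "rv t3 2 = e" "rv t3 4 = \<Delta>" "rv t3 5 = ratio_bound N ss \<Delta>"
    "ar t3 5 = ar t2 5"
    using fr3 f2 by (simp_all add: frame_def score_prog_def)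
   have b': "\<forall>i<N. ar t3 6 i = old_score N A w i" using b R by (simp add: old_score_def f2 w)
   show "tc I L (Seq (total_prog 6 5) (Seq (total_prog 7 6) down_prog)) t3 ?Q"
   proof (rule tc_SeqI[OF total_run[OF f3(1)]])
    fix t4 assume fr4: "frame (total_prog 6 5) t3 t4" and n: "rv t4 6 = (\<Sum>i<N. ar t3 3 i * ar t3 5 i)"
    have f4: "nv t4 0 = N" "nv t4 2 = ss" "ar t4 = ar t3" "rv t4 2 = e" "rv t4 4 = \<Delta>" "rv t4 5 = ratio_bound N ss \<Delta>"
     using fr4 f3 by (simp_all add: frame_def total_prog_def fun_eq_iff)
    have n': "rv t4 6 = new_total N A w" using n a' by (simp add: new_total_def f3 w)
    show "tc I L (Seq (total_prog 7 6) down_prog) t4 ?Q"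
    proof (rule tc_SeqI[OF total_run[OF f4(1)]])
     fix t5 assume fr5: "frame (total_prog 7 6) t4 t5" and m: "rv t5 7 = (\<Sum>i<N. ar t4 3 i * ar t4 6 i)"
     have f5: "nv t5 0 = N" "nv t5 2 = ss" "ar t5 = ar t3" "rv t5 2 = e" "rv t5 4 = \<Delta>" "rv t5 5 = ratio_bound N ss \<Delta>"
      "rv t5 6 = rv t4 6"
      using fr5 f4 by (simp_all add: frame_def total_prog_def fun_eq_iff)
     show "tc I L down_prog t5 ?Q"
     proof (rule down_run[OF f5(1,2) _ f5(4-6)])
      show "\<forall>i<N. ar t5 3 i = w i" using f5 f3 w by simp
      show "\<forall>i<N. ar t5 5 i = new_score N A w i" using f5 f3 a' by simp
      show "\<forall>i<N. ar t5 6 i = old_score N A w i" using f5 b' by simp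
      show "rv t5 6 = new_total N A w" using f5 n' by simp
      show "rv t5 7 = old_total N A w" using m b' by (simp add: old_total_def f4 f3 w)
     qed
    qed
   qed
  qed simp_all
 qed simp_all
qed

text \<open>The flag is overwritten in every round; after N rounds it belongs to the weights with
  which the last round started, hence the index N - 1.\<close>

lemma filter_run:
 assumes N: "nv s 0 = N" "0 < N" and ss: "nv s 2 = ss" and A: "\<forall>i<N. \<forall>j<N. ar s 0 (i * N + j) = A i j"
  and w: "\<forall>i<N. ar s 3 i = 1" and p: "rv s 2 = e" "rv s 4 = \<Delta>" "rv s 5 = ratio_bound N ss \<Delta>"
 shows "tc I L filter_prog s (\<lambda>t. (\<forall>i<N. ar t 3 i = weights N ss A e \<Delta> N i) \<and>
  rv t 8 = of_bool (violated N ss A \<Delta> (weights N ss A e \<Delta> (N - 1))))"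
proof -
 let ?P = "\<lambda>k t. (\<forall>i<N. ar t 3 i = weights N ss A e \<Delta> k i) \<and>
  (k = 0 \<or> rv t 8 = of_bool (violated N ss A \<Delta> (weights N ss A e \<Delta> (k - 1))))"
 have "tc I L filter_prog s (?P (nv s 0))"
  unfolding filter_prog_def
 proof (rule tc_For)
  show "?P 0 (s\<lparr>nv := (nv s)(8 := 0)\<rparr>)" using w by (simp add: weights_def)
  fix k t assume k: "nv t 8 = k" and fr: "frame (For 8 0 round_prog) s t" and P: "?P k t"
  have f: "nv t 0 = N" "nv t 2 = ss" "ar t 0 = ar s 0" "rv t 2 = e" "rv t 4 = \<Delta>" "rv t 5 = ratio_bound N ss \<Delta>"
   using fr N ss p by (simp_all add: frame_def prog_defs)
  have "tc I L round_prog t (\<lambda>u. (\<forall>i<N. ar u 3 i = downweight N ss A e \<Delta> (weights N ss A e \<Delta> k) i) \<and>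
   rv u 8 = of_bool (violated N ss A \<Delta> (weights N ss A e \<Delta> k)))"
   by (rule round_run[OF f(1) N(2) f(2) _ _ f(4-6)]) (use A P f in auto)
  then show "tc I L round_prog t (\<lambda>u. ?P (Suc k) (u\<lparr>nv := (nv u)(8 := Suc k)\<rparr>))"
   by (rule tc_mono) (simp add: weights_def)
 qed
 then show ?thesis by (rule tc_mono) (use N in auto)
qed

lemma clip_run:
 assumes N: "nv s 0 = N" and A: "\<forall>i<N. \<forall>j<N. ar s 0 (i * N + j) = A i j"
  and w: "\<forall>i<N. ar s 3 i = w i" and p: "rv s 3 = D"
 shows "tc I L clip_prog s (\<lambda>t. \<forall>i<N. ar t 7 i = clip N A (D / 32) w i)"
proof -
 let ?b = "sumR 1 4 0 (accu 1 (RMul (Arr 0 (ent 3 4)) (Arr 3 (NV 4))))"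
  and ?i = "IfLe (RV 1) (RDiv (RV 3) (RC 32)) (IfLe (RSub (RC 0) (RDiv (RV 3) (RC 32))) (RV 1)
   (ASet 7 (NV 3) (Arr 3 (NV 3))) (ASet 7 (NV 3) (RC 0))) (ASet 7 (NV 3) (RC 0))"
 have "tc I L clip_prog s (\<lambda>t. \<forall>i<nv s 0. ar t 7 i = clip N A (D / 32) w i)"
  unfolding clip_prog_def
 proof (rule tc_vfill)
  fix a t assume a: "a < nv s 0" "nv t 3 = a" and fr: "frame (For 3 0 (Seq ?b ?i)) s t"
  from fr have f: "nv t 0 = N" "ar t 0 = ar s 0" "ar t 3 = ar s 3" "rv t 3 = D" using N p by (simp_all add: frame_def)
  have aN: "a < N" using a N by simp
  show "tc I L (Seq ?b ?i) t (\<lambda>u. ar u 7 = (ar t 7)(a := clip N A (D / 32) w a))"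
  proof (rule tc_SeqI[OF tc_sum[where F = "\<lambda>j. A a j * w j"]])
   fix u assume fu: "frame ?b t u" and ru: "rv u 1 = (\<Sum>j<nv t 0. A a j * w j)"
   have r: "rv u 1 = row N A w a" using ru f by (simp add: row_def)
   have fu': "nv u 3 = a" "ar u 3 = ar s 3" "ar u 7 = ar t 7" "rv u 3 = D" using fu f a by (simp_all add: frame_def)
   show "tc I L ?i u (\<lambda>u. ar u 7 = (ar t 7)(a := clip N A (D / 32) w a))"
   proof (cases "\<bar>row N A w a\<bar> <= D / 32")
    case True
    then have "row N A w a <= D / 32" "- (D / 32) <= row N A w a" by linarith+
    then show ?thesis using True aN w by (simp add: tc_simps r[unfolded One_nat_def] fu' clip_def)
   next
    case False
    then have "\<not> (row N A w a <= D / 32 \<and> - (D / 32) <= row N A w a)" by linarith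
    then show ?thesis using False by (auto simp add: tc_simps r[unfolded One_nat_def] fu' clip_def)
   qed
  qed (use a aN A w f in \<open>simp add: tc_simps frame_def\<close>)
 qed
 then show ?thesis using N by simp
qed

lemma mass_run:
 assumes N: "nv s 0 = N"
 shows "tc I L mass_prog s (\<lambda>t. rv t 10 = (\<Sum>i<N. ar s 7 i))"
 unfolding mass_prog_def N[symmetric] by (rule tc_sum) (simp add: tc_simps frame_def)

lemma stat_run:
 assumes N: "nv s 0 = N"
 shows "tc I L stat_prog s (\<lambda>t. rv t 11 = (\<Sum>i<N. \<Sum>j<N. ar s 0 (i * N + j) * ar s 7 i * ar s 7 j))"
 unfolding stat_prog_def N[symmetric]
proof (rule tc_sum)
 let ?b = "sumR 1 4 0 (accu 1 (RMul (RMul (Arr 0 (ent 3 4)) (Arr 7 (NV 3))) (Arr 7 (NV 4))))"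
 let ?F = "\<lambda>i j. ar s 0 (i * nv s 0 + j) * ar s 7 i * ar s 7 j"
 fix a t assume a: "nv t 3 = a" and fr: "frame (sumR 11 3 0 (Seq ?b (accu 11 (RV 1)))) s t"
 from fr have f: "nv t 0 = nv s 0" "ar t 0 = ar s 0" "ar t 7 = ar s 7" by (simp_all add: frame_def)
 show "tc I L (Seq ?b (accu 11 (RV 1))) t (\<lambda>u. rv u 11 = rv t 11 + (\<Sum>j<nv s 0. ?F a j))"
 proof (rule tc_SeqI[OF tc_sum[where F = "?F a"]])
  fix u assume "frame ?b t u" "rv u 1 = (\<Sum>j<nv t 0. ?F a j)"
  then show "tc I L (accu 11 (RV 1)) u (\<lambda>u. rv u 11 = rv t 11 + (\<Sum>j<nv s 0. ?F a j))"
   using f by (simp add: tc_simps frame_def)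
 qed (use a f in \<open>simp add: tc_simps frame_def\<close>)
qed

lemma gram_run:
 fixes X :: "nat \<Rightarrow> nat \<Rightarrow> real" and h :: "nat \<Rightarrow> nat"
 assumes N: "nv s 0 = N" and d: "nv s 1 = d" and ss: "nv s 2 = ss" and sig: "I 2 = \<sigma>"
  and h: "\<And>l. l < ss ==> I (9 + l) = real (h l) \<and> h l < d"
  and X: "\<And>i c. i < N ==> c < d ==> I (9 + ss + (i * d + c)) = X i c"
  and L: "L = 9 + ss + N * d"
 shows "tc I L gram_prog s (\<lambda>t. \<forall>a<N. \<forall>b<N. ar t 0 (a * N + b) =
   shifted N ss (\<lambda>a b. \<Sum>l<ss. X a (h l) * X b (h l) / (\<sigma> * \<sigma>)) a b)"
 unfolding gram_prog_def N[symmetric]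
proof (rule tc_mfill)
 let ?c = "Seq (LdN 6 (NAdd (NC 9) (NV 5))) (Seq (RSet 14 (Inp (dat 3)))
   (accu 1 (RDiv (RMul (RV 14) (Inp (dat 4))) (RMul (Inp (NC 2)) (Inp (NC 2))))))"
 let ?b = "sumR 1 5 2 ?c"
 let ?i = "IfLe rss rsN Skip (IfLe (RN (NV 3)) (RN (NV 4)) (IfLe (RN (NV 4)) (RN (NV 3)) (RSet 1 (RSub (RV 1) rss)) Skip) Skip)"
 let ?a = "ASet 0 (ent 3 4) (RV 1)"
 let ?G = "\<lambda>a b. \<Sum>l<ss. X a (h l) * X b (h l) / (\<sigma> * \<sigma>)"
 fix a b t assume ab: "a < nv s 0" "b < nv s 0" "nv t 3 = a" "nv t 4 = b"
  and fr: "frame (For 3 0 (For 4 0 (Seq ?b (Seq ?i ?a)))) s t"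
 from fr have f: "nv t 0 = N" "nv t 1 = d" "nv t 2 = ss" using N d ss by (simp_all add: frame_def)
 have abN: "a < N" "b < N" using ab N by simp_all
 have inL: "9 + ss + (a' * d + c) < L" if "a' < N" "c < d" for a' c
 proof -
  have "a' * d + c < a' * d + d" using that by simp
  also have "\<dots> = Suc a' * d" by simp
  also have "\<dots> <= N * d" using that by (intro mult_right_mono) auto
  finally show ?thesis by (simp add: L)
 qed
 have i2: "2 < L" by (simp add: L)
 show "tc I L (Seq ?b (Seq ?i ?a)) t (\<lambda>u. ar u 0 = (ar t 0)(a * nv s 0 + b := shifted (nv s 0) ss ?G a b))"
 proof (rule tc_SeqI[OF tc_sum[where F = "\<lambda>l. X a (h l) * X b (h l) / (\<sigma> * \<sigma>)"]])
  fix l u assume l: "l < nv t 2" "nv u 5 = l" and fu: "frame ?b t u"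
  have fu': "nv u 0 = N" "nv u 1 = d" "nv u 2 = ss" "nv u 3 = a" "nv u 4 = b"
   using fu f ab by (simp_all add: frame_def)
  have ls: "l < ss" using l f by simp
  note hl = h[OF ls]
  have lL: "9 + l < L" using ls by (simp add: L)
  have nn: "nat \<lfloor>real (h l)\<rfloor> = h l" "real (h l) \<in> \<nat>" by simp_all
  show "tc I L ?c u (\<lambda>u'. rv u' 1 = rv u 1 + X a (h l) * X b (h l) / (\<sigma> * \<sigma>))"
   using X[OF abN(1), of "h l"] X[OF abN(2), of "h l"] hl inL[OF abN(1), of "h l"] inL[OF abN(2), of "h l"] i2 lL nn
   by (simp add: tc_simps tc_Seq fu' fu'(2)[unfolded One_nat_def] l sig)
 next
  fix u assume fu: "frame ?b t u" and r: "rv u 1 = (\<Sum>l<nv t 2. X a (h l) * X b (h l) / (\<sigma> * \<sigma>))"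
  have fu': "nv u 0 = N" "nv u 2 = ss" "nv u 3 = a" "nv u 4 = b" "ar u 0 = ar t 0"
   using fu f ab by (simp_all add: frame_def)
  have r': "rv u (Suc 0) = ?G a b" using r f by simp
  show "tc I L (Seq ?i ?a) u (\<lambda>u. ar u 0 = (ar t 0)(a * nv s 0 + b := shifted (nv s 0) ss ?G a b))"
   using N by (cases "a = b") (simp_all add: tc_simps tc_Seq fu' r' shifted_def shift_of_def)
 qed
qed simp_all

lemma main_run:
 fixes X :: "nat \<Rightarrow> nat \<Rightarrow> real" and h :: "nat \<Rightarrow> nat"
 assumes N: "nv s 0 = N" "0 < N" and d: "nv s 1 = d" and ss: "nv s 2 = ss" and sig: "I 2 = \<sigma>"
  and par: "I 3 = \<epsilon>" "I 5 = \<rho>"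
  and h: "\<And>l. l < ss ==> I (9 + l) = real (h l) \<and> h l < d"
  and X: "\<And>i c. i < N ==> c < d ==> I (9 + ss + (i * d + c)) = X i c"
  and L: "L = 9 + ss + N * d"
 shows "tc I L main_prog s (\<lambda>t. rv t 0 = of_bool (filter_rejects N ss
   (shifted N ss (\<lambda>a b. \<Sum>l<ss. X a (h l) * X b (h l) / (\<sigma> * \<sigma>)))
   (\<epsilon> * real N) (real N * (\<rho> * \<rho> / (\<sigma> * \<sigma>)) / \<epsilon>) (real N * real N * (\<rho> * \<rho> / (\<sigma> * \<sigma>)))))"
proof -
 define A where "A = shifted N ss (\<lambda>a b. \<Sum>l<ss. X a (h l) * X b (h l) / (\<sigma> * \<sigma>))"
 define e where "e = \<epsilon> * real N"
 define D where "D = real N * (\<rho> * \<rho> / (\<sigma> * \<sigma>)) / \<epsilon>"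
 define P where "P = real N * real N * (\<rho> * \<rho> / (\<sigma> * \<sigma>))"
 define w where "w = (if 1 <= e then clip N A (D / 32) (weights N ss A e (D / 32000) N) else (\<lambda>_. 1))"
 define fl where "fl = (1 <= e \<and> violated N ss A (D / 32000) (weights N ss A e (D / 32000) (N - 1)))"
 let ?Q = "\<lambda>t. rv t 0 = of_bool (filter_rejects N ss A e D P)"
 let ?A = "\<lambda>t. \<forall>i<N. \<forall>j<N. ar t 0 (i * N + j) = A i j"
 have rej: "filter_rejects N ss A e D P \<longleftrightarrow> fl \<or> (\<Sum>i<N. w i) < real N - 140 * e \<or>
   P / 4 < quad {..<N} A w w - (if ss <= N then real ss * real N else 0)"
  by (simp add: filter_rejects_def Let_def w_def fl_def noise_free_total_def shift_of_def)
 have small: "2 < L" "3 < L" "5 < L" by (simp_all add: L)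
 have "tc I L main_prog s ?Q"
  unfolding main_prog_def
 proof (rule tc_SeqI[OF gram_run[where X = X and h = h and d = d and ss = ss and \<sigma> = \<sigma>]])
  fix t1 assume fr1: "frame gram_prog s t1"
   and A1: "\<forall>a<N. \<forall>b<N. ar t1 0 (a * N + b) = shifted N ss (\<lambda>a b. \<Sum>l<ss. X a (h l) * X b (h l) / (\<sigma> * \<sigma>)) a b"
  have f1: "nv t1 0 = N" "nv t1 2 = ss" using fr1 N ss by (simp_all add: frame_def gram_prog_def)
  let ?par = "\<lambda>t. rv t 2 = e \<and> rv t 3 = D \<and> rv t 4 = D / 32000 \<and> rv t 5 = ratio_bound N ss (D / 32000) \<and>
   rv t 12 = P \<and> rv t 13 = (if ss <= N then real ss * real N else 0) \<and> rv t 8 = 0"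
  have "tc I L param_prog t1 ?par"
   using small by (simp add: param_prog_def tc_Seq tc_simps f1 sig par e_def D_def P_def ratio_bound_def power2_eq_square)
  then show "tc I L (Seq param_prog (Seq init_prog (Seq (IfLe (RC 1) (RV 2) (Seq filter_prog clip_prog) ones_prog)
    (Seq mass_prog (Seq stat_prog decide_prog))))) t1 ?Q"
  proof (rule tc_SeqI)
   fix t2 assume fr2: "frame param_prog t1 t2" and p2: "?par t2"
   have f2: "nv t2 0 = N" "nv t2 2 = ss" "?A t2"
    using fr2 f1 A1 by (simp_all add: frame_def param_prog_def A_def)
   have "tc I L init_prog t2 (\<lambda>t. \<forall>i<nv t2 0. ar t 3 i = 1)"
    unfolding init_prog_def by (rule tc_vfill) (simp add: tc_simps)
   then show "tc I L (Seq init_prog (Seq (IfLe (RC 1) (RV 2) (Seq filter_prog clip_prog) ones_prog)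
     (Seq mass_prog (Seq stat_prog decide_prog)))) t2 ?Q"
   proof (rule tc_SeqI)
    fix t3 assume fr3: "frame init_prog t2 t3" and w3: "\<forall>i<nv t2 0. ar t3 3 i = 1"
    have f3: "nv t3 0 = N" "nv t3 2 = ss" "?A t3" "?par t3"
     using fr3 f2 p2 by (simp_all add: frame_def init_prog_def)
    have w3': "\<forall>i<N. ar t3 3 i = 1" using w3 f2 by simp
    let ?W = "\<lambda>t. (\<forall>i<N. ar t 7 i = w i) \<and> rv t 8 = of_bool fl"
    have "tc I L (IfLe (RC 1) (RV 2) (Seq filter_prog clip_prog) ones_prog) t3 ?W"
    proof (cases "1 <= e")
     case True
     have "tc I L (Seq filter_prog clip_prog) t3 ?W"
     proof (rule tc_SeqI[OF filter_run[where A = A and ss = ss and e = e and \<Delta> = "D / 32000"]])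
      fix u assume fu: "frame filter_prog t3 u"
       and u: "(\<forall>i<N. ar u 3 i = weights N ss A e (D / 32000) N i) \<and>
        rv u 8 = of_bool (violated N ss A (D / 32000) (weights N ss A e (D / 32000) (N - 1)))"
      have fu': "nv u 0 = N" "?A u" "rv u 3 = D" using fu f3 by (simp_all add: frame_def prog_defs)
      have "tc I L clip_prog u (\<lambda>t. \<forall>i<N. ar t 7 i = clip N A (D / 32) (weights N ss A e (D / 32000) N) i)"
       by (rule clip_run) (use fu' u in auto)
      then show "tc I L clip_prog u ?W"
      proof (rule tc_mono)
       fix x assume "frame clip_prog u x" "\<forall>i<N. ar x 7 i = clip N A (D / 32) (weights N ss A e (D / 32000) N) i"
       then show "?W x" using u True by (simp add: frame_def clip_prog_def w_def fl_def)
      qed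
     qed (use f3 w3' N in auto)
     then show ?thesis using True f3 by (simp add: tc_simps)
    next
     case False
     have "tc I L ones_prog t3 (\<lambda>t. \<forall>i<nv t3 0. ar t 7 i = 1)"
      unfolding ones_prog_def by (rule tc_vfill) (simp add: tc_simps)
     then have "tc I L ones_prog t3 ?W"
      by (rule tc_mono) (use f3 False in \<open>simp add: frame_def ones_prog_def w_def fl_def\<close>)
     then show ?thesis using False f3 by (simp add: tc_simps)
    qed
    then show "tc I L (Seq (IfLe (RC 1) (RV 2) (Seq filter_prog clip_prog) ones_prog)
      (Seq mass_prog (Seq stat_prog decide_prog))) t3 ?Q"
    proof (rule tc_SeqI)
     fix t4 assume fr4: "frame (IfLe (RC 1) (RV 2) (Seq filter_prog clip_prog) ones_prog) t3 t4" and W: "?W t4"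
     have f4: "nv t4 0 = N" "nv t4 2 = ss" "?A t4" "rv t4 2 = e" "rv t4 12 = P"
      "rv t4 13 = (if ss <= N then real ss * real N else 0)"
      using fr4 f3 by (simp_all add: frame_def prog_defs)
     show "tc I L (Seq mass_prog (Seq stat_prog decide_prog)) t4 ?Q"
     proof (rule tc_SeqI[OF mass_run[OF f4(1)]])
      fix t5 assume fr5: "frame mass_prog t4 t5" and m: "rv t5 10 = (\<Sum>i<N. ar t4 7 i)"
      have f5: "nv t5 0 = N" "nv t5 2 = ss" "?A t5" "rv t5 2 = e" "rv t5 12 = P"
       "rv t5 13 = (if ss <= N then real ss * real N else 0)" "?W t5" "rv t5 10 = (\<Sum>i<N. w i)"
       using fr5 f4 W m by (simp_all add: frame_def mass_prog_def)
      show "tc I L (Seq stat_prog decide_prog) t5 ?Q"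
      proof (rule tc_SeqI[OF stat_run[OF f5(1)]])
       fix t6 assume fr6: "frame stat_prog t5 t6"
        and q: "rv t6 11 = (\<Sum>i<N. \<Sum>j<N. ar t5 0 (i * N + j) * ar t5 7 i * ar t5 7 j)"
       have f6: "nv t6 0 = N" "nv t6 2 = ss" "rv t6 2 = e" "rv t6 12 = P"
        "rv t6 13 = (if ss <= N then real ss * real N else 0)" "rv t6 8 = of_bool fl" "rv t6 10 = (\<Sum>i<N. w i)"
        using fr6 f5 by (simp_all add: frame_def stat_prog_def)
       have q': "rv t6 11 = quad {..<N} A w w"
        unfolding q quad_def by (intro sum.cong) (use f5 in auto)
       show "tc I L decide_prog t6 ?Q"
        unfolding rej decide_prog_def by (simp add: tc_simps f6 q')
      qed
     qed
    qed
   qed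
  qed
 qed (use N d ss sig h X L in auto)
 then show ?thesis by (simp only: A_def e_def D_def P_def)
qed

end

section \<open>Rates\<close>

lemma Max_le_dim:
 fixes d :: nat
 assumes "g 0"
 shows "Max {j. j <= d \<and> g j} <= d" "Max {j. j <= d \<and> g j} < d ==> \<not> g (Suc (Max {j. j <= d \<and> g j}))"
  "j <= d ==> g j ==> j <= Max {j. j <= d \<and> g j}" "g (Max {j. j <= d \<and> g j})"
proof -
 let ?S = "{j. j <= d \<and> g j}"
 have fin: "finite ?S" by simp
 have "0 \<in> ?S" using assms by simp
 then have mem: "Max ?S \<in> ?S" using fin by (intro Max_in) auto
 then show "Max ?S <= d" "g (Max ?S)" by auto
 show le: "j <= Max ?S" if "j <= d" "g j" for j using that fin by (intro Max_ge) auto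
 show "Max ?S < d ==> \<not> g (Suc (Max ?S))" using le[of "Suc (Max ?S)"] by (metis Suc_leI Suc_n_not_le_n)
qed

lemma width_neg: "ennreal x < kolmogorov_width d K (int 0 - 1)"
 by (simp add: kolmogorov_width_def)

text \<open>Serves to exclude d = 0, where the standing assumption on the width fails.\<close>

lemma width_dim0: "kolmogorov_width 0 K 0 = 0"
proof -
 have r: "vec_space.rank 0 (0\<^sub>m 0 0 :: real mat) = 0"
  using vec_space.rank_le_nc[of "0\<^sub>m 0 0 :: real mat" 0 0] by simp
 have "(0\<^sub>m 0 0 :: real mat) \<in> orth_projections 0 0"
  unfolding orth_projections_def using r by auto
 then have "kolmogorov_width 0 K 0 <= (SUP \<theta>\<in>K. ennreal (L2_set (\<lambda>i. \<theta> i - vec_index (0\<^sub>m 0 0 *\<^sub>v vec 0 \<theta>) i) {..<0}))"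
  unfolding kolmogorov_width_def by (auto intro: INF_lower)
 also have "\<dots> <= 0" by (intro SUP_least) simp
 finally show ?thesis by simp
qed

lemma powr_quarter_sq: "0 <= x ==> (x powr (1/4))\<^sup>2 = sqrt (x :: real)"
 by (simp add: power2_eq_square powr_add[symmetric] powr_half_sqrt)

text \<open>The threshold that the width fails to exceed at m + 1, squared, divided by the variance
  and multiplied by 8; for m > 0, sqrt (m + 1) <= 2 sqrt m gives 16.\<close>

definition tail_bound :: "nat \<Rightarrow> nat \<Rightarrow> real \<Rightarrow> real" where
 "tail_bound m N \<epsilon> = (if m = 0 then 8 * (\<epsilon> / sqrt (real N))
   else 16 * (sqrt (real m) * max (1 / real N) (\<epsilon> / sqrt (real N))))"

text \<open>Unless m = d, the index m + 1 fails one of the two defining inequalities, and this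
  bounds the width at m. Since the first dimension is at least 1, m = 0 means that the second one is
  0; then the width D_0 lies between the two thresholds, whence 1 < N \<epsilon>^2.\<close>

lemma coords_tail:
 assumes md: "model c0 d K N \<sigma> \<epsilon>"
 defines "m \<equiv> opt_dim_min d K N \<sigma> \<epsilon>"
 shows "1 <= d" "m <= d" "m = 0 ==> 1 < real N * \<epsilon>\<^sup>2"
  "\<theta> \<in> K ==> (\<Sum>i\<in>{..<d} - coords d K m. (\<theta> i)\<^sup>2) <= \<sigma>\<^sup>2 * tail_bound m N \<epsilon>"
proof -
 have K: "QCO d K" and N1: "1 <= N" and sg: "0 < \<sigma>" and ep: "0 <= \<epsilon>"
  and D0: "ennreal (\<sigma> / sqrt (real N)) < kolmogorov_width d K 0"
  using md by (auto simp: model_def)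
 have N: "1 <= real N" using N1 by simp
 show d1: "1 <= d"
 proof (rule ccontr)
  assume "\<not> 1 <= d"
  then have "d = 0" by simp
  then show False using D0 width_dim0[of K] by simp
 qed
 define t1 where "t1 j = real j powr (1/4) / sqrt (real N) * \<sigma>" for j
 define t2 where "t2 j = real j powr (1/4) * sqrt \<epsilon> / real N powr (1/4) * \<sigma>" for j
 let ?g1 = "\<lambda>j. kolmogorov_width d K (int j - 1) > ennreal (t1 j)"
 let ?g2 = "\<lambda>j. kolmogorov_width d K (int j - 1) > ennreal (t2 j)"
 define k1 where "k1 = opt_dim1 d K N \<sigma>"
 define k2 where "k2 = opt_dim2 d K N \<sigma> \<epsilon>"
 have k1: "k1 = Max {j. j <= d \<and> ?g1 j}" and k2: "k2 = Max {j. j <= d \<and> ?g2 j}"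
  by (simp_all add: k1_def k2_def opt_dim1_def opt_dim2_def t1_def t2_def)
 have m: "m = min k1 k2" by (simp add: m_def opt_dim_min_def k1_def k2_def)
 have M1: "k1 <= d" "k1 < d ==> \<not> ?g1 (Suc k1)" "\<And>j. j <= d ==> ?g1 j ==> j <= k1" "?g1 k1"
  unfolding k1
  by (rule Max_le_dim(1)[where g = ?g1, OF width_neg] Max_le_dim(2)[where g = ?g1, OF width_neg]
   Max_le_dim(3)[where g = ?g1, OF width_neg] Max_le_dim(4)[where g = ?g1, OF width_neg]; assumption?)+
 have M2: "k2 <= d" "k2 < d ==> \<not> ?g2 (Suc k2)" "\<And>j. j <= d ==> ?g2 j ==> j <= k2" "?g2 k2"
  unfolding k2
  by (rule Max_le_dim(1)[where g = ?g2, OF width_neg] Max_le_dim(2)[where g = ?g2, OF width_neg]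
   Max_le_dim(3)[where g = ?g2, OF width_neg] Max_le_dim(4)[where g = ?g2, OF width_neg]; assumption?)+
 show md': "m <= d" using M1(1) by (simp add: m)
 have t1sq: "(t1 j)\<^sup>2 = \<sigma>\<^sup>2 * (sqrt (real j) / real N)" for j
  using N by (simp add: t1_def power_mult_distrib power_divide powr_quarter_sq)
 have t2sq: "(t2 j)\<^sup>2 = \<sigma>\<^sup>2 * (sqrt (real j) * (\<epsilon> / sqrt (real N)))" for j
  using N ep by (simp add: t2_def power_mult_distrib power_divide powr_quarter_sq)
 have t0: "0 <= t1 j" "0 <= t2 j" for j using sg ep by (simp_all add: t1_def t2_def)
 have "?g1 1" using D0 by (simp add: t1_def)
 then have k11: "1 <= k1" using d1 by (intro M1(3))
 have gc: "good_coords d K m (coords d K m)" by (rule good_coords[OF K d1 md'])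
 have tail: "(\<Sum>i\<in>{..<d} - coords d K m. (\<theta> i)\<^sup>2) <= 2 * b\<^sup>2"
  if "0 < b" "m = d \<or> kolmogorov_width d K (int m) < ennreal b" "\<theta> \<in> K" for b \<theta>
  using gc that unfolding good_coords_def by blast
 have wle: "(\<Sum>i\<in>{..<d} - coords d K m. (\<theta> i)\<^sup>2) <= 8 * t\<^sup>2"
  if "0 < t" "\<not> ennreal t < kolmogorov_width d K (int (Suc m) - 1)" "\<theta> \<in> K" for t \<theta>
 proof -
  have "kolmogorov_width d K (int m) <= ennreal t" using that(2) by simp
  \<comment> \<open>\<open>good_coords\<close> asks for a strict bound; doubling t provides it, and
    2 * 2^2 is the factor 8.\<close>
  also have "\<dots> < ennreal (2 * t)" using that(1) by (simp add: ennreal_less_iff)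
  finally show ?thesis using tail[of "2 * t" \<theta>] that by (simp add: power_mult_distrib)
 qed
 have m0: "m = 0 ==> k2 = 0" using k11 m by simp
 have D0k: "\<sigma> / sqrt (real N) < t2 1" if "m = 0"
 proof -
  have "\<not> ?g2 (Suc k2)" using M2(2) m0[OF that] d1 by simp
  then have "kolmogorov_width d K 0 <= ennreal (t2 1)" using m0[OF that] by simp
  then have "ennreal (\<sigma> / sqrt (real N)) < ennreal (t2 1)" using D0 by (rule less_le_trans[rotated])
  then show ?thesis using sg by (simp add: ennreal_less_iff)
 qed
 show "1 < real N * \<epsilon>\<^sup>2" if m0': "m = 0"
 proof -
  have "(\<sigma> / sqrt (real N))\<^sup>2 < (t2 1)\<^sup>2" using D0k[OF m0'] sg by (intro power_strict_mono) auto
  then have "\<sigma>\<^sup>2 * (1 / real N) < \<sigma>\<^sup>2 * (\<epsilon> / sqrt (real N))" by (simp add: t2sq power_divide)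
  then have "1 / real N < \<epsilon> / sqrt (real N)" using sg by (simp only: mult_less_cancel_left_pos zero_less_power)
  then have "1 / real N * real N < \<epsilon> / sqrt (real N) * real N" using N by (intro mult_strict_right_mono) auto
  moreover have "\<epsilon> / sqrt (real N) * real N = \<epsilon> * sqrt (real N)"
   using N real_sqrt_mult_self[of "real N"] by (simp add: divide_simps)
  moreover have "1 / real N * real N = 1" using N by simp
  ultimately have "1 < \<epsilon> * sqrt (real N)" by linarith
  then have "1\<^sup>2 < (\<epsilon> * sqrt (real N))\<^sup>2" by (intro power_strict_mono) auto
  then show ?thesis using N by (simp add: power_mult_distrib mult.commute)
 qed
 assume \<theta>: "\<theta> \<in> K"
 have sm: "sqrt (real (Suc m)) <= 2 * sqrt (real m)" if "0 < m"
 proof -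
  have "sqrt (real (Suc m)) <= sqrt (4 * real m)" using that by simp
  then show ?thesis by (simp add: real_sqrt_mult)
 qed
 have s2: "0 <= \<sigma>\<^sup>2" by simp
 consider "m = 0" | "0 < m" "m = d" | "0 < m" "m < d" "m = k1" | "0 < m" "m < d" "m = k2" "k2 < k1"
  using md' m by linarith
 then show "(\<Sum>i\<in>{..<d} - coords d K m. (\<theta> i)\<^sup>2) <= \<sigma>\<^sup>2 * tail_bound m N \<epsilon>"
 proof cases
  case 1
  have "0 < \<sigma> / sqrt (real N)" using sg N by simp
  then have "0 < t2 (Suc m)" using D0k[OF 1] 1 by simp
  moreover have "\<not> ?g2 (Suc m)" using M2(2) m0[OF 1] d1 1 by simp
  ultimately have "(\<Sum>i\<in>{..<d} - coords d K m. (\<theta> i)\<^sup>2) <= 8 * (t2 (Suc m))\<^sup>2" using \<theta> by (rule wle)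
  also have "8 * (t2 (Suc m))\<^sup>2 = \<sigma>\<^sup>2 * tail_bound m N \<epsilon>"
   unfolding t2sq tail_bound_def using 1 by simp
  finally show ?thesis .
 next
  case 2
  define b where "b = sqrt (\<sigma>\<^sup>2 * (8 * (sqrt (real m) * (1 / real N))))"
  have p: "0 < \<sigma>\<^sup>2 * (8 * (sqrt (real m) * (1 / real N)))" using sg 2 N by simp
  have "(\<Sum>i\<in>{..<d} - coords d K m. (\<theta> i)\<^sup>2) <= 2 * b\<^sup>2" using p 2 \<theta> by (intro tail) (simp_all add: b_def)
  also have "\<dots> = \<sigma>\<^sup>2 * (16 * (sqrt (real m) * (1 / real N)))" using p by (simp add: b_def)
  also have "\<dots> <= \<sigma>\<^sup>2 * tail_bound m N \<epsilon>"
  proof (rule mult_left_mono[OF _ s2])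
   have "sqrt (real m) * (1 / real N) <= sqrt (real m) * max (1 / real N) (\<epsilon> / sqrt (real N))"
    by (rule mult_left_mono[OF max.cobounded1]) simp
   then show "16 * (sqrt (real m) * (1 / real N)) <= tail_bound m N \<epsilon>"
    unfolding tail_bound_def using 2(1) by (simp del: max.cobounded1)
  qed
  finally show ?thesis .
 next
  case 3
  have "0 < t1 (Suc m)" using sg N by (simp add: t1_def)
  moreover have "\<not> ?g1 (Suc m)" using M1(2) 3 by simp
  ultimately have "(\<Sum>i\<in>{..<d} - coords d K m. (\<theta> i)\<^sup>2) <= 8 * (t1 (Suc m))\<^sup>2" using \<theta> by (rule wle)
  also have "\<dots> = \<sigma>\<^sup>2 * (8 * (sqrt (real (Suc m)) * (1 / real N)))" by (simp add: t1sq)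
  also have "\<dots> <= \<sigma>\<^sup>2 * (8 * ((2 * sqrt (real m)) * max (1 / real N) (\<epsilon> / sqrt (real N))))"
  proof (rule mult_left_mono[OF _ s2])
   have "sqrt (real (Suc m)) * (1 / real N) <= (2 * sqrt (real m)) * max (1 / real N) (\<epsilon> / sqrt (real N))"
    by (rule mult_mono[OF sm[OF 3(1)] max.cobounded1]) (use ep in simp_all)
   then show "8 * (sqrt (real (Suc m)) * (1 / real N)) <= 8 * ((2 * sqrt (real m)) * max (1 / real N) (\<epsilon> / sqrt (real N)))"
    by (rule mult_left_mono) simp
  qed
  also have "\<dots> = \<sigma>\<^sup>2 * tail_bound m N \<epsilon>" unfolding tail_bound_def using 3(1) by (simp only: if_False less_not_refl2)
  finally show ?thesis .
 next
  case 4
  \<comment> \<open>For \<epsilon> = 0 the second threshold is 0, so the second dimension could not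
    be below the first.\<close>
  have "0 < \<epsilon>"
  proof (rule ccontr)
   assume "\<not> 0 < \<epsilon>"
   then have "\<epsilon> = 0" using ep by simp
   then have "t2 k1 <= t1 k1" using t0(1)[of k1] by (simp add: t2_def)
   then have "ennreal (t2 k1) <= ennreal (t1 k1)" by (rule ennreal_leI)
   then have "?g2 k1" using M1(4) by (rule le_less_trans)
   then have "k1 <= k2" by (rule M2(3)[OF M1(1)])
   then show False using 4 by simp
  qed
  then have "0 < t2 (Suc m)" using sg N by (simp add: t2_def)
  moreover have "\<not> ?g2 (Suc m)" using M2(2) 4 by simp
  ultimately have "(\<Sum>i\<in>{..<d} - coords d K m. (\<theta> i)\<^sup>2) <= 8 * (t2 (Suc m))\<^sup>2" using \<theta> by (rule wle)
  also have "\<dots> = \<sigma>\<^sup>2 * (8 * (sqrt (real (Suc m)) * (\<epsilon> / sqrt (real N))))" by (simp add: t2sq)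
  also have "\<dots> <= \<sigma>\<^sup>2 * (8 * ((2 * sqrt (real m)) * max (1 / real N) (\<epsilon> / sqrt (real N))))"
  proof (rule mult_left_mono[OF _ s2])
   have "sqrt (real (Suc m)) * (\<epsilon> / sqrt (real N)) <= (2 * sqrt (real m)) * max (1 / real N) (\<epsilon> / sqrt (real N))"
    by (rule mult_mono[OF sm[OF 4(1)] max.cobounded2]) (use ep in simp_all)
   then show "8 * (sqrt (real (Suc m)) * (\<epsilon> / sqrt (real N))) <= 8 * ((2 * sqrt (real m)) * max (1 / real N) (\<epsilon> / sqrt (real N)))"
    by (rule mult_left_mono) simp
  qed
  also have "\<dots> = \<sigma>\<^sup>2 * tail_bound m N \<epsilon>" unfolding tail_bound_def using 4(1) by (simp only: if_False less_not_refl2)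
  finally show ?thesis .
 qed
qed

lemma sqrt_le_mult:
 fixes a b c :: real
 assumes "a <= c\<^sup>2 * b" "0 <= c"
 shows "sqrt a <= c * sqrt b"
proof -
 have "sqrt a <= sqrt (c\<^sup>2 * b)" using assms by simp
 then show ?thesis using assms by (simp add: real_sqrt_mult)
qed

text \<open>The common part of the two rates: \<open>l\<close> is \<open>ln (1 / \<epsilon>)\<close> or \<open>ln (N / \<alpha>)\<close>.\<close>

lemma rate_consequences:
 fixes \<epsilon> q l :: real and N m s :: nat
 assumes N: "1 <= N" and ep: "0 <= \<epsilon>" and l: "0 < \<epsilon> ==> 1/2 <= l" and s: "s <= 2 * m + 1"
  and m0: "m = 0 ==> 1 < real N * \<epsilon>\<^sup>2"
  and q1: "sqrt (real m) / real N <= 2 * q" and q2: "\<epsilon>\<^sup>2 * l <= q" and q3: "sqrt (\<epsilon>\<^sup>2 * l * real m / real N) <= q"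
 shows "sqrt (real s) * real N <= 4 * ((real N)\<^sup>2 * q)"
  "0 < \<epsilon> ==> \<epsilon> * sqrt (real s * real N * l) <= 2 * (real N * q)"
  "tail_bound m N \<epsilon> <= 32 * q"
proof -
 have N0: "0 < real N" using N by simp
 have "0 <= sqrt (real m) / real N" by simp
 then have q0: "0 <= q" using q1 by linarith
 \<comment> \<open>For m = 0 the terms of the rate with m vanish, although one coordinate is still
   used. The term \<epsilon>^2 l takes over, because 1 / N is then at most \<epsilon>^2.\<close>
 have m_eps: "1 / real N <= \<epsilon>\<^sup>2" "0 < \<epsilon>" "1 / sqrt (real N) <= \<epsilon>" if "m = 0"
 proof -
  have "1 / real N < real N * \<epsilon>\<^sup>2 / real N" using m0[OF that] N0 by (intro divide_strict_right_mono) auto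
  then show 1: "1 / real N <= \<epsilon>\<^sup>2" using N0 by simp
  show "0 < \<epsilon>" using m0[OF that] ep by (cases "\<epsilon> = 0") auto
  have "sqrt (1 / real N) <= sqrt (\<epsilon>\<^sup>2)" using 1 by (rule real_sqrt_le_mono)
  then show "1 / sqrt (real N) <= \<epsilon>" using ep by (simp add: real_sqrt_divide)
 qed
 have e2: "\<epsilon>\<^sup>2 <= 2 * q" if "0 < \<epsilon>"
 proof -
  have "\<epsilon>\<^sup>2 * (1/2) <= \<epsilon>\<^sup>2 * l" using l[OF that] by (intro mult_left_mono) auto
  then show ?thesis using q2 by simp
 qed
 have sm: "real s <= 4 * real m" if "0 < m" using s that by linarith
 have sqs: "sqrt (real s) <= 2 * sqrt (real m)" if "0 < m"
  using sm[OF that] by (intro sqrt_le_mult) auto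
 have "sqrt (real s) / real N <= 4 * q"
 proof (cases "m = 0")
  case True
  then have "sqrt (real s) <= 1" using s by simp
  then have "sqrt (real s) / real N <= 1 / real N" using N0 by (intro divide_right_mono) auto
  then show ?thesis using m_eps[OF True] e2 q0 by linarith
 next
  case False
  then have "sqrt (real s) / real N <= 2 * sqrt (real m) / real N" using sqs N0 by (intro divide_right_mono) auto
  then show ?thesis using q1 by linarith
 qed
 from mult_right_mono[OF this, of "(real N)\<^sup>2"] show "sqrt (real s) * real N <= 4 * ((real N)\<^sup>2 * q)"
  using N0 by (simp add: power2_eq_square mult_ac)
 show "\<epsilon> * sqrt (real s * real N * l) <= 2 * (real N * q)" if e: "0 < \<epsilon>"
 proof -
  have l0: "0 <= l" using l[OF e] by simp
  have "\<epsilon>\<^sup>2 * l * real s / real N <= (2 * q)\<^sup>2"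
  proof (cases "m = 0")
   case True
   have "\<epsilon>\<^sup>2 * l * real s / real N <= \<epsilon>\<^sup>2 * l * 1 / real N"
    using s True l0 N0 by (intro divide_right_mono mult_left_mono) auto
   also have "\<dots> = (\<epsilon>\<^sup>2 * l) * (1 / real N)" by simp
   also have "\<dots> <= q * (2 * q)" using q2 m_eps(1)[OF True] e2[OF e] l0 q0 by (intro mult_mono) auto
   also have "\<dots> <= (2 * q)\<^sup>2" by (simp add: power2_eq_square)
   finally show ?thesis .
  next
   case False
   have "\<epsilon>\<^sup>2 * l * real s / real N <= \<epsilon>\<^sup>2 * l * (4 * real m) / real N"
    using sm False l0 N0 by (intro divide_right_mono mult_left_mono) auto
   also have "\<dots> = 4 * (sqrt (\<epsilon>\<^sup>2 * l * real m / real N))\<^sup>2" using l0 by simp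
   also have "\<dots> <= 4 * q\<^sup>2" using q3 l0 by (intro mult_left_mono power_mono) auto
   finally show ?thesis by (simp add: power_mult_distrib)
  qed
  then have "sqrt (\<epsilon>\<^sup>2 * l * real s / real N) <= 2 * q" using q0 by (intro real_le_lsqrt) auto
  from mult_right_mono[OF this, of "real N"]
  have "sqrt (\<epsilon>\<^sup>2 * l * real s / real N) * real N <= 2 * (real N * q)" by (simp add: mult_ac)
  moreover have "sqrt (\<epsilon>\<^sup>2 * l * real s / real N) * real N = \<epsilon> * sqrt (real s * real N * l)"
  proof -
   have "sqrt (\<epsilon>\<^sup>2 * l * real s / real N) * sqrt ((real N)\<^sup>2) = sqrt (\<epsilon>\<^sup>2 * l * real s / real N * (real N)\<^sup>2)"
    by (rule real_sqrt_mult[symmetric])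
   also have "\<epsilon>\<^sup>2 * l * real s / real N * (real N)\<^sup>2 = \<epsilon>\<^sup>2 * (real s * real N * l)" using N0 by (simp add: power2_eq_square)
   also have "sqrt \<dots> = \<epsilon> * sqrt (real s * real N * l)" using e by (simp only: real_sqrt_mult) simp
   finally show ?thesis using N0 by simp
  qed
  ultimately show ?thesis by simp
 qed
 show "tail_bound m N \<epsilon> <= 32 * q"
 proof (cases "m = 0")
  case True
  have "\<epsilon> * (1 / sqrt (real N)) <= \<epsilon> * \<epsilon>" using m_eps(3)[OF True] ep by (intro mult_left_mono) auto
  then have "\<epsilon> / sqrt (real N) <= 2 * q" using e2[OF m_eps(2)[OF True]] by (simp add: power2_eq_square)
  then show ?thesis using True q0 by (simp add: tail_bound_def)
 next
  case False
  have "sqrt (real m) * (\<epsilon> / sqrt (real N)) <= 2 * q"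
  proof (cases "\<epsilon> = 0")
   case True
   then show ?thesis using q0 by simp
  next
   case False
   then have e: "0 < \<epsilon>" using ep by simp
   have A: "\<epsilon>\<^sup>2 * real m / real N * (1/2) <= \<epsilon>\<^sup>2 * real m / real N * l" using l[OF e] by (intro mult_left_mono) auto
   have dbl: "x <= 4 * (x * l)" if "x * (1/2) <= x * l" "0 <= x" for x using that by linarith
   have "\<epsilon>\<^sup>2 * real m / real N <= 4 * (\<epsilon>\<^sup>2 * real m / real N * l)" by (rule dbl[OF A]) simp
   also have "\<dots> = 2\<^sup>2 * (\<epsilon>\<^sup>2 * l * real m / real N)" by simp
   finally have "\<epsilon>\<^sup>2 * real m / real N <= 2\<^sup>2 * (\<epsilon>\<^sup>2 * l * real m / real N)" .
   then have "sqrt (\<epsilon>\<^sup>2 * real m / real N) <= 2 * sqrt (\<epsilon>\<^sup>2 * l * real m / real N)" by (rule sqrt_le_mult) simp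
   moreover have "sqrt (\<epsilon>\<^sup>2 * real m / real N) = sqrt (real m) * (\<epsilon> / sqrt (real N))"
    using ep by (simp add: real_sqrt_mult real_sqrt_divide)
   ultimately show ?thesis using q3 by linarith
  qed
  then have "sqrt (real m) * max (1 / real N) (\<epsilon> / sqrt (real N)) <= 2 * q" using q1 by (simp add: max_def)
  then show ?thesis using False by (simp add: tail_bound_def)
 qed
qed

section \<open>From good events to error probabilities\<close>

lemma emeasure_le_fails:
 assumes "fails_le M p Q" "prob_space M" "\<And>x. x \<in> space M ==> Q x ==> \<not> R x"
 shows "emeasure M {x \<in> space M. R x} <= ennreal p"
proof -
 interpret prob_space M by fact
 obtain E where E: "E \<in> sets M" "measure M E <= p" "\<forall>x\<in>space M - E. Q x" using assms(1) unfolding fails_le_def by auto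
 have "emeasure M {x \<in> space M. R x} <= emeasure M E" using E assms(3) by (intro emeasure_mono) auto
 also have "\<dots> <= ennreal p" using E by (simp add: emeasure_eq_measure ennreal_leI)
 finally show ?thesis .
qed

lemma type1_le:
 assumes sig: "0 < \<sigma>" and f: "fails_le (data_law N d (\<lambda>i\<in>{..<d}. 0) \<sigma>) p Q"
  and Q: "\<And>A x. A \<in> adversaries N d \<epsilon> ==> x \<in> space (data_space N d) ==> Q x ==> \<phi> (A x) \<noteq> 1"
 shows "type1_error N d \<sigma> \<epsilon> \<phi> <= ennreal p"
 unfolding type1_error_def
 using emeasure_le_fails[OF f prob_space_data[OF sig], where R = "\<lambda>x. \<phi> (_ x) = 1"] Q
 by (intro SUP_least) (auto simp: space_data_law[OF sig])

lemma type2_le: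
 assumes sig: "0 < \<sigma>"
  and f: "\<And>\<mu>. \<mu> \<in> K ==> \<rho> <= L2_set \<mu> {..<d} ==> fails_le (data_law N d \<mu> \<sigma>) p (Q \<mu>)"
  and Q: "\<And>\<mu> A x. \<mu> \<in> K ==> \<rho> <= L2_set \<mu> {..<d} ==> A \<in> adversaries N d \<epsilon> ==>
   x \<in> space (data_space N d) ==> Q \<mu> x ==> \<phi> (A x) \<noteq> 0"
 shows "type2_error N d K \<sigma> \<epsilon> \<rho> \<phi> <= ennreal p"
 unfolding type2_error_def
proof (intro SUP_least)
 fix \<mu> A assume mu: "\<mu> \<in> {\<mu> \<in> K. \<rho> <= L2_set \<mu> {..<d}}" and A: "A \<in> adversaries N d \<epsilon>"
 have "emeasure (data_law N d \<mu> \<sigma>) {x \<in> space (data_law N d \<mu> \<sigma>). \<phi> (A x) = 0} <= ennreal p"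
  by (rule emeasure_le_fails[OF f prob_space_data[OF sig]]) (use mu A Q space_data_law[OF sig] in auto)
 then show "emeasure (data_law N d \<mu> \<sigma>) {x \<in> space (data_space N d). \<phi> (A x) = 0} <= ennreal p"
  by (simp add: space_data_law[OF sig])
qed

lemma adversary_rows:
 assumes "A \<in> adversaries N d \<epsilon>" "x \<in> space (data_space N d)" "0 <= \<epsilon>"
 obtains C where "C \<subseteq> {..<N}" "real (card C) <= \<epsilon> * real N" "\<And>i. i < N ==> i \<notin> C ==> A x i = x i"
  "card C <= nat \<lfloor>\<epsilon> * real N\<rfloor>"
proof -
 let ?C = "{i \<in> {..<N}. A x i \<noteq> x i}"
 have c: "real (card ?C) <= \<epsilon> * real N" using assms by (simp add: adversaries_def)
 then have "card ?C <= nat \<lfloor>\<epsilon> * real N\<rfloor>" by (rule le_nat_floor)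
 then show ?thesis using c by (intro that[of ?C]) auto
qed

text \<open>At least 3/4 of the squared norm stays on \<open>S\<close>, which is more than the half
  that is needed.\<close>

lemma signal_on_coords:
 fixes \<mu> :: "nat \<Rightarrow> real"
 assumes S: "S \<subseteq> {..<d}" and sig: "0 < \<sigma>" and rho: "0 <= \<rho>" "\<rho> <= L2_set \<mu> {..<d}"
  and tail: "(\<Sum>i\<in>{..<d} - S. (\<mu> i)\<^sup>2) <= \<rho>\<^sup>2 / 4"
 shows "(\<rho> / \<sigma>)\<^sup>2 <= 2 * (\<Sum>c\<in>S. (\<mu> c / \<sigma>)\<^sup>2)"
proof -
 have "\<rho>\<^sup>2 <= (L2_set \<mu> {..<d})\<^sup>2" using rho by (intro power_mono)
 also have "\<dots> = (\<Sum>i<d. (\<mu> i)\<^sup>2)" by (simp add: L2_set_def sum_nonneg)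
 also have "\<dots> = (\<Sum>i\<in>{..<d} - S. (\<mu> i)\<^sup>2) + (\<Sum>i\<in>S. (\<mu> i)\<^sup>2)" using S by (intro sum.subset_diff) auto
 finally have "\<rho>\<^sup>2 <= 2 * (\<Sum>i\<in>S. (\<mu> i)\<^sup>2)" using tail by (simp add: sum_nonneg) (smt (verit) zero_le_power2)
 then have "\<rho>\<^sup>2 / \<sigma>\<^sup>2 <= 2 * (\<Sum>i\<in>S. (\<mu> i)\<^sup>2) / \<sigma>\<^sup>2" by (intro divide_right_mono) auto
 then show ?thesis by (simp only: power_divide sum_divide_distrib[symmetric] times_divide_eq_right)
qed

text \<open>With t0 = ln (64 / \<alpha>) the failure probabilities 16 exp (- t0) and 12 exp (- t0)
  are at most \<alpha> / 4. The constant in front is the 10^20 of the noise events times the 4 from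
  \<open>rate_consequences\<close>; its square root appears because the rates are squared
  separations.\<close>

definition sep_const :: "real \<Rightarrow> real" where
 "sep_const \<alpha> = sqrt (400000000000000000000 * ln (64 / \<alpha>))"

lemma log_level:
 assumes "\<alpha> \<in> {0<..<1/2 :: real}"
 shows "1 <= ln (64 / \<alpha>)" "exp (- ln (64 / \<alpha>)) = \<alpha> / 64" "1/2 <= ln (1 / \<alpha>)" "0 < sep_const \<alpha>"
proof -
 have a: "0 < \<alpha>" "\<alpha> < 1/2" using assms by auto
 have e: "exp 1 <= (3 :: real)" by (rule exp_le)
 have "exp 1 * \<alpha> <= 3 * (1/2)" using a e by (intro mult_mono) auto
 then have "exp 1 <= 64 / \<alpha>" using a by (simp add: le_divide_eq)
 then show 1: "1 <= ln (64 / \<alpha>)" using a by (simp add: ln_ge_iff)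
 show "exp (- ln (64 / \<alpha>)) = \<alpha> / 64" using a by (simp add: exp_minus)
 have "2 <= 1 / \<alpha>" using a by (simp add: le_divide_eq)
 then have "ln 2 <= ln (1 / \<alpha>)" using a by (intro ln_mono) auto
 then show "1/2 <= ln (1 / \<alpha>)" using ln2_ge_two_thirds by linarith
 show "0 < sep_const \<alpha>" using 1 by (simp add: sep_const_def)
qed

lemma separation_sq:
 assumes a: "\<alpha> \<in> {0<..<1/2 :: real}" and sig: "0 < \<sigma>" and q: "0 <= q"
  and rho: "sep_const \<alpha> * sqrt (\<sigma>\<^sup>2 * q) <= \<rho>"
 shows "0 <= \<rho>" "400000000000000000000 * ln (64 / \<alpha>) * q <= (\<rho> / \<sigma>)\<^sup>2"
proof -
 have p: "0 <= sep_const \<alpha> * sqrt (\<sigma>\<^sup>2 * q)" using log_level(4)[OF a] q by simp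
 then show "0 <= \<rho>" using rho by linarith
 have "(sep_const \<alpha> * sqrt (\<sigma>\<^sup>2 * q))\<^sup>2 <= \<rho>\<^sup>2" using rho p by (rule power_mono)
 then have "400000000000000000000 * ln (64 / \<alpha>) * q * \<sigma>\<^sup>2 <= \<rho>\<^sup>2"
  using q log_level(1)[OF a] by (simp add: power_mult_distrib sep_const_def mult_ac)
 then show "400000000000000000000 * ln (64 / \<alpha>) * q <= (\<rho> / \<sigma>)\<^sup>2"
  using sig by (simp add: power_divide le_divide_eq)
qed

lemma tail_small:
 assumes "tail_bound m N \<epsilon> <= 32 * q" "400000000000000000000 * t0 * q <= (\<rho> / \<sigma>)\<^sup>2" "1 <= t0" "0 <= q" "0 < \<sigma>"
  "T <= \<sigma>\<^sup>2 * tail_bound m N \<epsilon>"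
 shows "T <= \<rho>\<^sup>2 / 4"
proof -
 have "1 * q <= t0 * q" using assms by (intro mult_right_mono)
 then have "tail_bound m N \<epsilon> <= (\<rho> / \<sigma>)\<^sup>2 / 4" using assms(1,2,4) by linarith
 then have "\<sigma>\<^sup>2 * tail_bound m N \<epsilon> <= \<sigma>\<^sup>2 * ((\<rho> / \<sigma>)\<^sup>2 / 4)" by (intro mult_left_mono) auto
 also have "\<dots> = \<rho>\<^sup>2 / 4" using assms by (simp add: power_divide)
 finally show ?thesis using assms by linarith
qed

theorem exhaustive_test:
 assumes a: "\<alpha> \<in> {0<..<1/2 :: real}" and md: "model (1/100000) d K N \<sigma> \<epsilon>"
  and rho: "sep_const \<alpha> * sqrt (rate_E_sq d K N \<sigma> \<epsilon>) <= \<rho>"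
 shows "\<exists>\<phi>\<in>tests N d. type1_error N d \<sigma> \<epsilon> \<phi> < ennreal \<alpha> \<and> type2_error N d K \<sigma> \<epsilon> \<rho> \<phi> < ennreal \<alpha>"
proof -
 have K: "QCO d K" and N1: "1 <= N" and sg: "0 < \<sigma>" and ep: "0 <= \<epsilon>" "\<epsilon> < 1/100000"
  using md by (auto simp: model_def)
 define m where "m = opt_dim_min d K N \<sigma> \<epsilon>"
 note ct = coords_tail[OF md, folded m_def]
 define S where "S = coords d K m"
 have gc: "good_coords d K m S" unfolding S_def by (rule good_coords[OF K ct(1,2)])
 then have S: "S \<subseteq> {..<d}" "1 <= card S" "card S <= 2 * m + 1" by (simp_all add: good_coords_def)
 define l where "l = ln (1 / \<epsilon>)"
 define q where "q = Max {sqrt (real m) / real N, \<epsilon>\<^sup>2 * l, sqrt (\<epsilon>\<^sup>2 * l * real m / real N)}"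
 define t0 where "t0 = ln (64 / \<alpha>)"
 note lv = log_level[OF a, folded t0_def]
 have l1: "1 <= l" if "0 < \<epsilon>"
 proof -
  have "exp 1 * \<epsilon> <= 3 * (1/100000)" using that ep exp_le by (intro mult_mono) auto
  then have "exp 1 <= 1 / \<epsilon>" using that by (simp add: le_divide_eq)
  then show ?thesis using that by (simp add: l_def ln_ge_iff)
 qed
 have q: "sqrt (real m) / real N <= q" "\<epsilon>\<^sup>2 * l <= q" "sqrt (\<epsilon>\<^sup>2 * l * real m / real N) <= q"
  unfolding q_def by (intro Max_ge; simp)+
 have q0: "0 <= q"
 proof -
  have "0 <= sqrt (real m) / real N" by simp
  then show ?thesis using q(1) by linarith
 qed
 have "rate_E_sq d K N \<sigma> \<epsilon> = \<sigma>\<^sup>2 * q"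
  by (simp add: rate_E_sq_def Let_def m_def[symmetric] l_def[symmetric] q_def)
 note sep = separation_sq[OF a sg q0 rho[unfolded this], folded t0_def]
 have q1': "sqrt (real m) / real N <= 2 * q" using q(1) q0 by linarith
 have l12: "1/2 <= l" if "0 < \<epsilon>" using l1[OF that] by simp
 note rc = rate_consequences[OF N1 ep(1) l12 S(3) ct(3) q1' q(2,3)]
 \<comment> \<open>The largest number of samples that can be replaced. It may be 0, also because
   \<epsilon> = 0, and the bounds with ln (1 / \<epsilon>) are stated for positive k.\<close>
 define k where "k = nat \<lfloor>\<epsilon> * real N\<rfloor>"
 define P where "P = (real N)\<^sup>2 * (\<rho> / \<sigma>)\<^sup>2"
 have eN: "\<epsilon> * real N <= 1/100000 * real N" using ep by (intro mult_right_mono) auto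
 have kle: "real k <= \<epsilon> * real N" "\<epsilon> * real N < real k + 1"
  using ep by (simp_all add: k_def)
 have k200: "200 * k <= N" using kle eN by linarith
 have Pq: "400000000000000000000 * (t0 * ((real N)\<^sup>2 * q)) <= P"
 proof -
  have "(real N)\<^sup>2 * (400000000000000000000 * t0 * q) <= P" unfolding P_def by (intro mult_left_mono sep) auto
  then show ?thesis by (simp add: mult_ac)
 qed
 have H1: "100000000 * t0 * (sqrt (real (card S)) * real N) <= P"
 proof -
  have "t0 * (sqrt (real (card S)) * real N) <= t0 * (4 * ((real N)\<^sup>2 * q))" using rc(1) lv(1) by (intro mult_left_mono) auto
  moreover have "0 <= t0 * ((real N)\<^sup>2 * q)" using lv(1) q0 by simp
  ultimately show ?thesis using Pq by linarith
 qed
 have P0: "0 < P"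
 proof -
  have "0 < sqrt (real (card S)) * real N" using S(2) N1 by simp
  then have "0 < 100000000 * t0 * (sqrt (real (card S)) * real N)" using lv(1) S(2) N1 by (intro mult_pos_pos) auto
  then show ?thesis using H1 by linarith
 qed
 have epk: "0 < \<epsilon>" if "0 < k" using that kle ep by (cases "\<epsilon> = 0") auto
 have H2: "100000000 * t0 * (real k * sqrt (real (card S) * real N * l)) <= P" if "0 < k"
 proof -
  have "real k * sqrt (real (card S) * real N * l) <= \<epsilon> * real N * sqrt (real (card S) * real N * l)"
   using kle l1[OF epk[OF that]] by (intro mult_right_mono) auto
  also have "\<dots> = real N * (\<epsilon> * sqrt (real (card S) * real N * l))" by simp
  also have "\<dots> <= real N * (2 * (real N * q))" using rc(2)[OF epk[OF that]] by (rule mult_left_mono) (use epk[OF that] in simp_all)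
  finally have "t0 * (real k * sqrt (real (card S) * real N * l)) <= t0 * (2 * ((real N)\<^sup>2 * q))"
   using lv(1) by (intro mult_left_mono) (auto simp: power2_eq_square mult_ac)
  moreover have "0 <= t0 * ((real N)\<^sup>2 * q)" using lv(1) q0 by simp
  ultimately show ?thesis using Pq by linarith
 qed
 have H3: "100000000 * t0 * ((real k)\<^sup>2 * l) <= P" if "0 < k"
 proof -
  have "(real k)\<^sup>2 * l <= (\<epsilon> * real N)\<^sup>2 * l" using kle l1[OF epk[OF that]] by (intro mult_right_mono power_mono) auto
  also have "\<dots> = (real N)\<^sup>2 * (\<epsilon>\<^sup>2 * l)" by (simp add: power_mult_distrib)
  also have "\<dots> <= (real N)\<^sup>2 * q" using q(2) by (intro mult_left_mono) auto
  finally have "t0 * ((real k)\<^sup>2 * l) <= t0 * ((real N)\<^sup>2 * q)" using lv(1) by (intro mult_left_mono) auto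
  moreover have "0 <= t0 * ((real N)\<^sup>2 * q)" using lv(1) q0 by simp
  ultimately show ?thesis using Pq by linarith
 qed
 have lnk: "ln (real N / real (2 * k)) <= l" if "0 < k"
 proof -
  have k1: "1 <= real k" using that by simp
  have "real N * \<epsilon> <= real (2 * k)" using kle k1 by (simp add: mult.commute)
  then have "real N / real (2 * k) <= 1 / \<epsilon>" using epk[OF that] that by (simp add: divide_simps mult.commute)
  then show ?thesis unfolding l_def using that N1 by (intro ln_mono) auto
 qed
 have event: "fails_le (data_law N d \<mu> \<sigma>) (\<alpha> / 4) (\<lambda>x. subset_noise N S (\<lambda>i j. (x i j - \<mu> j) / \<sigma>) (\<lambda>c. \<mu> c / \<sigma>) (2 * k) P)"
  if mu: "(\<forall>c\<in>S. \<mu> c = 0) \<or> P <= 2 * ((real N)\<^sup>2 * (\<Sum>j\<in>S. (\<mu> j / \<sigma>)\<^sup>2))" for \<mu>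
 proof -
  interpret smp: sample N d \<mu> \<sigma> S by unfold_locales (use sg N1 S in auto)
  have "fails_le (data_law N d \<mu> \<sigma>) (12 * exp (- t0)) (\<lambda>x. subset_noise N S (\<lambda>i j. (x i j - \<mu> j) / \<sigma>) (\<lambda>c. \<mu> c / \<sigma>) (2 * k) P)"
   by (rule smp.subset_noise_event[OF lv(1) P0 H1 H2 H3 l1[OF epk] _ lnk mu]) (use k200 in auto)
  then show ?thesis by (rule fails_le_mono) (use lv(2) a in auto)
 qed
 define \<phi> :: "(nat \<Rightarrow> nat \<Rightarrow> real) \<Rightarrow> nat" where
  "\<phi> = (\<lambda>X. if core_accept N S k P (\<lambda>i c. X i c / \<sigma>) then 0 else 1)"
 have test: "\<phi> \<in> tests N d"
  unfolding tests_def \<phi>_def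
 proof (rule measurable_If)
  show "{x \<in> space (data_space N d). core_accept N S k P (\<lambda>i c. x i c / \<sigma>)} \<in> sets (data_space N d)"
   using core_accept_measurable[OF S(1) sg, of N "\<lambda>_. 0" k P \<sigma>] by (simp only: sets_data_law[OF sg] space_data_law[OF sg])
 qed (rule measurable_const, simp)+
 have "type1_error N d \<sigma> \<epsilon> \<phi> <= ennreal (\<alpha> / 4)"
 proof (rule type1_le[OF sg event])
  show "(\<forall>c\<in>S. (\<lambda>i\<in>{..<d}. 0 :: real) c = 0) \<or> P <= 2 * ((real N)\<^sup>2 * (\<Sum>j\<in>S. ((\<lambda>i\<in>{..<d}. 0) j / \<sigma>)\<^sup>2))" using S(1) by auto
 next
  fix A x assume A: "A \<in> adversaries N d \<epsilon>" "x \<in> space (data_space N d)"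
   and g: "subset_noise N S (\<lambda>i j. (x i j - (\<lambda>i\<in>{..<d}. 0) j) / \<sigma>) (\<lambda>c. (\<lambda>i\<in>{..<d}. 0) c / \<sigma>) (2 * k) P"
  obtain C where C: "C \<subseteq> {..<N}" "card C <= k" "\<And>i. i < N ==> i \<notin> C ==> A x i = x i"
   using adversary_rows[OF A ep(1)] unfolding k_def by metis
  have "core_accept N S k P (\<lambda>i c. A x i c / \<sigma>)"
   by (rule core_null[OF g less_imp_le[OF P0] C(1,2)]) (use C(3) S(1) in auto)
  then show "\<phi> (A x) \<noteq> 1" by (simp add: \<phi>_def)
 qed
 moreover have "type2_error N d K \<sigma> \<epsilon> \<rho> \<phi> <= ennreal (\<alpha> / 4)"
 proof (rule type2_le[OF sg])
  fix \<mu> assume mu: "\<mu> \<in> K" "\<rho> <= L2_set \<mu> {..<d}"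
  have "(\<rho> / \<sigma>)\<^sup>2 <= 2 * (\<Sum>c\<in>S. (\<mu> c / \<sigma>)\<^sup>2)"
   using tail_small[OF rc(3) sep(2) lv(1) q0 sg ct(4)[OF mu(1)]] unfolding S_def[symmetric]
   by (rule signal_on_coords[OF S(1) sg sep(1) mu(2)])
  then have "(real N)\<^sup>2 * (\<rho> / \<sigma>)\<^sup>2 <= (real N)\<^sup>2 * (2 * (\<Sum>c\<in>S. (\<mu> c / \<sigma>)\<^sup>2))" by (intro mult_left_mono) auto
  then have Pn: "P <= 2 * ((real N)\<^sup>2 * (\<Sum>c\<in>S. (\<mu> c / \<sigma>)\<^sup>2))" by (simp add: P_def mult_ac)
  then show "fails_le (data_law N d \<mu> \<sigma>) (\<alpha> / 4) (\<lambda>x. subset_noise N S (\<lambda>i j. (x i j - \<mu> j) / \<sigma>) (\<lambda>c. \<mu> c / \<sigma>) (2 * k) P)"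
   by (intro event disjI2)
  fix A x assume A: "A \<in> adversaries N d \<epsilon>" "x \<in> space (data_space N d)"
   and g: "subset_noise N S (\<lambda>i j. (x i j - \<mu> j) / \<sigma>) (\<lambda>c. \<mu> c / \<sigma>) (2 * k) P"
  obtain C where C: "C \<subseteq> {..<N}" "card C <= k" "\<And>i. i < N ==> i \<notin> C ==> A x i = x i"
   using adversary_rows[OF A ep(1)] unfolding k_def by metis
  have "\<not> core_accept N S k P (\<lambda>i c. A x i c / \<sigma>)"
   by (rule core_alternative[OF g P0 k200 Pn C(1,2)]) (use C(3) in \<open>auto simp: add_divide_distrib[symmetric]\<close>)
  then show "\<phi> (A x) \<noteq> 0" by (simp add: \<phi>_def)
 qed
 moreover have "ennreal (\<alpha> / 4) < ennreal \<alpha>" using a by (simp add: ennreal_less_iff)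
 ultimately show ?thesis using test by (meson le_less_trans)
qed

section \<open>The decision of the filter on good data\<close>

lemma good_noise_cong:
 assumes "\<And>c. c \<in> S ==> mu c = mu' c"
 shows "good_noise N S Z mu e D = good_noise N S Z mu' e D"
proof -
 have "(\<Sum>c\<in>S. mu c * Z i c) = (\<Sum>c\<in>S. mu' c * Z i c)" for i using assms by (intro sum.cong) auto
 moreover have "(\<Sum>c\<in>S. (mu c)\<^sup>2) = (\<Sum>c\<in>S. (mu' c)\<^sup>2)" using assms by (intro sum.cong) auto
 ultimately show ?thesis by (simp only: good_noise_def)
qed

lemma contaminatedI:
 assumes "good_noise N S Z mu e D" "finite S" "1 <= card S" "C \<subseteq> {..<N}" "real (card C) <= e" "1 <= e"
  "100000 * e <= real N" "0 < D" "card S <= N ==> sqrt (real (card S) * real N) <= eta * D"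
  "\<And>i c. i < N ==> i \<notin> C ==> c \<in> S ==> X i c = mu c + Z i c"
 shows "contaminated N S X Z mu C e D"
 using assms(1) unfolding good_noise_def
 by (intro contaminated.intro) (use assms(2-) in \<open>blast+\<close>)

lemma clip_mass:
 "(\<Sum>i<N. w i) < real N - x \<longleftrightarrow> \<not> (\<Sum>i<N. 1 - w i) <= (x :: real)"
 by (simp add: sum_subtractf) linarith

lemma filter_null:
 assumes c: "contaminated N S X Z (\<lambda>_. 0) C e D"
 shows "\<not> filter_rejects N (card S) (shifted N (card S) (gram S X)) e D (e * D)"
proof -
 interpret contaminated N S X Z "\<lambda>_. 0" C e D by fact
 show ?thesis
  using null_accept[OF refl] e(1)
  unfolding filter_rejects_def Let_def noise_free_total_def clip_mass \<Delta>_def \<tau>_def by auto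
qed

lemma filter_alternative:
 assumes c: "contaminated N S X Z mu C e D" and P: "e * D <= 2 * ((real N)\<^sup>2 * (\<Sum>c\<in>S. (mu c)\<^sup>2))"
 shows "filter_rejects N (card S) (shifted N (card S) (gram S X)) e D (e * D)"
proof -
 interpret contaminated N S X Z mu C e D by fact
 show ?thesis
  using alt_reject[OF P] e(1)
  unfolding filter_rejects_def Let_def noise_free_total_def clip_mass \<Delta>_def \<tau>_def by auto
qed

text \<open>For e < 1 the filter takes all weights equal to 1, and a core for k = 0 is the whole
  sample; thus the analysis of the exhaustive test covers this case.\<close>

lemma filter_small:
 assumes e: "0 <= e" "e < 1"
 shows "filter_rejects N (card S) (shifted N (card S) (gram S X)) e D P \<longleftrightarrow> \<not> core_accept N S 0 P X"
proof -
 have full: "T = {..<N}" if "T \<subseteq> {..<N}" "N <= card T" for T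
  using card_seteq[OF finite_lessThan that(1)] that(2) by simp
 have "core_accept N S 0 P X \<longleftrightarrow> excess N S X {..<N} <= P / 4"
 proof
  assume "core_accept N S 0 P X"
  then obtain T1 where T1: "T1 \<subseteq> {..<N}" "N <= card T1"
   and all: "\<And>T. T \<subseteq> T1 ==> N <= card T ==> excess N S X T <= P / 4"
   unfolding core_accept_def by auto
  show "excess N S X {..<N} <= P / 4" using all[of T1] T1 full[OF T1] by simp
 next
  assume a: "excess N S X {..<N} <= P / 4"
  show "core_accept N S 0 P X"
   unfolding core_accept_def
  proof (intro bexI[of _ "{..<N}"] conjI ballI impI)
   fix T assume "T \<in> Pow {..<N}" "N <= card T + 2 * 0"
   then show "excess N S X T <= P / 4" using a full[of T] by simp
  qed auto
 qed
 moreover have "quad {..<N} (gram S X) (ind {..<N}) (ind {..<N}) = quad {..<N} (gram S X) (\<lambda>_. 1) (\<lambda>_. 1)"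
  unfolding quad_def by (intro sum.cong) (auto simp: ind_def)
 then have "excess N S X {..<N} =
   quad {..<N} (shifted N (card S) (gram S X)) (\<lambda>_. 1) (\<lambda>_. 1) - noise_free_total N (card S)"
  by (simp add: excess_def quad_shifted noise_free_total_def algebra_simps)
 ultimately show ?thesis using e by (auto simp: filter_rejects_def Let_def)
qed

section \<open>Input layout and running the program\<close>

lemma concat_rows:
 "length (concat (map (\<lambda>i. map (f i) [0..<d]) [0..<N])) = N * d"
 "i < N ==> c < d ==> concat (map (\<lambda>i. map (f i) [0..<d]) [0..<N]) ! (i * d + c) = f i c"
proof -
 have len: "length (concat (map (\<lambda>i. map (f i) [0..<d]) [0..<N])) = N * d" for N
  by (induction N) simp_all
 then show "length (concat (map (\<lambda>i. map (f i) [0..<d]) [0..<N])) = N * d" .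
 show "concat (map (\<lambda>i. map (f i) [0..<d]) [0..<N]) ! (i * d + c) = f i c" if "i < N" "c < d"
  using that
 proof (induction N)
  case (Suc N)
  show ?case
  proof (cases "i < N")
   case True
   have "i * d + c < Suc i * d" using Suc.prems by simp
   also have "\<dots> <= N * d" using True by (intro mult_right_mono) auto
   finally show ?thesis using True Suc by (simp add: nth_append len)
  next
   case False
   then have "i = N" using Suc.prems by simp
   then show ?thesis using Suc.prems by (simp add: nth_append len)
  qed
 qed simp
qed

definition filter_program :: program where
 "filter_program = assemble (Seq load_prog main_prog)"

definition coord_list :: "nat \<Rightarrow> (nat \<Rightarrow> real) set \<Rightarrow> nat \<Rightarrow> nat \<Rightarrow> real list" where
 "coord_list d K k1 k2 = map real (sorted_list_of_set (coords d K (min k1 k2)))"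

definition filter_test ::
 "nat \<Rightarrow> nat set \<Rightarrow> real \<Rightarrow> real \<Rightarrow> real \<Rightarrow> (nat \<Rightarrow> nat \<Rightarrow> real) \<Rightarrow> bool" where
 "filter_test N S \<sigma> \<epsilon> \<rho> X \<longleftrightarrow> filter_rejects N (card S) (shifted N (card S) (gram S (\<lambda>i c. X i c / \<sigma>)))
   (\<epsilon> * real N) (real N * (\<rho> * \<rho> / (\<sigma> * \<sigma>)) / \<epsilon>) (real N * real N * (\<rho> * \<rho> / (\<sigma> * \<sigma>)))"

lemma filter_program_run:
 assumes N: "0 < N" and S: "S \<subseteq> {..<d}" and h: "h = map real (sorted_list_of_set S)"
  and xs_def: "xs = test_input N d \<sigma> \<epsilon> \<alpha> \<rho> k1 k2 h X"
 shows "\<exists>t m v. t <= time_bound load_prog (\<lambda>_. 0) + time_bound main_prog v + 4 \<and> v 0 = N \<and> v 2 = card S \<and>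
  (step (snd filter_program) ^^ t) (input_config (fst filter_program) xs) = (length (snd filter_program), m) \<and>
  m 0 = of_bool (filter_test N S \<sigma> \<epsilon> \<rho> X)"
proof -
 define s where "s = card S"
 define L where "L = length xs"
 define I where "I i = xs ! i" for i
 have I: "(\<lambda>i. xs ! i) = I" by (simp add: I_def fun_eq_iff)
 have fS: "finite S" using S finite_subset by auto
 have lh: "length h = s" using fS by (simp add: h s_def)
 have L: "L = 9 + s + N * d" by (simp add: L_def xs_def test_input_def lh concat_rows(1))
 have hd: "I 0 = real N" "I 1 = real d" "I 2 = \<sigma>" "I 3 = \<epsilon>" "I 5 = \<rho>" "I 8 = real s"
  by (simp_all add: I_def xs_def test_input_def lh)
 define hh where "hh l = sorted_list_of_set S ! l" for l
 have hI: "I (9 + l) = real (hh l) \<and> hh l < d" if "l < s" for l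
 proof -
  have "I (9 + l) = h ! l" using that by (simp add: I_def xs_def test_input_def lh nth_append)
  moreover have "h ! l = real (hh l)" using that fS by (simp add: h hh_def s_def)
  moreover have "hh l \<in> set (sorted_list_of_set S)" using that fS unfolding hh_def by (intro nth_mem) (simp add: s_def)
  ultimately show ?thesis using S fS by auto
 qed
 have XI: "I (9 + s + (i * d + c)) = X i c" if "i < N" "c < d" for i c
  using concat_rows(2)[OF that, of X] by (simp add: I_def xs_def test_input_def lh nth_append)
 let ?s0 = "ev I load_prog init_st"
 have ld: "tc I L load_prog init_st (\<lambda>t. nv t 0 = N \<and> nv t 1 = d \<and> nv t 2 = s)"
  using hd by (simp add: load_prog_def tc_Seq tc_simps init_st_def L)
 then have s0: "nv ?s0 0 = N" "nv ?s0 1 = d" "nv ?s0 2 = s" and sf1: "safe I L load_prog init_st"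
  by (simp_all add: tc_def)
 have gr: "(\<lambda>a b. \<Sum>l<s. X a (hh l) * X b (hh l) / (\<sigma> * \<sigma>)) = gram S (\<lambda>i c. X i c / \<sigma>)"
 proof (intro ext)
  fix a b
  have "bij_betw hh {..<s} S"
   unfolding hh_def using bij_betw_nth[of "sorted_list_of_set S" "{..<s}" S] fS by (simp add: s_def)
  from sum.reindex_bij_betw[OF this, of "\<lambda>c. X a c / \<sigma> * (X b c / \<sigma>)"]
  show "(\<Sum>l<s. X a (hh l) * X b (hh l) / (\<sigma> * \<sigma>)) = gram S (\<lambda>i c. X i c / \<sigma>) a b"
   by (simp add: gram_def)
 qed
 have mr: "tc I L main_prog ?s0 (\<lambda>t. rv t 0 = of_bool (filter_test N S \<sigma> \<epsilon> \<rho> X))"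
  unfolding filter_test_def gr[symmetric] s_def[symmetric]
  by (rule main_run[OF s0(1) N s0(2,3) hd(3) hd(4,5) hI XI L])
 have sf: "safe (\<lambda>i. xs ! i) (length xs) (Seq load_prog main_prog) init_st"
  unfolding I L_def[symmetric] using mr sf1 by (simp add: tc_def)
 have len: "length xs = 9 + s + N * d" using L by (simp add: L_def)
 have x0: "xs ! 0 = real N" "xs ! 1 = real d" "xs ! 8 = real s" using hd by (simp_all add: I_def)
 from assemble_Seq_correct[OF len x0 wf_progs(1,2) sf wf_progs(3,4)] obtain t m where
  t: "t <= time_bound load_prog (\<lambda>_. 0) + time_bound main_prog (nv ?s0) + 4"
  "(step (snd filter_program) ^^ t) (input_config (fst filter_program) xs) = (length (snd filter_program), m)"
  "\<forall>i<30. m i = rv (ev I (Seq load_prog main_prog) init_st) i"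
  unfolding I filter_program_def by blast
 have "m 0 = of_bool (filter_test N S \<sigma> \<epsilon> \<rho> X)" using t(3) mr by (simp add: tc_def)
 then show ?thesis using t(1,2) s0 unfolding s_def by blast
qed

lemma input_measurable:
 "(\<lambda>X. snd (input_config r (test_input N d \<sigma> \<epsilon> \<alpha> \<rho> k1 k2 h X)) i) \<in> borel_measurable (data_space N d)"
proof -
 define xs where "xs X = test_input N d \<sigma> \<epsilon> \<alpha> \<rho> k1 k2 h X" for X
 have len: "length (xs X) = 9 + length h + N * d" for X by (simp add: xs_def test_input_def concat_rows(1))
 consider "i < r \<or> r + (9 + length h + N * d) <= i" | "r <= i" "i - r < 9 + length h"
  | "r <= i" "9 + length h <= i - r" "i - r < 9 + length h + N * d" by linarith
 then show ?thesis
 proof cases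
  case 1
  then show ?thesis by (auto simp: input_config_def xs_def[symmetric] len)
 next
  case 2
  let ?p = "[real N, real d, \<sigma>, \<epsilon>, \<alpha>, \<rho>, real k1, real k2, real (length h)] @ h"
  have "xs X ! (i - r) = ?p ! (i - r)" for X
   using 2 nth_append_left[of "i - r" ?p] by (simp add: xs_def test_input_def del: append_Cons)
  then have e: "snd (input_config r (xs X)) i = ?p ! (i - r)" for X using 2 by (simp add: input_config_def len)
  show ?thesis unfolding xs_def[symmetric] e by simp
 next
  case 3
  define j where "j = i - r - (9 + length h)"
  have j: "j < N * d" using 3 by (simp add: j_def)
  then have d0: "0 < d" by (cases d) auto
  have jj: "j div d < N" "j mod d < d" using j d0 by (simp_all add: less_mult_imp_div_less)
  let ?p = "[real N, real d, \<sigma>, \<epsilon>, \<alpha>, \<rho>, real k1, real k2, real (length h)] @ h"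
  have x: "xs X ! (i - r) = X (j div d) (j mod d)" for X
  proof -
   have "xs X = ?p @ concat (map (\<lambda>i. map (X i) [0..<d]) [0..<N])" by (simp add: xs_def test_input_def)
   moreover have "i - r = length ?p + j" using 3 by (simp add: j_def)
   ultimately have "xs X ! (i - r) = concat (map (\<lambda>i. map (X i) [0..<d]) [0..<N]) ! j"
    by (simp only: nth_append_length_plus)
   also have "j = j div d * d + j mod d" by simp
   finally show ?thesis using concat_rows(2)[OF jj, of X] by simp
  qed
  have e: "snd (input_config r (xs X)) i = X (j div d) (j mod d)" for X using 3 x[of X] by (simp add: input_config_def len)
  have "(\<lambda>X. X (j div d) (j mod d)) \<in> borel_measurable (data_space N d)"
  proof -
   have "(\<lambda>x. x (j div d)) \<in> measurable (data_space N d) (\<Pi>\<^sub>M j\<in>{..<d}. borel :: real measure)"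
    unfolding data_space_def by (rule measurable_component_singleton) (use jj in simp)
   moreover have "(\<lambda>y. y (j mod d)) \<in> borel_measurable (\<Pi>\<^sub>M j\<in>{..<d}. borel :: real measure)"
    by (rule measurable_component_singleton) (use jj in simp)
   ultimately show ?thesis by (rule measurable_compose)
  qed
  then show ?thesis unfolding xs_def[symmetric] e .
 qed
qed

text \<open>The decision can be read off cell 0 after a number of steps that does not depend on the
  data: the loop bounds are N and the number of coordinates, and a halted machine stays where it
  is.\<close>

lemma filter_test_measurable:
 assumes N: "0 < N" and S: "S \<subseteq> {..<d}"
 shows "(\<lambda>X. of_bool (filter_test N S \<sigma> \<epsilon> \<rho> X) :: nat) \<in> tests N d"
proof -
 define h where "h = map real (sorted_list_of_set S)"
 define T where "T = time_bound load_prog (\<lambda>_. 0) + time_bound main_prog (\<lambda>x. if x = 0 then N else card S) + 4"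
 define s0 where "s0 X = snd (input_config (fst filter_program) (test_input N d \<sigma> \<epsilon> 0 \<rho> 0 0 h X))" for X
 have s0: "input_config (fst filter_program) (test_input N d \<sigma> \<epsilon> 0 \<rho> 0 0 h X) = (0, s0 X)" for X
  by (simp add: s0_def input_config_def)
 have eq: "snd ((step (snd filter_program) ^^ T) (0, s0 X)) 0 = of_bool (filter_test N S \<sigma> \<epsilon> \<rho> X)" for X
 proof -
  from filter_program_run[OF N S h_def refl, of \<sigma> \<epsilon> 0 \<rho> 0 0 X] obtain t m v where
   t: "t <= time_bound load_prog (\<lambda>_. 0) + time_bound main_prog v + 4" "v 0 = N" "v 2 = card S"
   "(step (snd filter_program) ^^ t) (0, s0 X) = (length (snd filter_program), m)"
   "m 0 = of_bool (filter_test N S \<sigma> \<epsilon> \<rho> X)" unfolding s0 by blast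
  have "time_bound main_prog v = time_bound main_prog (\<lambda>x. if x = 0 then N else card S)"
   by (rule time_bound_cong) (use wf_progs(5) t in auto)
  then have "t <= T" using t(1) by (simp add: T_def)
  then have "(step (snd filter_program) ^^ T) (0, s0 X) = (step (snd filter_program) ^^ (T - t)) ((step (snd filter_program) ^^ t) (0, s0 X))"
   by (simp add: funpow_add[symmetric, unfolded comp_def, THEN fun_cong])
  also have "\<dots> = (length (snd filter_program), m)" unfolding t(4) by (rule step_halted) simp
  finally show ?thesis using t(5) by simp
 qed
 have "(\<lambda>X. snd ((step (snd filter_program) ^^ T) (0, s0 X)) 0) \<in> borel_measurable (data_space N d)"
  using steps_measurable[where s = s0 and M = "data_space N d" and code = "snd filter_program" and t = T and pc = 0]
   input_measurable[of "fst filter_program" N d \<sigma> \<epsilon> 0 \<rho> 0 0 h] unfolding s0_def by blast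
 then have m[measurable]: "(\<lambda>X. of_bool (filter_test N S \<sigma> \<epsilon> \<rho> X) :: real) \<in> borel_measurable (data_space N d)"
  unfolding eq .
 have "{X \<in> space (data_space N d). (of_bool (filter_test N S \<sigma> \<epsilon> \<rho> X) :: real) = 1} \<in> sets (data_space N d)"
  by measurable
 then have "(\<lambda>X. if filter_test N S \<sigma> \<epsilon> \<rho> X then 1 else 0) \<in> measurable (data_space N d) (count_space {0, 1 :: nat})"
  by (intro measurable_If measurable_const) simp_all
 then show ?thesis by (simp only: tests_def of_bool_def)
qed

text \<open>With l = ln (N / \<alpha>), each term of the rate supplies one premise of
  \<open>noise_event\<close>: \<epsilon> l / sqrt N bounds the row sums, \<epsilon>^2 l the small
  subsets, the square root the dimension-dependent part of the rows, and the last term the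
  total.\<close>

lemma filter_test_errors:
 assumes a: "\<alpha> \<in> {0<..<1/2 :: real}" and md: "model (1/100000) d K N \<sigma> \<epsilon>"
  and rho: "sep_const \<alpha> * sqrt (rate_P_sq \<alpha> d K N \<sigma> \<epsilon>) <= \<rho>"
 defines "\<phi> \<equiv> \<lambda>X. of_bool (filter_test N (coords d K (opt_dim_min d K N \<sigma> \<epsilon>)) \<sigma> \<epsilon> \<rho> X) :: nat"
 shows "\<phi> \<in> tests N d" "type1_error N d \<sigma> \<epsilon> \<phi> < ennreal \<alpha>" "type2_error N d K \<sigma> \<epsilon> \<rho> \<phi> < ennreal \<alpha>"
proof -
 have K: "QCO d K" and N1: "1 <= N" and sg: "0 < \<sigma>" and ep: "0 <= \<epsilon>" "\<epsilon> < 1/100000"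
  using md by (auto simp: model_def)
 have N0: "0 < real N" using N1 by simp
 define m where "m = opt_dim_min d K N \<sigma> \<epsilon>"
 note ct = coords_tail[OF md, folded m_def]
 define S where "S = coords d K m"
 have gc: "good_coords d K m S" unfolding S_def by (rule good_coords[OF K ct(1,2)])
 then have S: "S \<subseteq> {..<d}" "1 <= card S" "card S <= 2 * m + 1" by (simp_all add: good_coords_def)
 have fS: "finite S" using S finite_subset by auto
 have \<phi>: "\<phi> = (\<lambda>X. of_bool (filter_test N S \<sigma> \<epsilon> \<rho> X))" by (simp add: \<phi>_def S_def m_def)
 show test: "\<phi> \<in> tests N d" unfolding \<phi> using N1 S(1) by (intro filter_test_measurable) auto
 define l where "l = ln (real N / \<alpha>)"
 define q where "q = Max {\<epsilon> * l / sqrt (real N), \<epsilon>\<^sup>2 * l, sqrt (\<epsilon>\<^sup>2 * real m * l / real N), sqrt (real m) * ln (1 / \<alpha>) / real N}"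
 define t0 where "t0 = ln (64 / \<alpha>)"
 note lv = log_level[OF a, folded t0_def]
 have al: "0 < \<alpha>" "\<alpha> < 1" using a by auto
 have "1 / \<alpha> <= real N / \<alpha>" using N1 al by (intro divide_right_mono) auto
 then have "ln (1 / \<alpha>) <= l" unfolding l_def using al N0 by (intro ln_mono) auto
 then have l12: "1/2 <= l" using lv(3) by linarith
 have lN: "ln (real N) <= l"
 proof -
  have "real N * \<alpha> <= real N * 1" using al by (intro mult_left_mono) auto
  then have "real N <= real N / \<alpha>" using al by (simp add: le_divide_eq)
  then show ?thesis unfolding l_def using N0 by (intro ln_mono) auto
 qed
 have q: "\<epsilon> * l / sqrt (real N) <= q" "\<epsilon>\<^sup>2 * l <= q" "sqrt (\<epsilon>\<^sup>2 * real m * l / real N) <= q"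
  "sqrt (real m) * ln (1 / \<alpha>) / real N <= q"
  unfolding q_def by (intro Max_ge; simp)+
 have q0: "0 <= q"
 proof -
  have "0 <= \<epsilon>\<^sup>2 * l" using l12 by simp
  then show ?thesis using q(2) by linarith
 qed
 have rP: "rate_P_sq \<alpha> d K N \<sigma> \<epsilon> = \<sigma>\<^sup>2 * q"
  by (simp add: rate_P_sq_def Let_def m_def[symmetric] l_def[symmetric] q_def)
 note sep = separation_sq[OF a sg q0 rho[unfolded rP], folded t0_def]
 have q1': "sqrt (real m) / real N <= 2 * q"
 proof -
  have "sqrt (real m) / real N * (1/2) <= sqrt (real m) / real N * ln (1 / \<alpha>)"
   using lv(3) by (intro mult_left_mono) auto
  then show ?thesis using q(4) by simp
 qed
 have q3': "sqrt (\<epsilon>\<^sup>2 * l * real m / real N) <= q" using q(3) by (simp only: mult_ac)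
 note rc = rate_consequences[OF N1 ep(1) l12 S(3) ct(3) q1' q(2) q3']
 define e where "e = \<epsilon> * real N"
 define D where "D = real N * (\<rho> * \<rho> / (\<sigma> * \<sigma>)) / \<epsilon>"
 define P where "P = real N * real N * (\<rho> * \<rho> / (\<sigma> * \<sigma>))"
 have P: "P = (real N)\<^sup>2 * (\<rho> / \<sigma>)\<^sup>2" by (simp add: P_def power2_eq_square)
 have Pq: "400000000000000000000 * (t0 * ((real N)\<^sup>2 * q)) <= P"
 proof -
  have "(real N)\<^sup>2 * (400000000000000000000 * t0 * q) <= P" unfolding P by (intro mult_left_mono sep) auto
  then show ?thesis by (simp add: mult_ac)
 qed
 have H1: "100000000000000000000 * t0 * (sqrt (real (card S)) * real N) <= P"
 proof -
  have "t0 * (sqrt (real (card S)) * real N) <= t0 * (4 * ((real N)\<^sup>2 * q))" using rc(1) lv(1) by (intro mult_left_mono) auto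
  then show ?thesis using Pq by linarith
 qed
 have H1pos: "0 < t0 * (sqrt (real (card S)) * real N)" using S(2) N1 lv(1) by (intro mult_pos_pos) auto
 have P0: "0 < P" using H1 H1pos by linarith
 have H1': "100000000 * t0 * (sqrt (real (card S)) * real N) <= P" using H1 H1pos by linarith
 have signal: "P <= 2 * ((real N)\<^sup>2 * (\<Sum>c\<in>S. (\<mu> c / \<sigma>)\<^sup>2))" if mu: "\<mu> \<in> K" "\<rho> <= L2_set \<mu> {..<d}" for \<mu>
 proof -
  have "(\<rho> / \<sigma>)\<^sup>2 <= 2 * (\<Sum>c\<in>S. (\<mu> c / \<sigma>)\<^sup>2)"
   using tail_small[OF rc(3) sep(2) lv(1) q0 sg ct(4)[OF mu(1)]] unfolding S_def[symmetric]
   by (rule signal_on_coords[OF S(1) sg sep(1) mu(2)])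
  then have "(real N)\<^sup>2 * (\<rho> / \<sigma>)\<^sup>2 <= (real N)\<^sup>2 * (2 * (\<Sum>c\<in>S. (\<mu> c / \<sigma>)\<^sup>2))" by (intro mult_left_mono) auto
  then show ?thesis by (simp add: P mult_ac)
 qed
 let ?z = "\<lambda>i\<in>{..<d}. 0 :: real"
 have zero: "(\<forall>c\<in>S. ?z c = 0) \<or> Y" for Y using S(1) by auto
 have "type1_error N d \<sigma> \<epsilon> \<phi> <= ennreal (\<alpha> / 4) \<and> type2_error N d K \<sigma> \<epsilon> \<rho> \<phi> <= ennreal (\<alpha> / 4)"
 proof (cases "1 <= e")
  case False
  have e1: "0 <= e" "e < 1" using False ep by (simp_all add: e_def)
  have k0: "nat \<lfloor>\<epsilon> * real N\<rfloor> = 0" using e1 by (simp add: e_def floor_eq_iff)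
  have ft: "filter_test N S \<sigma> \<epsilon> \<rho> X \<longleftrightarrow> \<not> core_accept N S 0 P (\<lambda>i c. X i c / \<sigma>)" for X
   unfolding filter_test_def e_def[symmetric] P_def[symmetric] by (rule filter_small[OF e1])
  have event: "fails_le (data_law N d \<mu> \<sigma>) (\<alpha> / 4) (\<lambda>x. subset_noise N S (\<lambda>i j. (x i j - \<mu> j) / \<sigma>) (\<lambda>c. \<mu> c / \<sigma>) (2 * 0) P)"
   if mu: "(\<forall>c\<in>S. \<mu> c = 0) \<or> P <= 2 * ((real N)\<^sup>2 * (\<Sum>j\<in>S. (\<mu> j / \<sigma>)\<^sup>2))" for \<mu>
  proof -
   interpret smp: sample N d \<mu> \<sigma> S by unfold_locales (use sg N1 S in auto)
   have "fails_le (data_law N d \<mu> \<sigma>) (12 * exp (- t0)) (\<lambda>x. subset_noise N S (\<lambda>i j. (x i j - \<mu> j) / \<sigma>) (\<lambda>c. \<mu> c / \<sigma>) (2 * 0) P)"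
    by (rule smp.subset_noise_event[where k = 0, OF lv(1) P0 H1' _ _ _ _ _ mu]) simp_all
   then show ?thesis by (rule fails_le_mono) (use lv(2) al in auto)
  qed
  have clean: "A x i = x i" if A: "A \<in> adversaries N d \<epsilon>" "x \<in> space (data_space N d)" and i: "i < N" for A x i
  proof -
   obtain C where C: "C \<subseteq> {..<N}" "card C <= nat \<lfloor>\<epsilon> * real N\<rfloor>" "\<And>i. i < N ==> i \<notin> C ==> A x i = x i"
    using adversary_rows[OF A ep(1)] by metis
   then have "C = {}" using k0 finite_subset[OF C(1)] by simp
   then show ?thesis using C(3) i by simp
  qed
  show ?thesis
  proof
   show "type1_error N d \<sigma> \<epsilon> \<phi> <= ennreal (\<alpha> / 4)"
   proof (rule type1_le[OF sg event[OF zero]])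
    fix A x assume A: "A \<in> adversaries N d \<epsilon>" "x \<in> space (data_space N d)"
     and g: "subset_noise N S (\<lambda>i j. (x i j - ?z j) / \<sigma>) (\<lambda>c. ?z c / \<sigma>) (2 * 0) P"
    have "core_accept N S 0 P (\<lambda>i c. A x i c / \<sigma>)"
     by (rule core_null[OF g less_imp_le[OF P0], of "{}"]) (use clean[OF A] S(1) in auto)
    then show "\<phi> (A x) \<noteq> 1" by (simp add: \<phi> ft)
   qed
   show "type2_error N d K \<sigma> \<epsilon> \<rho> \<phi> <= ennreal (\<alpha> / 4)"
   proof (rule type2_le[OF sg event[OF disjI2[OF signal]]])
    fix \<mu> A x assume mu: "\<mu> \<in> K" "\<rho> <= L2_set \<mu> {..<d}" and A: "A \<in> adversaries N d \<epsilon>" "x \<in> space (data_space N d)"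
     and g: "subset_noise N S (\<lambda>i j. (x i j - \<mu> j) / \<sigma>) (\<lambda>c. \<mu> c / \<sigma>) (2 * 0) P"
    have "\<not> core_accept N S 0 P (\<lambda>i c. A x i c / \<sigma>)"
     by (rule core_alternative[OF g P0 _ signal[OF mu], of "{}"])
      (use clean[OF A] in \<open>auto simp: add_divide_distrib[symmetric]\<close>)
    then show "\<phi> (A x) \<noteq> 0" by (simp add: \<phi> ft)
   qed
  qed
 next
  case True
  have ep0: "0 < \<epsilon>" using True ep by (cases "\<epsilon> = 0") (auto simp: e_def)
  have eD: "e * D = P" using ep0 by (simp add: e_def D_def P_def)
  have D0: "0 < D"
  proof -
   have "0 < e * D" using eD P0 by simp
   then show ?thesis using True by (simp add: zero_less_mult_iff)
  qed
  have eN: "100000 * e <= real N"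
  proof -
   have "\<epsilon> * real N <= 1/100000 * real N" using ep by (intro mult_right_mono) auto
   then show ?thesis by (simp add: e_def)
  qed
  \<comment> \<open>As D = N r^2 / \<epsilon> with r the separation in standard deviations, bounds
    by D are bounds on \<epsilon> times the quantity by N r^2.\<close>
  have Db: "100000000000000000000 * t0 * Y <= D" if "\<epsilon> * Y <= 2 * (real N * q)" for Y
  proof -
   have "t0 * (\<epsilon> * Y) <= t0 * (2 * (real N * q))" using that lv(1) by (intro mult_left_mono) auto
   moreover have "real N * (400000000000000000000 * t0 * q) <= real N * (\<rho> / \<sigma>)\<^sup>2" by (intro mult_left_mono sep) auto
   moreover have "real N * (400000000000000000000 * t0 * q) = 400000000000000000000 * (t0 * (real N * q))" by simp
   moreover have "t0 * (2 * (real N * q)) = 2 * (t0 * (real N * q))" by simp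
   moreover have "0 <= t0 * (real N * q)" using lv(1) q0 by simp
   ultimately have "100000000000000000000 * (t0 * (\<epsilon> * Y)) <= real N * (\<rho> / \<sigma>)\<^sup>2" by linarith
   moreover have "real N * (\<rho> / \<sigma>)\<^sup>2 = \<epsilon> * D" using ep0 by (simp add: D_def power2_eq_square)
   moreover have "100000000000000000000 * (t0 * (\<epsilon> * Y)) = \<epsilon> * (100000000000000000000 * t0 * Y)" by simp
   ultimately have "\<epsilon> * (100000000000000000000 * t0 * Y) <= \<epsilon> * D" by simp
   then show ?thesis by (rule mult_left_le_imp_le[OF _ ep0])
  qed
  have Nq: "0 <= real N * q" using q0 by simp
  have H2: "100000000000000000000 * t0 * sqrt (real (card S) * real N * l) <= D"
   by (rule Db, rule rc(2)[OF _ ep0])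
  have H3: "100000000000000000000 * t0 * (sqrt (real N) * l) <= D"
  proof (rule Db)
   have "\<epsilon> * l / sqrt (real N) * real N <= q * real N" using q(1) by (intro mult_right_mono) auto
   moreover have "\<epsilon> * l / sqrt (real N) * real N = \<epsilon> * (sqrt (real N) * l)"
    using N0 real_sqrt_mult_self[of "real N"] by (simp add: divide_simps)
   ultimately show "\<epsilon> * (sqrt (real N) * l) <= 2 * (real N * q)" using Nq mult.commute[of q "real N"] by linarith
  qed
  have H4: "100000000000000000000 * t0 * (e * l) <= D"
  proof (rule Db)
   have "real N * (\<epsilon>\<^sup>2 * l) <= real N * q" using q(2) by (intro mult_left_mono) auto
   moreover have "\<epsilon> * (e * l) = real N * (\<epsilon>\<^sup>2 * l)" by (simp add: e_def power2_eq_square)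
   ultimately show "\<epsilon> * (e * l) <= 2 * (real N * q)" using Nq by linarith
  qed
  have event: "fails_le (data_law N d \<mu> \<sigma>) (\<alpha> / 4) (\<lambda>x. good_noise N S (\<lambda>i j. (x i j - \<mu> j) / \<sigma>) (\<lambda>c. \<mu> c / \<sigma>) e D) \<and>
    (card S <= N --> sqrt (real (card S) * real N) <= eta * D)"
   if mu: "(\<forall>c\<in>S. \<mu> c = 0) \<or> e * D <= 2 * ((real N)\<^sup>2 * (\<Sum>j\<in>S. (\<mu> j / \<sigma>)\<^sup>2))" for \<mu>
  proof -
   interpret smp: sample N d \<mu> \<sigma> S by unfold_locales (use sg N1 S in auto)
   note ne = smp.noise_event[OF lv(1) l12 lN True eN D0 H1[folded eD] H2 H3 H4 mu]
   have "fails_le (data_law N d \<mu> \<sigma>) (\<alpha> / 4) (\<lambda>x. good_noise N S (\<lambda>i j. (x i j - \<mu> j) / \<sigma>) (\<lambda>c. \<mu> c / \<sigma>) e D)"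
    by (rule fails_le_mono[OF ne(1)]) (use lv(2) al in auto)
   then show ?thesis using ne(2) by blast
  qed
  have low: "sqrt (real (card S) * real N) <= eta * D" if "card S <= N"
   using event[of "\<lambda>_. 0"] that by simp
  have ft: "filter_test N S \<sigma> \<epsilon> \<rho> X \<longleftrightarrow> filter_rejects N (card S) (shifted N (card S) (gram S (\<lambda>i c. X i c / \<sigma>))) e D (e * D)" for X
   unfolding filter_test_def eD by (simp only: e_def D_def P_def)
  show ?thesis
  proof
   show "type1_error N d \<sigma> \<epsilon> \<phi> <= ennreal (\<alpha> / 4)"
   proof (rule type1_le[OF sg event[OF zero, THEN conjunct1]])
    fix A x assume A: "A \<in> adversaries N d \<epsilon>" "x \<in> space (data_space N d)"
     and g: "good_noise N S (\<lambda>i j. (x i j - ?z j) / \<sigma>) (\<lambda>c. ?z c / \<sigma>) e D"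
    obtain C where C: "C \<subseteq> {..<N}" "real (card C) <= e" "\<And>i. i < N ==> i \<notin> C ==> A x i = x i"
     using adversary_rows[OF A ep(1)] unfolding e_def by metis
    have g': "good_noise N S (\<lambda>i j. (x i j - ?z j) / \<sigma>) (\<lambda>_. 0) e D"
     by (rule good_noise_cong[THEN iffD1, OF _ g]) (use S(1) in auto)
    have "contaminated N S (\<lambda>i c. A x i c / \<sigma>) (\<lambda>i j. (x i j - ?z j) / \<sigma>) (\<lambda>_. 0) C e D"
     by (rule contaminatedI[OF g' fS S(2) C(1,2) True eN D0 low]) (use C(3) S(1) in auto)
    from filter_null[OF this] show "\<phi> (A x) \<noteq> 1" by (simp add: \<phi> ft)
   qed
   show "type2_error N d K \<sigma> \<epsilon> \<rho> \<phi> <= ennreal (\<alpha> / 4)"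
   proof (rule type2_le[OF sg event[OF disjI2[OF signal[folded eD]], THEN conjunct1]])
    fix \<mu> A x assume mu: "\<mu> \<in> K" "\<rho> <= L2_set \<mu> {..<d}" and A: "A \<in> adversaries N d \<epsilon>" "x \<in> space (data_space N d)"
     and g: "good_noise N S (\<lambda>i j. (x i j - \<mu> j) / \<sigma>) (\<lambda>c. \<mu> c / \<sigma>) e D"
    obtain C where C: "C \<subseteq> {..<N}" "real (card C) <= e" "\<And>i. i < N ==> i \<notin> C ==> A x i = x i"
     using adversary_rows[OF A ep(1)] unfolding e_def by metis
    have "contaminated N S (\<lambda>i c. A x i c / \<sigma>) (\<lambda>i j. (x i j - \<mu> j) / \<sigma>) (\<lambda>c. \<mu> c / \<sigma>) C e D"
     by (rule contaminatedI[OF g fS S(2) C(1,2) True eN D0 low]) (use C(3) in \<open>auto simp: add_divide_distrib[symmetric]\<close>)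
    from filter_alternative[OF this signal[OF mu, folded eD]] show "\<phi> (A x) \<noteq> 0" by (simp add: \<phi> ft)
   qed
  qed
 qed
 moreover have "ennreal (\<alpha> / 4) < ennreal \<alpha>" using a by (simp add: ennreal_less_iff)
 ultimately show "type1_error N d \<sigma> \<epsilon> \<phi> < ennreal \<alpha>" "type2_error N d K \<sigma> \<epsilon> \<rho> \<phi> < ennreal \<alpha>"
  by (meson le_less_trans)+
qed

lemma filter_program_time:
 "\<exists>c e. \<forall>\<alpha>\<in>{0<..<1/2}. \<forall>d K N \<sigma> \<epsilon> \<rho>. model (1/100000) d K N \<sigma> \<epsilon> -->
   test_poly_time filter_program c e coord_list d K N \<sigma> \<epsilon> \<alpha> \<rho>
    (\<lambda>X. of_bool (filter_test N (coords d K (opt_dim_min d K N \<sigma> \<epsilon>)) \<sigma> \<epsilon> \<rho> X))"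
proof -
 obtain C e where Ce: "\<And>v w. 1 <= w ==> \<forall>x\<in>bounds main_prog. real (v x) <= w ==> real (time_bound main_prog v) <= real C * w ^ e"
  using time_bound_poly[of main_prog] by metis
 define T0 where "T0 = time_bound load_prog (\<lambda>_. 0) + 4"
 \<comment> \<open>T0 accounts for prelude and address computation, the power of 2 for up to 2 w
   coordinates as a loop bound, and the last 2 for the number of hard-wired coordinates.\<close>
 define c where "c = T0 + C * 2 ^ Suc e + 2"
 show ?thesis
 proof (rule exI[of _ c], rule exI[of _ "Suc e"], intro ballI allI impI)
  fix \<alpha> :: real and d K N \<sigma> \<epsilon> \<rho>
  assume a: "\<alpha> \<in> {0<..<1/2}" and md: "model (1/100000) d K N \<sigma> \<epsilon>"
  have K: "QCO d K" and N1: "1 <= N" and ep: "0 <= \<epsilon>" using md by (auto simp: model_def)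
  define k1 where "k1 = opt_dim1 d K N \<sigma>"
  define k2 where "k2 = opt_dim2 d K N \<sigma> \<epsilon>"
  define m where "m = opt_dim_min d K N \<sigma> \<epsilon>"
  have m: "m = min k1 k2" by (simp add: m_def k1_def k2_def opt_dim_min_def)
  define S where "S = coords d K m"
  have "good_coords d K m S"
   unfolding S_def using coords_tail(1,2)[OF md] by (intro good_coords[OF K]) (simp_all add: m_def)
  then have S: "S \<subseteq> {..<d}" "card S <= 2 * m + 1" by (simp_all add: good_coords_def)
  have fS: "finite S" using S finite_subset by auto
  define h where "h = coord_list d K k1 k2"
  have h: "h = map real (sorted_list_of_set S)" by (simp add: h_def coord_list_def S_def m)
  have sk: "real (card S) <= 2 * (1 + real k1 + real k2)" using S(2) by (simp add: m)
  define w where "w = 1 + (real N + (real k1 + (real k2 + (1 / \<epsilon> + 1 / \<alpha>))))"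
  have w1: "1 <= w" "1 + real k1 + real k2 <= w" "real N <= w" using ep a by (simp_all add: w_def)
  have "real (length h) <= poly_bound c (Suc e) [real k1, real k2]"
  proof -
   let ?x = "1 + (real k1 + real k2)"
   have "?x <= ?x ^ Suc e" by (rule self_le_power) simp_all
   then have "2 * ?x <= 2 * ?x ^ Suc e" by (rule mult_left_mono) simp
   also have "\<dots> <= real c * ?x ^ Suc e" by (intro mult_right_mono) (auto simp: c_def)
   finally have "2 * ?x <= real c * ?x ^ Suc e" .
   moreover have "length h = card S" using fS by (simp add: h)
   ultimately show ?thesis using sk by (simp add: poly_bound_def add.assoc)
  qed
  moreover have "computes_within filter_program (test_input N d \<sigma> \<epsilon> \<alpha> \<rho> k1 k2 h X)
    (poly_bound c (Suc e) [real N, real k1, real k2, 1 / \<epsilon>, 1 / \<alpha>]) [real (of_bool (filter_test N S \<sigma> \<epsilon> \<rho> X) :: nat)]" for X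
  proof -
   have N0: "0 < N" using N1 by simp
   from filter_program_run[OF N0 S(1) h refl, of \<sigma> \<epsilon> \<alpha> \<rho> k1 k2 X] obtain t mm v where
    t: "t <= time_bound load_prog (\<lambda>_. 0) + time_bound main_prog v + 4" "v 0 = N" "v 2 = card S"
    "(step (snd filter_program) ^^ t) (input_config (fst filter_program) (test_input N d \<sigma> \<epsilon> \<alpha> \<rho> k1 k2 h X)) =
      (length (snd filter_program), mm)"
    "mm 0 = of_bool (filter_test N S \<sigma> \<epsilon> \<rho> X)" by blast
   have "real (time_bound main_prog v) <= real C * (2 * w) ^ e"
    by (rule Ce) (use w1 t sk wf_progs(5) in auto)
   also have "\<dots> <= real C * (2 * w) ^ Suc e" using w1 by (intro mult_left_mono power_increasing) auto
   finally have tm: "real (time_bound main_prog v) <= real (C * 2 ^ Suc e) * w ^ Suc e"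
    by (simp add: power_mult_distrib mult_ac)
   have "real T0 * 1 <= real T0 * w ^ Suc e" using one_le_power[OF w1(1), of "Suc e"] by (intro mult_left_mono) auto
   moreover have "real t <= real T0 + real (time_bound main_prog v)" using t(1) unfolding T0_def by linarith
   moreover have "0 <= 2 * w ^ Suc e" using w1 by simp
   moreover have "real c * w ^ Suc e = real T0 * w ^ Suc e + real (C * 2 ^ Suc e) * w ^ Suc e + 2 * w ^ Suc e"
    unfolding c_def of_nat_add distrib_right by simp
   ultimately have "real t <= real c * w ^ Suc e" using tm by linarith
   then have "real t <= poly_bound c (Suc e) [real N, real k1, real k2, 1 / \<epsilon>, 1 / \<alpha>]"
    by (simp add: poly_bound_def w_def)
   then show ?thesis unfolding computes_within_def
    by - (rule exI[of _ t], rule exI[of _ "length (snd filter_program)"], rule exI[of _ mm], simp add: t(4,5))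
  qed
  ultimately show "test_poly_time filter_program c (Suc e) coord_list d K N \<sigma> \<epsilon> \<alpha> \<rho>
    (\<lambda>X. of_bool (filter_test N (coords d K (opt_dim_min d K N \<sigma> \<epsilon>)) \<sigma> \<epsilon> \<rho> X))"
   unfolding test_poly_time_def Let_def k1_def[symmetric] k2_def[symmetric] m_def[symmetric] S_def[symmetric] h_def[symmetric]
   by blast
 qed
qed

theorem theorem3p14:
 shows "\<exists>(c0::real) (C :: real \<Rightarrow> real).
  0 < c0 \<and> c0 < 1/2 \<and> (\<forall>\<alpha>\<in>{0<..<1/2}. C \<alpha> > 0) \<and>
  (\<forall>\<alpha>\<in>{0<..<1/2}. \<forall>d K N \<sigma> \<epsilon> \<rho>.
    model c0 d K N \<sigma> \<epsilon> \<and> \<rho> \<ge> C \<alpha> * sqrt (rate_E_sq d K N \<sigma> \<epsilon>) \<longrightarrow>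
    (\<exists>\<phi>\<in>tests N d.
     type1_error N d \<sigma> \<epsilon> \<phi> < ennreal \<alpha> \<and>
     type2_error N d K \<sigma> \<epsilon> \<rho> \<phi> < ennreal \<alpha>)) \<and>
  (\<forall>\<K>. opt_dims_poly_time c0 \<K> \<longrightarrow>
    (\<exists>prog c e h. \<forall>\<alpha>\<in>{0<..<1/2}. \<forall>(w, d, K)\<in>\<K>. \<forall>N \<sigma> \<epsilon> \<rho>.
     model c0 d K N \<sigma> \<epsilon> \<and> \<rho> \<ge> C \<alpha> * sqrt (rate_P_sq \<alpha> d K N \<sigma> \<epsilon>) \<longrightarrow>
     (\<exists>\<phi>\<in>tests N d.
       test_poly_time prog c e h d K N \<sigma> \<epsilon> \<alpha> \<rho> \<phi> \<and>
       type1_error N d \<sigma> \<epsilon> \<phi> < ennreal \<alpha> \<and>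
       type2_error N d K \<sigma> \<epsilon> \<rho> \<phi> < ennreal \<alpha>)))"
\<comment> \<open>The contamination level 1/100000 is the premise
  \<open>100000 * e <= real N\<close> of the deterministic analysis.\<close>
proof (rule exI[of _ "1/100000"], rule exI[of _ sep_const], intro conjI)
 show "(0 :: real) < 1 / 100000" "(1 / 100000 :: real) < 1 / 2" by simp_all
 show "\<forall>\<alpha>\<in>{0<..<1/2}. 0 < sep_const \<alpha>" using log_level(4) by blast
 show "\<forall>\<alpha>\<in>{0<..<1/2}. \<forall>d K N \<sigma> \<epsilon> \<rho>.
    model (1/100000) d K N \<sigma> \<epsilon> \<and> \<rho> \<ge> sep_const \<alpha> * sqrt (rate_E_sq d K N \<sigma> \<epsilon>) \<longrightarrow>
    (\<exists>\<phi>\<in>tests N d.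
     type1_error N d \<sigma> \<epsilon> \<phi> < ennreal \<alpha> \<and>
     type2_error N d K \<sigma> \<epsilon> \<rho> \<phi> < ennreal \<alpha>)"
  by (intro ballI allI impI, elim conjE) (rule exhaustive_test)
 obtain c e where ce: "\<And>\<alpha> d K N \<sigma> \<epsilon> \<rho>. \<alpha> \<in> {0<..<1/2} \<Longrightarrow> model (1/100000) d K N \<sigma> \<epsilon> \<Longrightarrow>
   test_poly_time filter_program c e coord_list d K N \<sigma> \<epsilon> \<alpha> \<rho>
    (\<lambda>X. of_bool (filter_test N (coords d K (opt_dim_min d K N \<sigma> \<epsilon>)) \<sigma> \<epsilon> \<rho> X))"
  using filter_program_time by metis
 have main: "\<exists>\<phi>\<in>tests N d. test_poly_time filter_program c e coord_list d K N \<sigma> \<epsilon> \<alpha> \<rho> \<phi> \<and>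
    type1_error N d \<sigma> \<epsilon> \<phi> < ennreal \<alpha> \<and> type2_error N d K \<sigma> \<epsilon> \<rho> \<phi> < ennreal \<alpha>"
  if a: "\<alpha> \<in> {0<..<1/2}" and md: "model (1/100000) d K N \<sigma> \<epsilon>"
   and rho: "\<rho> \<ge> sep_const \<alpha> * sqrt (rate_P_sq \<alpha> d K N \<sigma> \<epsilon>)" for \<alpha> d K N \<sigma> \<epsilon> \<rho>
  using filter_test_errors[OF a md rho] ce[OF a md] by blast
 show "\<forall>\<K>. opt_dims_poly_time (1/100000) \<K> \<longrightarrow>
    (\<exists>prog c e h. \<forall>\<alpha>\<in>{0<..<1/2}. \<forall>(w, d, K)\<in>\<K>. \<forall>N \<sigma> \<epsilon> \<rho>.
     model (1/100000) d K N \<sigma> \<epsilon> \<and> \<rho> \<ge> sep_const \<alpha> * sqrt (rate_P_sq \<alpha> d K N \<sigma> \<epsilon>) \<longrightarrow>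
     (\<exists>\<phi>\<in>tests N d.
       test_poly_time prog c e h d K N \<sigma> \<epsilon> \<alpha> \<rho> \<phi> \<and>
       type1_error N d \<sigma> \<epsilon> \<phi> < ennreal \<alpha> \<and>
       type2_error N d K \<sigma> \<epsilon> \<rho> \<phi> < ennreal \<alpha>))"
  apply (intro allI impI)
  apply (rule exI[of _ filter_program], rule exI[of _ c], rule exI[of _ e], rule exI[of _ coord_list])
  apply (intro ballI)
  subgoal for \<K> \<alpha> x by (cases x) (simp add: main)
  done
qed

end
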